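(* Let $D\subset\mathbb R^d$, $d\in\{1,2,3\}$, be a convex bounded polyhedron with plane faces and $U=[0,1]^{\mathbb N}$. Let $a_0\in L_\infty(D)$ and $0\neq\psi_j\in L_\infty(D)$ ($j\ge1$) with $\sum_{j\ge1}\|\psi_j\|_{L_\infty(D)}<\infty$, $\|\psi_1\|_{L_\infty(D)}\ge\|\psi_2\|_{L_\infty(D)}\ge\cdots$, and $\sum_{j\ge1}\|\psi_j\|^p_{L_\infty(D)}<\infty$ for some $0<p<\frac12$, and let $a(\boldsymbol x,\boldsymbol y)=a_0(\boldsymbol x)+\frac1{\sqrt6}\sum_{j\ge1}\sin(2\pi y_j)\psi_j(\boldsymbol x)$ satisfy $0<a_{\min}\le a(\boldsymbol x,\boldsymbol y)\le a_{\max}<\infty$ for all $\boldsymbol x\in D$, $\boldsymbol y\in U$. (A) If $p\in\bigcup_{k=1}^\infty[\frac2{4k+3},\frac2{4k+1}]$, take $\alpha=2\lfloor\frac1{2p}-\frac14\rfloor$, $\sigma=\frac\alpha2$, and $\lambda=\frac1{2\sigma-4\delta}$ for arbitrary $\delta\in(0,\frac\sigma2-\frac14)$. (B) If $p\in(\frac25,\frac12)\cup\bigcup_{k=1}^\infty(\frac2{4k+5},\frac2{4k+3})$, take $\alpha=2\lceil\frac1{2p}-\frac14\rceil$, $\sigma=\frac\alpha2$, and $\lambda=\frac1{2/p-1-2\sigma-4\delta}$ for arbitrary $\delta\in(0,\frac1{2p}-\frac12-\frac\sigma2)$. Define product weights by $\gamma_\emptyset=1$ and $$\gamma_{\mathfrak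 u}=\prod_{j\in\mathfrak u}\Big(\frac{[(j\sigma)^\sigma\,\mathrm{Bell}_\sigma(b_j)]^2}{2e^{1/e}\zeta(\alpha\lambda)}\Big)^{\frac1{1+\lambda}}\qquad\text{for }\emptyset\ne\mathfrak u\subseteq\{1,\dots,s\}.$$ Let $q\in H^{-1}(D)$ and let $u_{s,h}$ be the dimensionally truncated finite element solution. For each $s\ge1$ and prime $n$, for every $\boldsymbol x\in D$ let $u_{s,h,n}(\boldsymbol x,\cdot)=A_n^*(u_{s,h}(\boldsymbol x,\cdot))$ be the kernel interpolant (with smoothness parameter $\alpha=2\lfloor\frac1{2p}-\frac14\rfloor$ in case (A), $\alpha=2\lceil\frac1{2p}-\frac14\rceil$ in case (B), and the product weights $\gamma_{\mathfrak u}$ defined in this statement) at the lattice points whose generating vector is obtained by the component-by-component (CBC) construction. Then, with $U_s=[0,1]^s$, $$\sqrt{\int_{U_s}\int_D\big(u_{s,h}-u_{s,h,n}\big)^2\,d\boldsymbol x\,d\boldsymbol y}\ \le\ \begin{cases}C\,\|q\|_{H^{-1}(D)}\,n^{-(\frac12\lfloor\frac1{2p}-\frac14\rfloor-\delta)}&\text{in case (A)},\\[2pt] C\,\|q\|_{H^{-1}(D)}\,n^{-(\frac1{2p}-\frac14-\frac12\lceil\frac1{2p}-\frac14\rceil-\delta)}&\text{in case (B)},\end{cases}$$ where the constant $C>0$ is independent of the truncation dimension $s$ (and of $n$, $h$, $q$).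
   Context: PDE notation. $H_0^1(D)$ carries the norm $\|\nabla v\|_{L_2(D)}$; $H^{-1}(D)$ is its dual. $\{V_h\}_h$ is a family of conforming finite element subspaces $V_h\subset H_0^1(D)$ with mesh size $h>0$, spanned by continuous piecewise linear basis functions on triangulations obtained from an initial regular triangulation of $D$ by recursive uniform partition of simplices. For $\boldsymbol y\in U$, $u_h(\cdot,\boldsymbol y)\in V_h$ solves $\int_Da(\boldsymbol x,\boldsymbol y)\nabla u_h\cdot\nabla v_h\,d\boldsymbol x=\langle q,v_h\rangle_{H^{-1},H_0^1}$ for all $v_h\in V_h$. The dimensionally truncated finite element solution is $u_{s,h}(\cdot,\boldsymbol y)=u_h(\cdot,(y_1,\dots,y_s,0,0,\dots))$. Put $b_j=\frac1{\sqrt6}\|\psi_j\|_{L_\infty(D)}/a_{\min}$. $\mathrm{Bell}_\sigma(x)=\sum_{m=0}^\sigma S(\sigma,m)x^m$ with $S(\sigma,m)$ the Stirling numbers of the second kind; $\zeta$ is the Riemann zeta function. Kernel interpolation. For $\boldsymbol h\in\mathbb Z^s$: $\mathrm{supp}(\boldsymbol h)=\{j:h_j\neq0\}$, $r(\boldsymbol h)=\gamma_{\mathrm{supp}(\boldsymbol h)}^{-1}\prod_{j\in\mathrm{supp}(\boldsymbol h)}|h_j|^\alpha$. The kernel is $K(\boldsymbol y,\boldsymbol y')=\sum_{\mathfrak u\subseteq\{1,\dots,s\}}\gamma_{\mathfrak u}\prod_{j\in\mathfrak u}\eta_\alpha(y_j-y_j')$, $\eta_\alpha(y)=\sum_{h\ne0}|h|^{-\alpha}e^{2\pi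 ihy}$, which is the reproducing kernel of the Hilbert space of 1-periodic functions on $[0,1]^s$ with finite norm $(\sum_{\boldsymbol h\in\mathbb Z^s}r(\boldsymbol h)|\widehat f(\boldsymbol h)|^2)^{1/2}$. For $\boldsymbol z\in\{1,\dots,n-1\}^s$ let $\boldsymbol t_k=\{k\boldsymbol z/n\}$ (componentwise fractional parts), $k=1,\dots,n$. $A_n^*(f)$ is the unique function of the form $\sum_{k=1}^na_kK(\boldsymbol t_k,\cdot)$ that agrees with $f$ at $\boldsymbol t_1,\dots,\boldsymbol t_n$. CBC construction (from Cools, Kuo, Nuyens, Sloan). $\mathcal S_s(\boldsymbol z)=\sum_{\boldsymbol h\in\mathbb Z^s}\sum_{\boldsymbol\ell\in\mathbb Z^s\setminus\{\boldsymbol0\},\,\boldsymbol\ell\cdot\boldsymbol z\equiv0\,(\mathrm{mod}\,n)}\frac1{r(\boldsymbol h)r(\boldsymbol h+\boldsymbol\ell)}=\sum_{d=1}^sT_d(z_1,\dots,z_d)$, where $T_d$ is the part of the sum over those $\boldsymbol\ell$ with $\ell_d\ne0$ and $\ell_j=0$ for $j>d$. For $d=1,\dots,s$ successively, with $z_1,\dots,z_{d-1}$ fixed, $z_d\in\{1,\dots,n-1\}$ is chosen to minimize $T_d(z_1,\dots,z_d)$. *)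

theory Defs
  imports
    "HOL-Probability.Essential_Supremum"
    "HOL-Combinatorics.Stirling"
    "HOL-Computational_Algebra.Primes"
    "HOL-Number_Theory.Cong"
begin

text \<open>
  Sequences \<open>(\<psi>\<^sub>j)\<close>, \<open>(y\<^sub>j)\<close>, \<open>(z\<^sub>j)\<close>, \<open>(b\<^sub>j)\<close> are indexed by \<open>j \<ge> 1\<close>; their value at index 0 is never used.
  Elements of function spaces over \<open>D\<close> are represented by functions on the whole space, and all
  measure-theoretic notions refer to \<^term>\<open>lebesgue_on D\<close>.
\<close>


section \<open>Lebesgue and Sobolev spaces\<close>

definition Linf :: "'a::euclidean_space set \<Rightarrow> ('a \<Rightarrow> real) set" where
  "Linf D = {f \<in> borel_measurable (lebesgue_on D).
               esssup (lebesgue_on D) (\<lambda>x. ereal \<bar>f x\<bar>) < \<infinity>}"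

definition Linf_norm :: "'a::euclidean_space set \<Rightarrow> ('a \<Rightarrow> real) \<Rightarrow> real" where
  "Linf_norm D f = real_of_ereal (esssup (lebesgue_on D) (\<lambda>x. ereal \<bar>f x\<bar>))"

definition L2 :: "'a::euclidean_space set \<Rightarrow> ('a \<Rightarrow> 'b::euclidean_space) set" where
  "L2 D = {f \<in> borel_measurable (lebesgue_on D). integrable (lebesgue_on D) (\<lambda>x. (norm (f x))\<^sup>2)}"

primrec Ck :: "nat \<Rightarrow> ('a::euclidean_space \<Rightarrow> real) \<Rightarrow> bool" where
  "Ck 0 f \<longleftrightarrow> continuous_on UNIV f"
| "Ck (Suc k) f \<longleftrightarrow> (\<exists>g. (\<forall>x. GDERIV f x :> g x) \<and> (\<forall>b\<in>Basis. Ck k (\<lambda>x. g x \<bullet> b)))"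

definition test_functions :: "'a::euclidean_space set \<Rightarrow> ('a \<Rightarrow> real) set" where
  "test_functions D = {\<phi>. (\<forall>k. Ck k \<phi>) \<and> (\<exists>K. compact K \<and> K \<subseteq> D \<and> (\<forall>x. x \<notin> K \<longrightarrow> \<phi> x = 0))}"

definition weak_gradient :: "'a::euclidean_space set \<Rightarrow> ('a \<Rightarrow> real) \<Rightarrow> ('a \<Rightarrow> 'a) \<Rightarrow> bool" where
  "weak_gradient D v g \<longleftrightarrow> g \<in> L2 D \<and>
     (\<forall>\<phi>\<in>test_functions D. \<forall>b\<in>Basis.
        (LINT x|lebesgue_on D. v x * frechet_derivative \<phi> (at x) b)
          = - (LINT x|lebesgue_on D. (g x \<bullet> b) * \<phi> x))"

definition H1 :: "'a::euclidean_space set \<Rightarrow> ('a \<Rightarrow> real) set" where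
  "H1 D = {v \<in> L2 D. \<exists>g. weak_gradient D v g}"

text \<open>For \<open>D\<close> open, the weak gradient is unique up to null sets, so the choice is immaterial under integrals.\<close>

definition grad :: "'a::euclidean_space set \<Rightarrow> ('a \<Rightarrow> real) \<Rightarrow> 'a \<Rightarrow> 'a" where
  "grad D v = (SOME g. weak_gradient D v g)"

definition H1_norm :: "'a::euclidean_space set \<Rightarrow> ('a \<Rightarrow> real) \<Rightarrow> real" where
  "H1_norm D v = sqrt ((LINT x|lebesgue_on D. (v x)\<^sup>2) + (LINT x|lebesgue_on D. (norm (grad D v x))\<^sup>2))"

definition H10 :: "'a::euclidean_space set \<Rightarrow> ('a \<Rightarrow> real) set" where
  "H10 D = {v \<in> H1 D. \<forall>\<epsilon>>0. \<exists>\<phi>\<in>test_functions D. H1_norm D (\<lambda>x. v x - \<phi> x) < \<epsilon>}"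

definition H10_norm :: "'a::euclidean_space set \<Rightarrow> ('a \<Rightarrow> real) \<Rightarrow> real" where
  "H10_norm D v = sqrt (LINT x|lebesgue_on D. (norm (grad D v x))\<^sup>2)"

text \<open>
  Bounded linear functionals on \<open>H\<^sup>1\<^sub>0(D)\<close>. Boundedness and linearity force such a functional to agree on
  functions that are equal almost everywhere on \<open>D\<close>.
\<close>

definition Hm1 :: "'a::euclidean_space set \<Rightarrow> (('a \<Rightarrow> real) \<Rightarrow> real) set" where
  "Hm1 D = {q. (\<forall>v\<in>H10 D. \<forall>w\<in>H10 D. q (\<lambda>x. v x + w x) = q v + q w) \<and>
               (\<forall>c. \<forall>v\<in>H10 D. q (\<lambda>x. c * v x) = c * q v) \<and>
               (\<exists>B. \<forall>v\<in>H10 D. \<bar>q v\<bar> \<le> B * H10_norm D v)}"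

definition Hm1_norm :: "'a::euclidean_space set \<Rightarrow> (('a \<Rightarrow> real) \<Rightarrow> real) \<Rightarrow> real" where
  "Hm1_norm D q = (SUP v\<in>{v \<in> H10 D. H10_norm D v \<le> 1}. \<bar>q v\<bar>)"


section \<open>Uniformly refined triangulations and finite elements\<close>

definition triangulation_of :: "'a::euclidean_space set \<Rightarrow> 'a set set \<Rightarrow> bool" where
  "triangulation_of D \<T> \<longleftrightarrow>
     triangulation \<T> \<and> (\<forall>K\<in>\<T>. int DIM('a) simplex K) \<and> \<Union>\<T> = closure D"

definition vertices :: "'a::euclidean_space set \<Rightarrow> 'a set" where
  "vertices K = {v. v extreme_point_of K}"

text \<open>
  Uniform partition of every simplex into \<open>2\<^sup>d\<close> simplices, \<open>d\<close> being the dimension of the space, whose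
  vertices are vertices and edge midpoints (\<open>v = w\<close> gives the vertices) of the given simplex, and
  which include the half-size copy of it at each of its vertices. For \<open>d = 1\<close> this is bisection and
  for \<open>d = 2\<close> the partition into four congruent triangles; for \<open>d = 3\<close> the remaining octahedron is cut
  along one of its three diagonals, the choice of the diagonal being left open.
\<close>

definition uniform_refinement :: "'a::euclidean_space set set \<Rightarrow> 'a set set \<Rightarrow> bool" where
  "uniform_refinement \<T> \<T>' \<longleftrightarrow>
     (\<forall>K\<in>\<T>. \<Union>{K'\<in>\<T>'. K' \<subseteq> K} = K \<and> card {K'\<in>\<T>'. K' \<subseteq> K} = 2 ^ DIM('a) \<and>
       (\<forall>v\<in>vertices K. convex hull (midpoint v ` vertices K) \<in> \<T>') \<and>
       (\<forall>K'\<in>\<T>'. K' \<subseteq> K \<longrightarrow> vertices K' \<subseteq> {midpoint v w | v w. v \<in> vertices K \<and> w \<in> vertices K}))"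

text \<open>
  The meshes obtained from \<open>\<T> 0\<close> by recursive refinement. The mesh size \<open>h\<close> is determined by the
  refinement level, so the discrete spaces \<open>V\<^sub>h\<close> are indexed by the level; independence of \<open>h\<close> is
  uniformity in the level.
\<close>

definition mesh_family :: "'a::euclidean_space set \<Rightarrow> (nat \<Rightarrow> 'a set set) \<Rightarrow> bool" where
  "mesh_family D \<T> \<longleftrightarrow>
     (\<forall>k. triangulation_of D (\<T> k)) \<and> (\<forall>k. uniform_refinement (\<T> k) (\<T> (Suc k)))"

definition fe_space :: "'a::euclidean_space set \<Rightarrow> 'a set set \<Rightarrow> ('a \<Rightarrow> real) set" where
  "fe_space D \<T> = {v. continuous_on UNIV v \<and> (\<forall>x. x \<notin> D \<longrightarrow> v x = 0) \<and>
                      (\<forall>K\<in>\<T>. \<exists>c g. \<forall>x\<in>K. v x = c + g \<bullet> x)}"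

definition fe_solution ::
  "'a::euclidean_space set \<Rightarrow> 'a set set \<Rightarrow> ('a \<Rightarrow> real) \<Rightarrow> (('a \<Rightarrow> real) \<Rightarrow> real) \<Rightarrow> 'a \<Rightarrow> real" where
  "fe_solution D \<T> A q = (THE u. u \<in> fe_space D \<T> \<and>
     (\<forall>v\<in>fe_space D \<T>. (LINT x|lebesgue_on D. A x * (grad D u x \<bullet> grad D v x)) = q v))"


section \<open>The parametric problem\<close>

definition param_domain :: "(nat \<Rightarrow> real) set" where
  "param_domain = {y. \<forall>j\<ge>1. 0 \<le> y j \<and> y j \<le> 1}"

definition diffusion_coeff :: "('a \<Rightarrow> real) \<Rightarrow> (nat \<Rightarrow> 'a \<Rightarrow> real) \<Rightarrow> (nat \<Rightarrow> real) \<Rightarrow> 'a \<Rightarrow> real" where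
  "diffusion_coeff a0 \<psi> y x = a0 x + 1 / sqrt 6 * (\<Sum>j. sin (2 * pi * y (Suc j)) * \<psi> (Suc j) x)"

definition truncate :: "nat \<Rightarrow> (nat \<Rightarrow> real) \<Rightarrow> nat \<Rightarrow> real" where
  "truncate s y = (\<lambda>j. if j \<in> {1..s} then y j else 0)"

definition u_fe ::
  "'a::euclidean_space set \<Rightarrow> ('a \<Rightarrow> real) \<Rightarrow> (nat \<Rightarrow> 'a \<Rightarrow> real) \<Rightarrow> 'a set set
     \<Rightarrow> (('a \<Rightarrow> real) \<Rightarrow> real) \<Rightarrow> nat \<Rightarrow> 'a \<Rightarrow> (nat \<Rightarrow> real) \<Rightarrow> real" where
  "u_fe D a0 \<psi> \<T> q s x y = fe_solution D \<T> (diffusion_coeff a0 \<psi> (truncate s y)) q x"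

definition b_seq :: "'a::euclidean_space set \<Rightarrow> (nat \<Rightarrow> 'a \<Rightarrow> real) \<Rightarrow> real \<Rightarrow> nat \<Rightarrow> real" where
  "b_seq D \<psi> amin j = 1 / sqrt 6 * Linf_norm D (\<psi> j) / amin"


section \<open>Weights\<close>

definition Bell_poly :: "nat \<Rightarrow> real \<Rightarrow> real" where
  "Bell_poly \<sigma> x = (\<Sum>m=0..\<sigma>. real (Stirling \<sigma> m) * x ^ m)"

definition zeta_real :: "real \<Rightarrow> real" where
  "zeta_real x = (\<Sum>k. 1 / real (Suc k) powr x)"

definition product_weight :: "(nat \<Rightarrow> real) \<Rightarrow> nat \<Rightarrow> nat \<Rightarrow> real \<Rightarrow> nat set \<Rightarrow> real" where
  "product_weight b \<alpha> \<sigma> lam \<uu> =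
     (\<Prod>j\<in>\<uu>. (((real j * real \<sigma>) ^ \<sigma> * Bell_poly \<sigma> (b j))\<^sup>2
               / (2 * exp 1 powr (1 / exp 1) * zeta_real (real \<alpha> * lam))) powr (1 / (1 + lam)))"


section \<open>Kernel interpolation at lattice points\<close>

text \<open>The terms for \<open>h\<close> and \<open>-h\<close> are complex conjugates, so the series has a real sum.\<close>

definition eta :: "nat \<Rightarrow> real \<Rightarrow> real" where
  "eta \<alpha> y = Re (\<Sum>\<^sub>\<infinity>h\<in>-{0::int}. exp (2 * of_real pi * \<i> * of_int h * of_real y) / of_int \<bar>h\<bar> ^ \<alpha>)"

definition kernel :: "(nat set \<Rightarrow> real) \<Rightarrow> nat \<Rightarrow> nat \<Rightarrow> (nat \<Rightarrow> real) \<Rightarrow> (nat \<Rightarrow> real) \<Rightarrow> real" where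
  "kernel \<gamma> \<alpha> s y y' = (\<Sum>\<uu>\<in>Pow {1..s}. \<gamma> \<uu> * (\<Prod>j\<in>\<uu>. eta \<alpha> (y j - y' j)))"

definition lattice_point :: "nat \<Rightarrow> nat \<Rightarrow> (nat \<Rightarrow> nat) \<Rightarrow> nat \<Rightarrow> nat \<Rightarrow> real" where
  "lattice_point s n z k = (\<lambda>j\<in>{1..s}. frac (real k * real (z j) / real n))"

definition kernel_interpolant ::
  "(nat set \<Rightarrow> real) \<Rightarrow> nat \<Rightarrow> nat \<Rightarrow> nat \<Rightarrow> (nat \<Rightarrow> nat)
     \<Rightarrow> ((nat \<Rightarrow> real) \<Rightarrow> real) \<Rightarrow> (nat \<Rightarrow> real) \<Rightarrow> real" where
  "kernel_interpolant \<gamma> \<alpha> s n z f =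
     (THE g. (\<exists>c. g = (\<lambda>y. \<Sum>k=1..n. c k * kernel \<gamma> \<alpha> s (lattice_point s n z k) y)) \<and>
             (\<forall>k\<in>{1..n}. g (lattice_point s n z k) = f (lattice_point s n z k)))"

text \<open>The squared \<open>L\<^sub>2(U\<^sub>s \<times> D)\<close> error uses \<open>U\<^sub>s = [0,1]\<^sup>s\<close> with coordinates indexed by \<open>{1..s}\<close>.\<close>

definition interpolation_error ::
  "'a::euclidean_space set \<Rightarrow> (nat set \<Rightarrow> real) \<Rightarrow> nat \<Rightarrow> nat \<Rightarrow> nat \<Rightarrow> (nat \<Rightarrow> nat)
     \<Rightarrow> ('a \<Rightarrow> (nat \<Rightarrow> real) \<Rightarrow> real) \<Rightarrow> real" where
  "interpolation_error D \<gamma> \<alpha> s n z u =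
     sqrt (LINT y|Pi\<^sub>M {1..s} (\<lambda>_. restrict_space lborel {0..1}). LINT x|lebesgue_on D.
             (u x y - kernel_interpolant \<gamma> \<alpha> s n z (u x) y)\<^sup>2)"


section \<open>Component-by-component construction\<close>

text \<open>\<open>\<int>\<^sup>s\<close> is represented by the integer sequences supported in \<open>{1..s}\<close>.\<close>

definition Zs :: "nat \<Rightarrow> (nat \<Rightarrow> int) set" where
  "Zs s = {h. \<forall>j. j \<notin> {1..s} \<longrightarrow> h j = 0}"

definition r_weight :: "(nat set \<Rightarrow> real) \<Rightarrow> nat \<Rightarrow> (nat \<Rightarrow> int) \<Rightarrow> real" where
  "r_weight \<gamma> \<alpha> h = inverse (\<gamma> {j. h j \<noteq> 0}) * (\<Prod>j\<in>{j. h j \<noteq> 0}. real_of_int \<bar>h j\<bar> ^ \<alpha>)"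

definition dual_lattice :: "nat \<Rightarrow> nat \<Rightarrow> (nat \<Rightarrow> nat) \<Rightarrow> (nat \<Rightarrow> int) set" where
  "dual_lattice s n z =
     {l \<in> Zs s. l \<noteq> (\<lambda>_. 0) \<and> [(\<Sum>j=1..s. l j * int (z j)) = 0] (mod int n)}"

definition lattice_sum :: "(nat set \<Rightarrow> real) \<Rightarrow> nat \<Rightarrow> nat \<Rightarrow> (nat \<Rightarrow> int) set \<Rightarrow> real" where
  "lattice_sum \<gamma> \<alpha> s L =
     (\<Sum>\<^sub>\<infinity>(h, l)\<in>Zs s \<times> L. 1 / (r_weight \<gamma> \<alpha> h * r_weight \<gamma> \<alpha> (\<lambda>j. h j + l j)))"

text \<open>
  The part of the full error criterion \<^term>\<open>lattice_sum \<gamma> \<alpha> s (dual_lattice s n z)\<close> in which \<open>d\<close> is the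
  last nonzero component of \<open>l\<close>; it depends on \<open>z\<close> only through components up to \<open>d\<close>.
\<close>

definition cbc_criterion ::
  "(nat set \<Rightarrow> real) \<Rightarrow> nat \<Rightarrow> nat \<Rightarrow> nat \<Rightarrow> nat \<Rightarrow> (nat \<Rightarrow> nat) \<Rightarrow> real" where
  "cbc_criterion \<gamma> \<alpha> s n d z =
     lattice_sum \<gamma> \<alpha> s {l \<in> dual_lattice s n z. l d \<noteq> 0 \<and> (\<forall>j>d. l j = 0)}"

definition cbc_vector :: "(nat set \<Rightarrow> real) \<Rightarrow> nat \<Rightarrow> nat \<Rightarrow> nat \<Rightarrow> (nat \<Rightarrow> nat) \<Rightarrow> bool" where
  "cbc_vector \<gamma> \<alpha> s n z \<longleftrightarrow>
     (\<forall>d\<in>{1..s}. z d \<in> {1..n - 1} \<and>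
        (\<forall>w\<in>{1..n - 1}. cbc_criterion \<gamma> \<alpha> s n d z \<le> cbc_criterion \<gamma> \<alpha> s n d (z(d := w))))"

end

theory Submission
  imports Defs "HOL-Probability.Infinite_Product_Measure"
begin

text \<open>
  Expand the finite element solution in a basis that is orthonormal for the gradient inner product. Its
  coefficient vector \<open>c(y)\<close> solves \<open>(A\<^sub>0 + \<Sum>\<^sub>j sin (2 \<pi> y\<^sub>j) P\<^sub>j) c(y) = l\<close>, so the Fourier coefficients
  of \<open>c\<close> solve a system on \<open>\<int>\<^sup>s\<close> that couples only nearest neighbours. Ellipticity, used at the
  parameters where all sines are \<open>\<plusminus>1\<close>, shows that this system stays coercive after conjugation with an
  exponential weight of rate about \<open>1 + 1 / (2 k b\<^sub>j)\<close> in \<open>k\<close> active directions. This gives the decay of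
  the Fourier coefficients, hence a bound of the weighted norm of \<open>c\<close>, with constants that depend
  neither on \<open>s\<close> nor on the mesh. Kernel interpolation at lattice points is bounded in \<open>L\<^sub>2\<close> by
  the fourth root of \<open>\<S>\<^sub>s(z)\<close>, up to a constant, times this norm, the CBC construction makes \<open>\<S>\<^sub>s(z)\<^sup>\<lambda>\<close> of order \<open>1 / n\<close> by averaging over
  the components of \<open>z\<close> and Jensen's inequality, and the weights are chosen such that the products in
  both bounds converge. The Poincare inequality passes from the gradient norm to \<open>L\<^sub>2(D)\<close>.
\<close>

section \<open>Orthonormal bases of finite-dimensional function spaces\<close>

text \<open>The sum of the norms \<open>b j\<close> may be large, so the perturbation cannot be
  split off by norms. The forms \<open>Q j\<close> of the absolute values of the perturbations are
  kept instead: ellipticity pays for one copy of each \<open>Q j\<close>, the neighbour terms cancel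
  in the sum over all frequencies by translation invariance, and only the excess
  \<open>R j - 1\<close> of the conjugated operator is paid for with \<open>b j\<close>, at a total
  price of at most 1/2. As this budget is shared by \<open>k\<close> directions, no single weight
  serves all frequencies: each support gets its own, and the resulting loss \<open>k ^ k\<close>
  becomes a product over the support through factorials, which matches the powers
  \<open>j ^ \<sigma>\<close> in the weights. The fixed-point iteration for the coefficients does
  not depend on the weight, so its limit obeys every weighted bound at once; \<open>N\<close> and
  \<open>s\<close> enter its step size but not the bounds. On the spatial side everything follows
  from one certificate, \<open>approx\<close>: bounded pointwise limits of test functions whose
  bounded gradients converge almost everywhere.\<close>

definition fun_subspace :: "('x \<Rightarrow> real) set \<Rightarrow> bool" where
  "fun_subspace V \<longleftrightarrow> (\<lambda>_. 0) \<in> V \<and> (\<forall>v\<in>V. \<forall>w\<in>V. (\<lambda>x. v x + w x) \<in> V) \<and> (\<forall>c. \<forall>v\<in>V. (\<lambda>x. c * v x) \<in> V)"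

lemma fun_subspace_zero: "fun_subspace V \<Longrightarrow> (\<lambda>_. 0) \<in> V"
  and fun_subspace_add: "fun_subspace V \<Longrightarrow> v \<in> V \<Longrightarrow> w \<in> V \<Longrightarrow> (\<lambda>x. v x + w x) \<in> V"
  and fun_subspace_scale: "fun_subspace V \<Longrightarrow> v \<in> V \<Longrightarrow> (\<lambda>x. c * v x) \<in> V"
  by (simp_all add: fun_subspace_def)

lemma fun_subspace_sum:
  assumes "fun_subspace V" "finite I" "\<And>i. i \<in> I \<Longrightarrow> e i \<in> V"
  shows "(\<lambda>x. \<Sum>i\<in>I. c i * e i x) \<in> V"
  using assms(2,3)
proof (induction I rule: finite_induct)
  case empty
  then show ?case using assms(1) by (simp add: fun_subspace_def)
next
  case (insert i I)
  then have "(\<lambda>x. c i * e i x) \<in> V" "(\<lambda>x. \<Sum>i\<in>I. c i * e i x) \<in> V"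
    using assms(1) by (auto simp: fun_subspace_def)
  then show ?case using assms(1) insert(1,2) by (simp add: fun_subspace_def)
qed

definition bilinear_on :: "('x \<Rightarrow> real) set \<Rightarrow> (('x \<Rightarrow> real) \<Rightarrow> ('x \<Rightarrow> real) \<Rightarrow> real) \<Rightarrow> bool" where
  "bilinear_on V B \<longleftrightarrow>
    (\<forall>u\<in>V. \<forall>v\<in>V. \<forall>w\<in>V. B (\<lambda>x. u x + v x) w = B u w + B v w \<and> B w (\<lambda>x. u x + v x) = B w u + B w v) \<and>
    (\<forall>c. \<forall>v\<in>V. \<forall>w\<in>V. B (\<lambda>x. c * v x) w = c * B v w \<and> B w (\<lambda>x. c * v x) = c * B w v)"

lemma bilinear_on_sum_left:
  assumes V: "fun_subspace V" and B: "bilinear_on V B" and w: "w \<in> V" and "finite I" "\<And>i. i \<in> I \<Longrightarrow> e i \<in> V"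
  shows "B (\<lambda>x. \<Sum>i\<in>I. c i * e i x) w = (\<Sum>i\<in>I. c i * B (e i) w)"
  using assms(4,5)
proof (induction I rule: finite_induct)
  case empty
  have "(\<lambda>_. 0) \<in> V" using V by (simp add: fun_subspace_def)
  moreover have "\<forall>c. \<forall>v\<in>V. B (\<lambda>x. c * v x) w = c * B v w" using B w by (simp add: bilinear_on_def)
  ultimately have "B (\<lambda>x. 0 * (\<lambda>_. 0) x) w = 0 * B (\<lambda>_. 0) w" by (elim allE[of _ 0] ballE[of _ _ "\<lambda>_. 0"]) simp_all
  then show ?case by simp
next
  case (insert i I)
  have "(\<lambda>x. c i * e i x) \<in> V" "(\<lambda>x. \<Sum>i\<in>I. c i * e i x) \<in> V" "e i \<in> V"
    by (use insert in \<open>auto intro!: fun_subspace_sum[OF V] fun_subspace_scale[OF V]\<close>)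
  then have "B (\<lambda>x. c i * e i x + (\<Sum>i\<in>I. c i * e i x)) w = c i * B (e i) w + B (\<lambda>x. \<Sum>i\<in>I. c i * e i x) w"
    using B w unfolding bilinear_on_def by auto
  then show ?case using insert by simp
qed

lemma bilinear_on_sum_right:
  assumes V: "fun_subspace V" and B: "bilinear_on V B" and w: "w \<in> V" and I: "finite I" "\<And>i. i \<in> I \<Longrightarrow> e i \<in> V"
  shows "B w (\<lambda>x. \<Sum>i\<in>I. c i * e i x) = (\<Sum>i\<in>I. c i * B w (e i))"
proof -
  have "bilinear_on V (\<lambda>v w. B w v)" using B unfolding bilinear_on_def by blast
  from bilinear_on_sum_left[OF V this w I] show ?thesis .
qed

text \<open>Induction on a finite set \<open>X\<close> of points whose values determine the
  functions of \<open>V\<close>: those vanishing at one point form a subspace of codimension at most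
  one, and one Gram-Schmidt step restores the lost direction. It is applied to finite element
  functions with the gradient inner product and to coefficient vectors with the Gram form of the
  kernel.\<close>

theorem orthonormal_basis_exists:
  fixes V :: "('x \<Rightarrow> real) set"
  assumes "finite X" and "fun_subspace V" and "bilinear_on V B"
    and "\<And>v w. v \<in> V \<Longrightarrow> w \<in> V \<Longrightarrow> B v w = B w v"
    and "\<And>v. v \<in> V \<Longrightarrow> v \<noteq> (\<lambda>_. 0) \<Longrightarrow> 0 < B v v"
    and "\<And>v. v \<in> V \<Longrightarrow> (\<forall>x\<in>X. v x = 0) \<Longrightarrow> v = (\<lambda>_. 0)"
  shows "\<exists>N (e :: nat \<Rightarrow> 'x \<Rightarrow> real). (\<forall>i<N. e i \<in> V) \<and>
      (\<forall>i<N. \<forall>j<N. B (e i) (e j) = (if i = j then 1 else 0)) \<and>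
      (\<forall>v\<in>V. v = (\<lambda>x. \<Sum>i<N. B v (e i) * e i x))"
  using assms
proof (induction X arbitrary: V rule: finite_induct)
  case empty
  then have "\<forall>v\<in>V. v = (\<lambda>_. 0)" by auto
  then show ?case by (intro exI[of _ 0]) auto
next
  case (insert x0 X)
  note V = insert.prems(1) and B = insert.prems(2) and sym = insert.prems(3) and pos = insert.prems(4)
  show ?case
  proof (cases "\<forall>v\<in>V. v x0 = 0")
    case True
    show ?thesis
      by (rule insert.IH[OF V B sym pos]) (use insert.prems(5) True in auto)
  next
    case False
    then obtain f where f: "f \<in> V" "f x0 \<noteq> 0" by auto
    define W where "W = {v \<in> V. v x0 = 0}"
    have W: "fun_subspace W" using V unfolding fun_subspace_def W_def by auto
    have BW: "bilinear_on W B" using B unfolding bilinear_on_def W_def by auto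
    obtain N and e :: "nat \<Rightarrow> 'x \<Rightarrow> real" where e: "\<And>i. i < N \<Longrightarrow> e i \<in> W"
      and on: "\<And>i j. i < N \<Longrightarrow> j < N \<Longrightarrow> B (e i) (e j) = (if i = j then 1 else 0)"
      and ex: "\<And>v. v \<in> W \<Longrightarrow> v = (\<lambda>x. \<Sum>i<N. B v (e i) * e i x)"
    proof -
      have "\<exists>N (e :: nat \<Rightarrow> 'x \<Rightarrow> real). (\<forall>i<N. e i \<in> W) \<and>
        (\<forall>i<N. \<forall>j<N. B (e i) (e j) = (if i = j then 1 else 0)) \<and>
        (\<forall>v\<in>W. v = (\<lambda>x. \<Sum>i<N. B v (e i) * e i x))"
        by (rule insert.IH[OF W BW]) (use sym pos insert.prems(5) in \<open>auto simp: W_def\<close>)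
      then show thesis using that by blast
    qed
    have eV: "\<And>i. i < N \<Longrightarrow> e i \<in> V" and e0: "\<And>i. i < N \<Longrightarrow> e i x0 = 0" using e W_def by auto
    \<comment> \<open>Adding \<open>p\<close> removes from \<open>f\<close> its components along the
      basis of \<open>W\<close>; the normalised remainder is the new basis vector.\<close>
    define p where "p = (\<lambda>x. \<Sum>i<N. (- B f (e i)) * e i x)"
    define g where "g = (\<lambda>x. f x + p x)"
    have pV: "p \<in> V" unfolding p_def by (rule fun_subspace_sum[OF V]) (use eV in auto)
    have gV: "g \<in> V" using V f pV unfolding g_def fun_subspace_def by auto
    have g0: "g x0 \<noteq> 0" using f e0 unfolding g_def p_def by simp
    have ge: "B g (e j) = 0" if "j < N" for j
    proof -
      have "B g (e j) = B f (e j) + B p (e j)"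
        using B f pV eV[OF that] unfolding g_def bilinear_on_def by auto
      also have "B p (e j) = (\<Sum>i<N. (- B f (e i)) * B (e i) (e j))"
        unfolding p_def by (rule bilinear_on_sum_left[OF V B eV[OF that]]) (use eV in auto)
      also have "\<dots> = (\<Sum>i<N. if i = j then - B f (e i) else 0)"
        by (intro sum.cong) (use on that in auto)
      also have "\<dots> = - B f (e j)" using that by simp
      finally show ?thesis by simp
    qed
    have gpos: "0 < B g g" using pos[OF gV] g0 by auto
    define c where "c = 1 / sqrt (B g g)"
    define h where "h = (\<lambda>x. c * g x)"
    have hV: "h \<in> V" using V gV unfolding h_def fun_subspace_def by auto
    have hl: "B h v = c * B g v" if "v \<in> V" for v using B gV that unfolding h_def bilinear_on_def by auto
    have hr: "B v h = c * B v g" if "v \<in> V" for v using B gV that unfolding h_def bilinear_on_def by auto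
    have hh: "B h h = 1" using hl[OF hV] hr[OF gV] gpos by (simp add: c_def)
    have he: "B h (e j) = 0" "B (e j) h = 0" if "j < N" for j
      using hl[OF eV[OF that]] ge[OF that] sym[OF hV eV[OF that]] by auto
    have c0: "c \<noteq> 0" using gpos by (simp add: c_def)
    have h0: "h x0 \<noteq> 0" using c0 g0 by (simp add: h_def)
    define e' where "e' = (\<lambda>i. if i < N then e i else h)"
    have "v = (\<lambda>x. \<Sum>i<Suc N. B v (e' i) * e' i x)" if v: "v \<in> V" for v
    proof -
      \<comment> \<open>Subtracting this multiple of \<open>h\<close> makes \<open>v\<close> vanish
        at \<open>x0\<close>, so that the expansion in \<open>W\<close> applies to the rest.\<close>
      define a where "a = v x0 / h x0"
      define w where "w = (\<lambda>x. v x + (- a) * h x)"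
      have ah: "(\<lambda>x. a * h x) \<in> V" "(\<lambda>x. (- a) * h x) \<in> V" using V hV unfolding fun_subspace_def by blast+
      have wV: "w \<in> V" unfolding w_def by (rule fun_subspace_add[OF V v ah(2)])
      have wW: "w \<in> W" using h0 wV by (simp add: W_def w_def a_def)
      have vw: "v = (\<lambda>x. w x + a * h x)" by (auto simp: w_def)
      have Bv: "B v u = B w u + a * B h u" if "u \<in> V" for u
        using B wV ah hV that unfolding vw bilinear_on_def by auto
      have we: "w = (\<lambda>x. \<Sum>i<N. B w (e i) * e i x)" using ex[OF wW] .
      have "B w h = B (\<lambda>x. \<Sum>i<N. B w (e i) * e i x) h" using we by simp
      also have "\<dots> = (\<Sum>i<N. B w (e i) * B (e i) h)"
        by (rule bilinear_on_sum_left[OF V B hV]) (use eV in auto)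
      also have "\<dots> = 0" using he by simp
      finally have "B v h = a" using Bv[OF hV] hh by simp
      moreover have "B v (e i) = B w (e i)" if "i < N" for i using Bv[OF eV[OF that]] he that by simp
      ultimately have "(\<lambda>x. \<Sum>i<Suc N. B v (e' i) * e' i x) = (\<lambda>x. (\<Sum>i<N. B w (e i) * e i x) + a * h x)"
        by (simp add: e'_def)
      also have "\<dots> = v" using we vw by metis
      finally show ?thesis by simp
    qed
    moreover have "\<forall>i<Suc N. e' i \<in> V" using eV hV by (simp add: e'_def)
    moreover have "\<forall>i<Suc N. \<forall>j<Suc N. B (e' i) (e' j) = (if i = j then 1 else 0)"
      using on he hh by (auto simp: e'_def)
    ultimately show ?thesis by (intro exI[of _ "Suc N"] exI[of _ e']) auto
  qed
qed

section \<open>The parametric system for the Fourier coefficients\<close>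

definition shift :: "nat \<Rightarrow> int \<Rightarrow> (nat \<Rightarrow> int) \<Rightarrow> nat \<Rightarrow> int" where
  "shift j m h = h(j := h j + m)"

lemma shift_shift [simp]: "shift j m (shift j m' h) = shift j (m' + m) h"
  by (auto simp: shift_def)

lemma shift_0 [simp]: "shift j 0 h = h"
  by (auto simp: shift_def)

lemma shift_in_Zs: "j \<in> {1..s} \<Longrightarrow> h \<in> Zs s \<Longrightarrow> shift j m h \<in> Zs s"
  by (auto simp: Zs_def shift_def)

lemma bij_betw_shift: "j \<in> {1..s} \<Longrightarrow> bij_betw (shift j m) (Zs s) (Zs s)"
  by (rule bij_betwI[where g = "shift j (- m)"]) (auto intro: shift_in_Zs)

lemma zero_in_Zs [simp]: "(\<lambda>_. 0) \<in> Zs s"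
  by (simp add: Zs_def)

lemma has_sum_shift:
  fixes f :: "(nat \<Rightarrow> int) \<Rightarrow> 'b::{comm_monoid_add, t2_space}"
  assumes "j \<in> {1..s}" "(f has_sum a) (Zs s)"
  shows "((\<lambda>h. f (shift j m h)) has_sum a) (Zs s)"
  using has_sum_reindex_bij_betw[OF bij_betw_shift[OF assms(1)], of f m a] assms(2) by simp

lemma has_sum_finite_sum:
  fixes f :: "'i \<Rightarrow> 'x \<Rightarrow> 'b::topological_comm_monoid_add"
  assumes "\<And>i. i \<in> I \<Longrightarrow> (f i has_sum a i) A"
  shows "((\<lambda>x. \<Sum>i\<in>I. f i x) has_sum (\<Sum>i\<in>I. a i)) A"
  using assms by (induction I rule: infinite_finite_induct) (auto intro: has_sum_add)

section \<open>Quadratic forms, coercivity and contraction for the nearest-neighbour system\<close>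

definition sqn :: "nat \<Rightarrow> (nat \<Rightarrow> real) \<Rightarrow> real" where
  "sqn N v = (\<Sum>i<N. (v i)\<^sup>2)"

definition form :: "nat \<Rightarrow> (nat \<Rightarrow> nat \<Rightarrow> real) \<Rightarrow> (nat \<Rightarrow> real) \<Rightarrow> (nat \<Rightarrow> real) \<Rightarrow> real" where
  "form N M v w = (\<Sum>i<N. \<Sum>k<N. M i k * v i * w k)"

lemma sqn_nonneg [simp]: "0 \<le> sqn N v"
  by (simp add: sqn_def sum_nonneg)

lemma sqn_scale: "sqn N (\<lambda>i. c * v i) = c\<^sup>2 * sqn N v"
  by (simp add: sqn_def power_mult_distrib sum_distrib_left)

lemma abs_le_sqrt_sqn: "i < N \<Longrightarrow> \<bar>v i\<bar> \<le> sqrt (sqn N v)"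
  unfolding sqn_def by (rule real_le_rsqrt) (use member_le_sum[of i "{..<N}" "\<lambda>i. (v i)\<^sup>2"] in auto)

lemma sqn_add_le:
  assumes "0 < \<epsilon>"
  shows "sqn N (\<lambda>i. v i + w i) \<le> (1 + \<epsilon>) * sqn N v + (1 + 1 / \<epsilon>) * sqn N w"
proof -
  have "(v i + w i)\<^sup>2 \<le> (1 + \<epsilon>) * (v i)\<^sup>2 + (1 + 1 / \<epsilon>) * (w i)\<^sup>2" for i
  proof -
    have "0 \<le> (\<epsilon> * v i - w i)\<^sup>2 / \<epsilon>" using assms by simp
    also have "\<dots> = \<epsilon> * (v i)\<^sup>2 - 2 * v i * w i + 1 / \<epsilon> * (w i)\<^sup>2"
      using assms by (simp add: field_simps power2_eq_square)
    finally show ?thesis by (simp add: algebra_simps power2_eq_square)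
  qed
  then show ?thesis unfolding sqn_def sum_distrib_left sum.distrib[symmetric] by (intro sum_mono)
qed

text \<open>\<open>Q j\<close> stands for the energy form of the absolute value of the
  \<open>j\<close>-th perturbation. It is kept as a function of \<open>v\<close> because
  \<open>elliptic\<close>, the worst case over all signs, is expressed by the \<open>Q j\<close>;
  their upper bounds through \<open>b j\<close> alone could add up to more than ellipticity
  allows.\<close>

locale form_system =
  fixes s N :: nat and A0 :: "nat \<Rightarrow> nat \<Rightarrow> real" and P :: "nat \<Rightarrow> nat \<Rightarrow> nat \<Rightarrow> real"
    and Q :: "nat \<Rightarrow> (nat \<Rightarrow> real) \<Rightarrow> real" and b :: "nat \<Rightarrow> real" and amin :: real
  assumes amin: "0 < amin"
    and b_pos: "\<And>j. j \<in> {1..s} \<Longrightarrow> 0 < b j"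
    and P_le: "\<And>j v w. j \<in> {1..s} \<Longrightarrow> \<bar>form N (P j) v w\<bar> \<le> (Q j v + Q j w) / 2"
    and Q_nonneg: "\<And>j v. j \<in> {1..s} \<Longrightarrow> 0 \<le> Q j v"
    and Q_le: "\<And>j v. j \<in> {1..s} \<Longrightarrow> Q j v \<le> amin * b j * sqn N v"
    and elliptic: "\<And>v. amin * sqn N v \<le> form N A0 v v - (\<Sum>j=1..s. Q j v)"
begin

text \<open>The system operator conjugated with a weight: \<open>p j h\<close> and
  \<open>q j h\<close> will be the quotients of the weight at \<open>h\<close> and at its two
  neighbours in direction \<open>j\<close>. The factor 1/2 comes from writing a cosine as a mean of
  two exponentials.\<close>

definition weighted_op ::
  "(nat \<Rightarrow> (nat \<Rightarrow> int) \<Rightarrow> real) \<Rightarrow> (nat \<Rightarrow> (nat \<Rightarrow> int) \<Rightarrow> real) \<Rightarrow>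
    ((nat \<Rightarrow> int) \<Rightarrow> nat \<Rightarrow> real) \<Rightarrow> (nat \<Rightarrow> int) \<Rightarrow> nat \<Rightarrow> real" where
  "weighted_op p q v h i = (\<Sum>k<N. A0 i k * v h k) +
     (\<Sum>j=1..s. \<Sum>k<N. P j i k * ((p j h * v (shift j (-1) h) k + q j h * v (shift j 1 h) k) / 2))"

definition nbh :: "((nat \<Rightarrow> int) \<Rightarrow> real) \<Rightarrow> (nat \<Rightarrow> int) \<Rightarrow> real" where
  "nbh E h = E h + (\<Sum>j=1..s. E (shift j (-1) h) + E (shift j 1 h))"

text \<open>At a single frequency coercivity can fail, but only by second differences of
  \<open>Q j\<close> along the coordinate \<open>j\<close>, and these sum to zero over
  \<open>Zs s\<close>. One copy of each \<open>Q j\<close> is absorbed by \<open>elliptic\<close>;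
  only the excess \<open>R j - 1\<close> is estimated through \<open>b j\<close>.\<close>

lemma weighted_op_lower:
  assumes pq: "\<And>j. j \<in> {1..s} \<Longrightarrow> 0 \<le> p j h \<and> p j h \<le> R j \<and> 0 \<le> q j h \<and> q j h \<le> R j"
    and R: "(\<Sum>j=1..s. b j * (R j - 1)) \<le> 1 / 2" "\<And>j. j \<in> {1..s} \<Longrightarrow> 1 \<le> R j"
  shows "amin / 2 * sqn N (v h) -
      (\<Sum>j=1..s. R j * (Q j (v (shift j (-1) h)) + Q j (v (shift j 1 h)) - 2 * Q j (v h)) / 4)
    \<le> (\<Sum>i<N. v h i * weighted_op p q v h i)"
proof -
  let ?d = "\<lambda>j. v (shift j (-1) h)" and ?u = "\<lambda>j. v (shift j 1 h)"
  have e: "(\<Sum>i<N. v h i * weighted_op p q v h i) =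
    form N A0 (v h) (v h) + (\<Sum>j=1..s. (p j h * form N (P j) (v h) (?d j) + q j h * form N (P j) (v h) (?u j)) / 2)"
  proof -
    have 1: "(\<Sum>i<N. v h i * (\<Sum>k<N. A0 i k * v h k)) = form N A0 (v h) (v h)"
      by (simp add: form_def sum_distrib_left mult_ac)
    have 2: "(\<Sum>i<N. v h i * (\<Sum>j=1..s. \<Sum>k<N. P j i k * ((p j h * ?d j k + q j h * ?u j k) / 2)))
       = (\<Sum>j=1..s. \<Sum>i<N. v h i * (\<Sum>k<N. P j i k * ((p j h * ?d j k + q j h * ?u j k) / 2)))"
      unfolding sum_distrib_left by (rule sum.swap)
    have 3: "(\<Sum>i<N. v h i * (\<Sum>k<N. P j i k * ((p j h * ?d j k + q j h * ?u j k) / 2)))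
      = (p j h * form N (P j) (v h) (?d j) + q j h * form N (P j) (v h) (?u j)) / 2" for j
      unfolding form_def sum_distrib_left sum.distrib[symmetric] sum_divide_distrib
      by (intro sum.cong refl) (simp add: field_simps)
    show ?thesis
      unfolding weighted_op_def distrib_left sum.distrib 1 2 3 ..
  qed
  have l: "- (R j * (2 * Q j (v h) + Q j (?d j) + Q j (?u j)) / 4)
      \<le> (p j h * form N (P j) (v h) (?d j) + q j h * form N (P j) (v h) (?u j)) / 2" if j: "j \<in> {1..s}" for j
  proof -
    have *: "- (R j * ((Q j (v h) + Q j w) / 2)) \<le> c * form N (P j) (v h) w" if "0 \<le> c" "c \<le> R j" for c w
    proof -
      have "\<bar>c * form N (P j) (v h) w\<bar> \<le> R j * ((Q j (v h) + Q j w) / 2)"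
        unfolding abs_mult using that P_le[OF j, of "v h" w] by (intro mult_mono) auto
      then show ?thesis by linarith
    qed
    from *[of "p j h" "?d j"] *[of "q j h" "?u j"] pq[OF j] show ?thesis by (simp add: field_simps)
  qed
  have "amin / 2 * sqn N (v h) \<le> form N A0 (v h) (v h) - (\<Sum>j=1..s. R j * Q j (v h))"
  proof -
    have "(\<Sum>j=1..s. (R j - 1) * Q j (v h)) \<le> (\<Sum>j=1..s. (R j - 1) * (amin * b j * sqn N (v h)))"
      by (intro sum_mono mult_left_mono Q_le) (use R(2) in auto)
    also have "\<dots> = (amin * sqn N (v h)) * (\<Sum>j=1..s. b j * (R j - 1))"
      by (simp add: sum_distrib_left mult_ac)
    also have "\<dots> \<le> (amin * sqn N (v h)) * (1 / 2)"
      using R(1) amin by (intro mult_left_mono) auto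
    finally show ?thesis using elliptic[of "v h"] by (simp add: algebra_simps sum.distrib sum_subtractf)
  qed
  moreover have "(\<Sum>j=1..s. - (R j * (2 * Q j (v h) + Q j (?d j) + Q j (?u j)) / 4)) \<le>
      (\<Sum>j=1..s. (p j h * form N (P j) (v h) (?d j) + q j h * form N (P j) (v h) (?u j)) / 2)"
    by (intro sum_mono l)
  moreover have "(\<Sum>j=1..s. - (R j * (2 * Q j (v h) + Q j (?d j) + Q j (?u j)) / 4)) =
     - (\<Sum>j=1..s. R j * Q j (v h)) - (\<Sum>j=1..s. R j * (Q j (?d j) + Q j (?u j) - 2 * Q j (v h)) / 4)"
    unfolding sum_negf[symmetric] sum_subtractf[symmetric] by (intro sum.cong refl) (simp add: field_simps)
  ultimately show ?thesis unfolding e by linarith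
qed

text \<open>Deliberately crude, and dependent on \<open>N\<close> and \<open>s\<close>: it restricts
  the step size of the iteration and enters none of the bounds on the iterates.\<close>

definition op_bound :: "real \<Rightarrow> real" where
  "op_bound r = real N * ((\<Sum>i<N. \<Sum>k<N. \<bar>A0 i k\<bar>) + r * (\<Sum>j=1..s. \<Sum>i<N. \<Sum>k<N. \<bar>P j i k\<bar>))\<^sup>2"

lemma weighted_op_upper:
  assumes pq: "\<And>j. j \<in> {1..s} \<Longrightarrow> 0 \<le> p j h \<and> p j h \<le> r \<and> 0 \<le> q j h \<and> q j h \<le> r" and r: "0 \<le> r"
  shows "sqn N (weighted_op p q v h) \<le> op_bound r * nbh (\<lambda>h. sqn N (v h)) h"
proof -
  define T where "T = nbh (\<lambda>h. sqn N (v h)) h"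
  have T0: "0 \<le> T" unfolding T_def nbh_def by (intro add_nonneg_nonneg sum_nonneg) auto
  have le: "sqn N (v h) \<le> T" "\<And>j. j \<in> {1..s} \<Longrightarrow> sqn N (v (shift j (-1) h)) \<le> T"
    "\<And>j. j \<in> {1..s} \<Longrightarrow> sqn N (v (shift j 1 h)) \<le> T"
  proof -
    let ?g = "\<lambda>j. sqn N (v (shift j (-1) h)) + sqn N (v (shift j 1 h))"
    show "sqn N (v h) \<le> T" unfolding T_def nbh_def by (simp add: sum_nonneg)
    have "?g j \<le> T" if "j \<in> {1..s}" for j
      using member_le_sum[OF that, of ?g] unfolding T_def nbh_def by (simp add: add_increasing)
    then show "sqn N (v (shift j (-1) h)) \<le> T" "sqn N (v (shift j 1 h)) \<le> T" if "j \<in> {1..s}" for j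
      using that sqn_nonneg[of N "v (shift j (-1) h)"] sqn_nonneg[of N "v (shift j 1 h)"] by (smt (verit))+
  qed
  have ab: "\<bar>v h' k\<bar> \<le> sqrt T" if "sqn N (v h') \<le> T" "k < N" for h' k
    using abs_le_sqrt_sqn[OF that(2), of "v h'"] real_sqrt_le_mono[OF that(1)] by linarith
  let ?K = "(\<Sum>i<N. \<Sum>k<N. \<bar>A0 i k\<bar>) + r * (\<Sum>j=1..s. \<Sum>i<N. \<Sum>k<N. \<bar>P j i k\<bar>)"
  have "\<bar>weighted_op p q v h i\<bar> \<le> ?K * sqrt T" if i: "i < N" for i
  proof -
    have "\<bar>\<Sum>k<N. A0 i k * v h k\<bar> \<le> (\<Sum>k<N. \<bar>A0 i k\<bar> * sqrt T)"
      by (rule order_trans[OF sum_abs]) (auto simp: abs_mult intro!: sum_mono mult_left_mono ab le)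
    also have "\<dots> \<le> (\<Sum>i<N. \<Sum>k<N. \<bar>A0 i k\<bar>) * sqrt T"
      unfolding sum_distrib_right[symmetric]
      by (intro mult_right_mono member_le_sum[of i "{..<N}" "\<lambda>i. \<Sum>k<N. \<bar>A0 i k\<bar>"]) (use i T0 in \<open>auto intro: sum_nonneg\<close>)
    finally have 1: "\<bar>\<Sum>k<N. A0 i k * v h k\<bar> \<le> (\<Sum>i<N. \<Sum>k<N. \<bar>A0 i k\<bar>) * sqrt T" .
    have "\<bar>(p j h * v (shift j (-1) h) k + q j h * v (shift j 1 h) k) / 2\<bar> \<le> r * sqrt T" if "j \<in> {1..s}" "k < N" for j k
    proof -
      have "\<bar>p j h * v (shift j (-1) h) k\<bar> \<le> r * sqrt T" "\<bar>q j h * v (shift j 1 h) k\<bar> \<le> r * sqrt T"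
        unfolding abs_mult using pq[OF that(1)] ab le that r by (auto intro!: mult_mono)
      from order_trans[OF abs_triangle_ineq add_mono[OF this]] show ?thesis by simp
    qed
    then have "\<bar>\<Sum>j=1..s. \<Sum>k<N. P j i k * ((p j h * v (shift j (-1) h) k + q j h * v (shift j 1 h) k) / 2)\<bar>
       \<le> (\<Sum>j=1..s. \<Sum>k<N. \<bar>P j i k\<bar> * (r * sqrt T))"
      by (intro order_trans[OF sum_abs] sum_mono order_trans[OF sum_abs]) (simp only: abs_mult[of "P _ _ _"], rule mult_left_mono, auto)
    also have "\<dots> = r * (\<Sum>j=1..s. \<Sum>k<N. \<bar>P j i k\<bar>) * sqrt T"
      by (simp add: sum_distrib_left sum_distrib_right mult_ac)
    also have "\<dots> \<le> r * (\<Sum>j=1..s. \<Sum>i<N. \<Sum>k<N. \<bar>P j i k\<bar>) * sqrt T"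
      by (intro mult_right_mono mult_left_mono sum_mono member_le_sum[of i "{..<N}" "\<lambda>i. \<Sum>k<N. \<bar>P _ i k\<bar>"])
         (use i T0 r in \<open>auto intro: sum_nonneg\<close>)
    finally have 2: "\<bar>\<Sum>j=1..s. \<Sum>k<N. P j i k * ((p j h * v (shift j (-1) h) k + q j h * v (shift j 1 h) k) / 2)\<bar>
       \<le> r * (\<Sum>j=1..s. \<Sum>i<N. \<Sum>k<N. \<bar>P j i k\<bar>) * sqrt T" .
    show ?thesis using 1 2 unfolding weighted_op_def by (simp add: distrib_right)
  qed
  then have "(weighted_op p q v h i)\<^sup>2 \<le> ?K\<^sup>2 * T" if "i < N" for i
    using power_mono[OF that[THEN \<open>\<And>i. i < N \<Longrightarrow> _\<close>], of 2] T0 by (simp add: power_mult_distrib)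
  then have "sqn N (weighted_op p q v h) \<le> (\<Sum>i<N. ?K\<^sup>2 * T)" unfolding sqn_def by (intro sum_mono) auto
  then show ?thesis unfolding op_bound_def T_def by (simp add: mult_ac)
qed

lemma has_sum_nbh:
  assumes "(E has_sum X) (Zs s)"
  shows "(nbh E has_sum ((1 + 2 * real s) * X)) (Zs s)"
proof -
  have "((\<lambda>h. \<Sum>j\<in>{1..s}. E (shift j (-1) h) + E (shift j 1 h)) has_sum (\<Sum>j\<in>{1..s}. X + X)) (Zs s)"
    by (intro has_sum_finite_sum has_sum_add has_sum_shift assms) auto
  from has_sum_add[OF assms this] show ?thesis
    unfolding nbh_def by (simp add: algebra_simps)
qed

text \<open>Expand the square. After summation the linear term gains \<open>\<tau> * amin\<close>,
  since the second differences cancel, and the step size condition lets the quadratic term give back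
  at most half of that gain.\<close>

theorem contraction:
  assumes pq: "\<And>j h. j \<in> {1..s} \<Longrightarrow> h \<in> Zs s \<Longrightarrow> 0 \<le> p j h \<and> p j h \<le> R j \<and> 0 \<le> q j h \<and> q j h \<le> R j"
    and R: "(\<Sum>j=1..s. b j * (R j - 1)) \<le> 1 / 2" "\<And>j. j \<in> {1..s} \<Longrightarrow> 1 \<le> R j \<and> R j \<le> r"
    and r: "0 \<le> r"
    and \<tau>: "0 < \<tau>" "\<tau> * (op_bound r * (1 + 2 * real s)) \<le> amin / 2"
    and E: "(\<lambda>h. sqn N (v h)) summable_on Zs s"
  shows "(\<lambda>h. sqn N (\<lambda>i. v h i - \<tau> * weighted_op p q v h i)) summable_on Zs s"
    and "(\<Sum>\<^sub>\<infinity>h\<in>Zs s. sqn N (\<lambda>i. v h i - \<tau> * weighted_op p q v h i))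
          \<le> (1 - \<tau> * (amin / 2)) * (\<Sum>\<^sub>\<infinity>h\<in>Zs s. sqn N (v h))"
proof -
  let ?E = "\<lambda>h. sqn N (v h)" and ?F = "\<lambda>h. sqn N (\<lambda>i. v h i - \<tau> * weighted_op p q v h i)"
  define X where "X = infsum ?E (Zs s)"
  have EX: "(?E has_sum X) (Zs s)" unfolding X_def using E by simp
  have X0: "0 \<le> X" unfolding X_def by (rule infsum_nonneg) auto
  define G where "G h = (1 - 2 * \<tau> * (amin / 2)) * ?E h
     + 2 * \<tau> * (\<Sum>j=1..s. R j * (Q j (v (shift j (-1) h)) + Q j (v (shift j 1 h)) - 2 * Q j (v h)) / 4)
     + \<tau>\<^sup>2 * op_bound r * nbh ?E h" for h
  have FG: "?F h \<le> G h" if h: "h \<in> Zs s" for h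
  proof -
    have "?F h = ?E h - 2 * \<tau> * (\<Sum>i<N. v h i * weighted_op p q v h i) + \<tau>\<^sup>2 * sqn N (weighted_op p q v h)"
      unfolding sqn_def sum_distrib_left sum_subtractf[symmetric] sum.distrib[symmetric]
      by (intro sum.cong refl) (simp add: power2_eq_square algebra_simps)
    also have "\<dots> \<le> ?E h - 2 * \<tau> * (amin / 2 * sqn N (v h) -
      (\<Sum>j=1..s. R j * (Q j (v (shift j (-1) h)) + Q j (v (shift j 1 h)) - 2 * Q j (v h)) / 4))
      + \<tau>\<^sup>2 * (op_bound r * nbh ?E h)"
    proof (intro add_mono diff_mono mult_left_mono order_refl)
      show "amin / 2 * sqn N (v h) -
        (\<Sum>j=1..s. R j * (Q j (v (shift j (-1) h)) + Q j (v (shift j 1 h)) - 2 * Q j (v h)) / 4)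
        \<le> (\<Sum>i<N. v h i * weighted_op p q v h i)"
        by (rule weighted_op_lower) (use pq R h in auto)
      show "sqn N (weighted_op p q v h) \<le> op_bound r * nbh ?E h"
        by (rule weighted_op_upper) (use pq R(2) r h order_trans in \<open>blast+\<close>)
    qed (use \<tau> in auto)
    also have "\<dots> = G h"
    proof -
      have "e - 2 * \<tau> * (amin / 2 * e - S) + \<tau>\<^sup>2 * (c * n) = (1 - 2 * \<tau> * (amin / 2)) * e + 2 * \<tau> * S + \<tau>\<^sup>2 * c * n"
        for e S c n :: real by (simp add: algebra_simps)
      then show ?thesis unfolding G_def .
    qed
    finally show ?thesis .
  qed
  have Qs: "(\<lambda>h. Q j (v h)) summable_on Zs s" if j: "j \<in> {1..s}" for j
  proof (rule summable_on_comparison_test[of "\<lambda>h. amin * b j * ?E h"])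
    show "(\<lambda>h. amin * b j * ?E h) summable_on Zs s" using E by (rule summable_on_cmult_right)
  qed (use Q_le[OF j] Q_nonneg[OF j] in auto)
  \<comment> \<open>Shifting the summation index does not change the sum, so each second difference
    contributes \<open>Y + Y - 2 * Y\<close>.\<close>
  have "((\<lambda>h. R j * (Q j (v (shift j (-1) h)) + Q j (v (shift j 1 h)) - 2 * Q j (v h)) / 4)
      has_sum 0) (Zs s)" if j: "j \<in> {1..s}" for j
  proof -
    define Y where "Y = infsum (\<lambda>h. Q j (v h)) (Zs s)"
    have Y: "((\<lambda>h. Q j (v h)) has_sum Y) (Zs s)" unfolding Y_def using Qs[OF j] by simp
    have "((\<lambda>h. R j / 4 * (Q j (v (shift j (-1) h)) + Q j (v (shift j 1 h)) + (- 2) * Q j (v h)))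
      has_sum (R j / 4 * (Y + Y + (- 2) * Y))) (Zs s)"
      by (intro has_sum_cmult_right has_sum_add has_sum_shift[OF j, of "\<lambda>h. Q j (v h)"] Y)
    then show ?thesis by (simp add: mult.commute)
  qed
  then have "((\<lambda>h. \<Sum>j\<in>{1..s}. R j * (Q j (v (shift j (-1) h)) + Q j (v (shift j 1 h)) - 2 * Q j (v h)) / 4)
      has_sum (\<Sum>j\<in>{1..s}. 0)) (Zs s)" by (intro has_sum_finite_sum) auto
  then have "(G has_sum ((1 - 2 * \<tau> * (amin / 2)) * X + 2 * \<tau> * 0 + \<tau>\<^sup>2 * op_bound r * ((1 + 2 * real s) * X))) (Zs s)"
    unfolding G_def by (intro has_sum_add has_sum_cmult_right EX has_sum_nbh) auto
  moreover have "\<tau>\<^sup>2 * op_bound r * ((1 + 2 * real s) * X) \<le> \<tau> * (amin / 2) * X"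
    using mult_left_mono[OF mult_right_mono[OF \<tau>(2) X0], of \<tau>] \<tau>(1) by (simp add: power2_eq_square mult_ac)
  ultimately obtain Z where Z: "(G has_sum Z) (Zs s)" "Z \<le> (1 - \<tau> * (amin / 2)) * X"
    by (auto simp: algebra_simps)
  show F: "?F summable_on Zs s"
    by (rule summable_on_comparison_test[OF has_sum_imp_summable[OF Z(1)]]) (use FG in auto)
  show "infsum ?F (Zs s) \<le> (1 - \<tau> * (amin / 2)) * infsum ?E (Zs s)"
    using infsum_mono[OF F has_sum_imp_summable[OF Z(1)] FG] Z infsumI[OF Z(1)] unfolding X_def by simp
qed

section \<open>Fixed-point iteration for the Fourier coefficients\<close>

definition sys_op :: "((nat \<Rightarrow> int) \<Rightarrow> nat \<Rightarrow> real) \<Rightarrow> (nat \<Rightarrow> int) \<Rightarrow> nat \<Rightarrow> real" where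
  "sys_op = weighted_op (\<lambda>_ _. 1) (\<lambda>_ _. 1)"

text \<open>The load does not depend on the parameter, so it acts at the zero frequency
  only.\<close>

definition step :: "real \<Rightarrow> (nat \<Rightarrow> real) \<Rightarrow> ((nat \<Rightarrow> int) \<Rightarrow> nat \<Rightarrow> real) \<Rightarrow> (nat \<Rightarrow> int) \<Rightarrow> nat \<Rightarrow> real" where
  "step \<tau> l d h i = d h i - \<tau> * sys_op d h i + \<tau> * (if h = (\<lambda>_. 0) then l i else 0)"

definition iterate :: "real \<Rightarrow> (nat \<Rightarrow> real) \<Rightarrow> nat \<Rightarrow> (nat \<Rightarrow> int) \<Rightarrow> nat \<Rightarrow> real" where
  "iterate \<tau> l m = (step \<tau> l ^^ m) (\<lambda>_ _. 0)"

text \<open>Weights whose conjugated operator keeps half of the coercivity. The value 1 at the zero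
  frequency makes the weighted norm of the load its plain norm, and the common bound
  \<open>r\<close> lets one step size serve all weights.\<close>

definition admissible :: "real \<Rightarrow> ((nat \<Rightarrow> int) \<Rightarrow> real) \<Rightarrow> (nat \<Rightarrow> real) \<Rightarrow> bool" where
  "admissible r W R \<longleftrightarrow> W (\<lambda>_. 0) = 1 \<and> (\<forall>h. 0 < W h) \<and>
     (\<forall>j\<in>{1..s}. \<forall>h. W h \<le> R j * W (shift j 1 h) \<and> W h \<le> R j * W (shift j (-1) h)) \<and>
     (\<Sum>j=1..s. b j * (R j - 1)) \<le> 1 / 2 \<and> (\<forall>j\<in>{1..s}. 1 \<le> R j \<and> R j \<le> r)"

definition small_step :: "real \<Rightarrow> real \<Rightarrow> bool" where
  "small_step r \<tau> \<longleftrightarrow> 0 \<le> r \<and> 0 < \<tau> \<and> \<tau> * (op_bound r * (1 + 2 * real s)) \<le> amin / 2 \<and> \<tau> * (amin / 2) \<le> 1"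

lemma small_step_exists: "0 \<le> r \<Longrightarrow> \<exists>\<tau>. small_step r \<tau>"
proof -
  assume r: "0 \<le> r"
  define M where "M = op_bound r * (1 + 2 * real s)"
  have M: "0 \<le> M" unfolding M_def op_bound_def by simp
  define \<tau> where "\<tau> = min (amin / 2 / (M + 1)) (2 / amin)"
  have "\<tau> * M \<le> (amin / 2 / (M + 1)) * M" using M unfolding \<tau>_def by (intro mult_right_mono) auto
  also have "\<dots> \<le> amin / 2" using M amin by (simp add: field_simps)
  finally have "\<tau> * M \<le> amin / 2" .
  moreover have "\<tau> * (amin / 2) \<le> 2 / amin * (amin / 2)" unfolding \<tau>_def using amin by (intro mult_right_mono) auto
  moreover have "0 < \<tau>" using M amin by (simp add: \<tau>_def)
  ultimately show ?thesis unfolding small_step_def M_def using r amin by (intro exI[of _ \<tau>]) auto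
qed

lemma has_sum_delta:
  fixes c :: "'b::{comm_monoid_add, t2_space}"
  shows "((\<lambda>h. if h = (\<lambda>_. 0) then c else 0) has_sum c) (Zs s)"
  by (rule has_sum_finite_neutralI[of "{\<lambda>_. 0}"]) auto

text \<open>Multiplication by \<open>W\<close> turns \<open>sys_op\<close> into
  \<open>weighted_op\<close> with quotients of \<open>W\<close> as coefficients, so contraction in
  the weighted norm is contraction of the conjugated operator in the plain norm.\<close>

lemma weighted_contraction:
  assumes W: "admissible r W R" and \<tau>: "small_step r \<tau>"
    and E: "(\<lambda>h. sqn N (\<lambda>i. W h * d h i)) summable_on Zs s"
  shows "(\<lambda>h. sqn N (\<lambda>i. W h * (d h i - \<tau> * sys_op d h i))) summable_on Zs s"
    and "(\<Sum>\<^sub>\<infinity>h\<in>Zs s. sqn N (\<lambda>i. W h * (d h i - \<tau> * sys_op d h i)))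
          \<le> (1 - \<tau> * (amin / 2)) * (\<Sum>\<^sub>\<infinity>h\<in>Zs s. sqn N (\<lambda>i. W h * d h i))"
proof -
  define p q where "p = (\<lambda>j h. W h / W (shift j (-1) h))" and "q = (\<lambda>j h. W h / W (shift j 1 h))"
  define v where "v = (\<lambda>h i. W h * d h i)"
  have W0: "0 < W h" for h using W unfolding admissible_def by blast
  have e: "W h * (d h i - \<tau> * sys_op d h i) = v h i - \<tau> * weighted_op p q v h i" for h i
  proof -
    have "p j h * v (shift j (-1) h) k = W h * d (shift j (-1) h) k"
      "q j h * v (shift j 1 h) k = W h * d (shift j 1 h) k" for j k
      using W0[of "shift j (-1) h"] W0[of "shift j 1 h"] by (auto simp: p_def q_def v_def)
    note pq = this
    have "W h * sys_op d h i = weighted_op p q v h i"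
      unfolding sys_op_def weighted_op_def distrib_left sum_distrib_left
      by (intro arg_cong2[where f = "(+)"] sum.cong refl) (simp_all only: pq, simp_all add: v_def distrib_left)
    then show ?thesis by (simp add: v_def right_diff_distrib mult.left_commute)
  qed
  have R: "(\<Sum>j=1..s. b j * (R j - 1)) \<le> 1 / 2" "\<And>j. j \<in> {1..s} \<Longrightarrow> 1 \<le> R j \<and> R j \<le> r"
    and WR: "\<And>j h. j \<in> {1..s} \<Longrightarrow> W h \<le> R j * W (shift j 1 h) \<and> W h \<le> R j * W (shift j (-1) h)"
    using W unfolding admissible_def by auto
  have pq: "0 \<le> p j h \<and> p j h \<le> R j \<and> 0 \<le> q j h \<and> q j h \<le> R j" if "j \<in> {1..s}" for j h
    using WR[OF that] W0 less_imp_le[OF W0] unfolding p_def q_def by (simp add: pos_divide_le_eq)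
  from \<tau> have \<tau>': "0 \<le> r" "0 < \<tau>" "\<tau> * (op_bound r * (1 + 2 * real s)) \<le> amin / 2"
    unfolding small_step_def by auto
  have E': "(\<lambda>h. sqn N (v h)) summable_on Zs s" using E unfolding v_def .
  show "(\<lambda>h. sqn N (\<lambda>i. W h * (d h i - \<tau> * sys_op d h i))) summable_on Zs s"
    unfolding e by (rule contraction(1)[OF pq R \<tau>' E'])
  show "(\<Sum>\<^sub>\<infinity>h\<in>Zs s. sqn N (\<lambda>i. W h * (d h i - \<tau> * sys_op d h i)))
          \<le> (1 - \<tau> * (amin / 2)) * (\<Sum>\<^sub>\<infinity>h\<in>Zs s. sqn N (\<lambda>i. W h * d h i))"
    unfolding e using contraction(2)[OF pq R \<tau>' E'] unfolding v_def .
qed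

text \<open>The gain of the contraction leaves room to add the load by Young's inequality in every
  step. The iterates do not involve \<open>W\<close>, and the bound involves neither
  \<open>m\<close> nor \<tau> nor \<open>N\<close> nor \<open>s\<close>; both facts are essential
  for passing to the limit with all weights at once.\<close>

lemma iterate_bound:
  assumes W: "admissible r W R" and \<tau>: "small_step r \<tau>"
  shows "(\<lambda>h. sqn N (\<lambda>i. W h * iterate \<tau> l m h i)) summable_on Zs s \<and>
    (\<Sum>\<^sub>\<infinity>h\<in>Zs s. sqn N (\<lambda>i. W h * iterate \<tau> l m h i)) \<le> 6 * sqn N l / (amin / 2)\<^sup>2"
proof (induction m)
  case 0
  show ?case by (simp add: iterate_def sqn_def sum_nonneg)
next
  case (Suc m)
  define \<kappa> where "\<kappa> = amin / 2"
  have \<kappa>: "0 < \<kappa>" using amin by (simp add: \<kappa>_def)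
  have t: "0 < \<tau>" "\<tau> * \<kappa> \<le> 1" using \<tau> unfolding small_step_def \<kappa>_def by auto
  \<comment> \<open>The contraction factor is \<open>1 - 2 * \<epsilon>\<close>. Young's inequality
    with this same \<epsilon> costs a factor \<open>1 + \<epsilon>\<close>, and the product of the
    two stays below \<open>1 - \<epsilon>\<close>.\<close>
  define \<epsilon> where "\<epsilon> = \<tau> * \<kappa> / 2"
  have \<epsilon>: "0 < \<epsilon>" using t \<kappa> by (simp add: \<epsilon>_def)
  let ?d = "iterate \<tau> l m"
  define X where "X = (\<Sum>\<^sub>\<infinity>h\<in>Zs s. sqn N (\<lambda>i. W h * ?d h i))"
  define F where "F h = sqn N (\<lambda>i. W h * (?d h i - \<tau> * sys_op ?d h i))" for h
  define B where "B = 6 * sqn N l / \<kappa>\<^sup>2"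
  have X: "X \<le> B" using Suc.IH unfolding X_def B_def \<kappa>_def by simp
  have F: "F summable_on Zs s" "infsum F (Zs s) \<le> (1 - 2 * \<epsilon>) * X"
    using weighted_contraction[OF W \<tau> Suc.IH[THEN conjunct1]] unfolding F_def X_def \<epsilon>_def \<kappa>_def by auto
  define G where "G h = (1 + \<epsilon>) * F h + (1 + 1 / \<epsilon>) * (if h = (\<lambda>_. 0) then \<tau>\<^sup>2 * sqn N l else 0)" for h
  have G: "(G has_sum ((1 + \<epsilon>) * infsum F (Zs s) + (1 + 1 / \<epsilon>) * (\<tau>\<^sup>2 * sqn N l))) (Zs s)"
    unfolding G_def by (intro has_sum_add has_sum_cmult_right has_sum_infsum F has_sum_delta)
  have W1: "W (\<lambda>_. 0) = 1" using W unfolding admissible_def by blast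
  have le: "sqn N (\<lambda>i. W h * iterate \<tau> l (Suc m) h i) \<le> G h" for h
  proof -
    have "(\<lambda>i. W h * iterate \<tau> l (Suc m) h i) =
      (\<lambda>i. W h * (?d h i - \<tau> * sys_op ?d h i) + (if h = (\<lambda>_. 0) then \<tau> * l i else 0))"
      by (auto simp: iterate_def step_def W1 distrib_left)
    then have "sqn N (\<lambda>i. W h * iterate \<tau> l (Suc m) h i) \<le>
      (1 + \<epsilon>) * F h + (1 + 1 / \<epsilon>) * sqn N (\<lambda>i. if h = (\<lambda>_. 0) then \<tau> * l i else 0)"
      unfolding F_def using sqn_add_le[OF \<epsilon>] by simp
    also have "sqn N (\<lambda>i. if h = (\<lambda>_. 0) then \<tau> * l i else 0) = (if h = (\<lambda>_. 0) then \<tau>\<^sup>2 * sqn N l else 0)"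
      by (auto simp: sqn_scale) (simp add: sqn_def)
    finally show ?thesis unfolding G_def .
  qed
  have sm: "(\<lambda>h. sqn N (\<lambda>i. W h * iterate \<tau> l (Suc m) h i)) summable_on Zs s"
    by (rule summable_on_comparison_test[OF has_sum_imp_summable[OF G]]) (use le in auto)
  have "(\<Sum>\<^sub>\<infinity>h\<in>Zs s. sqn N (\<lambda>i. W h * iterate \<tau> l (Suc m) h i)) \<le> infsum G (Zs s)"
    by (rule infsum_mono[OF sm has_sum_imp_summable[OF G] le])
  also have "\<dots> = (1 + \<epsilon>) * infsum F (Zs s) + (1 + 1 / \<epsilon>) * (\<tau>\<^sup>2 * sqn N l)" by (rule infsumI[OF G])
  also have "\<dots> \<le> (1 - \<epsilon>) * B + \<epsilon> * B"
  proof (rule add_mono)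
    have X0: "0 \<le> X" unfolding X_def by (rule infsum_nonneg) auto
    have "(1 + \<epsilon>) * infsum F (Zs s) \<le> (1 + \<epsilon>) * ((1 - 2 * \<epsilon>) * X)" using F \<epsilon> by (intro mult_left_mono) auto
    also have "\<dots> = (1 - \<epsilon> - 2 * \<epsilon>\<^sup>2) * X" by (simp add: algebra_simps power2_eq_square)
    also have "\<dots> \<le> (1 - \<epsilon>) * X" using X0 by (intro mult_right_mono) auto
    also have "\<dots> \<le> (1 - \<epsilon>) * B" using X t by (intro mult_left_mono) (auto simp: \<epsilon>_def)
    finally show "(1 + \<epsilon>) * infsum F (Zs s) \<le> (1 - \<epsilon>) * B" .
    \<comment> \<open>The load costs at most \<open>3 * \<tau> / \<kappa>\<close> times its norm,
      and this equals \<open>\<epsilon> * (6 / \<kappa>\<^sup>2)\<close>. Hence the 6 in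
      \<open>B\<close>, which makes \<open>B\<close> invariant under the recursion.\<close>
    have "(1 + 1 / \<epsilon>) * \<tau>\<^sup>2 = \<tau> * (\<tau> + 2 / \<kappa>)" using t \<kappa> by (simp add: \<epsilon>_def field_simps power2_eq_square)
    also have "\<dots> \<le> \<tau> * (3 / \<kappa>)" using t \<kappa> by (intro mult_left_mono) (auto simp: field_simps)
    finally have "(1 + 1 / \<epsilon>) * \<tau>\<^sup>2 * sqn N l \<le> \<tau> * (3 / \<kappa>) * sqn N l" by (rule mult_right_mono) auto
    also have "\<dots> = \<epsilon> * B" using \<kappa> by (simp add: \<epsilon>_def B_def field_simps power2_eq_square)
    finally show "(1 + 1 / \<epsilon>) * (\<tau>\<^sup>2 * sqn N l) \<le> \<epsilon> * B" by (simp add: mult.assoc)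
  qed
  also have "\<dots> = B" by (simp add: algebra_simps)
  finally show ?case using sm unfolding B_def \<kappa>_def by simp
qed

text \<open>Differences of iterates contract in the plain norm, so they decay geometrically at each
  frequency and the iterates converge pointwise. A bound on sums over finite sets \<open>F\<close>
  survives pointwise limits, so the one limit \<open>d\<close> inherits the bounds for all
  admissible weights.\<close>

theorem solution_exists:
  assumes r: "1 \<le> r"
  obtains d where "\<And>h i. h \<in> Zs s \<Longrightarrow> i < N \<Longrightarrow> sys_op d h i = (if h = (\<lambda>_. 0) then l i else 0)"
    and "\<And>W R F. admissible r W R \<Longrightarrow> finite F \<Longrightarrow> F \<subseteq> Zs s \<Longrightarrow>
        (\<Sum>h\<in>F. (W h)\<^sup>2 * sqn N (d h)) \<le> 6 * sqn N l / (amin / 2)\<^sup>2"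
proof -
  obtain \<tau> where \<tau>: "small_step r \<tau>" using small_step_exists[of r] r by auto
  have t: "0 < \<tau>" "\<tau> * (amin / 2) \<le> 1" using \<tau> unfolding small_step_def by auto
  let ?x = "iterate \<tau> l"
  define \<theta> where "\<theta> = 1 - \<tau> * (amin / 2)"
  have \<theta>: "0 \<le> \<theta>" "\<theta> < 1" using t amin by (auto simp: \<theta>_def)
  have adm1: "admissible r (\<lambda>_. 1) (\<lambda>_. 1)" using r by (simp add: admissible_def)
  define D where "D m h i = ?x (Suc m) h i - ?x m h i" for m h i
  have Dstep: "D (Suc m) h i = D m h i - \<tau> * sys_op (D m) h i" for m h i
  proof -
    have lin: "sys_op (?x (Suc m)) h i - sys_op (?x m) h i = sys_op (D m) h i"
    proof -
      have "(\<Sum>k<N. A0 i k * ?x (Suc m) h k) - (\<Sum>k<N. A0 i k * ?x m h k) = (\<Sum>k<N. A0 i k * D m h k)"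
        unfolding D_def by (simp only: right_diff_distrib sum_subtractf)
      moreover have "(\<Sum>j=1..s. \<Sum>k<N. P j i k * ((1 * ?x (Suc m) (shift j (-1) h) k + 1 * ?x (Suc m) (shift j 1 h) k) / 2))
          - (\<Sum>j=1..s. \<Sum>k<N. P j i k * ((1 * ?x m (shift j (-1) h) k + 1 * ?x m (shift j 1 h) k) / 2))
          = (\<Sum>j=1..s. \<Sum>k<N. P j i k * ((1 * D m (shift j (-1) h) k + 1 * D m (shift j 1 h) k) / 2))"
        unfolding sum_subtractf[symmetric] right_diff_distrib[symmetric] D_def
        by (intro sum.cong refl arg_cong2[where f = "(*)"]) (simp add: field_simps)
      ultimately show ?thesis unfolding sys_op_def weighted_op_def by linarith
    qed
    have "D (Suc m) h i = step \<tau> l (?x (Suc m)) h i - step \<tau> l (?x m) h i"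
      by (simp add: D_def iterate_def)
    also have "\<dots> = D m h i - \<tau> * (sys_op (?x (Suc m)) h i - sys_op (?x m) h i)"
      by (simp add: step_def D_def algebra_simps)
    finally show ?thesis unfolding lin .
  qed
  define B where "B = infsum (\<lambda>h. sqn N (D 0 h)) (Zs s)"
  have Ds: "(\<lambda>h. sqn N (D m h)) summable_on Zs s \<and> infsum (\<lambda>h. sqn N (D m h)) (Zs s) \<le> \<theta> ^ m * B" for m
  proof (induction m)
    case 0
    have "D 0 h = ?x 1 h" for h by (auto simp: D_def iterate_def)
    then show ?case using iterate_bound[OF adm1 \<tau>, of l 1] by (simp add: B_def)
  next
    case (Suc m)
    have e: "(\<lambda>h. sqn N (D (Suc m) h)) = (\<lambda>h. sqn N (\<lambda>i. 1 * (D m h i - \<tau> * sys_op (D m) h i)))"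
      by (intro ext arg_cong[where f = "sqn N"]) (simp only: Dstep mult_1)
    have IH: "(\<lambda>h. sqn N (\<lambda>i. 1 * D m h i)) summable_on Zs s" using Suc.IH by simp
    have s: "(\<lambda>h. sqn N (D (Suc m) h)) summable_on Zs s"
      unfolding e by (rule weighted_contraction(1)[OF adm1 \<tau> IH])
    have "infsum (\<lambda>h. sqn N (D (Suc m) h)) (Zs s) \<le> \<theta> * infsum (\<lambda>h. sqn N (D m h)) (Zs s)"
      using weighted_contraction(2)[OF adm1 \<tau> IH] unfolding e \<theta>_def by simp
    also have "\<theta> * infsum (\<lambda>h. sqn N (D m h)) (Zs s) \<le> \<theta> * (\<theta> ^ m * B)"
      using Suc.IH \<theta> by (intro mult_left_mono) auto
    finally show ?case using s by (simp add: mult.assoc)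
  qed
  define d where "d h i = lim (\<lambda>m. ?x m h i)" for h i
  have lim: "(\<lambda>m. ?x m h i) \<longlonglongrightarrow> d h i" if h: "h \<in> Zs s" and i: "i < N" for h i
  proof -
    have "\<bar>D m h i\<bar> \<le> sqrt B * sqrt \<theta> ^ m" for m
    proof -
      have "sqn N (D m h) = (\<Sum>h\<in>{h}. sqn N (D m h))" by simp
      also have "\<dots> \<le> infsum (\<lambda>h. sqn N (D m h)) (Zs s)"
        using Ds[of m] h by (intro finite_sum_le_infsum) auto
      also have "\<dots> \<le> \<theta> ^ m * B" using Ds by blast
      finally have "sqrt (sqn N (D m h)) \<le> sqrt (\<theta> ^ m * B)" by (rule real_sqrt_le_mono)
      also have "\<dots> = sqrt B * sqrt \<theta> ^ m" by (simp only: real_sqrt_mult real_sqrt_power mult.commute)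
      finally have "sqrt (sqn N (D m h)) \<le> sqrt B * sqrt \<theta> ^ m" .
      then show ?thesis using abs_le_sqrt_sqn[OF i, of "D m h"] by linarith
    qed
    moreover have "summable (\<lambda>m. sqrt B * sqrt \<theta> ^ m)" using \<theta> by (intro summable_mult summable_geometric) auto
    ultimately have "summable (\<lambda>m. D m h i)" using summable_comparison_test'[of "\<lambda>m. sqrt B * sqrt \<theta> ^ m" 0 "\<lambda>m. D m h i"] by simp
    then have "convergent (\<lambda>m. \<Sum>k<m. D k h i)" by (simp add: summable_iff_convergent)
    moreover have "(\<Sum>k<m. D k h i) = ?x m h i" for m
    proof -
      have "?x 0 h i = 0" by (simp add: iterate_def)
      then show ?thesis unfolding D_def using sum_lessThan_telescope[of "\<lambda>k. ?x k h i" m] by (simp only: diff_0_right)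
    qed
    ultimately show ?thesis unfolding d_def by (simp only: convergent_LIMSEQ_iff)
  qed
  show thesis
  proof (rule that)
    fix h i assume h: "h \<in> Zs s" and i: "i < N"
    have "(\<lambda>m. sys_op (?x m) h i) \<longlonglongrightarrow> sys_op d h i"
      unfolding sys_op_def weighted_op_def
      by (intro tendsto_intros lim h shift_in_Zs) auto
    then have "(\<lambda>m. step \<tau> l (?x m) h i) \<longlonglongrightarrow> d h i - \<tau> * sys_op d h i + \<tau> * (if h = (\<lambda>_. 0) then l i else 0)"
      unfolding step_def by (intro tendsto_intros lim h i)
    moreover have "(\<lambda>m. step \<tau> l (?x m) h i) \<longlonglongrightarrow> d h i"
      using LIMSEQ_Suc[OF lim[OF h i]] by (simp add: iterate_def)
    ultimately have "d h i - \<tau> * sys_op d h i + \<tau> * (if h = (\<lambda>_. 0) then l i else 0) = d h i"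
      by (rule LIMSEQ_unique)
    then show "sys_op d h i = (if h = (\<lambda>_. 0) then l i else 0)" using t by (simp add: algebra_simps split: if_splits)
  next
    fix W R F assume W: "admissible r W R" and F: "finite F" "F \<subseteq> Zs s"
    have "(\<lambda>m. \<Sum>h\<in>F. sqn N (\<lambda>i. W h * ?x m h i)) \<longlonglongrightarrow> (\<Sum>h\<in>F. sqn N (\<lambda>i. W h * d h i))"
      unfolding sqn_def by (intro tendsto_intros lim) (use F in auto)
    moreover have "(\<Sum>h\<in>F. sqn N (\<lambda>i. W h * ?x m h i)) \<le> 6 * sqn N l / (amin / 2)\<^sup>2" for m
    proof -
      have "(\<Sum>h\<in>F. sqn N (\<lambda>i. W h * ?x m h i)) \<le> infsum (\<lambda>h. sqn N (\<lambda>i. W h * ?x m h i)) (Zs s)"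
        using iterate_bound[OF W \<tau>, of l m] F by (intro finite_sum_le_infsum) auto
      then show ?thesis using iterate_bound[OF W \<tau>, of l m] by linarith
    qed
    ultimately show "(\<Sum>h\<in>F. (W h)\<^sup>2 * sqn N (d h)) \<le> 6 * sqn N l / (amin / 2)\<^sup>2"
      unfolding sqn_scale[symmetric] by (intro LIMSEQ_le_const2) auto
  qed
qed

end

section \<open>Fourier series on the torus\<close>

lemma has_sum_times:
  fixes f :: "'x \<Rightarrow> 'b::{real_normed_field, banach}" and g :: "'y \<Rightarrow> 'b"
  assumes f: "(f has_sum a) A" "f abs_summable_on A" and g: "(g has_sum b) B" "g abs_summable_on B"
  shows "((\<lambda>(x, y). f x * g y) has_sum (a * b)) (A \<times> B)"
    and "(\<lambda>(x, y). f x * g y) abs_summable_on (A \<times> B)"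
proof -
  have "(\<lambda>(x, y). norm (f x) * norm (g y)) summable_on (A \<times> B)"
  proof (rule summable_on_SigmaI)
    show "((\<lambda>y. case (x, y) of (x, y) \<Rightarrow> norm (f x) * norm (g y)) has_sum (norm (f x) * infsum (\<lambda>y. norm (g y)) B)) B" for x
      using has_sum_cmult_right[OF has_sum_infsum[OF g(2)]] by simp
    show "(\<lambda>x. norm (f x) * infsum (\<lambda>y. norm (g y)) B) summable_on A"
      using f(2) by (rule summable_on_cmult_left)
  qed auto
  then show ab: "(\<lambda>(x, y). f x * g y) abs_summable_on (A \<times> B)"
    by (simp add: case_prod_unfold norm_mult)
  show "((\<lambda>(x, y). f x * g y) has_sum (a * b)) (A \<times> B)"
  proof (rule has_sum_SigmaI)
    show "((\<lambda>y. case (x, y) of (x, y) \<Rightarrow> f x * g y) has_sum (f x * b)) B" for x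
      using has_sum_cmult_right[OF g(1)] by simp
    show "((\<lambda>x. f x * b) has_sum (a * b)) A" by (rule has_sum_cmult_left[OF f(1)])
    show "(\<lambda>(x, y). f x * g y) summable_on A \<times> B" using ab by (rule abs_summable_summable)
  qed
qed

section \<open>Sums of products over integer vectors\<close>

definition supported :: "nat \<Rightarrow> 'z \<Rightarrow> (nat \<Rightarrow> 'z) set" where
  "supported s z = {h. \<forall>j. j \<notin> {1..s} \<longrightarrow> h j = z}"

lemma Zs_eq_supported: "Zs s = supported s 0"
  by (simp add: Zs_def supported_def)

lemma has_sum_prod_supported:
  fixes f :: "nat \<Rightarrow> 'z \<Rightarrow> 'b::{real_normed_field, banach}"
  assumes "\<And>j. j \<in> {1..s} \<Longrightarrow> (f j has_sum a j) UNIV" "\<And>j. j \<in> {1..s} \<Longrightarrow> f j abs_summable_on UNIV"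
  shows "((\<lambda>h. \<Prod>j=1..s. f j (h j)) has_sum (\<Prod>j=1..s. a j)) (supported s z) \<and>
    (\<lambda>h. \<Prod>j=1..s. f j (h j)) abs_summable_on (supported s z)"
  using assms
proof (induction s)
  case 0
  have e: "supported 0 z = {\<lambda>_. z}" by (auto simp: supported_def)
  show ?case unfolding e by (auto intro: has_sum_finiteI)
next
  case (Suc s)
  have bij: "bij_betw (\<lambda>(h, m). h(Suc s := m)) (supported s z \<times> UNIV) (supported (Suc s) z)"
    by (rule bij_betwI[where g = "\<lambda>h. (h(Suc s := z), h (Suc s))"]) (auto simp: supported_def fun_eq_iff)
  have e: "(\<Prod>j=1..Suc s. f j (((\<lambda>(h, m). h(Suc s := m)) p) j)) = (\<lambda>(h, m). (\<Prod>j=1..s. f j (h j)) * f (Suc s) m) p" for p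
    by (cases p) (simp add: prod.nat_ivl_Suc' mult.commute)
  from Suc have IH: "((\<lambda>h. \<Prod>j=1..s. f j (h j)) has_sum (\<Prod>j=1..s. a j)) (supported s z)"
    "(\<lambda>h. \<Prod>j=1..s. f j (h j)) abs_summable_on (supported s z)" by auto
  have l: "(f (Suc s) has_sum a (Suc s)) UNIV" "f (Suc s) abs_summable_on UNIV" using Suc.prems by auto
  note t = has_sum_times[OF IH l]
  have "((\<lambda>h. \<Prod>j=1..Suc s. f j (h j)) has_sum ((\<Prod>j=1..s. a j) * a (Suc s))) (supported (Suc s) z)"
    using has_sum_reindex_bij_betw[OF bij, of "\<lambda>h. \<Prod>j=1..Suc s. f j (h j)"] t(1) unfolding e by (simp add: case_prod_unfold)
  moreover have "(\<lambda>h. \<Prod>j=1..Suc s. f j (h j)) abs_summable_on (supported (Suc s) z)"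
    using summable_on_reindex_bij_betw[OF bij, of "\<lambda>h. norm (\<Prod>j=1..Suc s. f j (h j))"] t(2) unfolding e by (simp add: case_prod_unfold)
  ultimately show ?case by (simp add: prod.nat_ivl_Suc' mult.commute)
qed

lemma has_sum_prod_Zs:
  fixes f :: "nat \<Rightarrow> int \<Rightarrow> 'b::{real_normed_field, banach}"
  assumes "\<And>j. j \<in> {1..s} \<Longrightarrow> (f j has_sum a j) UNIV" "\<And>j. j \<in> {1..s} \<Longrightarrow> f j abs_summable_on UNIV"
  shows "((\<lambda>h. \<Prod>j=1..s. f j (h j)) has_sum (\<Prod>j=1..s. a j)) (Zs s)"
    and "(\<lambda>h. \<Prod>j=1..s. f j (h j)) abs_summable_on (Zs s)"
  using has_sum_prod_supported[OF assms, where z = 0] unfolding Zs_eq_supported by auto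

text \<open>A pair of integer vectors is read as one vector of integer pairs, so that a double sum
  factorises over the coordinates. The sums over \<open>h\<close> and \<open>l\<close> in the CBC
  criterion are of this kind.\<close>

lemma has_sum_prod_Zs_Times:
  fixes f :: "nat \<Rightarrow> int \<times> int \<Rightarrow> 'b::{real_normed_field, banach}"
  assumes "\<And>j. j \<in> {1..s} \<Longrightarrow> (f j has_sum a j) UNIV" "\<And>j. j \<in> {1..s} \<Longrightarrow> f j abs_summable_on UNIV"
  shows "((\<lambda>(h, l). \<Prod>j=1..s. f j (h j, l j)) has_sum (\<Prod>j=1..s. a j)) (Zs s \<times> Zs s)"
proof -
  have bij: "bij_betw (\<lambda>(h, l) j. (h j, l j)) (Zs s \<times> Zs s) (supported s (0, 0))"
    by (rule bij_betwI[where g = "\<lambda>h. (\<lambda>j. fst (h j), \<lambda>j. snd (h j))"]) (auto simp: supported_def Zs_def fun_eq_iff)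
  show ?thesis
    using has_sum_reindex_bij_betw[OF bij, of "\<lambda>h. \<Prod>j=1..s. f j (h j)"]
      has_sum_prod_supported[OF assms, where z = "(0,0)", THEN conjunct1] by (simp add: case_prod_unfold)
qed

lemma infsum_Cauchy_Schwarz:
  fixes f g :: "'x \<Rightarrow> real"
  assumes f: "(\<lambda>x. (f x)\<^sup>2) summable_on A" and g: "(\<lambda>x. (g x)\<^sup>2) summable_on A"
  shows "(\<lambda>x. \<bar>f x * g x\<bar>) summable_on A"
    and "(\<Sum>\<^sub>\<infinity>x\<in>A. \<bar>f x * g x\<bar>) \<le> sqrt (\<Sum>\<^sub>\<infinity>x\<in>A. (f x)\<^sup>2) * sqrt (\<Sum>\<^sub>\<infinity>x\<in>A. (g x)\<^sup>2)"
proof -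
  have fin: "(\<Sum>x\<in>F. \<bar>f x * g x\<bar>) \<le> sqrt (\<Sum>\<^sub>\<infinity>x\<in>A. (f x)\<^sup>2) * sqrt (\<Sum>\<^sub>\<infinity>x\<in>A. (g x)\<^sup>2)"
    if F: "finite F" "F \<subseteq> A" for F
  proof -
    have "(\<Sum>x\<in>F. \<bar>f x\<bar> * \<bar>g x\<bar>) \<le> L2_set f F * L2_set g F" by (rule L2_set_mult_ineq)
    also have "\<dots> \<le> sqrt (\<Sum>\<^sub>\<infinity>x\<in>A. (f x)\<^sup>2) * sqrt (\<Sum>\<^sub>\<infinity>x\<in>A. (g x)\<^sup>2)"
      unfolding L2_set_def
      by (intro mult_mono real_sqrt_le_mono finite_sum_le_infsum f g F)
         (auto intro!: sum_nonneg infsum_nonneg)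
    finally show ?thesis by (simp add: abs_mult)
  qed
  show s: "(\<lambda>x. \<bar>f x * g x\<bar>) summable_on A"
    by (rule nonneg_bdd_above_summable_on) (auto intro!: bdd_aboveI2 fin)
  show "(\<Sum>\<^sub>\<infinity>x\<in>A. \<bar>f x * g x\<bar>) \<le> sqrt (\<Sum>\<^sub>\<infinity>x\<in>A. (f x)\<^sup>2) * sqrt (\<Sum>\<^sub>\<infinity>x\<in>A. (g x)\<^sup>2)"
    by (rule infsum_le_finite_sums[OF s fin])
qed

section \<open>Characters of the torus and the parametric system\<close>

definition dotp :: "nat \<Rightarrow> (nat \<Rightarrow> int) \<Rightarrow> (nat \<Rightarrow> real) \<Rightarrow> real" where
  "dotp s h y = (\<Sum>j=1..s. real_of_int (h j) * y j)"

definition chr :: "nat \<Rightarrow> (nat \<Rightarrow> int) \<Rightarrow> (nat \<Rightarrow> real) \<Rightarrow> complex" where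
  "chr s h y = cis (2 * pi * dotp s h y)"

lemma norm_chr [simp]: "norm (chr s h y) = 1"
  by (simp add: chr_def)

lemma chr_0 [simp]: "chr s (\<lambda>_. 0) y = 1"
  by (simp add: chr_def dotp_def)

lemma chr_prod: "chr s h y = (\<Prod>j=1..s. cis (2 * pi * (real_of_int (h j) * y j)))"
  unfolding chr_def dotp_def sum_distrib_left by (induction s) (simp_all add: cis_mult[symmetric])

lemma chr_add: "chr s (\<lambda>j. h j + h' j) y = chr s h y * chr s h' y"
  by (simp add: chr_def dotp_def cis_mult distrib_right distrib_left sum.distrib)

lemma cnj_chr: "cnj (chr s h y) = chr s (\<lambda>j. - h j) y"
  by (simp add: chr_def dotp_def cis_cnj sum_negf)

lemma chr_shift: "j \<in> {1..s} \<Longrightarrow> chr s (shift j m h) y = cis (2 * pi * (real_of_int m * y j)) * chr s h y"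
proof -
  assume j: "j \<in> {1..s}"
  have "dotp s (shift j m h) y = dotp s h y + real_of_int m * y j"
    unfolding dotp_def using j by (subst (1 2) sum.remove[of _ j]) (auto simp: shift_def algebra_simps)
  then show ?thesis by (simp add: chr_def cis_mult distrib_left add.commute)
qed

context form_system
begin

text \<open>
  With \<open>x = y - 1/4\<close> one has \<open>sin (2 \<pi> y) = cos (2 \<pi> x)\<close>, so in the variable \<open>x\<close> the parametric system
  has real Fourier coefficients.
\<close>

lemma fourier_series_solves:
  assumes d: "\<And>h i. h \<in> Zs s \<Longrightarrow> i < N \<Longrightarrow> sys_op d h i = (if h = (\<lambda>_. 0) then l i else 0)"
    and u: "\<And>i. i < N \<Longrightarrow> ((\<lambda>h. of_real (d h i) * chr s h x) has_sum u i) (Zs s)"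
    and i: "i < N"
  shows "(\<Sum>k<N. of_real (A0 i k + (\<Sum>j=1..s. P j i k * cos (2 * pi * x j))) * u k) = of_real (l i)"
proof -
  \<comment> \<open>Shifting the coefficients by \<open>m\<close> multiplies the series by an
    exponential of \<open>x j\<close>; the shifts by 1 and -1 together produce the cosine.\<close>
  have sh: "((\<lambda>h. of_real (d (shift j m h) k) * chr s h x) has_sum (cis (- 2 * pi * (m * x j)) * u k)) (Zs s)"
    if j: "j \<in> {1..s}" and k: "k < N" for j k and m :: int
  proof -
    have "((\<lambda>h. of_real (d (shift j m h) k) * chr s (shift j m h) x) has_sum u k) (Zs s)"
      by (rule has_sum_shift[OF j u[OF k]])
    then have "((\<lambda>h. cis (- 2 * pi * (m * x j)) * (of_real (d (shift j m h) k) * chr s (shift j m h) x))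
        has_sum cis (- 2 * pi * (m * x j)) * u k) (Zs s)"
      by (rule has_sum_cmult_right)
    also have "(\<lambda>h. cis (- 2 * pi * (m * x j)) * (of_real (d (shift j m h) k) * chr s (shift j m h) x))
        = (\<lambda>h. of_real (d (shift j m h) k) * chr s h x)"
    proof
      fix h
      have "cis (- 2 * pi * (m * x j)) * chr s (shift j m h) x = chr s h x"
        by (simp add: chr_shift[OF j] mult.assoc[symmetric] cis_mult)
      then show "cis (- 2 * pi * (m * x j)) * (of_real (d (shift j m h) k) * chr s (shift j m h) x)
        = of_real (d (shift j m h) k) * chr s h x" by (simp only: mult.left_commute)
    qed
    finally show ?thesis .
  qed
  have "((\<lambda>h. (\<Sum>k<N. of_real (A0 i k) * (of_real (d h k) * chr s h x)) +
      (\<Sum>j\<in>{1..s}. \<Sum>k<N. of_real (P j i k / 2) *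
        (of_real (d (shift j (-1) h) k) * chr s h x + of_real (d (shift j 1 h) k) * chr s h x)))
     has_sum ((\<Sum>k<N. of_real (A0 i k) * u k) +
      (\<Sum>j\<in>{1..s}. \<Sum>k<N. of_real (P j i k / 2) *
        (cis (- 2 * pi * (real_of_int (-1) * x j)) * u k + cis (- 2 * pi * (real_of_int 1 * x j)) * u k)))) (Zs s)"
    by (intro has_sum_add has_sum_finite_sum has_sum_cmult_right u sh) auto
  also have "(\<lambda>h. (\<Sum>k<N. of_real (A0 i k) * (of_real (d h k) * chr s h x)) +
      (\<Sum>j\<in>{1..s}. \<Sum>k<N. of_real (P j i k / 2) *
        (of_real (d (shift j (-1) h) k) * chr s h x + of_real (d (shift j 1 h) k) * chr s h x)))
     = (\<lambda>h. of_real (sys_op d h i) * chr s h x)"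
    unfolding sys_op_def weighted_op_def of_real_add of_real_sum distrib_right sum_distrib_right
    by (intro ext arg_cong2[where f = "(+)"] sum.cong refl) (simp_all add: algebra_simps)
  also have "(\<Sum>k<N. of_real (A0 i k) * u k) +
      (\<Sum>j\<in>{1..s}. \<Sum>k<N. of_real (P j i k / 2) *
        (cis (- 2 * pi * (real_of_int (-1) * x j)) * u k + cis (- 2 * pi * (real_of_int 1 * x j)) * u k))
    = (\<Sum>k<N. of_real (A0 i k + (\<Sum>j=1..s. P j i k * cos (2 * pi * x j))) * u k)"
  proof -
    have "of_real (P j i k / 2) * (cis (- 2 * pi * (real_of_int (-1) * x j)) * u k + cis (- 2 * pi * (real_of_int 1 * x j)) * u k)
      = of_real (P j i k * cos (2 * pi * x j)) * u k" for j k
    proof -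
      have c: "cis (- 2 * pi * (real_of_int (-1) * x j)) + cis (- 2 * pi * (real_of_int 1 * x j)) = of_real (2 * cos (2 * pi * x j))"
        by (simp add: complex_eq_iff)
      show ?thesis unfolding distrib_right[symmetric] c by simp
    qed
    then have "(\<Sum>j\<in>{1..s}. \<Sum>k<N. of_real (P j i k / 2) *
        (cis (- 2 * pi * (real_of_int (-1) * x j)) * u k + cis (- 2 * pi * (real_of_int 1 * x j)) * u k))
      = (\<Sum>j\<in>{1..s}. \<Sum>k<N. of_real (P j i k * cos (2 * pi * x j)) * u k)" by (simp only:)
    also have "\<dots> = (\<Sum>k<N. \<Sum>j\<in>{1..s}. of_real (P j i k * cos (2 * pi * x j)) * u k)" by (rule sum.swap)
    finally show ?thesis by (simp only: of_real_add of_real_sum distrib_right sum.distrib sum_distrib_right)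
  qed
  finally have "((\<lambda>h. of_real (sys_op d h i) * chr s h x) has_sum
    (\<Sum>k<N. of_real (A0 i k + (\<Sum>j=1..s. P j i k * cos (2 * pi * x j))) * u k)) (Zs s)" .
  moreover have "((\<lambda>h. of_real (sys_op d h i) * chr s h x) has_sum of_real (l i)) (Zs s)"
  proof -
    have "((\<lambda>h. if h = (\<lambda>_. 0) then of_real (l i) else 0) has_sum (of_real (l i) :: complex)) (Zs s)"
      by (rule has_sum_delta)
    then show ?thesis by (rule has_sum_cong[THEN iffD1, rotated]) (use d i in auto)
  qed
  ultimately show ?thesis by (rule has_sum_unique)
qed

end

section \<open>Decay of the Fourier coefficients\<close>

lemma power_le_fact_exp:
  assumes "0 \<le> (x::real)"
  shows "x ^ n \<le> fact n * exp x"
proof -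
  have s: "(\<lambda>n. x ^ n /\<^sub>R fact n) sums exp x" by (rule exp_converges)
  have "(\<Sum>k\<in>{n}. x ^ k /\<^sub>R fact k) \<le> (\<Sum>k. x ^ k /\<^sub>R fact k)"
    by (rule sum_le_suminf) (use s assms in \<open>auto simp: sums_iff\<close>)
  then show ?thesis using s by (simp add: sums_iff field_simps)
qed

text \<open>The largest element of a finite set of positive integers is at least its cardinality;
  remove it and use induction.\<close>

lemma fact_card_le_prod:
  assumes "finite u" "u \<subseteq> {1..}"
  shows "fact (card u) \<le> (\<Prod>j\<in>u. real j)"
  using assms
proof (induction "card u" arbitrary: u)
  case 0
  then show ?case by simp
next
  case (Suc k)
  then have ne: "u \<noteq> {}" by auto
  define m where "m = Max u"
  have m: "m \<in> u" using Suc ne by (simp add: m_def)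
  have "u \<subseteq> {1..m}" using Suc by (auto simp: m_def)
  then have "card u \<le> m" using card_mono[of "{1..m}" u] by simp
  moreover have "fact (card (u - {m})) \<le> (\<Prod>j\<in>u - {m}. real j)"
    using Suc m by (intro Suc.hyps(1)) auto
  ultimately have "real (card u) * fact (card (u - {m})) \<le> real m * (\<Prod>j\<in>u - {m}. real j)"
    by (intro mult_mono) (auto intro: prod_nonneg)
  moreover have "fact (card u) = real (card u) * fact (card (u - {m}))"
    using Suc m by (metis card.remove fact_Suc)
  ultimately show ?case using m Suc by (simp add: prod.remove[of u m])
qed

text \<open>Sharing the coercivity budget among \<open>k\<close> directions costs
  \<open>k ^ \<sigma>\<close> in each of them. The estimate turns the total loss into a product over
  the directions, which is the only shape that product weights can compensate.\<close>

lemma card_power_le_prod: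
  assumes "finite u" "u \<subseteq> {1..}"
  shows "(real (card u) ^ card u) ^ \<sigma> \<le> (\<Prod>j\<in>u. exp (real \<sigma>) * real j ^ \<sigma>)"
proof -
  have "real (card u) ^ card u \<le> fact (card u) * exp (real (card u))" by (rule power_le_fact_exp) simp
  also have "\<dots> \<le> (\<Prod>j\<in>u. real j) * exp (real (card u))"
    using fact_card_le_prod[OF assms] by (intro mult_right_mono) auto
  also have "\<dots> = (\<Prod>j\<in>u. exp 1 * real j)"
    by (simp add: prod.distrib exp_of_nat_mult[symmetric] mult.commute)
  finally have "(real (card u) ^ card u) ^ \<sigma> \<le> (\<Prod>j\<in>u. exp 1 * real j) ^ \<sigma>" by (intro power_mono) auto
  also have "\<dots> = (\<Prod>j\<in>u. exp (real \<sigma>) * real j ^ \<sigma>)"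
    by (simp add: prod_power_distrib power_mult_distrib exp_of_nat_mult[symmetric])
  finally show ?thesis .
qed

text \<open>The factor \<open>(1 + B) ^ \<sigma>\<close> pays for replacing
  \<open>b ^ \<sigma>\<close> by a single factor \<open>b\<close>: the Bell polynomial in the
  weights is only of first order for small arguments.\<close>

definition decay_const :: "nat \<Rightarrow> real \<Rightarrow> real" where
  "decay_const \<sigma> B = fact \<sigma> * 4 ^ Suc \<sigma> * (1 + B) ^ \<sigma>"

text \<open>
  The growth rate \<open>1 + 1 / (2 k b)\<close> is the largest one for which \<open>k\<close> active parameters perturb the
  coercivity constant by a factor of at most 2.
\<close>

lemma power_le_decay:
  assumes b: "0 < b" "b \<le> B" and k: "1 \<le> k" and m: "1 \<le> m" and \<sigma>: "1 \<le> \<sigma>"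
  shows "real m ^ \<sigma> \<le> decay_const \<sigma> B * (real k ^ \<sigma> * b) * (1 + 1 / (2 * real k * b)) ^ m"
proof -
  define t where "t = 1 / (2 * real k * b)"
  define R where "R = (1 + t) ^ m"
  have t: "0 < t" using b k by (simp add: t_def)
  have R0: "0 \<le> R" using t by (simp add: R_def)
  have kb: "2 * real k * b = 1 / t" using b k by (simp add: t_def)
  have B1: "b * 1 \<le> b * (1 + B) ^ \<sigma>" "1 \<le> (1 + B) ^ \<sigma>" using b by (auto intro!: mult_left_mono one_le_power)
  have bs: "b ^ \<sigma> \<le> b * (1 + B) ^ \<sigma>"
  proof -
    have "b ^ \<sigma> = b * b ^ (\<sigma> - 1)" using \<sigma> by (simp add: power_eq_if)
    also have "\<dots> \<le> b * (1 + B) ^ (\<sigma> - 1)" using b by (intro mult_left_mono power_mono) auto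
    also have "\<dots> \<le> b * (1 + B) ^ \<sigma>" using b by (intro mult_left_mono power_increasing) auto
    finally show ?thesis .
  qed
  show ?thesis
  \<comment> \<open>For \<open>t \<le> 1\<close> the power \<open>(1 + t) ^ m\<close> dominates the
    exponential of \<open>m * t / 2\<close>, which gives \<open>(k * b) ^ \<sigma>\<close>. For
    larger \<open>t\<close> it dominates \<open>t * 2 ^ (m - 1)\<close>, and dividing by
    \<open>t\<close> supplies the factor \<open>b\<close>.\<close>
  proof (cases "t \<le> 1")
    case True
    have "(real m * t / 2) ^ \<sigma> \<le> fact \<sigma> * exp (real m * t / 2)" using t by (intro power_le_fact_exp) auto
    also have "exp (real m * t / 2) = exp (t / 2) ^ m" by (simp add: exp_of_nat_mult[symmetric])
    also have "exp (t / 2) ^ m \<le> (1 + t) ^ m"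
    proof (rule power_mono)
      have "exp (t / 2) \<le> 1 + t / 2 + (t / 2)\<^sup>2" using True t by (intro exp_bound) auto
      also have "(t / 2)\<^sup>2 \<le> t / 2" using True t mult_left_mono[of t 1 t] by (simp add: power2_eq_square)
      finally show "exp (t / 2) \<le> 1 + t" by simp
    qed simp
    finally have "(real m * t / 2) ^ \<sigma> \<le> fact \<sigma> * R" by (simp add: R_def)
    then have "(2 / t) ^ \<sigma> * (real m * t / 2) ^ \<sigma> \<le> (2 / t) ^ \<sigma> * (fact \<sigma> * R)" using t by (intro mult_left_mono) auto
    moreover have "(2 / t) ^ \<sigma> * (real m * t / 2) ^ \<sigma> = real m ^ \<sigma>" using t by (simp add: power_mult_distrib[symmetric])
    moreover have "2 / t = 4 * (real k * b)" using kb by simp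
    ultimately have "real m ^ \<sigma> \<le> (4 * (real k * b)) ^ \<sigma> * (fact \<sigma> * R)" by (simp only:)
    also have "\<dots> = fact \<sigma> * 4 ^ \<sigma> * real k ^ \<sigma> * R * b ^ \<sigma>" by (simp add: power_mult_distrib mult_ac)
    also have "\<dots> \<le> fact \<sigma> * 4 ^ Suc \<sigma> * real k ^ \<sigma> * R * (b * (1 + B) ^ \<sigma>)"
      using R0 b bs by (intro mult_mono mult_right_mono) (auto intro!: mult_nonneg_nonneg)
    finally show ?thesis unfolding decay_const_def t_def[symmetric] R_def by (simp add: mult_ac)
  next
    case False
    have "(real m / 2) ^ \<sigma> \<le> fact \<sigma> * exp (real m / 2)" by (intro power_le_fact_exp) auto
    also have "exp (real m / 2) = exp (1 / 2) ^ m" by (simp add: exp_of_nat_mult[symmetric])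
    also have "exp (1 / 2 :: real) ^ m \<le> 2 ^ m"
    proof (rule power_mono)
      have "exp (1 / 2 :: real) \<le> 1 + 1 / 2 + (1 / 2)\<^sup>2" by (intro exp_bound) auto
      then show "exp (1 / 2 :: real) \<le> 2" by (simp add: power2_eq_square)
    qed simp
    also have "(2::real) ^ m = 2 * 2 ^ (m - 1)" using m by (simp add: power_eq_if)
    also have "(2::real) ^ (m - 1) \<le> R / t"
    proof -
      have "t * 2 ^ (m - 1) \<le> (1 + t) * (1 + t) ^ (m - 1)" using False by (intro mult_mono power_mono) auto
      also have "\<dots> = R" using m by (simp add: R_def power_eq_if)
      finally show ?thesis using t by (simp add: pos_le_divide_eq mult.commute)
    qed
    finally have "(real m / 2) ^ \<sigma> \<le> fact \<sigma> * (2 * (R / t))" by simp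
    then have "2 ^ \<sigma> * (real m / 2) ^ \<sigma> \<le> 2 ^ \<sigma> * (fact \<sigma> * (2 * (R / t)))" by (intro mult_left_mono) auto
    moreover have "2 ^ \<sigma> * (real m / 2) ^ \<sigma> = real m ^ \<sigma>" by (simp add: power_mult_distrib[symmetric])
    moreover have "R / t = R * (2 * real k * b)" using kb by simp
    ultimately have "real m ^ \<sigma> \<le> fact \<sigma> * (2 ^ \<sigma> * 4) * real k * R * b" by (simp add: mult_ac)
    also have "\<dots> \<le> fact \<sigma> * (4 ^ \<sigma> * 4) * real k ^ \<sigma> * R * (b * (1 + B) ^ \<sigma>)"
    proof (intro mult_mono)
      show "real k \<le> real k ^ \<sigma>" using k \<sigma> by (intro self_le_power) auto
      show "b \<le> b * (1 + B) ^ \<sigma>" using B1 by simp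
    qed (use R0 b in \<open>auto intro!: power_mono\<close>)
    finally show ?thesis unfolding decay_const_def t_def[symmetric] R_def by (simp add: mult_ac)
  qed
qed

section \<open>Weighted norm of the solution, one support at a time\<close>

definition rho :: "(nat \<Rightarrow> real) \<Rightarrow> nat \<Rightarrow> nat \<Rightarrow> int \<Rightarrow> real" where
  "rho g \<alpha> j m = (if m = 0 then 1 else g j / real_of_int \<bar>m\<bar> ^ \<alpha>)"

text \<open>The reciprocal of \<open>r_weight\<close> for product weights on \<open>Zs s\<close>,
  and hence the Fourier coefficients of the kernel; see \<open>r_weight_eq\<close> and
  \<open>kernel_has_sum\<close>.\<close>

definition wt :: "nat \<Rightarrow> (nat \<Rightarrow> real) \<Rightarrow> nat \<Rightarrow> (nat \<Rightarrow> int) \<Rightarrow> real" where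
  "wt s g \<alpha> h = (\<Prod>j=1..s. rho g \<alpha> j (h j))"

lemma rho_pos: "0 < g j \<Longrightarrow> 0 < rho g \<alpha> j m"
  by (simp add: rho_def)

lemma wt_pos: "(\<And>j. j \<in> {1..s} \<Longrightarrow> 0 < g j) \<Longrightarrow> 0 < wt s g \<alpha> h"
  unfolding wt_def by (intro prod_pos rho_pos) auto

context form_system
begin

text \<open>Each of the \<open>card u\<close> directions spends \<open>1 / (2 * card u)\<close> of
  the budget 1/2, which is thereby used up. A step of length one changes the absolute value of one
  component by at most one and so changes the weight by a factor of at most
  \<open>R j\<close>.\<close>

lemma growth_weight_admissible:
  assumes u: "u \<subseteq> {1..s}" "u \<noteq> {}"
  defines "R \<equiv> \<lambda>j. if j \<in> u then 1 + 1 / (2 * real (card u) * b j) else 1"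
  shows "admissible (1 + (\<Sum>j=1..s. 1 / b j)) (\<lambda>h. \<Prod>j\<in>u. R j ^ nat \<bar>h j\<bar>) R"
proof -
  have fu: "finite u" using u finite_subset by blast
  have k: "1 \<le> card u" using u fu by (simp add: Suc_le_eq card_gt_0_iff)
  have bp: "0 < b j" if "j \<in> u" for j using that u b_pos by auto
  have R1: "1 \<le> R j" for j using bp k by (simp add: R_def less_imp_le)
  have Rr: "R j \<le> 1 + (\<Sum>j=1..s. 1 / b j)" if j: "j \<in> {1..s}" for j
  proof (cases "j \<in> u")
    case True
    have "1 / (2 * real (card u) * b j) \<le> 1 / b j"
      using bp[OF True] k by (intro divide_left_mono) auto
    also have "\<dots> \<le> (\<Sum>j=1..s. 1 / b j)"
      using j b_pos by (intro member_le_sum) (auto simp: less_imp_le)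
    finally show ?thesis using True by (simp add: R_def)
  qed (use b_pos in \<open>auto simp: R_def less_imp_le intro!: sum_nonneg\<close>)
  have S: "(\<Sum>j=1..s. b j * (R j - 1)) = 1 / 2"
  proof -
    have "(\<Sum>j=1..s. b j * (R j - 1)) = (\<Sum>j\<in>u. b j * (R j - 1))"
      by (rule sum.mono_neutral_right) (use u in \<open>auto simp: R_def\<close>)
    also have "\<dots> = (\<Sum>j\<in>u. 1 / (2 * real (card u)))"
      by (intro sum.cong refl) (use bp in \<open>force simp: R_def\<close>)
    finally show ?thesis using k by simp
  qed
  have W: "(\<Prod>i\<in>u. R i ^ nat \<bar>h i\<bar>) \<le> R j * (\<Prod>i\<in>u. R i ^ nat \<bar>shift j m h i\<bar>)" if m: "\<bar>m\<bar> = 1" for j m h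
  proof (cases "j \<in> u")
    case True
    have "R j ^ nat \<bar>h j\<bar> \<le> R j ^ Suc (nat \<bar>shift j m h j\<bar>)"
      using R1 m by (intro power_increasing) (auto simp: shift_def)
    moreover have "(\<Prod>i\<in>u - {j}. R i ^ nat \<bar>shift j m h i\<bar>) = (\<Prod>i\<in>u - {j}. R i ^ nat \<bar>h i\<bar>)"
      by (intro prod.cong) (auto simp: shift_def)
    moreover have "0 \<le> (\<Prod>i\<in>u - {j}. R i ^ nat \<bar>h i\<bar>)"
      using R1 by (intro prod_nonneg) (auto intro!: zero_le_power intro: order_trans[OF zero_le_one])
    ultimately show ?thesis using True fu by (simp add: prod.remove[of u j] mult_right_mono mult.assoc[symmetric])
  next
    case False
    then have "(\<Prod>i\<in>u. R i ^ nat \<bar>shift j m h i\<bar>) = (\<Prod>i\<in>u. R i ^ nat \<bar>h i\<bar>)"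
      by (intro prod.cong) (auto simp: shift_def)
    then show ?thesis using False by (simp add: R_def)
  qed
  have "0 < (\<Prod>j\<in>u. R j ^ nat \<bar>h j\<bar>)" for h
    using R1 by (intro prod_pos) (auto intro!: zero_less_power intro: less_le_trans[OF zero_less_one])
  then show ?thesis unfolding admissible_def using W[of 1] W[of "-1"] S R1 Rr by auto
qed

text \<open>The frequencies are grouped by support, and each group is measured with the weight that
  grows in exactly those directions, because the growth rate deteriorates with the number of
  directions. Every group is bounded by the same \<open>E\<close> times a product over its support,
  and the sum of these products over all supports is again a product.\<close>

theorem weighted_norm_bound:
  assumes d: "\<And>W R F. admissible (1 + (\<Sum>j=1..s. 1 / b j)) W R \<Longrightarrow> finite F \<Longrightarrow> F \<subseteq> Zs s \<Longrightarrow>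
        (\<Sum>h\<in>F. (W h)\<^sup>2 * sqn N (d h)) \<le> E"
    and B: "\<And>j. j \<in> {1..s} \<Longrightarrow> b j \<le> B" and g: "\<And>j. j \<in> {1..s} \<Longrightarrow> 0 < g j" and \<sigma>: "1 \<le> \<sigma>"
    and F: "finite F" "F \<subseteq> Zs s"
  shows "(\<Sum>h\<in>F. sqn N (d h) / wt s g (2 * \<sigma>) h)
    \<le> E * (\<Prod>j=1..s. 1 + (decay_const \<sigma> B * exp (real \<sigma>) * (real j ^ \<sigma> * b j))\<^sup>2 / g j)"
proof -
  define c where "c j = (decay_const \<sigma> B * exp (real \<sigma>) * (real j ^ \<sigma> * b j))\<^sup>2 / g j" for j
  define supp where "supp h = {j \<in> {1..s}. h j \<noteq> 0}" for h :: "nat \<Rightarrow> int"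
  have adm1: "admissible (1 + (\<Sum>j=1..s. 1 / b j)) (\<lambda>_. 1) (\<lambda>_. 1)"
    using b_pos by (auto simp: admissible_def less_imp_le intro!: sum_nonneg)
  have part: "(\<Sum>h\<in>{h\<in>F. supp h = u}. sqn N (d h) / wt s g (2 * \<sigma>) h) \<le> E * (\<Prod>j\<in>u. c j)"
    if u: "u \<in> Pow {1..s}" for u
  proof (cases "u = {}")
    case True
    have "wt s g (2 * \<sigma>) h = 1" if "supp h = u" for h
      using that True unfolding wt_def supp_def by (intro prod.neutral) (auto simp: rho_def)
    then have "(\<Sum>h\<in>{h\<in>F. supp h = u}. sqn N (d h) / wt s g (2 * \<sigma>) h) = (\<Sum>h\<in>{h\<in>F. supp h = u}. 1\<^sup>2 * sqn N (d h))"
      by (intro sum.cong) auto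
    also have "\<dots> \<le> E" by (rule d[OF adm1]) (use F in auto)
    finally show ?thesis using True by simp
  next
    case False
    define k where "k = card u"
    define R where "R j = (if j \<in> u then 1 + 1 / (2 * real (card u) * b j) else 1)" for j
    define W where "W h = (\<Prod>j\<in>u. R j ^ nat \<bar>h j\<bar>)" for h :: "nat \<Rightarrow> int"
    have fu: "finite u" and us: "u \<subseteq> {1..s}" using u finite_subset by auto
    have k: "1 \<le> k" using fu False by (simp add: k_def Suc_le_eq card_gt_0_iff)
    have adm: "admissible (1 + (\<Sum>j=1..s. 1 / b j)) W R"
      using growth_weight_admissible[OF us False] unfolding W_def R_def .
    have dc: "0 \<le> decay_const \<sigma> B"
    proof -
      obtain j where "j \<in> u" using False by auto
      then have "0 \<le> B" using b_pos[of j] B[of j] us by force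
      then show ?thesis by (simp add: decay_const_def)
    qed
    have le: "1 / wt s g (2 * \<sigma>) h \<le> (\<Prod>j\<in>u. c j) * (W h)\<^sup>2" if h: "supp h = u" for h
    proof -
      have "wt s g (2 * \<sigma>) h = (\<Prod>j\<in>u. rho g (2 * \<sigma>) j (h j))"
        unfolding wt_def using h by (intro prod.mono_neutral_right) (auto simp: supp_def rho_def)
      also have "\<dots> = (\<Prod>j\<in>u. g j / (real_of_int \<bar>h j\<bar> ^ \<sigma>)\<^sup>2)"
        using h by (intro prod.cong) (auto simp: supp_def rho_def power_mult[symmetric] mult.commute)
      finally have w: "1 / wt s g (2 * \<sigma>) h = (\<Prod>j\<in>u. real_of_int \<bar>h j\<bar> ^ \<sigma>)\<^sup>2 / (\<Prod>j\<in>u. g j)"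
        by (simp add: prod_dividef prod_power_distrib)
      have "(\<Prod>j\<in>u. real_of_int \<bar>h j\<bar> ^ \<sigma>) \<le> (\<Prod>j\<in>u. decay_const \<sigma> B * (real k ^ \<sigma> * b j) * R j ^ nat \<bar>h j\<bar>)"
      proof (rule prod_mono)
        fix j assume j: "j \<in> u"
        have "1 \<le> nat \<bar>h j\<bar>" using h j by (auto simp: supp_def)
        then have "real (nat \<bar>h j\<bar>) ^ \<sigma> \<le> decay_const \<sigma> B * (real k ^ \<sigma> * b j) * (1 + 1 / (2 * real k * b j)) ^ nat \<bar>h j\<bar>"
          using j us b_pos B k \<sigma> by (intro power_le_decay) auto
        then show "0 \<le> real_of_int \<bar>h j\<bar> ^ \<sigma> \<and> real_of_int \<bar>h j\<bar> ^ \<sigma> \<le> decay_const \<sigma> B * (real k ^ \<sigma> * b j) * R j ^ nat \<bar>h j\<bar>"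
          using j by (simp add: R_def k_def)
      qed
      also have "\<dots> = (real k ^ k) ^ \<sigma> * (\<Prod>j\<in>u. decay_const \<sigma> B * b j) * W h"
        unfolding W_def by (simp add: prod.distrib k_def power_mult[symmetric] mult_ac)
      also have "\<dots> \<le> (\<Prod>j\<in>u. exp (real \<sigma>) * real j ^ \<sigma>) * (\<Prod>j\<in>u. decay_const \<sigma> B * b j) * W h"
      proof (intro mult_right_mono)
        show "(real k ^ k) ^ \<sigma> \<le> (\<Prod>j\<in>u. exp (real \<sigma>) * real j ^ \<sigma>)"
          unfolding k_def using us fu by (intro card_power_le_prod) auto
        show "0 \<le> (\<Prod>j\<in>u. decay_const \<sigma> B * b j)"
          using dc us b_pos by (intro prod_nonneg ballI mult_nonneg_nonneg) (auto simp: less_imp_le subset_iff)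
        show "0 \<le> W h" using adm unfolding admissible_def by (simp add: less_imp_le)
      qed
      also have "\<dots> = (\<Prod>j\<in>u. decay_const \<sigma> B * exp (real \<sigma>) * (real j ^ \<sigma> * b j)) * W h"
        by (simp add: prod.distrib mult_ac)
      finally have "(\<Prod>j\<in>u. real_of_int \<bar>h j\<bar> ^ \<sigma>)\<^sup>2 \<le> ((\<Prod>j\<in>u. decay_const \<sigma> B * exp (real \<sigma>) * (real j ^ \<sigma> * b j)) * W h)\<^sup>2"
        by (intro power_mono prod_nonneg) auto
      then have "1 / wt s g (2 * \<sigma>) h \<le> ((\<Prod>j\<in>u. decay_const \<sigma> B * exp (real \<sigma>) * (real j ^ \<sigma> * b j)) * W h)\<^sup>2 / (\<Prod>j\<in>u. g j)"
        unfolding w using g us by (intro divide_right_mono prod_nonneg) (auto simp: less_imp_le subset_iff)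
      also have "\<dots> = (\<Prod>j\<in>u. c j) * (W h)\<^sup>2"
        unfolding c_def prod_dividef prod_power_distrib[symmetric] by (simp only: power_mult_distrib times_divide_eq_left)
      finally show ?thesis .
    qed
    have c0: "0 \<le> c j" if "j \<in> u" for j using g[of j] that us by (auto simp: c_def less_imp_le subset_iff)
    have "(\<Sum>h\<in>{h\<in>F. supp h = u}. sqn N (d h) / wt s g (2 * \<sigma>) h)
      \<le> (\<Sum>h\<in>{h\<in>F. supp h = u}. (\<Prod>j\<in>u. c j) * ((W h)\<^sup>2 * sqn N (d h)))"
    proof (rule sum_mono)
      fix h assume "h \<in> {h\<in>F. supp h = u}"
      then have "1 / wt s g (2 * \<sigma>) h * sqn N (d h) \<le> (\<Prod>j\<in>u. c j) * (W h)\<^sup>2 * sqn N (d h)"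
        by (intro mult_right_mono le) auto
      then show "sqn N (d h) / wt s g (2 * \<sigma>) h \<le> (\<Prod>j\<in>u. c j) * ((W h)\<^sup>2 * sqn N (d h))" by (simp add: mult.assoc)
    qed
    also have "\<dots> \<le> (\<Prod>j\<in>u. c j) * E"
      unfolding sum_distrib_left[symmetric]
    proof (rule mult_left_mono)
      show "(\<Sum>h\<in>{h\<in>F. supp h = u}. (W h)\<^sup>2 * sqn N (d h)) \<le> E" by (rule d[OF adm]) (use F in auto)
    qed (use c0 in \<open>auto intro: prod_nonneg\<close>)
    finally show ?thesis by (simp add: mult.commute)
  qed
  have "(\<Sum>h\<in>F. sqn N (d h) / wt s g (2 * \<sigma>) h) = (\<Sum>u\<in>Pow {1..s}. \<Sum>h\<in>{h\<in>F. supp h = u}. sqn N (d h) / wt s g (2 * \<sigma>) h)"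
    by (rule sum.group[symmetric]) (use F in \<open>auto simp: supp_def\<close>)
  also have "\<dots> \<le> (\<Sum>u\<in>Pow {1..s}. E * (\<Prod>j\<in>u. c j))" by (intro sum_mono part)
  also have "\<dots> = E * (\<Prod>j=1..s. 1 + c j)"
    using prod_add[of "{1..s}" c "\<lambda>_. 1"] by (simp add: sum_distrib_left add.commute)
  finally show ?thesis unfolding c_def .
qed

end

section \<open>Lattice points and the kernel\<close>

lemma has_sum_int_split:
  fixes f :: "int \<Rightarrow> 'b::topological_comm_monoid_add"
  assumes p: "((\<lambda>k. f (int (Suc k))) has_sum a) UNIV" and m: "((\<lambda>k. f (- int (Suc k))) has_sum b) UNIV"
  shows "(f has_sum (f 0 + (a + b))) UNIV"
proof -
  have "bij_betw (\<lambda>k. int (Suc k)) UNIV {0<..}"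
    by (rule bij_betwI[where g = "\<lambda>m. nat m - 1"]) auto
  from has_sum_reindex_bij_betw[OF this, of f a] p have 1: "(f has_sum a) {0<..}" by simp
  have "bij_betw (\<lambda>k. - int (Suc k)) UNIV {..<0}"
    by (rule bij_betwI[where g = "\<lambda>m. nat (- m) - 1"]) auto
  from has_sum_reindex_bij_betw[OF this, of f b] m have 2: "(f has_sum b) {..<0}" by simp
  have 3: "(f has_sum f 0) {0}" by (rule has_sum_finiteI) auto
  have "(f has_sum (f 0 + (a + b))) ({0} \<union> ({0<..} \<union> {..<0}))"
    by (intro has_sum_Un_disjoint 1 2 3) auto
  moreover have "{0} \<union> ({0<..} \<union> {..<0}) = (UNIV :: int set)" by auto
  ultimately show ?thesis by simp
qed

lemma zeta_real_has_sum:
  assumes "1 < \<beta>"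
  shows "((\<lambda>k. 1 / real (Suc k) powr \<beta>) has_sum zeta_real \<beta>) UNIV"
proof -
  have "summable (\<lambda>k. 1 / real k powr \<beta>)"
    using assms by (simp add: summable_real_powr_iff powr_minus_divide[symmetric])
  then have "summable (\<lambda>k. 1 / real (Suc k) powr \<beta>)" by (subst (asm) summable_Suc_iff[symmetric])
  then show ?thesis unfolding zeta_real_def
    by (intro norm_summable_imp_has_sum) (auto simp: sums_iff summable_rabs_cancel)
qed

lemma zeta_real_pos: "1 < \<beta> \<Longrightarrow> 1 \<le> zeta_real \<beta>"
  using finite_sum_le_has_sum[OF zeta_real_has_sum, of \<beta> "{0}"] by simp

lemma has_sum_int_powr:
  assumes "1 < \<beta>"
  shows "((\<lambda>m. if m = 0 then a else c * (1 / real_of_int \<bar>m\<bar> powr \<beta>)) has_sum (a + c * (2 * zeta_real \<beta>))) UNIV"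
proof -
  have "((\<lambda>m. if m = 0 then a else c * (1 / real_of_int \<bar>m\<bar> powr \<beta>)) has_sum
      ((if (0::int) = 0 then a else c * (1 / real_of_int \<bar>0\<bar> powr \<beta>)) + (c * zeta_real \<beta> + c * zeta_real \<beta>))) UNIV"
    using has_sum_cmult_right[OF zeta_real_has_sum[OF assms], of c]
    by (intro has_sum_int_split) (auto simp: add.commute)
  then show ?thesis by (simp add: algebra_simps)
qed

lemma rho_powr:
  assumes "0 < g j"
  shows "rho g \<alpha> j m powr lam = (if m = 0 then 1 else g j powr lam * (1 / real_of_int \<bar>m\<bar> powr (real \<alpha> * lam)))"
  using assms by (auto simp: rho_def powr_divide powr_powr powr_realpow[symmetric])

lemma rho_powr_has_sum:
  assumes "0 < g j" "1 < real \<alpha> * lam"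
  shows "((\<lambda>m. rho g \<alpha> j m powr lam) has_sum (1 + g j powr lam * (2 * zeta_real (real \<alpha> * lam)))) UNIV"
  unfolding rho_powr[of g j, OF assms(1)] by (rule has_sum_int_powr[OF assms(2)])

lemma rho_summable: "0 < g j \<Longrightarrow> 2 \<le> \<alpha> \<Longrightarrow> Infinite_Sum.abs_summable_on (rho g \<alpha> j) UNIV"
proof -
  assume g: "0 < g j" and a: "2 \<le> \<alpha>"
  have "norm (rho g \<alpha> j m) = rho g \<alpha> j m powr 1" for m using rho_pos[of g j, OF g, of \<alpha> m] by simp
  then show ?thesis using rho_powr_has_sum[of g j \<alpha> 1, OF g] a by (simp only:) (auto intro: has_sum_imp_summable)
qed

text \<open>Reflection of the index conjugates the terms and preserves the sum, so the sum is real
  and the real part in \<open>eta\<close> loses nothing.\<close>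

lemma eta_has_sum:
  assumes a: "2 \<le> \<alpha>"
  shows "((\<lambda>m. if m = 0 then 0 else cis (2 * pi * (real_of_int m * y)) / of_real (real_of_int \<bar>m\<bar> ^ \<alpha>)) has_sum of_real (eta \<alpha> y)) UNIV"
    and "Infinite_Sum.abs_summable_on (\<lambda>m. if m = 0 then 0 else cis (2 * pi * (real_of_int m * y)) / of_real (real_of_int \<bar>m\<bar> ^ \<alpha>)) UNIV"
proof -
  define f where "f m = (if m = 0 then 0 else cis (2 * pi * (real_of_int m * y)) / of_real (real_of_int \<bar>m\<bar> ^ \<alpha>))" for m
  have nf: "norm (f m) \<le> norm (rho (\<lambda>_. 1) \<alpha> 0 m)" for m by (simp add: f_def rho_def norm_divide norm_power)
  have abs: "Infinite_Sum.abs_summable_on f UNIV"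
    by (rule Infinite_Sum.abs_summable_on_comparison_test[where g = "rho (\<lambda>_. 1) \<alpha> 0"]) (use a nf rho_summable in auto)
  then show "Infinite_Sum.abs_summable_on (\<lambda>m. if m = 0 then 0 else cis (2 * pi * (real_of_int m * y)) / of_real (real_of_int \<bar>m\<bar> ^ \<alpha>)) UNIV"
    unfolding f_def .
  define S where "S = infsum f UNIV"
  have S: "(f has_sum S) UNIV" unfolding S_def using abs_summable_summable[OF abs] by simp
  have "((\<lambda>m. f (- m)) has_sum S) UNIV"
    using has_sum_reindex_bij_betw[OF bij_betwI[of uminus UNIV UNIV uminus], of f S] S by simp
  moreover have "f (- m) = cnj (f m)" for m by (simp add: f_def cis_cnj)
  ultimately have "((\<lambda>m. cnj (f m)) has_sum S) UNIV" by simp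
  moreover have "((\<lambda>m. cnj (f m)) has_sum cnj S) UNIV" using S by simp
  ultimately have "cnj S = S" by (rule has_sum_unique[rotated])
  then have r: "S = of_real (Re S)" by (simp add: complex_eq_iff)
  have "(f has_sum S) (- {0}) \<longleftrightarrow> (f has_sum S) UNIV"
    by (rule has_sum_cong_neutral) (auto simp: f_def)
  then have "(f has_sum S) (- {0})" using S by simp
  moreover have "f h = exp (2 * of_real pi * \<i> * of_int h * of_real y) / of_int \<bar>h\<bar> ^ \<alpha>" if "h \<in> - {0}" for h :: int
  proof -
    have "exp (2 * of_real pi * \<i> * of_int h * of_real y) = cis (2 * pi * (real_of_int h * y))"
      unfolding cis_conv_exp by (intro arg_cong[where f = exp]) simp
    moreover have "complex_of_real (real_of_int \<bar>h\<bar>) = of_int \<bar>h\<bar>" by (rule of_real_of_int_eq)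
    ultimately show ?thesis using that by (simp only: f_def ComplI if_False) auto
  qed
  ultimately have "((\<lambda>h. exp (2 * of_real pi * \<i> * of_int h * of_real y) / of_int \<bar>h\<bar> ^ \<alpha>) has_sum S) (- {0})"
    by (subst (asm) has_sum_cong) auto
  then have "Re S = eta \<alpha> y" unfolding eta_def by (simp add: infsumI)
  then show "((\<lambda>m. if m = 0 then 0 else cis (2 * pi * (real_of_int m * y)) / of_real (real_of_int \<bar>m\<bar> ^ \<alpha>)) has_sum of_real (eta \<alpha> y)) UNIV"
    using S r unfolding f_def by simp
qed

text \<open>For product weights the sum over subsets in \<open>kernel\<close> is an expanded product
  of the factors \<open>1 + g j * eta \<alpha> (y j - y' j)\<close>. Multiplying their
  one-dimensional series yields the Fourier coefficients \<open>wt s g \<alpha>\<close>.\<close>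

lemma kernel_has_sum:
  assumes g: "\<And>j. j \<in> {1..s} \<Longrightarrow> 0 < g j" and a: "2 \<le> \<alpha>"
  shows "((\<lambda>h. of_real (wt s g \<alpha> h) * (chr s h y * cnj (chr s h y'))) has_sum of_real (kernel (prod g) \<alpha> s y y')) (Zs s)"
proof -
  define c where "c j m = cis (2 * pi * (real_of_int m * (y j - y' j)))" for j and m :: int
  have eq: "of_real (rho g \<alpha> j m) * c j m = (if m = 0 then 1 else 0) + of_real (g j) *
      (if m = 0 then 0 else c j m / of_real (real_of_int \<bar>m\<bar> ^ \<alpha>))" for j m
    by (simp add: rho_def c_def)
  have hs: "((\<lambda>m. of_real (rho g \<alpha> j m) * c j m) has_sum of_real (1 + g j * eta \<alpha> (y j - y' j))) UNIV" for j
    unfolding eq of_real_add of_real_mult of_real_1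
  proof (intro has_sum_add has_sum_cmult_right)
    show "((\<lambda>m. if m = 0 then 1 else 0) has_sum (1 :: complex)) (UNIV :: int set)"
      by (rule has_sum_finite_neutralI[of "{0}"]) auto
    show "((\<lambda>m. if m = 0 then 0 else c j m / of_real (real_of_int \<bar>m\<bar> ^ \<alpha>)) has_sum complex_of_real (eta \<alpha> (y j - y' j))) UNIV"
      unfolding c_def by (rule eta_has_sum[OF a])
  qed
  have as: "Infinite_Sum.abs_summable_on (\<lambda>m. of_real (rho g \<alpha> j m) * c j m) UNIV" if "j \<in> {1..s}" for j
    using rho_summable[of g j \<alpha>] g[OF that] a by (simp add: norm_mult c_def)
  have "((\<lambda>h. \<Prod>j=1..s. of_real (rho g \<alpha> j (h j)) * c j (h j)) has_sum (\<Prod>j=1..s. of_real (1 + g j * eta \<alpha> (y j - y' j)))) (Zs s)"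
    by (rule has_sum_prod_Zs(1)[OF hs as])
  moreover have "(\<Prod>j=1..s. of_real (rho g \<alpha> j (h j)) * c j (h j)) = of_real (wt s g \<alpha> h) * (chr s h y * cnj (chr s h y'))" for h
    unfolding wt_def chr_prod prod.distrib of_real_prod cnj_prod
    by (simp add: c_def cis_cnj prod.distrib[symmetric] cis_mult algebra_simps)
  moreover have "(\<Prod>j=1..s. 1 + g j * eta \<alpha> (y j - y' j)) = kernel (prod g) \<alpha> s y y'"
    using prod_add[of "{1..s}" "\<lambda>j. g j * eta \<alpha> (y j - y' j)" "\<lambda>_. 1"]
    by (simp add: kernel_def prod.distrib add.commute)
  ultimately show ?thesis by (simp only: of_real_prod[symmetric])
qed

lemma wt_summable:
  assumes g: "\<And>j. j \<in> {1..s} \<Longrightarrow> 0 < g j" and a: "2 \<le> \<alpha>"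
  shows "wt s g \<alpha> summable_on Zs s"
proof -
  have as: "Infinite_Sum.abs_summable_on (rho g \<alpha> j) UNIV" if "j \<in> {1..s}" for j
    using rho_summable[of g j \<alpha>] g[OF that] a by simp
  have "(rho g \<alpha> j has_sum infsum (rho g \<alpha> j) UNIV) UNIV" if "j \<in> {1..s}" for j
    using abs_summable_summable[OF as[OF that]] by simp
  from has_sum_prod_Zs(1)[OF this as] show ?thesis
    unfolding wt_def[abs_def] by (rule has_sum_imp_summable)
qed

lemma r_weight_eq:
  assumes h: "h \<in> Zs s"
  shows "1 / r_weight (prod g) \<alpha> h = wt s g \<alpha> h"
proof -
  have "{j. h j \<noteq> 0} \<subseteq> {1..s}" using h by (auto simp: Zs_def)
  then have "wt s g \<alpha> h = (\<Prod>j\<in>{j. h j \<noteq> 0}. rho g \<alpha> j (h j))"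
    unfolding wt_def by (intro prod.mono_neutral_right) (auto simp: rho_def)
  also have "\<dots> = prod g {j. h j \<noteq> 0} / (\<Prod>j\<in>{j. h j \<noteq> 0}. real_of_int \<bar>h j\<bar> ^ \<alpha>)"
    unfolding prod_dividef[symmetric] by (intro prod.cong) (auto simp: rho_def)
  finally show ?thesis by (simp add: r_weight_def field_simps)
qed

text \<open>Characters with integer frequencies do not see integer translations, so the fractional
  parts may be dropped.\<close>

lemma chr_lattice_point:
  "chr s h (lattice_point s n z k) = cis (2 * pi * (real k * real_of_int (\<Sum>j=1..s. h j * int (z j)) / real n))"
proof -
  have "cis (2 * pi * (real_of_int (h j) * frac (real k * real (z j) / real n))) =
      cis (2 * pi * (real_of_int (h j) * (real k * real (z j) / real n)))" for j
  proof -
    have "2 * pi * (real_of_int (h j) * frac x) = 2 * pi * (real_of_int (h j) * x) - 2 * pi * real_of_int (h j * \<lfloor>x\<rfloor>)" for x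
      by (simp add: frac_def algebra_simps)
    then show ?thesis by (simp add: cis_divide[symmetric] cis_multiple_2pi)
  qed
  then have "chr s h (lattice_point s n z k) = (\<Prod>j=1..s. cis (2 * pi * (real_of_int (h j) * (real k * real (z j) / real n))))"
    unfolding chr_prod by (intro prod.cong) (auto simp: lattice_point_def)
  also have "\<dots> = cis (2 * pi * dotp s h (\<lambda>j. real k * real (z j) / real n))" by (simp only: chr_prod[symmetric] chr_def[symmetric])
  also have "dotp s h (\<lambda>j. real k * real (z j) / real n) = real k * real_of_int (\<Sum>j=1..s. h j * int (z j)) / real n"
    by (simp add: dotp_def sum_distrib_left sum_divide_distrib mult_ac)
  finally show ?thesis .
qed

lemma sum_roots_of_unity:
  assumes n: "0 < n"
  shows "(\<Sum>k=1..n. cis (2 * pi * (real k * real_of_int m / real n))) = (if int n dvd m then of_nat n else 0)"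
proof -
  define w where "w = cis (2 * pi * (real_of_int m / real n))"
  have wk: "cis (2 * pi * (real k * real_of_int m / real n)) = w ^ k" for k
    unfolding w_def Complex.DeMoivre by (rule arg_cong[where f = cis]) simp
  have wn: "w ^ n = 1"
  proof -
    have "w ^ n = cis (2 * pi * real_of_int m)" unfolding w_def Complex.DeMoivre by (rule arg_cong[where f = cis]) (use n in simp)
    then show ?thesis using cis_multiple_2pi[of "real_of_int m"] by simp
  qed
  have w1: "w = 1 \<longleftrightarrow> int n dvd m"
  proof
    assume "w = 1"
    then have "cos (2 * pi * (real_of_int m / real n)) = 1" by (simp add: w_def complex_eq_iff)
    then obtain k :: int where "2 * pi * (real_of_int m / real n) = real_of_int k * (2 * pi)"
      by (auto simp: cos_one_2pi_int)
    then have "real_of_int m = real_of_int (k * int n)" using n by (simp add: field_simps)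
    then show "int n dvd m" by (simp only: of_int_eq_iff) simp
  next
    assume "int n dvd m"
    then obtain k where "m = int n * k" by (auto elim: dvdE)
    have "w = cis (2 * pi * real_of_int k)" unfolding w_def by (rule arg_cong[where f = cis]) (use n \<open>m = int n * k\<close> in simp)
    then show "w = 1" using cis_multiple_2pi[of "real_of_int k"] by simp
  qed
  have "(\<Sum>k=1..n. w ^ k) = (if w = 1 then of_nat n else 0)"
  proof (cases "w = 1")
    case False
    have "(\<Sum>k=1..n. w ^ k) = (\<Sum>k<n. w ^ Suc k)"
      by (rule sum.reindex_bij_witness[of _ Suc "\<lambda>k. k - 1"]) auto
    also have "\<dots> = w * ((w ^ n - 1) / (w - 1))" using False by (simp add: sum_distrib_left[symmetric] geometric_sum)
    finally show ?thesis using False wn by simp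
  qed simp
  then show ?thesis using w1 wk by simp
qed

section \<open>Kernel interpolation\<close>

lemma bij_betw_translate_Zs: "h \<in> Zs s \<Longrightarrow> bij_betw (\<lambda>l j. h j + l j) (Zs s) (Zs s)"
  by (rule bij_betwI[where g = "\<lambda>l j. l j - h j"]) (auto simp: Zs_def)

text \<open>Product weights appear as \<open>prod g\<close>, which already is a function on index
  sets as expected by \<open>kernel\<close> and \<open>r_weight\<close>. Primality of
  \<open>n\<close> makes every component of \<open>z\<close> invertible modulo
  \<open>n\<close>.\<close>

locale lattice_interpolation =
  fixes s n \<alpha> :: nat and z :: "nat \<Rightarrow> nat" and g :: "nat \<Rightarrow> real"
  assumes s: "1 \<le> s" and n: "prime n" and z: "\<And>j. j \<in> {1..s} \<Longrightarrow> z j \<in> {1..n - 1}"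
    and g: "\<And>j. j \<in> {1..s} \<Longrightarrow> 0 < g j" and \<alpha>: "2 \<le> \<alpha>"
begin

abbreviation "t k \<equiv> lattice_point s n z k"
abbreviation "K y y' \<equiv> kernel (prod g) \<alpha> s y y'"
abbreviation "L \<equiv> dual_lattice s n z"
abbreviation "w h \<equiv> wt s g \<alpha> h"
abbreviation "interpolant f \<equiv> kernel_interpolant (prod g) \<alpha> s n z f"

lemma n_pos: "0 < n" using n by (simp add: prime_gt_0_nat)

lemma w_pos: "0 < w h" using wt_pos[of s g] g by auto

lemma w_summable: "w summable_on Zs s"
  using wt_summable[of s g \<alpha>] g \<alpha> by auto

lemma kernel_point_has_sum:
  "((\<lambda>h. of_real (w h) * cnj (chr s h y) * chr s h y') has_sum of_real (K y y')) (Zs s)"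
  using has_sum_cnj_iff[THEN iffD2, OF kernel_has_sum[of s g \<alpha> y y', OF g \<alpha>]] by (simp add: mult.assoc)

lemma kernel_sym: "K y y' = K y' y"
proof -
  have "((\<lambda>h. of_real (w h) * cnj (chr s h y) * chr s h y') has_sum of_real (K y' y)) (Zs s)"
    using kernel_has_sum[of s g \<alpha> y' y, OF g \<alpha>] by (simp add: mult_ac)
  from has_sum_unique[OF this kernel_point_has_sum] show ?thesis by simp
qed

section \<open>Gram form of the kernel and existence of the interpolant\<close>

definition gram :: "(nat \<Rightarrow> real) \<Rightarrow> (nat \<Rightarrow> real) \<Rightarrow> real" where
  "gram c c' = (\<Sum>k=1..n. \<Sum>k'=1..n. c k * c' k' * K (t k) (t k'))"

text \<open>This writes the Gram form as a weighted sum of squares of exponential sums; it is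
  nonnegative, and it vanishes only if all these sums vanish.\<close>

lemma gram_has_sum:
  "((\<lambda>h. w h * (cmod (\<Sum>k=1..n. of_real (c k) * chr s h (t k)))\<^sup>2) has_sum gram c c) (Zs s)"
proof -
  have "((\<lambda>h. \<Sum>k\<in>{1..n}. \<Sum>k'\<in>{1..n}. of_real (c k * c k') * (of_real (w h) * cnj (chr s h (t k)) * chr s h (t k')))
     has_sum (\<Sum>k\<in>{1..n}. \<Sum>k'\<in>{1..n}. of_real (c k * c k') * of_real (K (t k) (t k')))) (Zs s)"
    by (intro has_sum_finite_sum has_sum_cmult_right kernel_point_has_sum)
  also have "(\<lambda>h. \<Sum>k\<in>{1..n}. \<Sum>k'\<in>{1..n}. of_real (c k * c k') * (of_real (w h) * cnj (chr s h (t k)) * chr s h (t k')))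
    = (\<lambda>h. of_real (w h * (cmod (\<Sum>k=1..n. of_real (c k) * chr s h (t k)))\<^sup>2))"
  proof
    fix h
    let ?P = "\<Sum>k=1..n. of_real (c k) * chr s h (t k)"
    have "of_real (w h * (cmod ?P)\<^sup>2) = of_real (w h) * (cnj ?P * ?P)"
      by (simp only: of_real_mult complex_norm_square mult.commute[of ?P])
    also have "\<dots> = (\<Sum>k\<in>{1..n}. \<Sum>k'\<in>{1..n}. of_real (c k * c k') * (of_real (w h) * cnj (chr s h (t k)) * chr s h (t k')))"
    proof -
      have "cnj ?P * ?P = (\<Sum>k=1..n. \<Sum>k'=1..n. cnj (of_real (c k) * chr s h (t k)) * (of_real (c k') * chr s h (t k')))"
        by (simp only: cnj_sum sum_product)
      note e = this
      show ?thesis unfolding e unfolding sum_distrib_left by (intro sum.cong refl) (simp add: mult_ac)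
    qed
    finally show "(\<Sum>k\<in>{1..n}. \<Sum>k'\<in>{1..n}. of_real (c k * c k') * (of_real (w h) * cnj (chr s h (t k)) * chr s h (t k')))
      = complex_of_real (w h * (cmod ?P)\<^sup>2)" by (rule sym)
  qed
  also have "(\<Sum>k\<in>{1..n}. \<Sum>k'\<in>{1..n}. complex_of_real (c k * c k') * of_real (K (t k) (t k'))) = of_real (gram c c)"
    by (simp add: gram_def)
  finally show ?thesis by (simp only: has_sum_of_real_iff)
qed

text \<open>Frequencies along the first coordinate suffice. Since \<open>z 1\<close> is invertible
  modulo \<open>n\<close>, the corresponding sums are a discrete Fourier transform of
  \<open>c\<close>, which is inverted by summing against roots of unity.\<close>

lemma chr_sums_vanish_imp:
  assumes v: "\<And>h. h \<in> Zs s \<Longrightarrow> (\<Sum>k=1..n. of_real (c k) * chr s h (t k)) = 0" and k0: "k0 \<in> {1..n}"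
  shows "c k0 = 0"
proof -
  define e :: "nat \<Rightarrow> nat \<Rightarrow> int" where "e m = (\<lambda>j. if j = 1 then int m else 0)" for m
  have e: "e m \<in> Zs s" for m using s by (auto simp: e_def Zs_def)
  have ez: "(\<Sum>j=1..s. e m j * int (z j)) = int m * int (z 1)" for m
  proof -
    have "(\<Sum>j=1..s. e m j * int (z j)) = (\<Sum>j\<in>{1}. e m j * int (z j))"
      by (rule sum.mono_neutral_right) (use s in \<open>auto simp: e_def\<close>)
    then show ?thesis by (simp add: e_def)
  qed
  have tw: "chr s (e m) (t k) * cis (- (2 * pi * (real m * (real k0 * real (z 1)) / real n)))
     = cis (2 * pi * (real m * real_of_int ((int k - int k0) * int (z 1)) / real n))" for m k
    unfolding chr_lattice_point ez cis_mult
    by (rule arg_cong[where f = cis]) (simp add: algebra_simps diff_divide_distrib)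
  have "0 = (\<Sum>m=1..n. (\<Sum>k=1..n. of_real (c k) * chr s (e m) (t k)) * cis (- (2 * pi * (real m * (real k0 * real (z 1)) / real n))))"
    using v[OF e] by simp
  also have "\<dots> = (\<Sum>k=1..n. of_real (c k) * (\<Sum>m=1..n. cis (2 * pi * (real m * real_of_int ((int k - int k0) * int (z 1)) / real n))))"
    unfolding sum_distrib_right sum_distrib_left by (subst sum.swap) (intro sum.cong refl, unfold tw[symmetric], rule mult.assoc)
  also have "\<dots> = (\<Sum>k=1..n. if k = k0 then of_real (c k) * of_nat n else 0)"
  proof (rule sum.cong[OF refl])
    fix k assume k: "k \<in> {1..n}"
    have "int n dvd (int k - int k0) * int (z 1) \<longleftrightarrow> k = k0"
    proof
      assume "int n dvd (int k - int k0) * int (z 1)"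
      then have "int n dvd (int k - int k0) \<or> int n dvd int (z 1)"
        using n prime_dvd_mult_iff[of "int n"] by simp
      moreover have "\<not> int n dvd int (z 1)" using z[of 1] s n_pos by (auto dest!: dvd_imp_le)
      ultimately have "int n dvd (int k - int k0)" by simp
      then obtain q where q: "int k - int k0 = int n * q" by (elim dvdE)
      have "\<bar>int n * q\<bar> < int n" unfolding q[symmetric] using k k0 by auto
      then have "q = 0" using n_pos by (simp add: abs_mult)
      then show "k = k0" using q by simp
    qed simp
    then show "of_real (c k) * (\<Sum>m=1..n. cis (2 * pi * (real m * real_of_int ((int k - int k0) * int (z 1)) / real n)))
        = (if k = k0 then complex_of_real (c k) * of_nat n else 0)"
      unfolding sum_roots_of_unity[OF n_pos] by simp
  qed
  also have "\<dots> = of_real (c k0) * of_nat n" using k0 by simp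
  finally show ?thesis using n_pos by simp
qed

lemma gram_nonneg: "0 \<le> gram c c"
  by (rule has_sum_nonneg[OF gram_has_sum]) (use w_pos in \<open>auto simp: less_imp_le\<close>)

lemma gram_zero_imp: "gram c c = 0 \<Longrightarrow> k \<in> {1..n} \<Longrightarrow> c k = 0"
proof -
  assume 0: "gram c c = 0" and k: "k \<in> {1..n}"
  have "(\<Sum>k=1..n. of_real (c k) * chr s h (t k)) = 0" if h: "h \<in> Zs s" for h
  proof -
    have "w h * (cmod (\<Sum>k=1..n. of_real (c k) * chr s h (t k)))\<^sup>2 = 0"
      using nonneg_has_sum_le_0D[OF gram_has_sum[of c]] 0 h w_pos by (auto simp: less_imp_le)
    then show ?thesis using w_pos[of h] by auto
  qed
  then show "c k = 0" using chr_sums_vanish_imp k by blast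
qed

text \<open>The data \<open>v\<close> define a linear functional on coefficient vectors, and
  \<open>c\<close> is its representer in the Gram inner product, written in an orthonormal basis.
  Testing with the unit vector at \<open>k\<close> recovers \<open>v k\<close>.\<close>

lemma interpolation_coefficients_exist:
  "\<exists>c. \<forall>k\<in>{1..n}. (\<Sum>k'=1..n. c k' * K (t k') (t k)) = v k"
proof -
  define V where "V = {c :: nat \<Rightarrow> real. \<forall>k. k \<notin> {1..n} \<longrightarrow> c k = 0}"
  have V: "fun_subspace V" by (auto simp: fun_subspace_def V_def)
  have B: "bilinear_on V gram"
    unfolding bilinear_on_def gram_def
    by (simp add: distrib_right distrib_left sum.distrib sum_distrib_left) (simp add: mult_ac)
  have sym: "gram c c' = gram c' c" for c c'
    unfolding gram_def by (subst sum.swap) (simp add: kernel_sym mult_ac)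
  obtain N and e :: "nat \<Rightarrow> nat \<Rightarrow> real" where e: "\<And>i. i < N \<Longrightarrow> e i \<in> V"
    and ex: "\<And>c. c \<in> V \<Longrightarrow> c = (\<lambda>k. \<Sum>i<N. gram c (e i) * e i k)"
  proof -
    have "\<exists>N (e :: nat \<Rightarrow> nat \<Rightarrow> real). (\<forall>i<N. e i \<in> V) \<and>
      (\<forall>i<N. \<forall>j<N. gram (e i) (e j) = (if i = j then 1 else 0)) \<and> (\<forall>c\<in>V. c = (\<lambda>k. \<Sum>i<N. gram c (e i) * e i k))"
    proof (rule orthonormal_basis_exists[of "{1..n}", OF _ V B sym])
      fix c assume c: "c \<in> V" "c \<noteq> (\<lambda>_. 0)"
      then obtain k where "c k \<noteq> 0" by auto
      with c have "k \<in> {1..n}" by (auto simp: V_def)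
      with \<open>c k \<noteq> 0\<close> have "gram c c \<noteq> 0" using gram_zero_imp by blast
      then show "0 < gram c c" using gram_nonneg[of c] by simp
    next
      fix c assume "c \<in> V" "\<forall>k\<in>{1..n}. c k = 0"
      then show "c = (\<lambda>_. 0)" unfolding V_def by blast
    qed simp
    then show thesis using that by blast
  qed
  define c where "c = (\<lambda>k. \<Sum>i<N. (\<Sum>k'=1..n. v k' * e i k') * e i k)"
  have cV: "c \<in> V" unfolding c_def by (rule fun_subspace_sum[OF V]) (use e in auto)
  have "(\<Sum>k'=1..n. c k' * K (t k') (t k)) = v k" if k: "k \<in> {1..n}" for k
  proof -
    define \<delta> where "\<delta> = (\<lambda>k'. if k' = k then 1 else 0 :: real)"
    have \<delta>: "\<delta> \<in> V" using k by (auto simp: \<delta>_def V_def)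
    have "(\<Sum>k'=1..n. c k' * K (t k') (t k)) = gram c \<delta>"
      unfolding gram_def
    proof (rule sum.cong[OF refl])
      fix i
      have "(\<Sum>k'=1..n. c i * \<delta> k' * K (t i) (t k')) = (\<Sum>k'\<in>{k}. c i * \<delta> k' * K (t i) (t k'))"
        by (rule sum.mono_neutral_right) (use k in \<open>auto simp: \<delta>_def\<close>)
      then show "c i * K (t i) (t k) = (\<Sum>k'=1..n. c i * \<delta> k' * K (t i) (t k'))" by (simp add: \<delta>_def)
    qed
    also have "\<dots> = (\<Sum>i<N. (\<Sum>k'=1..n. v k' * e i k') * gram (e i) \<delta>)"
      unfolding c_def by (rule bilinear_on_sum_left[OF V B \<delta>]) (use e in auto)
    also have "\<dots> = (\<Sum>k'=1..n. v k' * (\<Sum>i<N. gram \<delta> (e i) * e i k'))"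
      unfolding sum_distrib_left sum_distrib_right sym[of _ \<delta>] by (subst sum.swap) (simp add: mult_ac)
    also have "\<dots> = (\<Sum>k'=1..n. v k' * \<delta> k')" using ex[OF \<delta>] by (simp only: fun_eq_iff)
    also have "\<dots> = (\<Sum>k'\<in>{k}. v k' * \<delta> k')"
      by (rule sum.mono_neutral_right) (use k in \<open>auto simp: \<delta>_def\<close>)
    also have "\<dots> = v k" by (simp add: \<delta>_def)
    finally show ?thesis .
  qed
  then show ?thesis by blast
qed

definition interpolates :: "((nat \<Rightarrow> real) \<Rightarrow> real) \<Rightarrow> ((nat \<Rightarrow> real) \<Rightarrow> real) \<Rightarrow> bool" where
  "interpolates f u \<longleftrightarrow> (\<exists>c. u = (\<lambda>y. \<Sum>k=1..n. c k * K (t k) y)) \<and> (\<forall>k\<in>{1..n}. u (t k) = f (t k))"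

lemma interpolates_unique:
  assumes "interpolates f u" "interpolates f v"
  shows "u = v"
proof -
  obtain c d where u: "u = (\<lambda>y. \<Sum>k=1..n. c k * K (t k) y)" and v: "v = (\<lambda>y. \<Sum>k=1..n. d k * K (t k) y)"
    and uv: "\<And>k. k \<in> {1..n} \<Longrightarrow> u (t k) = v (t k)"
    using assms unfolding interpolates_def by auto
  define a where "a k = c k - d k" for k
  have "(\<Sum>k=1..n. a k * K (t k) (t k')) = 0" if "k' \<in> {1..n}" for k'
    using uv[OF that] unfolding u v a_def by (simp add: left_diff_distrib sum_subtractf)
  then have "gram a a = 0"
    unfolding gram_def by (subst sum.swap) (simp add: mult.commute[of "a _" "a _"] mult.assoc sum_distrib_left[symmetric])
  then have "c k = d k" if "k \<in> {1..n}" for k using gram_zero_imp[of a k] that by (simp add: a_def)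
  then show ?thesis unfolding u v by (intro ext sum.cong) auto
qed

lemma interpolates_interpolant: "interpolates f (interpolant f)"
proof -
  obtain c where c: "\<And>k. k \<in> {1..n} \<Longrightarrow> (\<Sum>k'=1..n. c k' * K (t k') (t k)) = f (t k)"
    using interpolation_coefficients_exist[of "\<lambda>k. f (t k)"] by blast
  then have "interpolates f (\<lambda>y. \<Sum>k=1..n. c k * K (t k) y)" unfolding interpolates_def by auto
  then have "\<exists>!u. interpolates f u" using interpolates_unique by blast
  from theI'[OF this] show ?thesis unfolding kernel_interpolant_def interpolates_def .
qed

text \<open>Linearity follows from uniqueness. It allows interpolation of the coefficient functions
  in a spatial basis instead of the values at each point of \<open>D\<close>.\<close>

lemma interpolant_sum:
  "interpolant (\<lambda>y. \<Sum>i<N. a i * f i y) = (\<lambda>y. \<Sum>i<N. a i * interpolant (f i) y)"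
proof (rule interpolates_unique[OF interpolates_interpolant])
  have "\<forall>i. \<exists>c. interpolant (f i) = (\<lambda>y. \<Sum>k=1..n. c k * K (t k) y)"
    using interpolates_interpolant unfolding interpolates_def by blast
  then obtain c where c: "\<And>i. interpolant (f i) = (\<lambda>y. \<Sum>k=1..n. c i k * K (t k) y)" by metis
  have "(\<lambda>y. \<Sum>i<N. a i * interpolant (f i) y) = (\<lambda>y. \<Sum>k=1..n. (\<Sum>i<N. a i * c i k) * K (t k) y)"
    unfolding c sum_distrib_left sum_distrib_right by (subst sum.swap) (simp add: mult_ac)
  then show "interpolates (\<lambda>y. \<Sum>i<N. a i * f i y) (\<lambda>y. \<Sum>i<N. a i * interpolant (f i) y)"
    unfolding interpolates_def using interpolates_interpolant unfolding interpolates_def by auto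
qed

section \<open>Dual lattice, aliasing and the error in terms of the criterion\<close>

lemma dual_lattice_iff:
  "l \<in> L \<longleftrightarrow> l \<in> Zs s \<and> l \<noteq> (\<lambda>_. 0) \<and> int n dvd (\<Sum>j=1..s. l j * int (z j))"
  by (auto simp: dual_lattice_def cong_0_iff)

lemma w_shift_summable: "(\<lambda>(h, l). w h * w (\<lambda>j. h j + l j)) summable_on (Zs s \<times> Zs s)"
proof -
  have bij: "bij_betw (\<lambda>(h, l). (h, \<lambda>j. h j + l j)) (Zs s \<times> Zs s) (Zs s \<times> Zs s)"
    by (rule bij_betwI[where g = "\<lambda>(h, l). (h, \<lambda>j. l j - h j)"]) (auto simp: Zs_def)
  have a: "Infinite_Sum.abs_summable_on w (Zs s)" using w_summable w_pos by (simp add: less_imp_le)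
  have "(\<lambda>(h, l). w h * w l) summable_on (Zs s \<times> Zs s)"
    by (rule has_sum_imp_summable[OF has_sum_times(1)[OF has_sum_infsum[OF w_summable] a has_sum_infsum[OF w_summable] a]])
  then show ?thesis
    using summable_on_reindex_bij_betw[OF bij, of "\<lambda>(h, l). w h * w l"] by (simp add: case_prod_unfold)
qed

definition S :: real where "S = lattice_sum (prod g) \<alpha> s L"

lemma S_eq: "S = (\<Sum>\<^sub>\<infinity>(h, l)\<in>Zs s \<times> L. w h * w (\<lambda>j. h j + l j))"
  unfolding S_def lattice_sum_def
proof (rule infsum_cong, clarify)
  fix h l assume "h \<in> Zs s" "l \<in> L"
  then have "h \<in> Zs s" "(\<lambda>j. h j + l j) \<in> Zs s" by (auto simp: dual_lattice_def Zs_def)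
  from this[THEN r_weight_eq[of _ s g \<alpha>]]
  show "1 / (r_weight (prod g) \<alpha> h * r_weight (prod g) \<alpha> (\<lambda>j. h j + l j)) = w h * w (\<lambda>j. h j + l j)"
    by (metis divide_divide_eq_left mult.commute times_divide_eq_right mult_1)
qed

lemma dual_summable: "(\<lambda>(h, l). w h * w (\<lambda>j. h j + l j)) summable_on (Zs s \<times> L)"
  by (rule summable_on_subset_banach[OF w_shift_summable]) (auto simp: dual_lattice_def)

text \<open>The total weight of the frequencies that coincide with \<open>h\<close> on the lattice
  points, \<open>h\<close> itself excluded because \<open>L\<close> omits the zero vector.\<close>

definition dual_sum :: "(nat \<Rightarrow> int) \<Rightarrow> real" where
  "dual_sum h = (\<Sum>\<^sub>\<infinity>l\<in>L. w (\<lambda>j. h j + l j))"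

lemma translate_summable: "h \<in> Zs s \<Longrightarrow> (\<lambda>l. w (\<lambda>j. h j + l j)) summable_on Zs s"
  using summable_on_reindex_bij_betw[OF bij_betw_translate_Zs, of h s w] w_summable by simp

lemma dual_sum_has_sum: "((\<lambda>h. w h * dual_sum h) has_sum S) (Zs s)"
proof (rule has_sum_SigmaD[where B = "\<lambda>_. L"])
  show "((\<lambda>(h, l). w h * w (\<lambda>j. h j + l j)) has_sum S) (Zs s \<times> L)"
    unfolding S_eq by (rule has_sum_infsum[OF dual_summable])
  fix h assume h: "h \<in> Zs s"
  have "(\<lambda>l. w (\<lambda>j. h j + l j)) summable_on L"
    by (rule summable_on_subset_banach[OF translate_summable[OF h]]) (auto simp: dual_lattice_def)
  then show "((\<lambda>l. case (h, l) of (h, l) \<Rightarrow> w h * w (\<lambda>j. h j + l j)) has_sum w h * dual_sum h) L"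
    unfolding dual_sum_def by (simp add: has_sum_cmult_right)
qed

text \<open>The vector with first component \<open>n\<close> and zeros elsewhere is dual for every
  \<open>z\<close>, so the criterion has a positive term. This permits dividing by
  \<open>sqrt S\<close>.\<close>

lemma S_pos: "0 < S"
proof -
  define l :: "nat \<Rightarrow> int" where "l = (\<lambda>j. if j = 1 then int n else 0)"
  have "(\<Sum>j=1..s. l j * int (z j)) = (\<Sum>j\<in>{1}. l j * int (z j))"
    by (rule sum.mono_neutral_right) (use s in \<open>auto simp: l_def\<close>)
  then have l: "l \<in> L" using n_pos s by (auto simp: dual_lattice_iff Zs_def l_def fun_eq_iff)
  have "0 < w (\<lambda>_. 0) * w (\<lambda>j. 0 + l j)" using w_pos by simp
  also have "\<dots> = (\<Sum>x\<in>{((\<lambda>_. 0), l)}. (\<lambda>(h, l). w h * w (\<lambda>j. h j + l j)) x)" by simp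
  also have "\<dots> \<le> S"
    unfolding S_eq by (rule finite_sum_le_infsum[OF dual_summable]) (use l w_pos in \<open>auto simp: less_imp_le\<close>)
  finally show ?thesis .
qed

text \<open>
  Since the error vanishes at the lattice points, each of its Fourier coefficients is minus the sum of the
  coefficients aliased with it.
\<close>

lemma aliasing:
  assumes W: "\<And>y. ((\<lambda>h. c h * chr s h y) has_sum W y) (Zs s)"
    and W0: "\<And>k. k \<in> {1..n} \<Longrightarrow> W (t k) = 0" and h: "h \<in> Zs s"
  shows "((\<lambda>l. c (\<lambda>j. h j + l j)) has_sum (- c h)) L"
proof -
  have "((\<lambda>h'. \<Sum>k\<in>{1..n}. c h' * chr s h' (t k) * cnj (chr s h (t k))) has_sum (\<Sum>k\<in>{1..n}. W (t k) * cnj (chr s h (t k)))) (Zs s)"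
    by (intro has_sum_finite_sum has_sum_cmult_left W)
  then have "((\<lambda>h'. \<Sum>k\<in>{1..n}. c h' * chr s h' (t k) * cnj (chr s h (t k))) has_sum 0) (Zs s)"
    using W0 by simp
  then have "((\<lambda>l. \<Sum>k\<in>{1..n}. c (\<lambda>j. h j + l j) * chr s (\<lambda>j. h j + l j) (t k) * cnj (chr s h (t k))) has_sum 0) (Zs s)"
    by (subst has_sum_reindex_bij_betw[OF bij_betw_translate_Zs[OF h]])
  moreover have "(\<Sum>k\<in>{1..n}. c (\<lambda>j. h j + l j) * chr s (\<lambda>j. h j + l j) (t k) * cnj (chr s h (t k)))
     = (if int n dvd (\<Sum>j=1..s. l j * int (z j)) then of_nat n * c (\<lambda>j. h j + l j) else 0)" for l
  proof -
    have "chr s (\<lambda>j. h j + l j) y * cnj (chr s h y) = chr s l y" for y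
      by (simp add: chr_add chr_def cis_cnj cis_mult)
    then have "(\<Sum>k\<in>{1..n}. c (\<lambda>j. h j + l j) * chr s (\<lambda>j. h j + l j) (t k) * cnj (chr s h (t k)))
      = c (\<lambda>j. h j + l j) * (\<Sum>k\<in>{1..n}. chr s l (t k))"
      by (simp add: mult.assoc sum_distrib_left)
    then show ?thesis unfolding chr_lattice_point sum_roots_of_unity[OF n_pos] by simp
  qed
  ultimately have *: "((\<lambda>l. if int n dvd (\<Sum>j=1..s. l j * int (z j)) then of_nat n * c (\<lambda>j. h j + l j) else 0) has_sum 0) (Zs s)"
    by simp
  have "((\<lambda>l. if int n dvd (\<Sum>j=1..s. l j * int (z j)) then of_nat n * c (\<lambda>j. h j + l j) else 0) has_sum 0) (Zs s)
    \<longleftrightarrow> ((\<lambda>l. of_nat n * c (\<lambda>j. h j + l j)) has_sum 0) (insert (\<lambda>_. 0) L)"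
    by (rule has_sum_cong_neutral) (auto simp: dual_lattice_iff)
  with * have "((\<lambda>l. of_nat n * c (\<lambda>j. h j + l j)) has_sum 0) (insert (\<lambda>_. 0) L)" by blast
  from has_sum_cmult_right[OF this, of "1 / of_nat n"]
  have ins: "((\<lambda>l. c (\<lambda>j. h j + l j)) has_sum 0) (insert (\<lambda>_. 0) L)" using n_pos by simp
  have "(\<lambda>l. c (\<lambda>j. h j + l j)) summable_on L"
    by (rule summable_on_subset_banach[OF has_sum_imp_summable[OF ins]]) auto
  then obtain X where X: "((\<lambda>l. c (\<lambda>j. h j + l j)) has_sum X) L" by (auto simp: summable_on_def)
  have "((\<lambda>l. c (\<lambda>j. h j + l j)) has_sum (c (\<lambda>j. h j + (\<lambda>_. 0) j) + X)) (insert (\<lambda>_. 0) L)"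
    by (rule has_sum_insert[OF _ X]) (auto simp: dual_lattice_def)
  from has_sum_unique[OF this ins] have "X = - c h" by (simp add: add_eq_0_iff2)
  with X show ?thesis by simp
qed

text \<open>Two bounds compete. Aliasing and Cauchy-Schwarz bound a squared coefficient by
  \<open>X * dual_sum h\<close>; trivially it is also \<open>w h\<close> times its share of the
  weighted norm. The first bound is used where \<open>w h \<ge> sqrt S\<close>, the second
  elsewhere, and each contributes at most \<open>sqrt S * X\<close> to the sum.\<close>

theorem vanishing_error_bound:
  assumes W: "\<And>y. ((\<lambda>h. c h * chr s h y) has_sum W y) (Zs s)"
    and W0: "\<And>k. k \<in> {1..n} \<Longrightarrow> W (t k) = 0"
    and c: "(\<lambda>h. (cmod (c h))\<^sup>2 / w h) summable_on Zs s"
    and X: "(\<Sum>\<^sub>\<infinity>h\<in>Zs s. (cmod (c h))\<^sup>2 / w h) \<le> X" "0 \<le> X"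
  shows "(\<lambda>h. cmod (c h)) summable_on Zs s" and "(\<lambda>h. (cmod (c h))\<^sup>2) summable_on Zs s"
    and "(\<Sum>\<^sub>\<infinity>h\<in>Zs s. (cmod (c h))\<^sup>2) \<le> 2 * sqrt S * X"
proof -
  have sq: "(cmod (c h) / sqrt (w h))\<^sup>2 = (cmod (c h))\<^sup>2 / w h" "(sqrt (w h))\<^sup>2 = w h" for h
    using w_pos[of h] by (auto simp: power_divide less_imp_le)
  have pr: "\<bar>cmod (c h) / sqrt (w h) * sqrt (w h)\<bar> = cmod (c h)" for h using w_pos[of h] by simp
  show "(\<lambda>h. cmod (c h)) summable_on Zs s"
    using infsum_Cauchy_Schwarz(1)[of "\<lambda>h. cmod (c h) / sqrt (w h)" "Zs s" "\<lambda>h. sqrt (w h)"] c w_summable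
    by (simp only: sq pr)
  have ds: "0 \<le> dual_sum h" for h unfolding dual_sum_def by (intro infsum_nonneg less_imp_le w_pos)
  have le: "(cmod (c h))\<^sup>2 \<le> X * dual_sum h" if h: "h \<in> Zs s" for h
  proof -
    have LZ: "L \<subseteq> Zs s" by (auto simp: dual_lattice_def)
    have s1: "(\<lambda>l. w (\<lambda>j. h j + l j)) summable_on L"
      by (rule summable_on_subset_banach[OF translate_summable[OF h] LZ])
    have tr: "(\<lambda>l. (cmod (c (\<lambda>j. h j + l j)))\<^sup>2 / w (\<lambda>j. h j + l j)) summable_on Zs s"
      "(\<Sum>\<^sub>\<infinity>l\<in>Zs s. (cmod (c (\<lambda>j. h j + l j)))\<^sup>2 / w (\<lambda>j. h j + l j)) \<le> X"
      using summable_on_reindex_bij_betw[OF bij_betw_translate_Zs[OF h], of "\<lambda>h. (cmod (c h))\<^sup>2 / w h"]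
        infsum_reindex_bij_betw[OF bij_betw_translate_Zs[OF h], of "\<lambda>h. (cmod (c h))\<^sup>2 / w h"] c X by simp_all
    have s2: "(\<lambda>l. (cmod (c (\<lambda>j. h j + l j)))\<^sup>2 / w (\<lambda>j. h j + l j)) summable_on L"
      by (rule summable_on_subset_banach[OF tr(1) LZ])
    have i2: "(\<Sum>\<^sub>\<infinity>l\<in>L. (cmod (c (\<lambda>j. h j + l j)))\<^sup>2 / w (\<lambda>j. h j + l j)) \<le> X"
      using infsum_mono2[OF s2 tr(1) LZ] tr(2) w_pos by (simp add: less_imp_le)
    note CS = infsum_Cauchy_Schwarz[of "\<lambda>l. cmod (c (\<lambda>j. h j + l j)) / sqrt (w (\<lambda>j. h j + l j))" L "\<lambda>l. sqrt (w (\<lambda>j. h j + l j))",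
        unfolded sq pr, OF s2 s1]
    have "cmod (- c h) \<le> (\<Sum>\<^sub>\<infinity>l\<in>L. cmod (c (\<lambda>j. h j + l j)))"
      using norm_infsum_bound[OF CS(1)] infsumI[OF aliasing[OF W W0 h]] by simp
    also have "\<dots> \<le> sqrt (\<Sum>\<^sub>\<infinity>l\<in>L. (cmod (c (\<lambda>j. h j + l j)))\<^sup>2 / w (\<lambda>j. h j + l j)) * sqrt (dual_sum h)"
      unfolding dual_sum_def by (rule CS(2))
    also have "\<dots> \<le> sqrt X * sqrt (dual_sum h)"
      using i2 ds by (intro mult_right_mono real_sqrt_le_mono) auto
    finally have "cmod (c h) \<le> sqrt (X * dual_sum h)" by (simp add: real_sqrt_mult)
    then have "(cmod (c h))\<^sup>2 \<le> (sqrt (X * dual_sum h))\<^sup>2" by (rule power_mono) simp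
    also have "\<dots> = X * dual_sum h"
      using X(2) by (simp add: dual_sum_def infsum_nonneg less_imp_le w_pos)
    finally show ?thesis .
  qed
  \<comment> \<open>This threshold balances the two totals \<open>X * M * S\<close> and
    \<open>X / M\<close>.\<close>
  define M where "M = 1 / sqrt S"
  have M: "0 < M" using S_pos by (simp add: M_def)
  define F where "F h = X * M * (w h * dual_sum h) + (1 / M) * ((cmod (c h))\<^sup>2 / w h)" for h
  have leF: "(cmod (c h))\<^sup>2 \<le> F h" if h: "h \<in> Zs s" for h
  proof (cases "1 \<le> M * w h")
    case True
    have "X * dual_sum h * 1 \<le> X * dual_sum h * (M * w h)" using True X(2) ds by (intro mult_left_mono) auto
    moreover have "0 \<le> (1 / M) * ((cmod (c h))\<^sup>2 / w h)" using M w_pos[of h] by (intro mult_nonneg_nonneg) auto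
    ultimately show ?thesis using le[OF h] unfolding F_def by (simp add: mult_ac)
  next
    case False
    have "(cmod (c h))\<^sup>2 * 1 \<le> (cmod (c h))\<^sup>2 * (1 / (M * w h))"
      using False M w_pos[of h] by (intro mult_left_mono) (auto simp: field_simps)
    moreover have "0 \<le> X * M * (w h * dual_sum h)" using X(2) M w_pos[of h] ds by (intro mult_nonneg_nonneg) auto
    ultimately show ?thesis unfolding F_def by (simp add: mult_ac)
  qed
  have F: "(F has_sum (X * M * S + (1 / M) * (\<Sum>\<^sub>\<infinity>h\<in>Zs s. (cmod (c h))\<^sup>2 / w h))) (Zs s)"
    unfolding F_def by (intro has_sum_add has_sum_cmult_right dual_sum_has_sum has_sum_infsum c)
  show c2: "(\<lambda>h. (cmod (c h))\<^sup>2) summable_on Zs s"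
    by (rule summable_on_comparison_test[OF has_sum_imp_summable[OF F]]) (use leF in auto)
  have "(\<Sum>\<^sub>\<infinity>h\<in>Zs s. (cmod (c h))\<^sup>2) \<le> X * M * S + (1 / M) * (\<Sum>\<^sub>\<infinity>h\<in>Zs s. (cmod (c h))\<^sup>2 / w h)"
    using infsum_mono[OF c2 has_sum_imp_summable[OF F] leF] infsumI[OF F] by simp
  also have "\<dots> \<le> X * M * S + (1 / M) * X" using X M by (intro add_left_mono mult_left_mono) auto
  also have "X * M * S + (1 / M) * X = 2 * sqrt S * X"
  proof -
  have "M * S = sqrt S" using S_pos by (simp add: M_def real_div_sqrt)
  moreover have "1 / M = sqrt S" by (simp add: M_def)
  ultimately show ?thesis by (simp add: mult.assoc)
  qed
  finally show "(\<Sum>\<^sub>\<infinity>h\<in>Zs s. (cmod (c h))\<^sup>2) \<le> 2 * sqrt S * X" .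
qed

text \<open>The error vanishes at the lattice points, so by the reproducing property it is
  orthogonal to the interpolant. Pythagoras bounds its weighted norm by that of \<open>f\<close>,
  and \<open>vanishing_error_bound\<close> applies.\<close>

theorem interpolation_error_coefficients:
  assumes f: "\<And>y. ((\<lambda>h. c h * chr s h y) has_sum of_real (f y)) (Zs s)"
    and c: "(\<lambda>h. (cmod (c h))\<^sup>2 / w h) summable_on Zs s"
  obtains d where "\<And>y. ((\<lambda>h. d h * chr s h y) has_sum of_real (f y - interpolant f y)) (Zs s)"
    and "(\<lambda>h. cmod (d h)) summable_on Zs s" and "(\<lambda>h. (cmod (d h))\<^sup>2) summable_on Zs s"
    and "(\<Sum>\<^sub>\<infinity>h\<in>Zs s. (cmod (d h))\<^sup>2) \<le> 2 * sqrt S * (\<Sum>\<^sub>\<infinity>h\<in>Zs s. (cmod (c h))\<^sup>2 / w h)"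
proof -
  obtain a where a: "interpolant f = (\<lambda>y. \<Sum>k=1..n. a k * K (t k) y)"
    and at: "\<And>k. k \<in> {1..n} \<Longrightarrow> interpolant f (t k) = f (t k)"
    using interpolates_interpolant[of f] unfolding interpolates_def by auto
  define P where "P h = (\<Sum>k=1..n. of_real (a k) * chr s h (t k))" for h
  define e where "e h = of_real (w h) * cnj (P h)" for h
  have es: "((\<lambda>h. e h * chr s h y) has_sum of_real (interpolant f y)) (Zs s)" for y
  proof -
    have "((\<lambda>h. \<Sum>k\<in>{1..n}. of_real (a k) * (of_real (w h) * cnj (chr s h (t k)) * chr s h y))
       has_sum (\<Sum>k\<in>{1..n}. of_real (a k) * of_real (K (t k) y))) (Zs s)"
      by (intro has_sum_finite_sum has_sum_cmult_right kernel_point_has_sum)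
    then show ?thesis unfolding e_def P_def a by (simp add: cnj_sum sum_distrib_left sum_distrib_right mult_ac)
  qed
  define d where "d h = c h - e h" for h
  have ds: "((\<lambda>h. d h * chr s h y) has_sum of_real (f y - interpolant f y)) (Zs s)" for y
    unfolding d_def left_diff_distrib of_real_diff
    using has_sum_add[OF f has_sum_cmult_right[OF es, of "-1"]] by simp
  \<comment> \<open>\<open>P h\<close> is the conjugate of \<open>e h / w h\<close>, so this series
    is the inner product of error and interpolant. Evaluated at the points, it is a combination of
    vanishing error values.\<close>
  have ip: "((\<lambda>h. d h * P h) has_sum 0) (Zs s)"
  proof -
    have "((\<lambda>h. \<Sum>k\<in>{1..n}. of_real (a k) * (d h * chr s h (t k))) has_sum (\<Sum>k\<in>{1..n}. of_real (a k) * of_real (f (t k) - interpolant f (t k)))) (Zs s)"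
      by (intro has_sum_finite_sum has_sum_cmult_right ds)
    then show ?thesis using at by (simp add: P_def sum_distrib_left mult_ac)
  qed
  define X where "X = (\<Sum>\<^sub>\<infinity>h\<in>Zs s. (cmod (c h))\<^sup>2 / w h)"
  define G where "G h = (cmod (c h))\<^sup>2 / w h + (- 2) * Re (d h * P h)" for h
  have G: "(G has_sum (X + (- 2) * Re 0)) (Zs s)"
    unfolding G_def X_def by (intro has_sum_add has_sum_cmult_right has_sum_infsum c has_sum_Re ip)
  have le: "(cmod (d h))\<^sup>2 / w h \<le> G h" for h
  proof -
    have "(cmod (c h))\<^sup>2 = (cmod (d h + e h))\<^sup>2" by (simp add: d_def)
    also have "\<dots> = (cmod (d h))\<^sup>2 + (cmod (e h))\<^sup>2 + 2 * Re (d h * cnj (e h))"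
      by (simp only: cmod_power2 complex_add_cnj times_complex.simps cnj.simps plus_complex.simps) (simp add: power2_eq_square algebra_simps)
    also have "Re (d h * cnj (e h)) = w h * Re (d h * P h)" by (simp add: e_def algebra_simps)
    finally have "(cmod (d h))\<^sup>2 \<le> (cmod (c h))\<^sup>2 - 2 * (w h * Re (d h * P h))" by simp
    also have "\<dots> = w h * G h"
      using w_pos[of h] unfolding G_def by (simp only: distrib_left) (simp add: algebra_simps)
    finally have "(cmod (d h))\<^sup>2 \<le> w h * G h" .
    then show ?thesis using w_pos[of h] by (simp add: pos_divide_le_eq mult.commute)
  qed
  have sd: "(\<lambda>h. (cmod (d h))\<^sup>2 / w h) summable_on Zs s"
    by (rule summable_on_comparison_test[OF has_sum_imp_summable[OF G]]) (use le w_pos in \<open>auto simp: less_imp_le\<close>)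
  have Xd: "(\<Sum>\<^sub>\<infinity>h\<in>Zs s. (cmod (d h))\<^sup>2 / w h) \<le> X"
    using infsum_mono[OF sd has_sum_imp_summable[OF G] le] infsumI[OF G] by simp
  have X0: "0 \<le> X" unfolding X_def by (intro infsum_nonneg divide_nonneg_pos w_pos) simp
  have z: "complex_of_real (f (t k) - interpolant f (t k)) = 0" if "k \<in> {1..n}" for k using at[OF that] by simp
  from vanishing_error_bound[OF ds z sd Xd X0] ds show thesis by (intro that) (auto simp: X_def)
qed

end

section \<open>Square integrals of Fourier series\<close>

abbreviation unit_measure :: "real measure" where
  "unit_measure \<equiv> restrict_space lborel {0..1}"

lemma prob_space_unit_measure: "prob_space unit_measure"
  by (rule prob_space_restrict_space) auto

lemma integral_cis_unit:
  "(LINT x|unit_measure. cis (2 * pi * (real_of_int m * x))) = (if m = 0 then 1 else 0)"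
proof (cases "m = 0")
  case True
  interpret prob_space unit_measure by (rule prob_space_unit_measure)
  show ?thesis using True prob_space by simp
next
  case False
  define c where "c = 2 * pi * real_of_int m"
  have c: "c \<noteq> 0" using False by (simp add: c_def)
  define F where "F x = cis (c * x) / (\<i> * of_real c)" for x
  have "(LINT x|unit_measure. cis (2 * pi * (real_of_int m * x))) = (LINT x|lborel. indicator {0..1} x *\<^sub>R cis (c * x))"
    by (subst integral_restrict_space) (auto simp: c_def mult.assoc)
  also have "\<dots> = F 1 - F 0"
  proof (rule integral_FTC_atLeastAtMost)
    fix x :: real
    have "((\<lambda>x. exp (x *\<^sub>R (\<i> * of_real c)) / (\<i> * of_real c)) has_vector_derivative
        exp (x *\<^sub>R (\<i> * of_real c)) * (\<i> * of_real c) / (\<i> * of_real c)) (at x within {0..1})"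
      by (rule has_vector_derivative_divide[OF exp_scaleR_has_vector_derivative_right])
    then show "(F has_vector_derivative cis (c * x)) (at x within {0..1})"
      using c by (simp add: F_def[abs_def] cis_conv_exp scaleR_conv_of_real mult_ac)
  next
    show "continuous_on {0..1} (\<lambda>x. cis (c * x))" by (intro continuous_intros)
  qed simp
  also have "\<dots> = 0" using cis_multiple_2pi[of "real_of_int m"] by (simp add: F_def c_def)
  finally show ?thesis using False by simp
qed

lemma
  assumes h: "h \<in> Zs s"
  shows integrable_chr: "integrable (Pi\<^sub>M {1..s} (\<lambda>_. unit_measure)) (chr s h)"
    and integral_chr: "(LINT y|Pi\<^sub>M {1..s} (\<lambda>_. unit_measure). chr s h y) = (if h = (\<lambda>_. 0) then 1 else 0)"
proof -
  interpret U: prob_space unit_measure by (rule prob_space_unit_measure)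
  interpret product_sigma_finite "\<lambda>_::nat. unit_measure" by unfold_locales
  have i: "integrable unit_measure (\<lambda>x. cis (2 * pi * (real_of_int m * x)))" for m
  proof (rule U.integrable_const_bound[of _ 1])
    have "(\<lambda>x. cis (2 * pi * (real_of_int m * x))) \<in> borel_measurable borel"
      by (intro borel_measurable_continuous_onI continuous_intros)
    then show "(\<lambda>x. cis (2 * pi * (real_of_int m * x))) \<in> borel_measurable unit_measure"
      by (intro measurable_restrict_space1) simp
  qed simp
  show "integrable (Pi\<^sub>M {1..s} (\<lambda>_. unit_measure)) (chr s h)"
    unfolding chr_prod[abs_def] by (rule product_integrable_prod[OF _ i]) simp
  have "(LINT y|Pi\<^sub>M {1..s} (\<lambda>_. unit_measure). chr s h y) = (\<Prod>j=1..s. LINT x|unit_measure. cis (2 * pi * (real_of_int (h j) * x)))"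
    unfolding chr_prod[abs_def] by (rule product_integral_prod[OF _ i]) simp
  also have "\<dots> = (if h = (\<lambda>_. 0) then 1 else 0)"
  proof (cases "h = (\<lambda>_. 0)")
    case False
    then obtain j where j: "h j \<noteq> 0" by auto
    with h have "j \<in> {1..s}" by (auto simp: Zs_def)
    with j have "(\<Prod>j=1..s. LINT x|unit_measure. cis (2 * pi * (real_of_int (h j) * x))) = 0"
      by (intro prod_zero) (auto simp: integral_cis_unit intro!: bexI[of _ j])
    then show ?thesis using False by simp
  next
    case True
    then show ?thesis using integral_cis_unit[of 0] by simp
  qed
  finally show "(LINT y|Pi\<^sub>M {1..s} (\<lambda>_. unit_measure). chr s h y) = (if h = (\<lambda>_. 0) then 1 else 0)" .
qed

lemma parseval_finite:
  fixes c :: "(nat \<Rightarrow> int) \<Rightarrow> complex"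
  assumes F: "finite F" "F \<subseteq> Zs s"
  defines "T \<equiv> \<lambda>y. \<Sum>h\<in>F. c h * chr s h y"
  shows "integrable (Pi\<^sub>M {1..s} (\<lambda>_. unit_measure)) (\<lambda>y. (cmod (T y))\<^sup>2)"
    and "(LINT y|Pi\<^sub>M {1..s} (\<lambda>_. unit_measure). (cmod (T y))\<^sup>2) = (\<Sum>h\<in>F. (cmod (c h))\<^sup>2)"
proof -
  let ?M = "Pi\<^sub>M {1..s} (\<lambda>_. unit_measure)"
  have T: "complex_of_real ((cmod (T y))\<^sup>2) = (\<Sum>h\<in>F. \<Sum>h'\<in>F. c h * cnj (c h') * chr s (\<lambda>j. h j + - h' j) y)" for y
    unfolding complex_norm_square T_def cnj_sum sum_product chr_add cnj_chr[symmetric]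
    by (intro sum.cong refl) (simp add: mult_ac)
  have mem: "(\<lambda>j. h j + - h' j) \<in> Zs s" if "h \<in> F" "h' \<in> F" for h h'     using subsetD[OF F(2) that(1)] subsetD[OF F(2) that(2)] unfolding Zs_def by simp
  have int: "integrable ?M (\<lambda>y. complex_of_real ((cmod (T y))\<^sup>2))"
    unfolding T by (intro Bochner_Integration.integrable_sum integrable_mult_right integrable_chr mem)
  then show "integrable ?M (\<lambda>y. (cmod (T y))\<^sup>2)" unfolding complex_of_real_integrable_eq .
  have "complex_of_real (LINT y|?M. (cmod (T y))\<^sup>2) = (LINT y|?M. complex_of_real ((cmod (T y))\<^sup>2))"
    by (rule integral_complex_of_real[symmetric])
  also have "\<dots> = (\<Sum>h\<in>F. \<Sum>h'\<in>F. c h * cnj (c h') * (LINT y|?M. chr s (\<lambda>j. h j + - h' j) y))"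
  proof -
    have i: "integrable ?M (\<lambda>y. c h * cnj (c h') * chr s (\<lambda>j. h j + - h' j) y)" if "h \<in> F" "h' \<in> F" for h h'
      by (intro integrable_mult_right integrable_chr mem that)
    have "(LINT y|?M. complex_of_real ((cmod (T y))\<^sup>2)) =
      (\<Sum>h\<in>F. LINT y|?M. (\<Sum>h'\<in>F. c h * cnj (c h') * chr s (\<lambda>j. h j + - h' j) y))"
      unfolding T by (rule Bochner_Integration.integral_sum) (intro Bochner_Integration.integrable_sum i)
    also have "\<dots> = (\<Sum>h\<in>F. \<Sum>h'\<in>F. LINT y|?M. c h * cnj (c h') * chr s (\<lambda>j. h j + - h' j) y)"
      by (rule sum.cong[OF refl], rule Bochner_Integration.integral_sum) (rule i)
    also have "\<dots> = (\<Sum>h\<in>F. \<Sum>h'\<in>F. c h * cnj (c h') * (LINT y|?M. chr s (\<lambda>j. h j + - h' j) y))"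
      by (simp only: integral_mult_right_zero)
    finally show ?thesis .
  qed
  also have "\<dots> = (\<Sum>h\<in>F. \<Sum>h'\<in>F. if h' = h then c h * cnj (c h') else 0)"
    by (intro sum.cong refl, subst integral_chr[OF mem]) (auto simp: fun_eq_iff)
  also have "\<dots> = complex_of_real (\<Sum>h\<in>F. (cmod (c h))\<^sup>2)"
    using F by (simp add: complex_norm_square[symmetric])
  finally show "(LINT y|?M. (cmod (T y))\<^sup>2) = (\<Sum>h\<in>F. (cmod (c h))\<^sup>2)" by (simp only: of_real_eq_iff)
qed

text \<open>A trigonometric polynomial uniformly close to \<open>W\<close> gives an integrable
  majorant at the price of \<epsilon>, and for polynomials Parseval is a finite computation. The
  final error integral is estimated through such majorants.\<close>

lemma parseval_majorant:
  assumes W: "\<And>y. ((\<lambda>h. c h * chr s h y) has_sum of_real (W y)) (Zs s)"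
    and c: "(\<lambda>h. cmod (c h)) summable_on Zs s" and c2: "(\<lambda>h. (cmod (c h))\<^sup>2) summable_on Zs s"
    and \<epsilon>: "0 < \<epsilon>"
  obtains G where "integrable (Pi\<^sub>M {1..s} (\<lambda>_. unit_measure)) G" and "\<And>y. (W y)\<^sup>2 \<le> G y"
    and "(LINT y|Pi\<^sub>M {1..s} (\<lambda>_. unit_measure). G y) \<le> (\<Sum>\<^sub>\<infinity>h\<in>Zs s. (cmod (c h))\<^sup>2) + \<epsilon>"
proof -
  let ?M = "Pi\<^sub>M {1..s} (\<lambda>_. unit_measure)"
  interpret prob_space ?M by (rule prob_space_PiM[OF prob_space_unit_measure])
  define A where "A = (\<Sum>\<^sub>\<infinity>h\<in>Zs s. cmod (c h))"
  have A0: "0 \<le> A" unfolding A_def by (rule infsum_nonneg) simp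
  \<comment> \<open>\<open>A\<close> bounds the partial sums uniformly, so a uniform deviation
    \<delta> raises the square by at most
    \<open>2 * A * \<delta> + \<delta>\<^sup>2\<close>.\<close>
  define \<delta> where "\<delta> = min 1 (\<epsilon> / (2 * A + 1))"
  have \<delta>: "0 < \<delta>" "\<delta> \<le> 1" using \<epsilon> A0 by (auto simp: \<delta>_def)
  have \<delta>2: "2 * A * \<delta> + \<delta>\<^sup>2 \<le> \<epsilon>"
  proof -
    have "\<delta>\<^sup>2 \<le> \<delta>" using \<delta> mult_left_le[of \<delta> \<delta>] by (simp add: power2_eq_square)
    then have "2 * A * \<delta> + \<delta>\<^sup>2 \<le> (2 * A + 1) * \<delta>" by (simp add: algebra_simps)
    also have "\<dots> \<le> (2 * A + 1) * (\<epsilon> / (2 * A + 1))" using A0 by (intro mult_left_mono) (auto simp: \<delta>_def)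
    also have "\<dots> = \<epsilon>" using A0 by simp
    finally show ?thesis .
  qed
  obtain F where F: "finite F" "F \<subseteq> Zs s" and d: "dist (\<Sum>h\<in>F. cmod (c h)) A \<le> \<delta>"
    using infsum_finite_approximation[OF c \<delta>(1)] unfolding A_def by blast
  define T where "T y = (\<Sum>h\<in>F. c h * chr s h y)" for y
  have TA: "cmod (T y) \<le> A" for y
  proof -
    have "cmod (T y) \<le> (\<Sum>h\<in>F. cmod (c h))" unfolding T_def by (rule order_trans[OF norm_sum]) (simp add: norm_mult)
    also have "\<dots> \<le> A" unfolding A_def by (rule finite_sum_le_infsum[OF c F]) auto
    finally show ?thesis .
  qed
  have WT: "cmod (of_real (W y) - T y) \<le> \<delta>" for y
  proof -
    have "((\<lambda>h. c h * chr s h y) has_sum (of_real (W y) - T y)) (Zs s - F)"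
      using has_sum_Diff[OF W has_sum_finiteI[OF F(1) refl] F(2)] unfolding T_def .
    moreover have "((\<lambda>h. cmod (c h)) has_sum (A - (\<Sum>h\<in>F. cmod (c h)))) (Zs s - F)"
      using has_sum_Diff[OF has_sum_infsum[OF c] has_sum_finiteI[OF F(1) refl] F(2)] unfolding A_def .
    ultimately have "cmod (of_real (W y) - T y) \<le> A - (\<Sum>h\<in>F. cmod (c h))"
      using norm_has_sum_bound[of "\<lambda>h. c h * chr s h y" "Zs s - F"] by (simp add: norm_mult)
    then show ?thesis using d by (simp add: dist_real_def)
  qed
  define G where "G y = (cmod (T y))\<^sup>2 + \<epsilon>" for y
  show thesis
  proof (rule that)
    show "integrable ?M G" unfolding G_def T_def
      by (intro Bochner_Integration.integrable_add parseval_finite(1)[OF F] integrable_const)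
    show "(W y)\<^sup>2 \<le> G y" for y
    proof -
      have "\<bar>W y\<bar> \<le> cmod (T y) + \<delta>" using norm_triangle_sub[of "complex_of_real (W y)" "T y"] WT[of y] by simp
      then have "(W y)\<^sup>2 \<le> (cmod (T y) + \<delta>)\<^sup>2" using abs_le_square_iff[of "W y" "cmod (T y) + \<delta>"] \<delta> by simp
      also have "\<dots> = (cmod (T y))\<^sup>2 + (2 * cmod (T y) * \<delta> + \<delta>\<^sup>2)" by (simp add: power2_eq_square algebra_simps)
      also have "\<dots> \<le> (cmod (T y))\<^sup>2 + (2 * A * \<delta> + \<delta>\<^sup>2)" using TA \<delta> by (intro add_mono mult_right_mono mult_left_mono) auto
      also have "\<dots> \<le> G y" using \<delta>2 by (simp add: G_def)
      finally show ?thesis .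
    qed
    have "(LINT y|?M. G y) = (\<Sum>h\<in>F. (cmod (c h))\<^sup>2) + \<epsilon>"
      unfolding G_def T_def
      by (subst Bochner_Integration.integral_add[OF parseval_finite(1)[OF F] integrable_const])
         (simp only: parseval_finite(2)[OF F] lebesgue_integral_const prob_space scaleR_one)
    also have "\<dots> \<le> (\<Sum>\<^sub>\<infinity>h\<in>Zs s. (cmod (c h))\<^sup>2) + \<epsilon>" using finite_sum_le_infsum[OF c2 F] by simp
    finally show "(LINT y|?M. G y) \<le> (\<Sum>\<^sub>\<infinity>h\<in>Zs s. (cmod (c h))\<^sup>2) + \<epsilon>" .
  qed
qed

section \<open>Test functions and weak gradients\<close>

lemma Ck_continuous: "Ck k f \<Longrightarrow> continuous_on UNIV f"
  by (cases k) (auto simp: gderiv_def continuous_on_eq_continuous_at intro: has_derivative_continuous)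

lemma Ck_Suc_imp: "Ck (Suc k) f \<Longrightarrow> Ck k f"
proof (induction k arbitrary: f)
  case 0
  then show ?case using Ck_continuous[OF 0] by simp
next
  case (Suc k)
  from Suc.prems obtain g where "\<And>x. GDERIV f x :> g x" "\<And>b. b \<in> Basis \<Longrightarrow> Ck (Suc k) (\<lambda>x. g x \<bullet> b)"
    by (subst (asm) Ck.simps(2)) blast
  with Suc.IH show ?case by (subst Ck.simps(2)) blast
qed

lemma Ck_const: "Ck k (\<lambda>_. c)"
proof (induction k arbitrary: c)
  case (Suc k)
  show ?case unfolding Ck.simps by (rule exI[of _ "\<lambda>_. 0"]) (auto intro: GDERIV_const Suc)
qed simp

lemma Ck_add: "Ck k f \<Longrightarrow> Ck k g \<Longrightarrow> Ck k (\<lambda>x. f x + g x)"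
proof (induction k arbitrary: f g)
  case (Suc k)
  from Suc.prems obtain f' g' where "\<And>x. GDERIV f x :> f' x" "\<And>b. b \<in> Basis \<Longrightarrow> Ck k (\<lambda>x. f' x \<bullet> b)"
    "\<And>x. GDERIV g x :> g' x" "\<And>b. b \<in> Basis \<Longrightarrow> Ck k (\<lambda>x. g' x \<bullet> b)" unfolding Ck.simps by blast
  then show ?case unfolding Ck.simps
    by (intro exI[of _ "\<lambda>x. f' x + g' x"] conjI allI ballI) (auto simp: inner_add_left intro: GDERIV_add Suc.IH)
qed (auto intro: continuous_intros)

lemma Ck_mult: "Ck k f \<Longrightarrow> Ck k g \<Longrightarrow> Ck k (\<lambda>x. f x * g x)"
proof (induction k arbitrary: f g)
  case (Suc k)
  have f0: "Ck k f" "Ck k g" using Suc.prems Ck_Suc_imp by auto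
  from Suc.prems obtain f' g' where "\<And>x. GDERIV f x :> f' x" "\<And>b. b \<in> Basis \<Longrightarrow> Ck k (\<lambda>x. f' x \<bullet> b)"
    "\<And>x. GDERIV g x :> g' x" "\<And>b. b \<in> Basis \<Longrightarrow> Ck k (\<lambda>x. g' x \<bullet> b)" unfolding Ck.simps by blast
  then show ?case unfolding Ck.simps using f0
    by (intro exI[of _ "\<lambda>x. f x *\<^sub>R g' x + g x *\<^sub>R f' x"] conjI allI ballI)
       (auto simp: inner_add_left intro!: GDERIV_mult Ck_add Suc.IH)
qed (auto intro: continuous_intros)

lemma Ck_diff: "Ck k f \<Longrightarrow> Ck k g \<Longrightarrow> Ck k (\<lambda>x. f x - g x)"
  using Ck_add[of k f "\<lambda>x. (-1) * g x"] Ck_mult[OF Ck_const[of k "-1"], of g] by simp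

lemma Ck_power: "Ck k f \<Longrightarrow> Ck k (\<lambda>x. f x ^ m)"
  by (induction m) (auto intro: Ck_const Ck_mult)

lemma Ck_prod: "finite I \<Longrightarrow> (\<And>i. i \<in> I \<Longrightarrow> Ck k (f i)) \<Longrightarrow> Ck k (\<lambda>x. \<Prod>i\<in>I. f i x)"
  by (induction I rule: finite_induct) (auto intro: Ck_const Ck_mult)

lemma GDERIV_linear: "GDERIV (\<lambda>x. c + x \<bullet> b) x :> b"
  unfolding gderiv_def by (auto intro!: derivative_eq_intros)

lemma Ck_linear: "Ck k (\<lambda>x. c + x \<bullet> b)"
proof (cases k)
  case (Suc m)
  then show ?thesis by (auto intro!: exI[of _ "\<lambda>_. b"] GDERIV_linear Ck_const)
qed (auto intro!: continuous_intros)

section \<open>Smooth bump functions supported in boxes\<close>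

definition flat :: "nat \<Rightarrow> real \<Rightarrow> real" where
  "flat m t = (if 0 < t then exp (- (1 / t)) / t ^ m else 0)"

lemma flat_le: "\<bar>flat m t\<bar> \<le> fact (m + n) * \<bar>t\<bar> ^ n"
proof (cases "0 < t")
  case True
  have "(1 / t) ^ (m + n) \<le> fact (m + n) * exp (1 / t)" using True by (intro power_le_fact_exp) auto
  then have "exp (- (1 / t)) * (1 / t) ^ (m + n) \<le> exp (- (1 / t)) * (fact (m + n) * exp (1 / t))"
    by (rule mult_left_mono) simp
  also have "\<dots> = fact (m + n)" by (simp add: exp_minus)
  finally have "exp (- (1 / t)) / t ^ (m + n) \<le> fact (m + n)" by (simp add: power_one_over)
  then have "exp (- (1 / t)) / t ^ (m + n) * t ^ n \<le> fact (m + n) * t ^ n" using True by (intro mult_right_mono) auto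
  then show ?thesis using True by (simp add: flat_def power_add)
qed (simp add: flat_def)

text \<open>The functions \<open>flat m\<close> are closed under differentiation up to linear
  combinations, so smoothness of all orders is an induction over the whole family. At zero the
  difference quotient tends to zero because \<open>flat_le\<close> with \<open>n = 2\<close> gives
  quadratic decay.\<close>

lemma flat_deriv: "(flat m has_real_derivative (flat (m + 2) t - real m * flat (m + 1) t)) (at t)"
proof -
  consider "0 < t" | "t < 0" | "t = 0" by linarith
  then show ?thesis
  proof cases
    case 1
    have "((\<lambda>t. exp (- (1 / t)) / t ^ m) has_real_derivative (flat (m + 2) t - real m * flat (m + 1) t)) (at t)"
    proof (cases m)
      case 0
      then show ?thesis using 1 by (auto intro!: derivative_eq_intros simp: flat_def power2_eq_square)
    next
      case (Suc k)
      show ?thesis using 1 unfolding Suc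
        by (auto intro!: derivative_eq_intros simp: flat_def power2_eq_square field_simps simp del: power_Suc)
           (simp add: field_simps power2_eq_square)
    qed
    moreover have "eventually (\<lambda>t. t \<in> {0<..}) (nhds t)" using 1 by (intro eventually_nhds_in_open) auto
    then have "eventually (\<lambda>t. flat m t = exp (- (1 / t)) / t ^ m) (nhds t)"
      by (rule eventually_mono) (simp add: flat_def)
    ultimately show ?thesis by (simp add: DERIV_cong_ev[OF refl])
  next
    case 2
    have "eventually (\<lambda>t. t \<in> {..<0}) (nhds t)" using 2 by (intro eventually_nhds_in_open) auto
    then have "eventually (\<lambda>t. flat m t = 0) (nhds t)" by (rule eventually_mono) (simp add: flat_def)
    then show ?thesis using 2 by (subst DERIV_cong_ev[OF refl _ refl, of _ "\<lambda>_. 0"]) (auto simp: flat_def)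
  next
    case 3
    have "((\<lambda>h. flat m h / h) \<longlongrightarrow> 0) (at 0)"
    proof (rule Lim_null_comparison[where g = "\<lambda>h. fact (m + 2) * \<bar>h\<bar>"])
      show "eventually (\<lambda>h. norm (flat m h / h) \<le> fact (m + 2) * \<bar>h\<bar>) (at 0)"
      proof (rule eventually_at_topological[THEN iffD2], intro exI[of _ UNIV] conjI ballI impI)
        fix h :: real assume "h \<noteq> 0"
        then show "norm (flat m h / h) \<le> fact (m + 2) * \<bar>h\<bar>"
          using flat_le[of m h 2] by (simp add: divide_le_eq power2_eq_square mult.assoc)
      qed auto
      show "((\<lambda>h. fact (m + 2) * \<bar>h\<bar>) \<longlongrightarrow> (0::real)) (at 0)" by (auto intro!: tendsto_eq_intros)
    qed
    then show ?thesis using 3 by (simp add: has_field_derivative_iff flat_def)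
  qed
qed

lemma flat_bounds: "0 \<le> flat 0 t" "flat 0 t < 1" and flat_pos: "0 < t \<Longrightarrow> 0 < flat m t" and flat_eq_0: "t \<le> 0 \<Longrightarrow> flat m t = 0"
  by (auto simp: flat_def)

lemma Ck_flat: "Ck k (\<lambda>x. flat m (c + x \<bullet> b))"
proof (induction k arbitrary: m)
  case 0
  have "continuous_on UNIV (flat m)"
    using flat_deriv by (auto simp: continuous_on_eq_continuous_at intro: DERIV_isCont)
  then show ?case by (auto intro!: continuous_on_compose2[of UNIV "flat m"] continuous_intros)
next
  case (Suc k)
  show ?case unfolding Ck.simps
  proof (intro exI[of _ "\<lambda>x. (flat (m + 2) (c + x \<bullet> b) - real m * flat (m + 1) (c + x \<bullet> b)) *\<^sub>R b"] conjI allI ballI)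
    fix x show "GDERIV (\<lambda>x. flat m (c + x \<bullet> b)) x :> (flat (m + 2) (c + x \<bullet> b) - real m * flat (m + 1) (c + x \<bullet> b)) *\<^sub>R b"
      by (rule GDERIV_DERIV_compose[OF GDERIV_linear flat_deriv])
  next
    fix i :: 'a
    show "Ck k (\<lambda>x. (flat (m + 2) (c + x \<bullet> b) - real m * flat (m + 1) (c + x \<bullet> b)) *\<^sub>R b \<bullet> i)"
      unfolding inner_scaleR_left by (intro Ck_mult Ck_diff Ck_const Suc)
  qed
qed

definition box_bump :: "'a::euclidean_space \<Rightarrow> 'a \<Rightarrow> 'a \<Rightarrow> real" where
  "box_bump a c x = (\<Prod>b\<in>Basis. flat 0 (- (a \<bullet> b) + x \<bullet> b) * flat 0 (c \<bullet> b + x \<bullet> (- b)))"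

lemma Ck_box_bump: "Ck k (box_bump a c)"
  unfolding box_bump_def[abs_def] by (intro Ck_prod Ck_mult Ck_flat finite_Basis)

lemma box_bump_pos: "x \<in> box a c \<Longrightarrow> 0 < box_bump a c x"
  unfolding box_bump_def by (intro prod_pos ballI mult_pos_pos flat_pos) (auto simp: mem_box)

lemma box_bump_eq_0: "x \<notin> box a c \<Longrightarrow> box_bump a c x = 0"
proof -
  assume "x \<notin> box a c"
  then obtain b where b: "b \<in> Basis" "\<not> (a \<bullet> b < x \<bullet> b \<and> x \<bullet> b < c \<bullet> b)" by (auto simp: mem_box)
  then have "flat 0 (- (a \<bullet> b) + x \<bullet> b) * flat 0 (c \<bullet> b + x \<bullet> (- b)) = 0" by (auto simp: flat_eq_0)
  then show ?thesis unfolding box_bump_def using b by (intro prod_zero) auto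
qed

lemma box_bump_bounds: "0 \<le> box_bump a c x" "box_bump a c x \<le> 1"
proof -
  show "0 \<le> box_bump a c x" unfolding box_bump_def by (intro prod_nonneg ballI mult_nonneg_nonneg flat_bounds)
  show "box_bump a c x \<le> 1" unfolding box_bump_def
    by (intro prod_le_1 conjI mult_nonneg_nonneg mult_le_one flat_bounds less_imp_le)
qed

lemma test_functionsI: "(\<And>k. Ck k f) \<Longrightarrow> compact K \<Longrightarrow> K \<subseteq> D \<Longrightarrow> (\<And>x. x \<notin> K \<Longrightarrow> f x = 0) \<Longrightarrow> f \<in> test_functions D"
  by (auto simp: test_functions_def)

section \<open>Gradients of smooth functions and their integrals\<close>

definition gr :: "('a::euclidean_space \<Rightarrow> real) \<Rightarrow> 'a \<Rightarrow> 'a" where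
  "gr f x = (\<Sum>b\<in>Basis. frechet_derivative f (at x) b *\<^sub>R b)"

lemma gr_eqI: "GDERIV f x :> g \<Longrightarrow> gr f x = g"
proof -
  assume "GDERIV f x :> g"
  then have "frechet_derivative f (at x) = (\<lambda>h. h \<bullet> g)"
    unfolding gderiv_def by (rule frechet_derivative_at[symmetric])
  then show ?thesis by (simp add: gr_def inner_commute[of _ g] euclidean_representation)
qed

lemma GDERIV_gr: "Ck (Suc k) f \<Longrightarrow> GDERIV f x :> gr f x"
proof -
  assume "Ck (Suc k) f"
  then obtain g where "\<And>x. GDERIV f x :> g x" unfolding Ck.simps by blast
  then show ?thesis using gr_eqI[of f x "g x"] by simp
qed

lemma frechet_eq_gr: "Ck (Suc k) f \<Longrightarrow> frechet_derivative f (at x) b = gr f x \<bullet> b"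
  using frechet_derivative_at[OF GDERIV_gr[unfolded gderiv_def], of k f x] by (metis inner_commute)

lemma Ck_gr: "Ck (Suc k) f \<Longrightarrow> b \<in> Basis \<Longrightarrow> Ck k (\<lambda>x. gr f x \<bullet> b)"
proof -
  assume "Ck (Suc k) f" and b: "b \<in> Basis"
  then obtain g where "\<And>x. GDERIV f x :> g x" "\<And>b. b \<in> Basis \<Longrightarrow> Ck k (\<lambda>x. g x \<bullet> b)" by auto
  moreover from this(1) have "gr f = g" using gr_eqI by blast
  ultimately show ?thesis using b by blast
qed

lemma continuous_gr: "Ck (Suc k) f \<Longrightarrow> continuous_on UNIV (gr f)"
  using Ck_continuous[OF Ck_gr, of k f] by (intro continuous_on_componentwise[THEN iffD2]) auto

lemma gr_add: "Ck 1 f \<Longrightarrow> Ck 1 g \<Longrightarrow> gr (\<lambda>x. f x + g x) x = gr f x + gr g x"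
  and gr_diff: "Ck 1 f \<Longrightarrow> Ck 1 g \<Longrightarrow> gr (\<lambda>x. f x - g x) x = gr f x - gr g x"
  and gr_mult: "Ck 1 f \<Longrightarrow> Ck 1 g \<Longrightarrow> gr (\<lambda>x. f x * g x) x = f x *\<^sub>R gr g x + g x *\<^sub>R gr f x"
  using GDERIV_gr[of 0 f x] GDERIV_gr[of 0 g x]
  by (auto simp del: Ck.simps intro!: gr_eqI GDERIV_add GDERIV_diff GDERIV_mult)

lemma gr_outside:
  assumes "compact K" "\<And>x. x \<notin> K \<Longrightarrow> f x = 0" "x \<notin> K"
  shows "gr f x = 0"
proof (rule gr_eqI)
  have "open (- K)" using assms by (simp add: compact_imp_closed open_Compl)
  then have "(f has_derivative (\<lambda>_. 0)) (at x)"
    by (rule has_derivative_transform_within_open[OF has_derivative_const[of 0]]) (use assms in auto)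
  then show "GDERIV f x :> 0" by (simp add: gderiv_def)
qed

lemma test_function_bounded:
  assumes "f \<in> test_functions D"
  shows "\<exists>B\<ge>0. \<forall>x. \<bar>f x\<bar> \<le> B \<and> norm (gr f x) \<le> B"
proof -
  from assms obtain K where K: "compact K" "\<And>x. x \<notin> K \<Longrightarrow> f x = 0" and C: "\<And>k. Ck k f"
    by (auto simp: test_functions_def)
  have c: "continuous_on K f" "continuous_on K (gr f)"
    using Ck_continuous[OF C] continuous_gr[OF C] continuous_on_subset by blast+
  obtain B1 where B1: "\<And>x. x \<in> K \<Longrightarrow> norm (f x) \<le> B1"
    using compact_imp_bounded[OF compact_continuous_image[OF c(1) K(1)]] by (auto simp: bounded_iff)
  obtain B2 where B2: "\<And>x. x \<in> K \<Longrightarrow> norm (gr f x) \<le> B2"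
    using compact_imp_bounded[OF compact_continuous_image[OF c(2) K(1)]] by (auto simp: bounded_iff)
  show ?thesis
  proof (intro exI[of _ "\<bar>B1\<bar> + \<bar>B2\<bar>"] conjI allI)
    fix x
    show "\<bar>f x\<bar> \<le> \<bar>B1\<bar> + \<bar>B2\<bar>" using B1[of x] K(2)[of x] by (cases "x \<in> K") auto
    show "norm (gr f x) \<le> \<bar>B1\<bar> + \<bar>B2\<bar>" using B2[of x] gr_outside[of K f x] K by (cases "x \<in> K") auto
  qed simp
qed

lemma gr_lipschitz:
  assumes C: "\<And>x. GDERIV f x :> gr f x" and B: "\<And>x. norm (gr f x) \<le> B"
  shows "\<bar>f x - f y\<bar> \<le> B * norm (x - y)"
proof -
  have "norm (f x - f y) \<le> B * norm (x - y)"
  proof (rule differentiable_bound[where S = UNIV and f' = "\<lambda>x h. h \<bullet> gr f x"])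
    fix z show "(f has_derivative (\<lambda>h. h \<bullet> gr f z)) (at z within UNIV)" using C[of z] by (simp add: gderiv_def)
    show "onorm (\<lambda>h. h \<bullet> gr f z) \<le> B"
      by (rule onorm_le) (metis B Cauchy_Schwarz_ineq2 inner_commute mult_right_mono norm_ge_zero order_trans real_norm_def)
  qed auto
  then show ?thesis by simp
qed

text \<open>Translation invariance makes difference quotients integrate to zero.\<close>

lemma integral_gr_eq_0:
  assumes C: "Ck 1 f" and K: "compact K" "\<And>x. x \<notin> K \<Longrightarrow> f x = 0"
  shows "(LINT x|lborel. gr f x \<bullet> b) = 0"
proof -
  have C': "GDERIV f x :> gr f x" for x using GDERIV_gr[of 0 f] C by (simp del: Ck.simps)
  have cf: "continuous_on UNIV f" and cg: "continuous_on UNIV (gr f)"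
    using Ck_continuous[OF C] continuous_gr[of 0 f] C by (auto simp del: Ck.simps)
  obtain B where B: "\<And>x. norm (gr f x) \<le> B" and B0: "0 \<le> B"
  proof -
    obtain B where "\<And>x. x \<in> K \<Longrightarrow> norm (gr f x) \<le> B"
      using compact_imp_bounded[OF compact_continuous_image[OF continuous_on_subset[OF cg] K(1)]] by (auto simp: bounded_iff)
    then have "norm (gr f x) \<le> \<bar>B\<bar>" for x using gr_outside[of K f x] K by (cases "x \<in> K") force+
    then show thesis using that[of "\<bar>B\<bar>"] by simp
  qed
  obtain R where R: "\<And>x. x \<in> K \<Longrightarrow> norm x \<le> R" using compact_imp_bounded[OF K(1)] by (auto simp: bounded_iff)
  have fi: "integrable lborel (\<lambda>x. f x)"
  proof -
    have "integrable lborel (\<lambda>x. indicator K x *\<^sub>R f x)"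
      by (rule borel_integrable_compact[OF K(1)]) (rule continuous_on_subset[OF cf], simp)
    moreover have "indicator K x *\<^sub>R f x = f x" for x using K(2) by (cases "x \<in> K") auto
    then have "(\<lambda>x. indicator K x *\<^sub>R f x) = f" by blast
    ultimately show ?thesis by simp
  qed
  define q where "q n x = real (Suc n) * (f (x + (1 / real (Suc n)) *\<^sub>R b) - f x)" for n x
  have tr: "integrable lborel (\<lambda>x. f (x + c))" "(LINT x|lborel. f (x + c)) = (LINT x|lborel. f x)" for c
  proof -
    have e: "(lborel :: 'a measure) = distr lborel borel ((+) c)" by (rule lborel_distr_plus[symmetric])
    have fm: "f \<in> borel_measurable borel" using cf by (rule borel_measurable_continuous_onI)
    have "integrable (distr lborel borel ((+) c)) f" using fi e by metis
    then show "integrable lborel (\<lambda>x. f (x + c))"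
      by (subst (asm) integrable_distr_eq) (use fm in \<open>auto simp: add.commute\<close>)
    have "(LINT x|lborel. f x) = (LINT x|distr lborel borel ((+) c). f x)" using e by metis
    also have "\<dots> = (LINT x|lborel. f (c + x))" by (rule integral_distr) (use fm in auto)
    finally show "(LINT x|lborel. f (x + c)) = (LINT x|lborel. f x)" by (simp add: add.commute)
  qed
  have q0: "(LINT x|lborel. q n x) = 0" for n
    unfolding q_def using tr fi by simp
  have "(\<lambda>n. LINT x|lborel. q n x) \<longlonglongrightarrow> (LINT x|lborel. gr f x \<bullet> b)"
  \<comment> \<open>The increments have length at most \<open>norm b\<close>, so all difference
    quotients vanish outside this ball; inside it the gradient bound makes them at most
    \<open>B * norm b\<close>.\<close>
  proof (rule integral_dominated_convergence[where w = "\<lambda>x. indicator (cball 0 (R + norm b)) x * (B * norm b)"])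
    show "(\<lambda>x. gr f x \<bullet> b) \<in> borel_measurable lborel"
      using cg by (auto intro!: borel_measurable_continuous_onI continuous_intros)
    show "q n \<in> borel_measurable lborel" for n
    proof -
      have "continuous_on UNIV (q n)" unfolding q_def[abs_def]
        by (intro continuous_intros continuous_on_compose2[OF cf]) auto
      then show ?thesis by (simp add: borel_measurable_continuous_onI)
    qed
    have "integrable lborel (\<lambda>x. indicator (cball (0::'a) (R + norm b)) x *\<^sub>R (B * norm b))"
      by (rule borel_integrable_compact) auto
    then show "integrable lborel (\<lambda>x::'a. indicator (cball 0 (R + norm b)) x * (B * norm b))" by simp
    show "AE x in lborel. (\<lambda>n. q n x) \<longlonglongrightarrow> gr f x \<bullet> b"
    proof (rule AE_I2)
      fix x
      have "((\<lambda>t. f (x + t *\<^sub>R b)) has_real_derivative (gr f x \<bullet> b)) (at 0)"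
      proof -
        have "((\<lambda>t. f (x + t *\<^sub>R b)) has_derivative (\<lambda>h. (h *\<^sub>R b) \<bullet> gr f x)) (at 0)"
          using C'[of x] unfolding gderiv_def
          by (intro has_derivative_compose[of "\<lambda>t. x + t *\<^sub>R b" "\<lambda>h. h *\<^sub>R b" 0 UNIV f]) (auto intro!: derivative_eq_intros)
        moreover have "(\<lambda>h. (h *\<^sub>R b) \<bullet> gr f x) = (*) (gr f x \<bullet> b)" by (auto simp: fun_eq_iff inner_commute)
        ultimately show ?thesis by (simp only: has_field_derivative_def)
      qed
      then have "((\<lambda>h. (f (x + h *\<^sub>R b) - f x) / h) \<longlongrightarrow> gr f x \<bullet> b) (at 0)"
        by (simp add: has_field_derivative_iff)
      moreover have "filterlim (\<lambda>n. 1 / real (Suc n)) (at 0) sequentially"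
        using LIMSEQ_inverse_real_of_nat by (auto simp: filterlim_at inverse_eq_divide)
      ultimately have "(\<lambda>n. (f (x + (1 / real (Suc n)) *\<^sub>R b) - f x) / (1 / real (Suc n))) \<longlonglongrightarrow> gr f x \<bullet> b"
        by (rule filterlim_compose)
      then show "(\<lambda>n. q n x) \<longlonglongrightarrow> gr f x \<bullet> b" by (simp add: q_def mult.commute)
    qed
    show "AE x in lborel. norm (q n x) \<le> indicator (cball 0 (R + norm b)) x * (B * norm b)" for n
    proof (rule AE_I2)
      fix x
      let ?e = "(1 / real (Suc n)) *\<^sub>R b"
      show "norm (q n x) \<le> indicator (cball 0 (R + norm b)) x * (B * norm b)"
      proof (cases "x \<in> cball 0 (R + norm b)")
        case True
        have "\<bar>f (x + ?e) - f x\<bar> \<le> B * norm ?e" using gr_lipschitz[OF C' B, of "x + ?e" x] by simp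
        then have "real (Suc n) * \<bar>f (x + ?e) - f x\<bar> \<le> real (Suc n) * (B * norm ?e)" by (intro mult_left_mono) auto
        also have "\<dots> = B * norm b" by simp
        finally show ?thesis using True by (simp add: q_def abs_mult)
      next
        case False
        have "norm ?e \<le> norm b" using mult_right_mono[of "1 / real (Suc n)" 1 "norm b"] by simp
        then have "R < norm (x + ?e)" using False norm_triangle_ineq4[of "x + ?e" ?e] by simp
        then have "x + ?e \<notin> K" using R[of "x + ?e"] by auto
        moreover have "x \<notin> K" using False R[of x] norm_ge_zero[of b] by (auto simp: not_le)
        ultimately show ?thesis using K(2) B0 by (simp add: q_def)
      qed
    qed
  qed
  then show ?thesis using q0 LIMSEQ_unique[of "\<lambda>_. 0::real" 0] by auto
qed

text \<open>Boxes are an intersection-stable generator of the Borel sets, so the integral vanishes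
  over every Borel set and the density must be zero. For this \<open>d\<close> is first replaced by
  a Borel function equal to it almost everywhere.\<close>

lemma integral_eq_0_on_box_imp_AE_0:
  fixes d :: "'a::euclidean_space \<Rightarrow> real"
  assumes d: "integrable lebesgue d"
    and box: "\<And>a c. (LINT x|lebesgue. indicator (box a c) x * d x) = 0"
  shows "AE x in lebesgue. d x = 0"
proof -
  obtain f where f: "f \<in> borel_measurable lborel" and df: "AE x in lborel. d x = f x"
    using completion_ex_borel_measurable_real[of d lborel] d by (auto simp: borel_measurable_integrable)
  have df': "AE x in lebesgue. d x = f x" using df by (rule AE_completion)
  have fm: "f \<in> borel_measurable lebesgue" using f by (rule measurable_completion)
  have fi: "integrable lborel f"
  proof -
    have "integrable lebesgue f \<longleftrightarrow> integrable lebesgue d"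
      by (rule integrable_cong_AE) (use fm d df' in \<open>auto simp: borel_measurable_integrable\<close>)
    then show ?thesis using d integrable_completion[OF f] by simp
  qed
  have fb: "(LINT x|lborel. indicator (box a c) x * f x) = 0" for a c
  proof -
    have "(LINT x|lborel. indicator (box a c) x * f x) = (LINT x|lebesgue. indicator (box a c) x * f x)"
      by (rule integral_completion[symmetric]) (use f in measurable)
    also have "\<dots> = (LINT x|lebesgue. indicator (box a c) x * d x)"
    proof (rule integral_cong_AE)
      show "(\<lambda>x. indicator (box a c) x * f x) \<in> borel_measurable lebesgue"
        "(\<lambda>x. indicator (box a c) x * d x) \<in> borel_measurable lebesgue"
        using fm d by (auto intro!: borel_measurable_times borel_measurable_indicator simp: borel_measurable_integrable)
    qed (use df' in auto)
    finally show ?thesis using box by simp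
  qed
  have fA: "integrable lborel (\<lambda>x. indicator A x * f x)" if "A \<in> sets borel" for A
    using integrable_real_mult_indicator[of A lborel f] fi that by (simp add: mult.commute)
  have UN: "(UNIV :: 'a set) = (\<Union>n. box (- (real n *\<^sub>R One)) (real n *\<^sub>R One))"
    by (rule UN_box_eq_UNIV[symmetric])
  have tot: "(LINT x|lborel. f x) = 0"
  proof -
    have "(\<lambda>n. LINT x|lborel. indicator (box (- (real n *\<^sub>R One)) (real n *\<^sub>R One)) x * f x) \<longlonglongrightarrow> (LINT x|lborel. f x)"
    proof (rule integral_dominated_convergence[where w = "\<lambda>x. \<bar>f x\<bar>"])
      show "AE x in lborel. (\<lambda>n. indicator (box (- (real n *\<^sub>R One)) (real n *\<^sub>R One)) x * f x) \<longlonglongrightarrow> f x"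
      proof (rule AE_I2)
        fix x :: 'a
        obtain m where m: "x \<in> box (- (real m *\<^sub>R One)) (real m *\<^sub>R One)" using UN by auto
        have "x \<in> box (- (real n *\<^sub>R One)) (real n *\<^sub>R One)" if "m \<le> n" for n
        proof -
          have "real m \<le> real n" using that by simp
          then show ?thesis unfolding mem_box
          proof (intro ballI conjI)
            fix b :: 'a assume b: "b \<in> Basis"
            from m b have "- real m < x \<bullet> b" "x \<bullet> b < real m" by (simp_all add: mem_box)
            then show "- (real n *\<^sub>R One) \<bullet> b < x \<bullet> b" "x \<bullet> b < (real n *\<^sub>R One) \<bullet> b"
              using \<open>real m \<le> real n\<close> b by simp_all
          qed
        qed
        then have "eventually (\<lambda>n. indicator (box (- (real n *\<^sub>R One)) (real n *\<^sub>R One)) x * f x = f x) sequentially"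
          by (intro eventually_sequentiallyI[of m]) auto
        then show "(\<lambda>n. indicator (box (- (real n *\<^sub>R One)) (real n *\<^sub>R One)) x * f x) \<longlonglongrightarrow> f x"
          by (rule tendsto_eventually)
      qed
      show "f \<in> borel_measurable lborel" by (rule f)
      show "(\<lambda>x. indicator (box (- (real n *\<^sub>R One)) (real n *\<^sub>R One)) x * f x) \<in> borel_measurable lborel" for n
        using f by measurable
      show "integrable lborel (\<lambda>x. \<bar>f x\<bar>)" using fi by simp
    qed (auto simp: abs_mult indicator_def)
    then show ?thesis unfolding fb using LIMSEQ_unique[of "\<lambda>_. 0::real" 0] by auto
  qed
  have sb: "sets (borel :: 'a measure) = sigma_sets UNIV (range (\<lambda>(a, c). box a c))"
    by (subst borel_eq_box) (rule sets_measure_of, simp)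
  have gen: "(LINT x|lborel. indicator A x * f x) = 0" if "A \<in> sigma_sets UNIV (range (\<lambda>(a, c). box a c))" for A
  proof -
    have bs: "A \<in> sets borel" if "A \<in> sigma_sets UNIV (range (\<lambda>(a, c). box a c))" for A :: "'a set"
      using that unfolding sb .
    show ?thesis
    proof (rule sigma_sets_induct_disjoint[OF _ _ that])
      show "Int_stable (range (\<lambda>(a, c). box a (c::'a)))"
      proof (rule Int_stableI)
        fix A B assume "A \<in> range (\<lambda>(a, c). box a (c::'a))" "B \<in> range (\<lambda>(a, c). box a (c::'a))"
        then obtain a c a' c' where "A = box a c" "B = box a' c'" by auto
        then show "A \<inter> B \<in> range (\<lambda>(a, c). box a (c::'a))"
          by (simp only: box_Int_box) (rule image_eqI[where x = "(_, _)"], rule prod.case[symmetric], simp)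
      qed
    next
      fix A assume "A \<in> range (\<lambda>(a, c). box a (c::'a))"
      then show "(LINT x|lborel. indicator A x * f x) = 0" using fb by auto
    next
      fix A assume A: "A \<in> sigma_sets UNIV (range (\<lambda>(a, c). box a (c::'a)))" "(LINT x|lborel. indicator A x * f x) = 0"
      have "(LINT x|lborel. indicator (UNIV - A) x * f x) = (LINT x|lborel. f x - indicator A x * f x)"
        by (intro Bochner_Integration.integral_cong) (auto simp: indicator_def)
      also have "\<dots> = 0" using tot A fi fA[OF bs[OF A(1)]] by simp
      finally show "(LINT x|lborel. indicator (UNIV - A) x * f x) = 0" .
    next
      fix A :: "nat \<Rightarrow> 'a set" assume A: "disjoint_family A" "range A \<subseteq> sigma_sets UNIV (range (\<lambda>(a, c). box a c))"
        "\<And>i. (LINT x|lborel. indicator (A i) x * f x) = 0"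
      have Ab: "A i \<in> sets borel" for i using A(2) bs by blast
      have "(LINT x:(\<Union>i. A i)|lborel. f x) = (\<Sum>i. (LINT x:(A i)|lborel. f x))"
      proof (rule lebesgue_integral_countable_add)
        show "set_integrable lborel (\<Union>i. A i) f"
          using fA[of "\<Union>i. A i"] Ab by (auto simp: set_integrable_def)
        fix i j :: nat assume "i \<noteq> j" then show "A i \<inter> A j = {}" using A(1) by (auto simp: disjoint_family_on_def)
      qed (use Ab in auto)
      then show "(LINT x|lborel. indicator (\<Union>i. A i) x * f x) = 0"
        using A(3) by (simp add: set_lebesgue_integral_def)
    qed auto
  qed
  have "AE x in lborel. f x = 0"
  proof (rule sigma_finite_measure.density_zero[OF sigma_finite_lborel fi])
    fix A assume "A \<in> sets (lborel :: 'a measure)"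
    then have "A \<in> sigma_sets UNIV (range (\<lambda>(a, c). box a c))"
      using sb by (simp only: sets_lborel)
    then show "set_lebesgue_integral lborel A f = 0" using gen by (simp add: set_lebesgue_integral_def)
  qed
  then have "AE x in lborel. d x = 0" using df by auto
  then show ?thesis by (rule AE_completion)
qed

lemma continuous_imp_measurable_on:
  fixes f :: "'a::euclidean_space \<Rightarrow> 'b::euclidean_space"
  shows "continuous_on UNIV f \<Longrightarrow> f \<in> borel_measurable (lebesgue_on D)"
  by (intro measurable_restrict_space1 measurable_completion) (simp add: borel_measurable_continuous_onI)

lemma test_functions_Ck: "f \<in> test_functions D \<Longrightarrow> Ck k f"
  by (simp add: test_functions_def)

lemma test_function_measurable: "f \<in> test_functions D \<Longrightarrow> f \<in> borel_measurable (lebesgue_on D)"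
  by (rule continuous_imp_measurable_on[OF Ck_continuous[OF test_functions_Ck[of _ _ 0]]])

lemma gr_test_function_measurable: "f \<in> test_functions D \<Longrightarrow> gr f \<in> borel_measurable (lebesgue_on D)"
  by (rule continuous_imp_measurable_on[OF continuous_gr[OF test_functions_Ck[of _ _ "Suc 0"]]])

section \<open>Weak gradients on a bounded open set\<close>

locale bounded_domain =
  fixes D :: "'a::euclidean_space set"
  assumes D_open: "open D" and D_bounded: "bounded D"
begin

abbreviation "M \<equiv> lebesgue_on D"

lemma D_lmeasurable: "D \<in> lmeasurable"
  using D_open D_bounded by (simp add: lmeasurable_open)

sublocale finite_measure M
  by (rule finite_measure_lebesgue_on[OF D_lmeasurable])

lemma AE_M_iff: "(AE x in M. P x) \<longleftrightarrow> (AE x in lebesgue. x \<in> D \<longrightarrow> P x)"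
  by (rule AE_restrict_space_iff) (use D_open in auto)

lemma L2_integrable:
  assumes "g \<in> L2 D"
  shows "integrable M g"
proof (rule Bochner_Integration.integrable_bound[of M "\<lambda>x. 1 + (norm (g x))\<^sup>2"])
  show "integrable M (\<lambda>x. 1 + (norm (g x))\<^sup>2)" using assms by (auto simp: L2_def)
  show "g \<in> borel_measurable M" using assms by (simp add: L2_def)
  have "t \<le> 1 + t\<^sup>2" for t :: real
  proof -
    have "0 \<le> (t - 1 / 2)\<^sup>2" by simp
    then show ?thesis by (simp add: power2_eq_square algebra_simps)
  qed
  then show "AE x in M. norm (g x) \<le> norm (1 + (norm (g x))\<^sup>2)" by (intro AE_I2) (simp add: add_nonneg_nonneg)
qed

lemma integral_test_support:
  fixes f :: "'a \<Rightarrow> real"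
  assumes c: "continuous_on UNIV f" and K: "K \<subseteq> D" "\<And>x. x \<notin> K \<Longrightarrow> f x = 0"
  shows "(LINT x|M. f x) = (LINT x|lborel. f x)"
proof -
  have "(LINT x|M. f x) = (LINT x|lebesgue. indicator D x *\<^sub>R f x)"
    by (rule integral_restrict_space) (use D_open in auto)
  also have "(\<lambda>x. indicator D x *\<^sub>R f x) = f" using K by (auto simp: fun_eq_iff indicator_def)
  also have "(LINT x|lebesgue. f x) = (LINT x|lborel. f x)"
    by (rule integral_completion) (simp add: c borel_measurable_continuous_onI)
  finally show ?thesis .
qed

text \<open>The product of \<open>f\<close> with a test function has compact support, so its
  gradient integrates to zero over the whole space; \<open>f\<close> itself may be nonzero on the
  boundary.\<close>

lemma integration_by_parts:
  assumes f: "Ck 1 f" and \<phi>: "\<phi> \<in> test_functions D"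
  shows "(LINT x|M. f x * (gr \<phi> x \<bullet> b)) = - (LINT x|M. (gr f x \<bullet> b) * \<phi> x)"
proof -
  from \<phi> obtain K where K: "compact K" "K \<subseteq> D" "\<And>x. x \<notin> K \<Longrightarrow> \<phi> x = 0" and C: "\<And>k. Ck k \<phi>"
    by (auto simp: test_functions_def)
  have C1: "Ck 1 \<phi>" by (rule C)
  have cf: "continuous_on UNIV f" "continuous_on UNIV (gr f)" "continuous_on UNIV \<phi>" "continuous_on UNIV (gr \<phi>)"
    using Ck_continuous[OF f] Ck_continuous[OF C] continuous_gr[of 0] f C by (auto simp del: Ck.simps)
  have g0: "gr \<phi> x = 0" if "x \<notin> K" for x using gr_outside[of K \<phi> x] K that by auto
  have ci: "integrable lborel h" if "continuous_on UNIV h" "\<And>x. x \<notin> K \<Longrightarrow> h x = 0" for h :: "'a \<Rightarrow> real"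
  proof -
    have "integrable lborel (\<lambda>x. indicator K x *\<^sub>R h x)"
      by (rule borel_integrable_compact[OF K(1)]) (rule continuous_on_subset[OF that(1)], simp)
    moreover have "(\<lambda>x. indicator K x *\<^sub>R h x) = h" using that(2) by (auto simp: fun_eq_iff indicator_def)
    ultimately show ?thesis by simp
  qed
  have "0 = (LINT x|lborel. gr (\<lambda>x. f x * \<phi> x) x \<bullet> b)"
    by (rule integral_gr_eq_0[symmetric, OF Ck_mult[OF f C1] K(1)]) (simp add: K(3))
  also have "\<dots> = (LINT x|lborel. f x * (gr \<phi> x \<bullet> b) + (gr f x \<bullet> b) * \<phi> x)"
    unfolding gr_mult[OF f C1] by (simp add: inner_add_left mult.commute)
  also have "\<dots> = (LINT x|lborel. f x * (gr \<phi> x \<bullet> b)) + (LINT x|lborel. (gr f x \<bullet> b) * \<phi> x)"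
    by (intro Bochner_Integration.integral_add ci continuous_intros cf) (auto simp: g0 K(3))
  also have "(LINT x|lborel. f x * (gr \<phi> x \<bullet> b)) = (LINT x|M. f x * (gr \<phi> x \<bullet> b))"
    by (rule integral_test_support[symmetric, of _ K]) (auto intro!: continuous_intros cf simp: g0 K)
  also have "(LINT x|lborel. (gr f x \<bullet> b) * \<phi> x) = (LINT x|M. (gr f x \<bullet> b) * \<phi> x)"
    by (rule integral_test_support[symmetric, of _ K]) (auto intro!: continuous_intros cf simp: g0 K)
  finally show ?thesis by simp
qed

lemma weak_gradient_iff:
  "weak_gradient D v g \<longleftrightarrow> g \<in> L2 D \<and>
     (\<forall>\<phi>\<in>test_functions D. \<forall>b\<in>Basis. (LINT x|M. v x * (gr \<phi> x \<bullet> b)) = - (LINT x|M. (g x \<bullet> b) * \<phi> x))"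
proof -
  have "frechet_derivative \<phi> (at x) b = gr \<phi> x \<bullet> b" if "\<phi> \<in> test_functions D" for \<phi> x b
    by (rule frechet_eq_gr[OF test_functions_Ck[OF that]])
  then show ?thesis unfolding weak_gradient_def by auto
qed

text \<open>The powers \<open>1 - (1 - P)\<^sup>n\<close> of a bump function \<open>P\<close> increase to the indicator of the box where \<open>P\<close> is positive.\<close>

lemma weak_gradient_unique:
  assumes g: "weak_gradient D v g" and h: "weak_gradient D v h"
  shows "AE x in M. g x = h x"
proof -
  have gw: "g \<in> L2 D" and hw: "h \<in> L2 D"
    "\<And>\<phi> b. \<phi> \<in> test_functions D \<Longrightarrow> b \<in> Basis \<Longrightarrow> (LINT x|M. (g x \<bullet> b) * \<phi> x) = (LINT x|M. (h x \<bullet> b) * \<phi> x)"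
  proof -
    show "g \<in> L2 D" "h \<in> L2 D" using g h by (simp_all add: weak_gradient_iff)
    fix \<phi> b assume "\<phi> \<in> test_functions D" "b \<in> (Basis :: 'a set)"
    then have "(LINT x|M. v x * (gr \<phi> x \<bullet> b)) = - (LINT x|M. (g x \<bullet> b) * \<phi> x)"
      "(LINT x|M. v x * (gr \<phi> x \<bullet> b)) = - (LINT x|M. (h x \<bullet> b) * \<phi> x)"
      using g h unfolding weak_gradient_iff by blast+
    then show "(LINT x|M. (g x \<bullet> b) * \<phi> x) = (LINT x|M. (h x \<bullet> b) * \<phi> x)" by linarith
  qed
  have comp: "AE x in M. (g x - h x) \<bullet> b = 0" if b: "b \<in> Basis" for b
  proof -
    define d where "d x = (g x - h x) \<bullet> b" for x
    have gi: "integrable M (\<lambda>x. g x \<bullet> b)" "integrable M (\<lambda>x. h x \<bullet> b)"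
      using L2_integrable[of g] L2_integrable[of h] gw hw(1) by auto
    have di: "integrable M d" unfolding d_def inner_diff_left using gi by simp
    have d0: "(LINT x|M. d x * \<phi> x) = 0" if \<phi>: "\<phi> \<in> test_functions D" for \<phi>
    proof -
      obtain B where B: "\<And>x. \<bar>\<phi> x\<bar> \<le> B" using test_function_bounded[OF \<phi>] by blast
      have m: "\<phi> \<in> borel_measurable M"
        by (rule test_function_measurable[OF \<phi>])
      have i: "integrable M (\<lambda>x. u x * \<phi> x)" if "integrable M u" for u :: "'a \<Rightarrow> real"
      proof (rule Bochner_Integration.integrable_bound[of M "\<lambda>x. B * u x"])
        show "AE x in M. norm (u x * \<phi> x) \<le> norm (B * u x)"
        proof (rule AE_I2)
          fix x
          have "\<bar>u x\<bar> * \<bar>\<phi> x\<bar> \<le> \<bar>u x\<bar> * \<bar>B\<bar>" using B[of x] by (intro mult_left_mono) auto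
          then show "norm (u x * \<phi> x) \<le> norm (B * u x)" by (simp only: real_norm_def abs_mult mult.commute[of "\<bar>B\<bar>"])
        qed
        show "integrable M (\<lambda>x. B * u x)" by (rule integrable_mult_right[OF that])
        show "(\<lambda>x. u x * \<phi> x) \<in> borel_measurable M" using borel_measurable_integrable[OF that] m by (rule borel_measurable_times)
      qed
      have "(LINT x|M. d x * \<phi> x) = (LINT x|M. (g x \<bullet> b) * \<phi> x - (h x \<bullet> b) * \<phi> x)"
        by (simp only: d_def inner_diff_left left_diff_distrib)
      also have "\<dots> = (LINT x|M. (g x \<bullet> b) * \<phi> x) - (LINT x|M. (h x \<bullet> b) * \<phi> x)"
        by (rule Bochner_Integration.integral_diff[OF i[OF gi(1)] i[OF gi(2)]])
      also have "\<dots> = 0" using hw(2)[OF \<phi> b] by simp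
      finally show ?thesis .
    qed
    have box0: "(LINT x|M. indicator (box a c) x * d x) = 0" if ac: "cbox a c \<subseteq> D" for a c
    proof -
      define \<phi> where "\<phi> n x = 1 - (1 - box_bump a c x) ^ n" for n x
      have \<phi>t: "\<phi> n \<in> test_functions D" for n
      proof (rule test_functionsI[OF _ compact_cbox ac])
        show "Ck k (\<phi> n)" for k
          unfolding \<phi>_def[abs_def] by (intro Ck_diff Ck_power Ck_const Ck_box_bump)
        fix x assume "x \<notin> cbox a c"
        then have "x \<notin> box a c" using box_subset_cbox by blast
        then show "\<phi> n x = 0" by (simp add: \<phi>_def box_bump_eq_0)
      qed
      have "(\<lambda>n. LINT x|M. d x * \<phi> n x) \<longlonglongrightarrow> (LINT x|M. indicator (box a c) x * d x)"
      proof (rule integral_dominated_convergence[where w = "\<lambda>x. \<bar>d x\<bar>"])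
        have dm: "d \<in> borel_measurable M" using di by simp
        have "(indicator (box a c) :: 'a \<Rightarrow> real) \<in> borel_measurable M"
          by (intro measurable_restrict_space1 measurable_completion) auto
        then show "(\<lambda>x. indicator (box a c) x * d x) \<in> borel_measurable M" using dm by (rule borel_measurable_times)
        show "(\<lambda>x. d x * \<phi> n x) \<in> borel_measurable M" for n
        proof -
          have "\<phi> n \<in> borel_measurable M"
            by (rule test_function_measurable[OF \<phi>t])
          then show ?thesis using dm by simp
        qed
        show "integrable M (\<lambda>x. \<bar>d x\<bar>)" using di by simp
        show "AE x in M. (\<lambda>n. d x * \<phi> n x) \<longlonglongrightarrow> indicator (box a c) x * d x"
        proof (rule AE_I2)
          fix x
          show "(\<lambda>n. d x * \<phi> n x) \<longlonglongrightarrow> indicator (box a c) x * d x"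
          proof (cases "x \<in> box a c")
            case True
            have "(\<lambda>n. (1 - box_bump a c x) ^ n) \<longlonglongrightarrow> 0"
              using box_bump_pos[OF True] box_bump_bounds[of a c x] by (intro LIMSEQ_power_zero) (simp add: abs_if)
            from tendsto_mult[OF tendsto_const[of "d x"] tendsto_diff[OF tendsto_const[of 1] this]]
            have "(\<lambda>n. d x * \<phi> n x) \<longlonglongrightarrow> d x * (1 - 0)" unfolding \<phi>_def .
            then show ?thesis using True by simp
          next
            case False
            then show ?thesis by (simp add: \<phi>_def box_bump_eq_0)
          qed
        qed
        show "AE x in M. norm (d x * \<phi> n x) \<le> \<bar>d x\<bar>" for n
        proof (rule AE_I2)
          fix x
          have "0 \<le> (1 - box_bump a c x) ^ n" "(1 - box_bump a c x) ^ n \<le> 1"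
            using box_bump_bounds[of a c x] by (auto intro!: power_le_one)
          then show "norm (d x * \<phi> n x) \<le> \<bar>d x\<bar>" by (simp add: \<phi>_def abs_mult mult_left_le)
        qed
      qed
      then show ?thesis unfolding d0[OF \<phi>t] using LIMSEQ_unique[of "\<lambda>_. 0::real" 0] by auto
    qed
    have Q: "AE x in lebesgue. x \<in> cbox a c \<longrightarrow> d x = 0" if ac: "cbox a c \<subseteq> D" for a c
    proof -
      define e where "e x = indicator (box a c) x * d x" for x
      have bD: "box a c \<subseteq> D" using ac box_subset_cbox by blast
      have eM: "(LINT x|lebesgue. indicator B x * e x) = (LINT x|M. indicator B x * (indicator (box a c) x * d x))" for B
      proof -
        have "(LINT x|M. indicator B x * (indicator (box a c) x * d x)) = (LINT x|lebesgue. indicator D x *\<^sub>R (indicator B x * (indicator (box a c) x * d x)))"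
          by (rule integral_restrict_space) (use D_open in auto)
        also have "(\<lambda>x. indicator D x *\<^sub>R (indicator B x * (indicator (box a c) x * d x))) = (\<lambda>x. indicator B x * e x)"
          using bD by (auto simp: fun_eq_iff e_def indicator_def)
        finally show ?thesis by simp
      qed
      have "AE x in lebesgue. e x = 0"
      proof (rule integral_eq_0_on_box_imp_AE_0)
        have "integrable M (\<lambda>x. indicator (box a c) x * d x)"
        proof (rule Bochner_Integration.integrable_bound[OF di])
          have "(indicator (box a c) :: 'a \<Rightarrow> real) \<in> borel_measurable M"
            by (intro measurable_restrict_space1 measurable_completion) auto
          then show "(\<lambda>x. indicator (box a c) x * d x) \<in> borel_measurable M" using borel_measurable_integrable[OF di] by (rule borel_measurable_times)
        qed (auto simp: indicator_def)
        then have "integrable lebesgue (\<lambda>x. indicator D x *\<^sub>R (indicator (box a c) x * d x))"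
          by (subst (asm) integrable_restrict_space) (use D_open in auto)
        moreover have "(\<lambda>x. indicator D x *\<^sub>R (indicator (box a c) x * d x)) = e"
          using bD by (auto simp: fun_eq_iff e_def indicator_def)
        ultimately show "integrable lebesgue e" by simp
        fix a' c' :: 'a
        obtain a2 c2 where i: "box a' c' \<inter> box a c = box a2 c2" using box_Int_box[of a' c' a c] by blast
        have "(LINT x|M. indicator (box a' c') x * (indicator (box a c) x * d x)) = (LINT x|M. indicator (box a2 c2) x * d x)"
          unfolding i[symmetric] by (simp add: indicator_inter_arith mult.assoc)
        also have "\<dots> = 0"
        proof (cases "box a2 c2 = {}")
          case False
          have "cbox a2 c2 = closure (box a2 c2)" using False by (simp add: closure_box)
          also have "\<dots> \<subseteq> closure (box a c)" using i by (intro closure_mono) auto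
          also have "\<dots> \<subseteq> cbox a c" by (rule closure_minimal[OF box_subset_cbox closed_cbox])
          finally show ?thesis using ac by (intro box0) auto
        qed simp
        finally show "(LINT x|lebesgue. indicator (box a' c') x * e x) = 0" unfolding eM .
      qed
      moreover have "AE x in lebesgue. x \<notin> cbox a c - box a c"
        by (rule AE_not_in) (use negligible_frontier_interval[of a c] in \<open>simp add: negligible_iff_null_sets\<close>)
      ultimately show ?thesis by eventually_elim (auto simp: e_def)
    qed
    \<comment> \<open>Up to here \<open>d\<close> vanishes almost everywhere on each closed box
      inside \<open>D\<close>; countably many such boxes exhaust \<open>D\<close>.\<close>
    have "\<exists>\<D>. countable \<D> \<and> \<D> \<subseteq> Pow D \<and> (\<forall>X\<in>\<D>. \<exists>a b. X = cbox a b) \<and> \<Union>\<D> = D"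
    proof -
      obtain \<D> where "countable \<D>" "\<D> \<subseteq> Pow D" and c: "\<And>X. X \<in> \<D> \<Longrightarrow> \<exists>a b. X = cbox a b" and "\<Union>\<D> = D"
        using open_countable_Union_open_cbox[OF D_open] by metis
      then show ?thesis by (intro exI[of _ \<D>] conjI ballI c)
    qed
    then obtain \<D> where cD: "countable \<D>" "\<D> \<subseteq> Pow D" "\<forall>X\<in>\<D>. \<exists>a b. X = cbox a b" "\<Union>\<D> = D"
      by (elim exE conjE)
    have "AE x in lebesgue. x \<in> X \<longrightarrow> d x = 0" if X: "X \<in> \<D>" for X
    proof -
      obtain a c where ac: "X = cbox a c" using cD(3) X by blast
      have "cbox a c \<subseteq> D" using cD(2) X ac by blast
      from Q[OF this] show ?thesis unfolding ac .
    qed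
    then have "AE x in lebesgue. \<forall>X\<in>\<D>. x \<in> X \<longrightarrow> d x = 0"
      by (subst AE_ball_countable[OF cD(1)]) blast
    then have "AE x in lebesgue. x \<in> D \<longrightarrow> d x = 0"
    proof (rule AE_mp, intro AE_I2 impI)
      fix x assume a: "\<forall>X\<in>\<D>. x \<in> X \<longrightarrow> d x = 0" and "x \<in> D"
      then obtain X where "X \<in> \<D>" "x \<in> X" using cD(4) by blast
      then show "d x = 0" using a by blast
    qed
    then show ?thesis unfolding AE_M_iff d_def .
  qed
  have "AE x in M. \<forall>b\<in>Basis. (g x - h x) \<bullet> b = 0"
    by (rule AE_finite_allI) (use comp in auto)
  then show ?thesis by eventually_elim (auto simp: euclidean_all_zero_iff)
qed

end

section \<open>Limits of test functions\<close>

context bounded_domain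
begin

text \<open>A certificate stronger than membership in \<open>H10 D\<close>. It is stable under
  linear combinations and supplies exactly what dominated convergence on the finite measure space
  \<open>M\<close> asks for, so every statement about test functions passes to
  \<open>v\<close>.\<close>

definition approx :: "('a \<Rightarrow> real) \<Rightarrow> (nat \<Rightarrow> 'a \<Rightarrow> real) \<Rightarrow> real \<Rightarrow> bool" where
  "approx v \<phi> B \<longleftrightarrow> (\<forall>k. \<phi> k \<in> test_functions D) \<and> (\<forall>x. (\<lambda>k. \<phi> k x) \<longlonglongrightarrow> v x) \<and>
     (\<forall>k x. \<bar>\<phi> k x\<bar> \<le> B \<and> norm (gr (\<phi> k) x) \<le> B) \<and> (AE x in M. convergent (\<lambda>k. gr (\<phi> k) x))"

lemma integrable_bounded:
  fixes f :: "'a \<Rightarrow> 'b::euclidean_space"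
  shows "f \<in> borel_measurable M \<Longrightarrow> AE x in M. norm (f x) \<le> B \<Longrightarrow> integrable M f"
  by (rule integrable_const_bound)

lemma bounded_convergence:
  fixes f :: "'a \<Rightarrow> real"
  assumes "\<And>k. F k \<in> borel_measurable M" "f \<in> borel_measurable M" "AE x in M. (\<lambda>k. F k x) \<longlonglongrightarrow> f x"
    and "\<And>k. AE x in M. \<bar>F k x\<bar> \<le> B"
  shows "(\<lambda>k. LINT x|M. F k x) \<longlonglongrightarrow> (LINT x|M. f x)"
  by (rule integral_dominated_convergence[where w = "\<lambda>_. B"]) (use assms in auto)

context
  fixes v \<phi> B
  assumes v: "approx v \<phi> B"
begin

lemma approx_test: "\<phi> k \<in> test_functions D"
  and approx_lim: "(\<lambda>k. \<phi> k x) \<longlonglongrightarrow> v x"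
  and approx_bound: "\<bar>\<phi> k x\<bar> \<le> B" "norm (gr (\<phi> k) x) \<le> B"
  and approx_convergent: "AE x in M. convergent (\<lambda>k. gr (\<phi> k) x)"
  using v by (simp_all add: approx_def)

lemma approx_bound_nonneg: "0 \<le> B"
  using approx_bound(1)[of 0 0] by linarith

lemma approx_value_bound: "\<bar>v x\<bar> \<le> B"
  using LIMSEQ_le_const2[OF tendsto_rabs[OF approx_lim[of x]], of B] approx_bound(1) by blast

lemma approx_value_measurable: "v \<in> borel_measurable M"
  by (rule borel_measurable_LIMSEQ_metric[OF test_function_measurable[OF approx_test] approx_lim])

text \<open>Integration by parts holds for each \<open>\<phi> k\<close>, and both of its sides
  converge boundedly.\<close>

lemma approx_weak_gradient: "weak_gradient D v (\<lambda>x. lim (\<lambda>k. gr (\<phi> k) x))"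
proof -
  let ?G = "\<lambda>x. lim (\<lambda>k. gr (\<phi> k) x)"
  have Gm: "?G \<in> borel_measurable M"
    by (rule borel_measurable_lim_metric[OF gr_test_function_measurable[OF approx_test]])
  have lim: "AE x in M. (\<lambda>k. gr (\<phi> k) x) \<longlonglongrightarrow> ?G x"
    using approx_convergent by eventually_elim (simp add: convergent_LIMSEQ_iff)
  have Gb: "AE x in M. norm (?G x) \<le> B"
    using lim
  proof eventually_elim
    case (elim x)
    show ?case by (rule LIMSEQ_le_const2[OF tendsto_norm[OF elim]]) (use approx_bound(2) in blast)
  qed
  have L2: "?G \<in> L2 D"
    unfolding L2_def
  proof (intro CollectI conjI Gm)
    show "integrable M (\<lambda>x. (norm (?G x))\<^sup>2)"
    proof (rule integrable_bounded[where B = "B\<^sup>2"])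
      show "AE x in M. norm ((norm (?G x))\<^sup>2) \<le> B\<^sup>2" using Gb by eventually_elim (simp add: power_mono)
    qed (use Gm in measurable)
  qed
  show ?thesis unfolding weak_gradient_iff
  proof (intro conjI L2 ballI)
    fix \<xi> and b :: 'a assume \<xi>: "\<xi> \<in> test_functions D" and b: "b \<in> Basis"
    obtain C where C: "0 \<le> C" "\<And>x. \<bar>\<xi> x\<bar> \<le> C" "\<And>x. norm (gr \<xi> x) \<le> C" using test_function_bounded[OF \<xi>] by blast
    have gb: "\<bar>gr \<xi> x \<bullet> b\<bar> \<le> C" for x using Basis_le_norm[OF b, of "gr \<xi> x"] C(3)[of x] by linarith
    note m = test_function_measurable[OF approx_test] gr_test_function_measurable[OF approx_test]
      test_function_measurable[OF \<xi>] gr_test_function_measurable[OF \<xi>] approx_value_measurable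
    have 1: "(\<lambda>k. LINT x|M. \<phi> k x * (gr \<xi> x \<bullet> b)) \<longlonglongrightarrow> (LINT x|M. v x * (gr \<xi> x \<bullet> b))"
    proof (rule bounded_convergence[where B = "B * C"])
      show "(\<lambda>x. \<phi> k x * (gr \<xi> x \<bullet> b)) \<in> borel_measurable M" for k
        by (intro borel_measurable_times borel_measurable_inner m) auto
      show "(\<lambda>x. v x * (gr \<xi> x \<bullet> b)) \<in> borel_measurable M"
        by (intro borel_measurable_times borel_measurable_inner m) auto
      show "AE x in M. (\<lambda>k. \<phi> k x * (gr \<xi> x \<bullet> b)) \<longlonglongrightarrow> v x * (gr \<xi> x \<bullet> b)"
        by (intro AE_I2 tendsto_mult approx_lim tendsto_const)
      show "AE x in M. \<bar>\<phi> k x * (gr \<xi> x \<bullet> b)\<bar> \<le> B * C" for k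
        unfolding abs_mult by (intro AE_I2 mult_mono approx_bound gb approx_bound_nonneg) auto
    qed
    have 2: "(\<lambda>k. LINT x|M. (gr (\<phi> k) x \<bullet> b) * \<xi> x) \<longlonglongrightarrow> (LINT x|M. (?G x \<bullet> b) * \<xi> x)"
    proof (rule bounded_convergence[where B = "B * C"])
      show "(\<lambda>x. (gr (\<phi> k) x \<bullet> b) * \<xi> x) \<in> borel_measurable M" for k
        by (intro borel_measurable_times borel_measurable_inner m) auto
      show "(\<lambda>x. (?G x \<bullet> b) * \<xi> x) \<in> borel_measurable M"
        by (intro borel_measurable_times borel_measurable_inner m Gm) auto
      show "AE x in M. (\<lambda>k. (gr (\<phi> k) x \<bullet> b) * \<xi> x) \<longlonglongrightarrow> (?G x \<bullet> b) * \<xi> x"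
        using lim by eventually_elim (intro tendsto_mult tendsto_inner tendsto_const)
      show "AE x in M. \<bar>(gr (\<phi> k) x \<bullet> b) * \<xi> x\<bar> \<le> B * C" for k
      proof (rule AE_I2)
        fix x
        have "\<bar>gr (\<phi> k) x \<bullet> b\<bar> \<le> B" using Basis_le_norm[OF b, of "gr (\<phi> k) x"] approx_bound(2)[of k x] by linarith
        then show "\<bar>(gr (\<phi> k) x \<bullet> b) * \<xi> x\<bar> \<le> B * C"
          unfolding abs_mult by (intro mult_mono C approx_bound_nonneg) auto
      qed
    qed
    have "(LINT x|M. \<phi> k x * (gr \<xi> x \<bullet> b)) = - (LINT x|M. (gr (\<phi> k) x \<bullet> b) * \<xi> x)" for k
      by (rule integration_by_parts[OF test_functions_Ck[OF approx_test] \<xi>])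
    then show "(LINT x|M. v x * (gr \<xi> x \<bullet> b)) = - (LINT x|M. (?G x \<bullet> b) * \<xi> x)"
      using LIMSEQ_unique[OF 1] tendsto_minus[OF 2] by simp
  qed
qed

lemma approx_grad_weak: "weak_gradient D v (grad D v)"
  unfolding grad_def by (rule someI[of "weak_gradient D v", OF approx_weak_gradient])

lemma approx_grad_measurable: "grad D v \<in> borel_measurable M"
  using approx_grad_weak by (simp add: weak_gradient_iff L2_def)

lemma approx_grad_lim: "AE x in M. (\<lambda>k. gr (\<phi> k) x) \<longlonglongrightarrow> grad D v x"
  using weak_gradient_unique[OF approx_weak_gradient approx_grad_weak] approx_convergent
proof eventually_elim
  case (elim x)
  show ?case using convergent_LIMSEQ_iff[THEN iffD1, OF elim(2)] unfolding elim(1) .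
qed

lemma approx_grad_bound: "AE x in M. norm (grad D v x) \<le> B"
  using approx_grad_lim
proof eventually_elim
  case (elim x)
  show ?case by (rule LIMSEQ_le_const2[OF tendsto_norm[OF elim]]) (use approx_bound(2) in blast)
qed

lemma approx_H1: "v \<in> H1 D"
  unfolding H1_def L2_def
proof (intro CollectI conjI approx_value_measurable)
  show "integrable M (\<lambda>x. (norm (v x))\<^sup>2)"
  proof (rule integrable_bounded[where B = "B\<^sup>2"])
    show "AE x in M. norm ((norm (v x))\<^sup>2) \<le> B\<^sup>2"
      using approx_value_bound approx_bound_nonneg by (intro AE_I2) (simp add: abs_le_square_iff[symmetric])
  qed (use approx_value_measurable in measurable)
  show "\<exists>g. weak_gradient D v g" using approx_grad_weak by blast
qed

end

lemma gr_scale: "Ck 1 f \<Longrightarrow> gr (\<lambda>x. c * f x) x = c *\<^sub>R gr f x"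
  using gr_mult[OF Ck_const[of 1 c], of f x] gr_eqI[OF GDERIV_const[of c x]] by simp

lemma test_functions_lin:
  assumes "f \<in> test_functions D" "g \<in> test_functions D"
  shows "(\<lambda>x. f x + c * g x) \<in> test_functions D"
proof -
  from assms(1) obtain K where K: "compact K" "K \<subseteq> D" "\<And>x. x \<notin> K \<Longrightarrow> f x = 0"
    unfolding test_functions_def by auto
  from assms(2) obtain K' where K': "compact K'" "K' \<subseteq> D" "\<And>x. x \<notin> K' \<Longrightarrow> g x = 0"
    unfolding test_functions_def by auto
  show ?thesis
  proof (rule test_functionsI)
    show "compact (K \<union> K')" by (rule compact_Un[OF K(1) K'(1)])
    show "Ck k (\<lambda>x. f x + c * g x)" for k
      by (rule Ck_add[OF test_functions_Ck[OF assms(1)] Ck_mult[OF Ck_const test_functions_Ck[OF assms(2)]]])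
  qed (use K K' in auto)
qed

lemma approx_lin:
  assumes v: "approx v \<phi> B" and w: "approx w \<xi> C"
  shows "approx (\<lambda>x. v x + c * w x) (\<lambda>k x. \<phi> k x + c * \<xi> k x) (B + \<bar>c\<bar> * C)"
proof -
  have g: "gr (\<lambda>x. \<phi> k x + c * \<xi> k x) x = gr (\<phi> k) x + c *\<^sub>R gr (\<xi> k) x" for k x
  proof -
    have C: "Ck 1 (\<phi> k)" "Ck 1 (\<xi> k)"
      by (rule test_functions_Ck[OF approx_test[OF v]], rule test_functions_Ck[OF approx_test[OF w]])
    show ?thesis by (simp only: gr_add[OF C(1) Ck_mult[OF Ck_const C(2)]] gr_scale[OF C(2)])
  qed
  show ?thesis unfolding approx_def g
  proof (intro conjI allI)
    show "(\<lambda>x. \<phi> k x + c * \<xi> k x) \<in> test_functions D" for k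
      by (rule test_functions_lin[OF approx_test[OF v] approx_test[OF w]])
    show "(\<lambda>k. \<phi> k x + c * \<xi> k x) \<longlonglongrightarrow> v x + c * w x" for x
      by (intro tendsto_intros approx_lim[OF v] approx_lim[OF w])
    fix k x
    have "\<bar>c * \<xi> k x\<bar> \<le> \<bar>c\<bar> * C" "norm (c *\<^sub>R gr (\<xi> k) x) \<le> \<bar>c\<bar> * C"
      using approx_bound[OF w, of k x] by (auto simp: abs_mult intro: mult_left_mono)
    then show "\<bar>\<phi> k x + c * \<xi> k x\<bar> \<le> B + \<bar>c\<bar> * C" "norm (gr (\<phi> k) x + c *\<^sub>R gr (\<xi> k) x) \<le> B + \<bar>c\<bar> * C"
      using approx_bound[OF v, of k x] abs_triangle_ineq[of "\<phi> k x" "c * \<xi> k x"]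
        norm_triangle_ineq[of "gr (\<phi> k) x" "c *\<^sub>R gr (\<xi> k) x"] by linarith+
  next
    show "AE x in M. convergent (\<lambda>k. gr (\<phi> k) x + c *\<^sub>R gr (\<xi> k) x)"
      using approx_grad_lim[OF v] approx_grad_lim[OF w]
    proof eventually_elim
      case (elim x)
      show ?case by (rule convergentI, rule tendsto_add[OF elim(1) tendsto_scaleR[OF tendsto_const elim(2)]])
    qed
  qed
qed

text \<open>Both sides are limits of the same smooth gradients. Equality is only almost everywhere
  because \<open>grad\<close> picks an arbitrary representative.\<close>

lemma grad_lin:
  assumes v: "approx v \<phi> B" and w: "approx w \<xi> C"
  shows "AE x in M. grad D (\<lambda>x. v x + c * w x) x = grad D v x + c *\<^sub>R grad D w x"
proof -
  have g: "gr (\<lambda>x. \<phi> k x + c * \<xi> k x) x = gr (\<phi> k) x + c *\<^sub>R gr (\<xi> k) x" for k x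
  proof -
    have C: "Ck 1 (\<phi> k)" "Ck 1 (\<xi> k)"
      by (rule test_functions_Ck[OF approx_test[OF v]], rule test_functions_Ck[OF approx_test[OF w]])
    show ?thesis by (simp only: gr_add[OF C(1) Ck_mult[OF Ck_const C(2)]] gr_scale[OF C(2)])
  qed
  show ?thesis
    using approx_grad_lim[OF v] approx_grad_lim[OF w] approx_grad_lim[OF approx_lin[OF v w, of c], unfolded g]
  proof eventually_elim
    case (elim x)
    show ?case by (rule LIMSEQ_unique[OF elim(3) tendsto_add[OF elim(1) tendsto_scaleR[OF tendsto_const elim(2)]]])
  qed
qed

lemma approx_const_test:
  assumes f: "f \<in> test_functions D"
  shows "\<exists>B. approx f (\<lambda>_. f) B"
proof -
  obtain B where B: "\<And>x. \<bar>f x\<bar> \<le> B \<and> norm (gr f x) \<le> B" using test_function_bounded[OF f] by blast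
  show ?thesis by (rule exI[of _ B]) (use f B in \<open>simp add: approx_def convergent_const\<close>)
qed

lemma grad_test: "f \<in> test_functions D \<Longrightarrow> AE x in M. grad D f x = gr f x"
proof -
  assume "f \<in> test_functions D"
  then obtain B where B: "approx f (\<lambda>_. f) B" using approx_const_test by blast
  show ?thesis using approx_grad_lim[OF B] by eventually_elim (simp add: LIMSEQ_const_iff)
qed

lemma zero_test: "(\<lambda>_. 0) \<in> test_functions D"
  by (rule test_functionsI[of _ "{}"]) (auto intro: Ck_const)

lemma approx_zero: "\<exists>B. approx (\<lambda>_. 0) (\<lambda>_ _. 0) B"
  by (rule approx_const_test[OF zero_test])

lemma approx_scale: "approx v \<phi> B \<Longrightarrow> approx (\<lambda>x. c * v x) (\<lambda>k x. c * \<phi> k x) (\<bar>c\<bar> * B)"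
proof -
  assume v: "approx v \<phi> B"
  have "approx (\<lambda>_. 0) (\<lambda>_ _. 0) 0"
  proof -
    have "gr (\<lambda>_. 0) x = 0" for x :: 'a by (rule gr_eqI[OF GDERIV_const])
    then show ?thesis by (simp add: approx_def zero_test convergent_const)
  qed
  from approx_lin[OF this v, of c] show ?thesis by simp
qed

lemma grad_scale: "approx v \<phi> B \<Longrightarrow> AE x in M. grad D (\<lambda>x. c * v x) x = c *\<^sub>R grad D v x"
proof -
  assume v: "approx v \<phi> B"
  obtain Z where Z: "approx (\<lambda>_. 0) (\<lambda>_ _. 0) Z" using approx_zero by blast
  have "gr (\<lambda>_. 0) x = 0" for x :: 'a by (rule gr_eqI[OF GDERIV_const])
  then have "AE x in M. grad D (\<lambda>_. 0) x = 0" using grad_test[OF zero_test] by simp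
  then show ?thesis using grad_lin[OF Z v, of c] by eventually_elim simp
qed

text \<open>Bounded convergence of the values and of the gradients makes the test functions of the
  certificate converge in the full \<open>H1_norm\<close>.\<close>

lemma approx_H10:
  assumes v: "approx v \<phi> B"
  shows "v \<in> H10 D"
  unfolding H10_def
proof (intro CollectI conjI allI impI approx_H1[OF v])
  fix \<epsilon> :: real assume \<epsilon>: "0 < \<epsilon>"
  define d where "d k x = v x - \<phi> k x" for k x
  have dlim: "(\<lambda>k. LINT x|M. (d k x)\<^sup>2) \<longlonglongrightarrow> (LINT x|M. 0)"
  proof (rule bounded_convergence[where B = "(B + B)\<^sup>2"])
    show "(\<lambda>x. (d k x)\<^sup>2) \<in> borel_measurable M" for k
      unfolding d_def using approx_value_measurable[OF v] test_function_measurable[OF approx_test[OF v]] by measurable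
    show "AE x in M. (\<lambda>k. (d k x)\<^sup>2) \<longlonglongrightarrow> 0"
    proof (rule AE_I2)
      fix x
      have "(\<lambda>k. (d k x)\<^sup>2) \<longlonglongrightarrow> (v x - v x)\<^sup>2" unfolding d_def by (intro tendsto_intros approx_lim[OF v])
      then show "(\<lambda>k. (d k x)\<^sup>2) \<longlonglongrightarrow> 0" by simp
    qed
    fix k
    have "\<bar>d k x\<bar> \<le> B + B" for x unfolding d_def using approx_value_bound[OF v, of x] approx_bound(1)[OF v, of k x] by linarith
    then have "(d k x)\<^sup>2 \<le> (B + B)\<^sup>2" for x using power_mono[of "\<bar>d k x\<bar>" "B + B" 2] by simp
    then show "AE x in M. \<bar>(d k x)\<^sup>2\<bar> \<le> (B + B)\<^sup>2" by simp
  qed simp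
  have glim: "(\<lambda>k. LINT x|M. (norm (grad D (d k) x))\<^sup>2) \<longlonglongrightarrow> (LINT x|M. 0)"
  proof -
    have ge: "AE x in M. grad D (d k) x = grad D v x - gr (\<phi> k) x" and dm: "grad D (d k) \<in> borel_measurable M" for k
    proof -
      obtain C where C: "approx (\<phi> k) (\<lambda>_. \<phi> k) C" using approx_const_test[OF approx_test[OF v]] by blast
      have dk: "(\<lambda>x. v x + (-1) * \<phi> k x) = d k" by (auto simp: d_def)
      show "AE x in M. grad D (d k) x = grad D v x - gr (\<phi> k) x"
        using grad_lin[OF v C, of "-1"] grad_test[OF approx_test[OF v], of k] unfolding dk by eventually_elim simp
      show "grad D (d k) \<in> borel_measurable M"
        using approx_grad_measurable[OF approx_lin[OF v C, of "-1"]] unfolding dk .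
    qed
    show ?thesis
    proof (rule bounded_convergence[where B = "(B + B)\<^sup>2"])
      show "(\<lambda>x. (norm (grad D (d k) x))\<^sup>2) \<in> borel_measurable M" for k using dm by measurable
      have "AE x in M. \<forall>k. grad D (d k) x = grad D v x - gr (\<phi> k) x" using ge by (simp add: AE_all_countable)
      then show "AE x in M. (\<lambda>k. (norm (grad D (d k) x))\<^sup>2) \<longlonglongrightarrow> 0"
        using approx_grad_lim[OF v]
      proof eventually_elim
        case (elim x)
        have "(\<lambda>k. (norm (grad D v x - gr (\<phi> k) x))\<^sup>2) \<longlonglongrightarrow> (norm (grad D v x - grad D v x))\<^sup>2"
          by (intro tendsto_intros elim(2))
        then show ?case using elim(1) by simp
      qed
      fix k
      show "AE x in M. \<bar>(norm (grad D (d k) x))\<^sup>2\<bar> \<le> (B + B)\<^sup>2"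
        using ge[of k] approx_grad_bound[OF v]
      proof eventually_elim
        case (elim x)
        have "norm (grad D (d k) x) \<le> B + B"
          using elim approx_bound(2)[OF v, of k x] norm_triangle_ineq4[of "grad D v x" "gr (\<phi> k) x"] by simp
        then show ?case using power_mono[of "norm (grad D (d k) x)" "B + B" 2] by simp
      qed
    qed simp
  qed
  have "(\<lambda>k. H1_norm D (d k)) \<longlonglongrightarrow> sqrt (0 + 0)"
    unfolding H1_norm_def using tendsto_real_sqrt[OF tendsto_add[OF dlim glim]] by simp
  then have "eventually (\<lambda>k. H1_norm D (d k) < \<epsilon>) sequentially" using \<epsilon> by (intro order_tendstoD) auto
  then obtain k where "H1_norm D (d k) < \<epsilon>" by (auto simp: eventually_sequentially)
  then show "\<exists>\<phi>\<in>test_functions D. H1_norm D (\<lambda>x. v x - \<phi> x) < \<epsilon>"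
    unfolding d_def using approx_test[OF v] by blast
qed

text \<open>Integrate \<open>p\<close>, that is \<open>x \<bullet> b\<close> times
  \<open>\<phi>\<close> times its derivative along \<open>b\<close>, by parts: the derivative of
  \<open>x \<bullet> b\<close> is 1 and shows that the integral of \<open>\<phi>\<^sup>2\<close> is
  minus twice the integral of \<open>p\<close>. Young's inequality absorbs half of it, which leaves
  the constant \<open>4 * R\<^sup>2\<close>.\<close>

lemma poincare_test:
  assumes \<phi>: "\<phi> \<in> test_functions D" and R: "\<And>x. x \<in> D \<Longrightarrow> norm x \<le> R" "0 < R"
  shows "(LINT x|M. (\<phi> x)\<^sup>2) \<le> 4 * R\<^sup>2 * (LINT x|M. (norm (gr \<phi> x))\<^sup>2)"
proof -
  obtain b :: 'a where b: "b \<in> Basis" using nonempty_Basis by blast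
  have C: "Ck 1 \<phi>" by (rule test_functions_Ck[OF \<phi>])
  have lin: "Ck 1 (\<lambda>x. x \<bullet> b)" using Ck_linear[of 1 0 b] by simp
  have gl: "gr (\<lambda>x. x \<bullet> b) x = b" for x using gr_eqI[OF GDERIV_linear[of 0 b x]] by simp
  obtain B where B: "0 \<le> B" "\<And>x. \<bar>\<phi> x\<bar> \<le> B" "\<And>x. norm (gr \<phi> x) \<le> B" using test_function_bounded[OF \<phi>] by blast
  note m = test_function_measurable[OF \<phi>] gr_test_function_measurable[OF \<phi>]
  have xm: "(\<lambda>x. x \<bullet> b) \<in> borel_measurable M"
    by (rule continuous_imp_measurable_on) (intro continuous_intros)
  define p where "p x = (x \<bullet> b) * \<phi> x * (gr \<phi> x \<bullet> b)" for x
  have pb: "\<bar>p x\<bar> \<le> R * \<bar>\<phi> x\<bar> * norm (gr \<phi> x)" if "x \<in> D" for x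
    unfolding p_def abs_mult
    using Basis_le_norm[OF b, of x] Basis_le_norm[OF b, of "gr \<phi> x"] R(1)[OF that] R(2) by (intro mult_mono) auto
  have i2: "integrable M (\<lambda>x. (\<phi> x)\<^sup>2)"
    by (rule integrable_bounded[where B = "B\<^sup>2"]) (use m B in \<open>auto simp: abs_le_square_iff[symmetric]\<close>)
  have ig: "integrable M (\<lambda>x. (norm (gr \<phi> x))\<^sup>2)"
    by (rule integrable_bounded[where B = "B\<^sup>2"]) (use m B in \<open>auto intro!: power_mono\<close>)
  have ip: "integrable M p"
  proof (rule integrable_bounded[where B = "R * B * B"])
    show "p \<in> borel_measurable M" unfolding p_def[abs_def] using xm m by measurable
    show "AE x in M. norm (p x) \<le> R * B * B"
    proof (rule AE_I2)
      fix x assume "x \<in> space M"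
      then have x: "x \<in> D" by (simp add: space_restrict_space)
      have "R * \<bar>\<phi> x\<bar> * norm (gr \<phi> x) \<le> R * B * B" using B R(2) by (intro mult_mono) auto
      then show "norm (p x) \<le> R * B * B" using pb[OF x] by simp
    qed
  qed
  have "(LINT x|M. p x) = (LINT x|M. ((x \<bullet> b) * \<phi> x) * (gr \<phi> x \<bullet> b))" by (simp add: p_def)
  also have "\<dots> = - (LINT x|M. (gr (\<lambda>x. (x \<bullet> b) * \<phi> x) x \<bullet> b) * \<phi> x)"
    by (rule integration_by_parts[OF Ck_mult[OF lin C] \<phi>])
  also have "(\<lambda>x. (gr (\<lambda>x. (x \<bullet> b) * \<phi> x) x \<bullet> b) * \<phi> x) = (\<lambda>x. p x + (\<phi> x)\<^sup>2)"
    using b unfolding gr_mult[OF lin C] gl p_def by (simp add: inner_add_left power2_eq_square algebra_simps)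
  also have "(LINT x|M. p x + (\<phi> x)\<^sup>2) = (LINT x|M. p x) + (LINT x|M. (\<phi> x)\<^sup>2)"
    by (rule Bochner_Integration.integral_add[OF ip i2])
  finally have e: "(LINT x|M. (\<phi> x)\<^sup>2) = (LINT x|M. (- 2) * p x)" by simp
  have "(LINT x|M. (- 2) * p x) \<le> (LINT x|M. (\<phi> x)\<^sup>2 / 2 + 2 * R\<^sup>2 * (norm (gr \<phi> x))\<^sup>2)"
  proof (rule integral_mono)
    show "integrable M (\<lambda>x. (- 2) * p x)" using ip by simp
    show "integrable M (\<lambda>x. (\<phi> x)\<^sup>2 / 2 + 2 * R\<^sup>2 * (norm (gr \<phi> x))\<^sup>2)" using i2 ig by simp
    fix x assume "x \<in> space M"
    then have x: "x \<in> D" by (simp add: space_restrict_space)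
    have "(- 2) * p x \<le> 2 * (R * \<bar>\<phi> x\<bar> * norm (gr \<phi> x))" using pb[OF x] by linarith
    also have "\<dots> \<le> (\<phi> x)\<^sup>2 / 2 + 2 * R\<^sup>2 * (norm (gr \<phi> x))\<^sup>2"
    proof -
      have "0 \<le> (\<bar>\<phi> x\<bar> - 2 * R * norm (gr \<phi> x))\<^sup>2" by simp
      also have "\<dots> = (\<phi> x)\<^sup>2 - 4 * (R * \<bar>\<phi> x\<bar> * norm (gr \<phi> x)) + 4 * R\<^sup>2 * (norm (gr \<phi> x))\<^sup>2"
        by (simp add: power2_diff power_mult_distrib)
      finally show ?thesis by simp
    qed
    finally show "(- 2) * p x \<le> (\<phi> x)\<^sup>2 / 2 + 2 * R\<^sup>2 * (norm (gr \<phi> x))\<^sup>2" .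
  qed
  also have "\<dots> = (LINT x|M. (\<phi> x)\<^sup>2) / 2 + 2 * R\<^sup>2 * (LINT x|M. (norm (gr \<phi> x))\<^sup>2)" using i2 ig by simp
  finally show ?thesis using e by simp
qed

lemma poincare:
  assumes v: "approx v \<phi> B" and R: "\<And>x. x \<in> D \<Longrightarrow> norm x \<le> R" "0 < R"
  shows "(LINT x|M. (v x)\<^sup>2) \<le> 4 * R\<^sup>2 * (LINT x|M. (norm (grad D v x))\<^sup>2)"
proof -
  have 1: "(\<lambda>k. LINT x|M. (\<phi> k x)\<^sup>2) \<longlonglongrightarrow> (LINT x|M. (v x)\<^sup>2)"
  proof (rule bounded_convergence[where B = "B\<^sup>2"])
    show "AE x in M. (\<lambda>k. (\<phi> k x)\<^sup>2) \<longlonglongrightarrow> (v x)\<^sup>2" by (intro AE_I2 tendsto_power approx_lim[OF v])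
    show "AE x in M. \<bar>(\<phi> k x)\<^sup>2\<bar> \<le> B\<^sup>2" for k
      using power_mono[OF approx_bound(1)[OF v], where n = 2] by (intro AE_I2) simp
  qed (use approx_value_measurable[OF v] test_function_measurable[OF approx_test[OF v]] in auto)
  have 2: "(\<lambda>k. LINT x|M. (norm (gr (\<phi> k) x))\<^sup>2) \<longlonglongrightarrow> (LINT x|M. (norm (grad D v x))\<^sup>2)"
  proof (rule bounded_convergence[where B = "B\<^sup>2"])
    show "AE x in M. (\<lambda>k. (norm (gr (\<phi> k) x))\<^sup>2) \<longlonglongrightarrow> (norm (grad D v x))\<^sup>2"
      using approx_grad_lim[OF v] by eventually_elim (intro tendsto_intros)
    show "AE x in M. \<bar>(norm (gr (\<phi> k) x))\<^sup>2\<bar> \<le> B\<^sup>2" for k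
      using power_mono[OF approx_bound(2)[OF v], where n = 2] by (intro AE_I2) simp
  qed (use approx_grad_measurable[OF v] gr_test_function_measurable[OF approx_test[OF v]] in auto)
  show ?thesis
    by (rule LIMSEQ_le[OF 1 tendsto_mult[OF tendsto_const 2]])
       (use poincare_test[OF approx_test[OF v] R] in blast)
qed

text \<open>Scaling to norm one puts \<open>v\<close> among the competitors of the supremum, which
  is finite because \<open>q\<close> is bounded. A function of norm zero cannot be scaled; there the
  bound of \<open>q\<close> applies directly.\<close>

lemma Hm1_bound:
  assumes q: "q \<in> Hm1 D" and v: "approx v \<phi> B"
  shows "\<bar>q v\<bar> \<le> Hm1_norm D q * H10_norm D v"
proof -
  let ?n = "H10_norm D v"
  have n0: "0 \<le> ?n" by (simp add: H10_norm_def)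
  obtain C where C: "\<And>v. v \<in> H10 D \<Longrightarrow> \<bar>q v\<bar> \<le> C * H10_norm D v" using q unfolding Hm1_def by blast
  show ?thesis
  proof (cases "?n = 0")
    case True
    then show ?thesis using C[OF approx_H10[OF v]] by simp
  next
    case False
    then have n: "0 < ?n" using n0 by simp
    define w where "w x = (1 / ?n) * v x" for x
    have w: "w \<in> H10 D" unfolding w_def by (rule approx_H10[OF approx_scale[OF v]])
    have "(LINT x|M. (norm (grad D w x))\<^sup>2) = (LINT x|M. (1 / ?n)\<^sup>2 * (norm (grad D v x))\<^sup>2)"
    proof (rule integral_cong_AE)
      show "AE x in M. (norm (grad D w x))\<^sup>2 = (1 / ?n)\<^sup>2 * (norm (grad D v x))\<^sup>2"
        using grad_scale[OF v, of "1 / ?n"] unfolding w_def by eventually_elim (simp add: power_mult_distrib power_divide)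
    qed (use approx_grad_measurable[OF v] approx_grad_measurable[OF approx_scale[OF v, of "1 / ?n"]] in \<open>auto simp: w_def[abs_def]\<close>)
    also have "\<dots> = (1 / ?n)\<^sup>2 * ?n\<^sup>2" by (simp add: H10_norm_def)
    also have "\<dots> = 1" using n by (simp add: power_divide)
    finally have wn: "H10_norm D w = 1" by (simp add: H10_norm_def)
    have "\<bar>q w\<bar> \<le> Hm1_norm D q" unfolding Hm1_norm_def
    proof (rule cSUP_upper)
      show "w \<in> {v \<in> H10 D. H10_norm D v \<le> 1}" using w wn by simp
      show "bdd_above ((\<lambda>v. \<bar>q v\<bar>) ` {v \<in> H10 D. H10_norm D v \<le> 1})"
      proof (rule bdd_aboveI2[where M = "\<bar>C\<bar>"])
        fix u assume u: "u \<in> {v \<in> H10 D. H10_norm D v \<le> 1}"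
        have "\<bar>q u\<bar> \<le> C * H10_norm D u" using C u by blast
        also have "\<dots> \<le> \<bar>C\<bar> * 1" using u by (intro mult_mono) (auto simp: H10_norm_def)
        finally show "\<bar>q u\<bar> \<le> \<bar>C\<bar>" by simp
      qed
    qed
    moreover have "q w = (1 / ?n) * q v"
      using q approx_H10[OF v] unfolding Hm1_def w_def[abs_def] by blast
    ultimately show ?thesis using n by (simp add: abs_mult field_simps)
  qed
qed

end

section \<open>Finite element functions\<close>

text \<open>Derivatives fall on the smooth factor only. By the Leibniz rule the components of the
  gradient are convolutions of \<open>v\<close> with partial derivatives of \<open>\<Phi>\<close>,
  so the induction has to range over all smooth \<open>\<Phi>\<close>.\<close>

lemma Ck_convolution:
  fixes v :: "'a::euclidean_space \<Rightarrow> real"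
  assumes v: "continuous_on UNIV v" and \<Phi>: "\<And>k. Ck k \<Phi>"
  shows "Ck k (\<lambda>x. integral (cbox a c) (\<lambda>z. \<Phi> (x - z) * v z))"
  using \<Phi>
proof (induction k arbitrary: \<Phi>)
  case 0
  have c: "continuous_on UNIV \<Phi>" by (rule Ck_continuous[OF 0])
  have "continuous_on UNIV (\<lambda>x. integral (cbox a c) (\<lambda>z. \<Phi> (x - z) * v z))"
  proof (rule integral_continuous_on_param)
    show "continuous_on (UNIV \<times> cbox a c) (\<lambda>(x, z). \<Phi> (x - z) * v z)"
      unfolding case_prod_unfold
      by (intro continuous_intros continuous_on_compose2[OF c] continuous_on_compose2[OF v]) auto
  qed
  then show ?case by simp
next
  case (Suc k)
  have C1: "Ck 1 \<Phi>" and cg: "continuous_on UNIV (gr \<Phi>)" and c: "continuous_on UNIV \<Phi>"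
    using Suc.prems continuous_gr[of 0 \<Phi>] Ck_continuous[of 0 \<Phi>] by (simp_all del: Ck.simps)
  have GD: "GDERIV \<Phi> y :> gr \<Phi> y" for y using GDERIV_gr[of 0 \<Phi>] C1 by (simp del: Ck.simps)
  define G where "G x = integral (cbox a c) (\<lambda>z. v z *\<^sub>R gr \<Phi> (x - z))" for x
  have gi: "(\<lambda>z. v z *\<^sub>R gr \<Phi> (x - z)) integrable_on cbox a c" for x
    by (intro integrable_continuous continuous_intros continuous_on_compose2[OF cg] continuous_on_subset[OF v]) auto
  have ic: "G x \<bullet> b = integral (cbox a c) (\<lambda>z. (gr \<Phi> (x - z) \<bullet> b) * v z)" for x b
    using integral_linear[OF gi bounded_linear_inner_left[of b], of x] unfolding G_def o_def by (simp add: mult.commute)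
  show ?case unfolding Ck.simps
  proof (intro exI[of _ G] conjI allI ballI)
    fix x0
    have "((\<lambda>x. integral (cbox a c) ((\<lambda>x z. \<Phi> (x - z) * v z) x)) has_derivative
      blinfun_apply (integral (cbox a c) ((\<lambda>x z. blinfun_inner_right (v z *\<^sub>R gr \<Phi> (x - z))) x0))) (at x0 within UNIV)"
    proof (rule leibniz_rule)
      fix x z
      have "(\<Phi> has_derivative (\<lambda>h. h \<bullet> gr \<Phi> (x - z))) (at (x - z))" using GD by (simp add: gderiv_def)
      then have "((\<lambda>x. \<Phi> (x - z)) has_derivative (\<lambda>h. h \<bullet> gr \<Phi> (x - z))) (at x)"
        by (rule has_derivative_compose[of "\<lambda>x. x - z" "\<lambda>h. h" x UNIV, rotated]) (auto intro!: derivative_eq_intros)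
      note D = this
      show "((\<lambda>x. \<Phi> (x - z) * v z) has_derivative blinfun_apply (blinfun_inner_right (v z *\<^sub>R gr \<Phi> (x - z)))) (at x within UNIV)"
      proof -
        have e: "(\<lambda>h. (h \<bullet> gr \<Phi> (x - z)) * v z) = blinfun_apply (blinfun_inner_right (v z *\<^sub>R gr \<Phi> (x - z)))"
          by (auto simp: fun_eq_iff inner_commute)
        show ?thesis using has_derivative_mult_left[OF D, of "v z"] unfolding e by simp
      qed
    next
      show "(\<lambda>z. \<Phi> (x - z) * v z) integrable_on cbox a c" for x
        by (intro integrable_continuous continuous_intros continuous_on_compose2[OF c] continuous_on_subset[OF v]) auto
      show "continuous_on (UNIV \<times> cbox a c) (\<lambda>(x, z). blinfun_inner_right (v z *\<^sub>R gr \<Phi> (x - z)))"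
        unfolding case_prod_unfold
        by (intro bounded_linear.continuous_on[OF bounded_linear_blinfun_inner_right] continuous_intros
            continuous_on_compose2[OF cg] continuous_on_compose2[OF v]) auto
    qed auto
    moreover have "integral (cbox a c) (\<lambda>z. blinfun_inner_right (v z *\<^sub>R gr \<Phi> (x0 - z))) = blinfun_inner_right (G x0)"
      using integral_linear[OF gi bounded_linear_blinfun_inner_right, of x0] unfolding G_def o_def by simp
    moreover have "(\<lambda>h. h \<bullet> G x0) = (\<bullet>) (G x0)" by (auto simp: fun_eq_iff inner_commute)
    ultimately show "GDERIV (\<lambda>x. integral (cbox a c) (\<lambda>z. \<Phi> (x - z) * v z)) x0 :> G x0"
      by (simp add: gderiv_def)
  next
    fix x b assume b: "b \<in> (Basis :: 'a set)"
    have "Ck k' (\<lambda>x. gr \<Phi> x \<bullet> b)" for k' by (rule Ck_gr[OF Suc.prems b])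
    from Suc.IH[OF this] show "Ck k (\<lambda>x. G x \<bullet> b)" unfolding ic .
  qed
qed

section \<open>Mollification with an even kernel\<close>

definition mesa :: "real \<Rightarrow> 'a::euclidean_space \<Rightarrow> real" where
  "mesa \<epsilon> = box_bump (- (\<epsilon> *\<^sub>R One)) (\<epsilon> *\<^sub>R One)"

lemma mesa_minus: "mesa \<epsilon> (- x) = mesa \<epsilon> x"
  unfolding mesa_def box_bump_def by (intro prod.cong refl) (simp add: mult.commute)

lemma mesa_nonneg: "0 \<le> mesa \<epsilon> x" and Ck_mesa: "Ck k (mesa \<epsilon>)"
  unfolding mesa_def by (rule box_bump_bounds, rule Ck_box_bump)

lemma mesa_support: "mesa \<epsilon> x \<noteq> 0 \<Longrightarrow> norm x \<le> \<epsilon> * real DIM('a)"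
  for x :: "'a::euclidean_space"
proof -
  assume "mesa \<epsilon> x \<noteq> 0"
  then have "x \<in> box (- (\<epsilon> *\<^sub>R One)) (\<epsilon> *\<^sub>R One)" unfolding mesa_def using box_bump_eq_0 by blast
  then have "\<bar>x \<bullet> b\<bar> \<le> \<epsilon>" if "b \<in> Basis" for b using that by (auto simp: mem_box)
  then have "(\<Sum>b\<in>Basis. \<bar>x \<bullet> b\<bar>) \<le> (\<Sum>b\<in>(Basis :: 'a set). \<epsilon>)" by (intro sum_mono) auto
  then show ?thesis using norm_le_l1[of x] by (simp add: mult.commute)
qed

lemma integrable_mesa_mult:
  fixes h :: "'a::euclidean_space \<Rightarrow> 'b::euclidean_space"
  assumes "continuous_on UNIV h"
  shows "integrable lborel (\<lambda>x. mesa \<epsilon> x *\<^sub>R h x)"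
proof -
  have "integrable lborel (\<lambda>x. indicator (cball 0 (\<epsilon> * real DIM('a))) x *\<^sub>R (mesa \<epsilon> x *\<^sub>R h x))"
    by (rule borel_integrable_compact)
       (auto intro!: continuous_intros continuous_on_subset[OF assms] continuous_on_subset[OF Ck_continuous[OF Ck_mesa[of 0]]])
  moreover have "(\<lambda>x. indicator (cball 0 (\<epsilon> * real DIM('a))) x *\<^sub>R (mesa \<epsilon> x *\<^sub>R h x)) = (\<lambda>x. mesa \<epsilon> x *\<^sub>R h x)"
    using mesa_support[of \<epsilon>] by (force simp: fun_eq_iff indicator_def)
  ultimately show ?thesis by simp
qed

definition mass :: "'a::euclidean_space itself \<Rightarrow> real \<Rightarrow> real" where
  "mass _ \<epsilon> = (LINT x|lborel. mesa \<epsilon> (x :: 'a))"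

lemma mass_pos: "0 < \<epsilon> \<Longrightarrow> 0 < mass TYPE('a::euclidean_space) \<epsilon>"
proof -
  assume \<epsilon>: "0 < \<epsilon>"
  have i: "integrable lborel (mesa \<epsilon> :: 'a \<Rightarrow> real)"
    using integrable_mesa_mult[of "\<lambda>_. 1::real" \<epsilon>] by simp
  have "mass TYPE('a) \<epsilon> \<noteq> 0"
  proof
    assume "mass TYPE('a) \<epsilon> = 0"
    then have "AE x in lborel. mesa \<epsilon> (x :: 'a) = 0"
      unfolding mass_def using integral_nonneg_eq_0_iff_AE[OF i] mesa_nonneg by auto
    then have "AE x in lebesgue. mesa \<epsilon> (x :: 'a) = 0" by (rule AE_completion)
    then obtain S where S: "S \<in> null_sets lebesgue" "{x :: 'a. mesa \<epsilon> x \<noteq> 0} \<subseteq> S"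
      by (auto simp: eventually_ae_filter)
    have "box (- (\<epsilon> *\<^sub>R One)) (\<epsilon> *\<^sub>R One :: 'a) \<subseteq> S"
      using S(2) box_bump_pos unfolding mesa_def by (force simp: less_le)
    then have "negligible (box (- (\<epsilon> *\<^sub>R One)) (\<epsilon> *\<^sub>R One :: 'a))"
      using S(1) negligible_subset by (auto simp: negligible_iff_null_sets[symmetric])
    moreover have "box (- (\<epsilon> *\<^sub>R One)) (\<epsilon> *\<^sub>R One :: 'a) \<noteq> {}" using \<epsilon> by (auto simp: box_ne_empty)
    ultimately show False using open_not_negligible[OF open_box] by blast
  qed
  moreover have "0 \<le> mass TYPE('a) \<epsilon>" unfolding mass_def by (intro integral_nonneg_AE) (simp add: mesa_nonneg)
  ultimately show ?thesis by simp
qed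

definition mollify :: "real \<Rightarrow> ('a::euclidean_space \<Rightarrow> real) \<Rightarrow> 'a \<Rightarrow> real" where
  "mollify \<epsilon> v x = (LINT w|lborel. mesa \<epsilon> w * v (x - w)) / mass TYPE('a) \<epsilon>"

lemma integral_lborel_reflect:
  fixes f :: "'a::euclidean_space \<Rightarrow> real"
  assumes "f \<in> borel_measurable borel"
  shows "(LINT z|lborel. f z) = (LINT w|lborel. f (x - w))"
proof -
  have e: "lborel = distr lborel borel (\<lambda>w::'a. x + (-1) *\<^sub>R w)"
    using lborel_affine[of "-1" x] by (simp add: density_1)
  have "(LINT z|lborel. f z) = (LINT z|distr lborel borel (\<lambda>w::'a. x + (-1) *\<^sub>R w). f z)" using e by simp
  also have "\<dots> = (LINT w|lborel. f (x + (-1) *\<^sub>R w))" by (rule integral_distr) (use assms in auto)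
  finally show ?thesis by simp
qed

lemma odd_integral_0:
  assumes "0 < \<epsilon>"
  shows "(LINT w|lborel. mesa \<epsilon> (w::'a::euclidean_space) * (g \<bullet> w)) = 0"
proof -
  have "(LINT w|lborel. mesa \<epsilon> w * (g \<bullet> w)) = (LINT w|lborel. mesa \<epsilon> (0 - w) * (g \<bullet> (0 - w)))"
    by (rule integral_lborel_reflect)
       (intro borel_measurable_continuous_onI continuous_intros Ck_continuous[OF Ck_mesa[of 0]])
  then show ?thesis by (simp add: mesa_minus)
qed

context
  fixes \<epsilon> :: real and v :: "'a::euclidean_space \<Rightarrow> real"
  assumes \<epsilon>: "0 < \<epsilon>" and v: "continuous_on UNIV v"
begin

lemma mollify_integrable: "integrable lborel (\<lambda>w. mesa \<epsilon> w * v (x - w))"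
  using integrable_mesa_mult[of "\<lambda>w. v (x - w)" \<epsilon>]
  by (simp add: continuous_on_compose2[OF v] continuous_intros)

lemma mollify_diff:
  "mollify \<epsilon> v x - a = (LINT w|lborel. mesa \<epsilon> w * (v (x - w) - a)) / mass TYPE('a) \<epsilon>"
proof -
  have "(LINT w|lborel. mesa \<epsilon> w * (v (x - w) - a)) = (LINT w|lborel. mesa \<epsilon> w * v (x - w)) - a * mass TYPE('a) \<epsilon>"
    unfolding right_diff_distrib mass_def using mollify_integrable integrable_mesa_mult[of "\<lambda>_. 1::real" \<epsilon>]
    by (subst Bochner_Integration.integral_diff) (auto simp: mult.commute)
  then show ?thesis using mass_pos[OF \<epsilon>, where 'a = 'a] by (simp add: mollify_def diff_divide_distrib)
qed

lemma mollify_close: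
  assumes "\<And>w. norm w \<le> \<epsilon> * real DIM('a) \<Longrightarrow> \<bar>v (x - w) - a\<bar> \<le> C"
  shows "\<bar>mollify \<epsilon> v x - a\<bar> \<le> C"
proof -
  have i1: "integrable lborel (\<lambda>w::'a. mesa \<epsilon> w * C)" "integrable lborel (\<lambda>w. mesa \<epsilon> w * (v (x - w) - a))"
    using integrable_mesa_mult[of "\<lambda>_. C" \<epsilon>] integrable_mesa_mult[of "\<lambda>w. v (x - w) - a" \<epsilon>]
    by (simp_all add: continuous_on_compose2[OF v] continuous_intros)
  have "norm (LINT w|lborel. mesa \<epsilon> w * (v (x - w) - a)) \<le> (LINT w|lborel. mesa \<epsilon> (w::'a) * C)"
  proof (rule Bochner_Integration.integral_norm_bound_integral[OF i1(2,1)])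
    fix w :: 'a
    show "norm (mesa \<epsilon> w * (v (x - w) - a)) \<le> mesa \<epsilon> w * C"
    proof (cases "mesa \<epsilon> w = 0")
      case False
      then have "\<bar>v (x - w) - a\<bar> \<le> C" using mesa_support assms by blast
      then show ?thesis using mesa_nonneg[of \<epsilon> w] by (simp add: abs_mult mult_left_mono)
    qed simp
  qed
  also have "\<dots> = C * mass TYPE('a) \<epsilon>" by (simp add: mass_def mult.commute)
  finally show ?thesis unfolding mollify_diff using mass_pos[OF \<epsilon>, where 'a = 'a] by (simp add: pos_divide_le_eq)
qed

text \<open>The kernel is even, so the linear part integrates to zero and functions that are affine
  near \<open>x\<close> are reproduced exactly, not just approximately.\<close>

lemma mollify_affine:
  assumes "\<And>w. norm w \<le> \<epsilon> * real DIM('a) \<Longrightarrow> v (x - w) = a + g \<bullet> (x - w)"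
  shows "mollify \<epsilon> v x = a + g \<bullet> x"
proof -
  have "(LINT w|lborel. mesa \<epsilon> w * (v (x - w) - (a + g \<bullet> x))) = (LINT w|lborel. - (mesa \<epsilon> w * (g \<bullet> w)))"
  proof (rule Bochner_Integration.integral_cong[OF refl])
    fix w :: 'a
    show "mesa \<epsilon> w * (v (x - w) - (a + g \<bullet> x)) = - (mesa \<epsilon> w * (g \<bullet> w))"
    proof (cases "mesa \<epsilon> w = 0")
      case False
      then have "v (x - w) = a + g \<bullet> (x - w)" using mesa_support assms by blast
      then show ?thesis by (simp add: inner_diff_right)
    qed simp
  qed
  also have "\<dots> = 0" using odd_integral_0[OF \<epsilon>, of g] by simp
  finally show ?thesis using mollify_diff[of x "a + g \<bullet> x"] by simp
qed

text \<open>Reflection of the variable moves \<open>x\<close> into the smooth kernel, and the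
  support of \<open>v\<close> confines the integral to a fixed box.\<close>

lemma mollify_Ck:
  assumes S: "bounded S" "\<And>x. x \<notin> S \<Longrightarrow> v x = 0"
  shows "Ck k (mollify \<epsilon> v)"
proof -
  obtain c where c: "S \<subseteq> cbox (- c) c" using bounded_subset_cbox_symmetric[OF S(1)] by blast
  have m: "continuous_on UNIV (mesa \<epsilon> :: 'a \<Rightarrow> real)" by (rule Ck_continuous[OF Ck_mesa[of 0]])
  have "mollify \<epsilon> v x = (1 / mass TYPE('a) \<epsilon>) * integral (cbox (- c) c) (\<lambda>z. mesa \<epsilon> (x - z) * v z)" for x
  proof -
    have "(LINT w|lborel. mesa \<epsilon> w * v (x - w)) = (LINT w|lborel. mesa \<epsilon> (x - w) * v (x - (x - w)))"
      by (rule integral_lborel_reflect)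
         (intro borel_measurable_continuous_onI continuous_intros m continuous_on_compose2[OF v]; simp)
    also have "\<dots> = (LINT z:cbox (- c) c|lborel. mesa \<epsilon> (x - z) * v z)"
      unfolding set_lebesgue_integral_def
      by (intro Bochner_Integration.integral_cong refl) (use S(2) c in \<open>auto simp: indicator_def subset_iff\<close>)
    also have "\<dots> = integral (cbox (- c) c) (\<lambda>z. mesa \<epsilon> (x - z) * v z)"
    proof (rule set_borel_integral_eq_integral)
      show "set_integrable lborel (cbox (- c) c) (\<lambda>z. mesa \<epsilon> (x - z) * v z)"
        unfolding set_integrable_def
        by (rule borel_integrable_compact[OF compact_cbox])
           (intro continuous_intros continuous_on_compose2[OF m] continuous_on_subset[OF v]; simp)
    qed
    finally show ?thesis by (simp add: mollify_def)
  qed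
  then have e: "mollify \<epsilon> v = (\<lambda>x. (1 / mass TYPE('a) \<epsilon>) * integral (cbox (- c) c) (\<lambda>z. mesa \<epsilon> (x - z) * v z))" by blast
  show ?thesis unfolding e by (intro Ck_mult Ck_const Ck_convolution v Ck_mesa)
qed

lemma mollify_eq_0: "(\<And>w. norm w \<le> \<epsilon> * real DIM('a) \<Longrightarrow> v (x - w) = 0) \<Longrightarrow> mollify \<epsilon> v x = 0"
  using mollify_affine[of x 0 0] by simp

lemma mollify_lipschitz:
  assumes L: "\<And>x y. \<bar>v x - v y\<bar> \<le> L * norm (x - y)"
  shows "\<bar>mollify \<epsilon> v x - mollify \<epsilon> v y\<bar> \<le> L * norm (x - y)"
proof -
  have "norm (LINT w|lborel. mesa \<epsilon> w * v (x - w) - mesa \<epsilon> w * v (y - w)) \<le> (LINT w|lborel. mesa \<epsilon> (w::'a) * (L * norm (x - y)))"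
  proof (rule Bochner_Integration.integral_norm_bound_integral)
    show "integrable lborel (\<lambda>w::'a. mesa \<epsilon> w * (L * norm (x - y)))"
      using integrable_mesa_mult[of "\<lambda>_. L * norm (x - y)" \<epsilon>] by simp
    fix w :: 'a
    have "\<bar>v (x - w) - v (y - w)\<bar> \<le> L * norm (x - y)" using L[of "x - w" "y - w"] by simp
    then show "norm (mesa \<epsilon> w * v (x - w) - mesa \<epsilon> w * v (y - w)) \<le> mesa \<epsilon> w * (L * norm (x - y))"
      unfolding right_diff_distrib[symmetric] using mesa_nonneg[of \<epsilon> w] by (simp add: abs_mult mult_left_mono)
  qed (intro Bochner_Integration.integrable_diff mollify_integrable)
  also have "\<dots> = (L * norm (x - y)) * mass TYPE('a) \<epsilon>" by (simp add: mass_def mult.commute)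
  finally show ?thesis
    using mass_pos[OF \<epsilon>, where 'a = 'a]
    unfolding Bochner_Integration.integral_diff[OF mollify_integrable mollify_integrable]
    by (simp add: mollify_def diff_divide_distrib[symmetric] pos_divide_le_eq)
qed

end

text \<open>Differentiate in the direction of the gradient itself.\<close>

lemma gderiv_norm_le:
  fixes f :: "'a::euclidean_space \<Rightarrow> real"
  assumes g: "GDERIV f x :> g" and L: "\<And>y. \<bar>f y - f x\<bar> \<le> L * norm (y - x)"
  shows "norm g \<le> L"
proof -
  have "((\<lambda>t. f (x + t *\<^sub>R g)) has_derivative (\<lambda>h. (h *\<^sub>R g) \<bullet> g)) (at 0)"
    using g unfolding gderiv_def
    by (intro has_derivative_compose[of "\<lambda>t. x + t *\<^sub>R g" "\<lambda>h. h *\<^sub>R g" 0 UNIV f]) (auto intro!: derivative_eq_intros)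
  moreover have "(\<lambda>h. (h *\<^sub>R g) \<bullet> g) = (*) (g \<bullet> g)" by (auto simp: fun_eq_iff)
  ultimately have "((\<lambda>t. f (x + t *\<^sub>R g)) has_real_derivative (g \<bullet> g)) (at 0)" by (simp only: has_field_derivative_def)
  then have lim: "((\<lambda>h. (f (x + h *\<^sub>R g) - f x) / h) \<longlongrightarrow> g \<bullet> g) (at 0)"
    by (simp add: has_field_derivative_iff)
  have "g \<bullet> g \<le> L * norm g"
  proof (rule tendsto_upperbound[OF lim])
    show "\<forall>\<^sub>F h in at 0. (f (x + h *\<^sub>R g) - f x) / h \<le> L * norm g"
      unfolding eventually_at_filter
    proof (rule always_eventually, intro allI impI)
      fix h :: real assume h: "h \<noteq> 0"
      have "\<bar>(f (x + h *\<^sub>R g) - f x) / h\<bar> \<le> L * norm g"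
        using L[of "x + h *\<^sub>R g"] h by (simp add: divide_le_eq mult_ac)
      then show "(f (x + h *\<^sub>R g) - f x) / h \<le> L * norm g" by linarith
    qed
  qed simp
  then have "norm g * norm g \<le> L * norm g" by (simp add: dot_square_norm power2_eq_square)
  moreover have "0 \<le> L" if "norm g = 0"
  proof -
    obtain b :: 'a where b: "b \<in> Basis" using nonempty_Basis by blast
    show ?thesis using L[of "x + b"] b abs_ge_zero[of "f (x + b) - f x"] by simp
  qed
  ultimately show ?thesis by (cases "norm g = 0") auto
qed

text \<open>Along the segment from \<open>x\<close> to \<open>y\<close> the finitely many closed
  pieces pull back to closed sets covering the parameter interval, and Lipschitz bounds with a
  common constant chain across them.\<close>

lemma lipschitz_via_closed_cover:
  fixes v :: "'a::euclidean_space \<Rightarrow> real"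
  assumes fin: "finite \<C>" and cl: "\<And>K. K \<in> \<C> \<Longrightarrow> closed K" and cov: "\<Union>\<C> = UNIV"
    and L: "\<And>K x y. K \<in> \<C> \<Longrightarrow> x \<in> K \<Longrightarrow> y \<in> K \<Longrightarrow> \<bar>v x - v y\<bar> \<le> L * norm (x - y)" and L0: "0 \<le> L"
  shows "\<bar>v x - v y\<bar> \<le> L * norm (x - y)"
proof -
  define p where "p t = x + t *\<^sub>R (y - x)" for t :: real
  have pc: "continuous_on UNIV p" unfolding p_def by (intro continuous_intros)
  have "(L * norm (x - y))-lipschitz_on {0..1} (\<lambda>t. v (p t))"
  proof (rule lipschitz_on_closed_Union[where I = \<C> and U = "\<lambda>K. p -` K"])
    fix K assume K: "K \<in> \<C>"
    show "closed (p -` K)" using continuous_closed_vimage[OF cl[OF K], of p] pc by (simp add: continuous_on_eq_continuous_at)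
    show "(L * norm (x - y))-lipschitz_on (p -` K) (\<lambda>t. v (p t))"
    proof (rule lipschitz_onI)
      fix t t' assume "t \<in> p -` K" "t' \<in> p -` K"
      then have "\<bar>v (p t) - v (p t')\<bar> \<le> L * norm (p t - p t')" using L[OF K] by simp
      also have "p t - p t' = (t - t') *\<^sub>R (y - x)" by (simp add: p_def algebra_simps)
      finally show "dist (v (p t)) (v (p t')) \<le> L * norm (x - y) * dist t t'"
        by (simp add: dist_real_def norm_minus_commute mult_ac)
    qed (use L0 in simp)
  qed (use fin L0 cov in auto)
  from lipschitz_onD[OF this, of 0 1] show ?thesis by (simp add: p_def dist_real_def)
qed

section \<open>Piecewise linear functions on a triangulation\<close>

locale fe_domain = bounded_domain +
  fixes \<T> :: "'a set set"
  assumes D_convex: "convex D" and D_nonempty: "D \<noteq> {}" and tri: "triangulation_of D \<T>"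
begin

lemma finite_T: "finite \<T>" and T_simplex: "K \<in> \<T> \<Longrightarrow> int DIM('a) simplex K" and Union_T: "\<Union>\<T> = closure D"
  using tri by (auto simp: triangulation_of_def triangulation_def)

lemma T_hull: "K \<in> \<T> \<Longrightarrow> \<exists>C. finite C \<and> K = convex hull C"
  using T_simplex aff_independent_finite unfolding simplex_def by blast

lemma T_closed_convex: "K \<in> \<T> \<Longrightarrow> closed K \<and> convex K"
  using T_hull by (metis compact_convex_hull compact_imp_closed convex_convex_hull finite_imp_compact)

lemma fe_D:
  assumes "v \<in> fe_space D \<T>"
  shows "continuous_on UNIV v" "\<And>x. x \<notin> D \<Longrightarrow> v x = 0" "\<And>K. K \<in> \<T> \<Longrightarrow> \<exists>c g. \<forall>x\<in>K. v x = c + g \<bullet> x"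
  using assms by (auto simp: fe_space_def)

lemma fe_subspace: "fun_subspace (fe_space D \<T>)"
  unfolding fun_subspace_def
proof (intro conjI ballI allI)
  show "(\<lambda>_. 0) \<in> fe_space D \<T>" by (auto simp: fe_space_def intro!: exI[of _ 0])
  fix v assume v: "v \<in> fe_space D \<T>"
  show "(\<lambda>x. c * v x) \<in> fe_space D \<T>" for c
    unfolding fe_space_def
  proof (intro CollectI conjI allI impI ballI)
    show "continuous_on UNIV (\<lambda>x. c * v x)" by (intro continuous_intros fe_D(1)[OF v])
    show "c * v x = 0" if "x \<notin> D" for x using fe_D(2)[OF v that] by simp
    fix K assume "K \<in> \<T>"
    then obtain a g where "\<forall>x\<in>K. v x = a + g \<bullet> x" using fe_D(3)[OF v] by blast
    then show "\<exists>a g. \<forall>x\<in>K. c * v x = a + g \<bullet> x"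
      by (intro exI[of _ "c * a"] exI[of _ "c *\<^sub>R g"]) (simp add: distrib_left)
  qed
  fix w assume w: "w \<in> fe_space D \<T>"
  show "(\<lambda>x. v x + w x) \<in> fe_space D \<T>"
    unfolding fe_space_def
  proof (intro CollectI conjI allI impI ballI)
    show "continuous_on UNIV (\<lambda>x. v x + w x)" by (intro continuous_intros fe_D(1)[OF v] fe_D(1)[OF w])
    show "v x + w x = 0" if "x \<notin> D" for x using fe_D(2)[OF v that] fe_D(2)[OF w that] by simp
    fix K assume K: "K \<in> \<T>"
    obtain a g where 1: "\<forall>x\<in>K. v x = a + g \<bullet> x" using fe_D(3)[OF v K] by blast
    obtain a' g' where 2: "\<forall>x\<in>K. w x = a' + g' \<bullet> x" using fe_D(3)[OF w K] by blast
    from 1 2 show "\<exists>a g. \<forall>x\<in>K. v x + w x = a + g \<bullet> x"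
      by (intro exI[of _ "a + a'"] exI[of _ "g + g'"]) (simp add: inner_add_left)
  qed
qed

text \<open>An affine function that vanishes on a generating set of a simplex vanishes on the
  simplex. The finite union of these generating sets is the determining set required by
  \<open>orthonormal_basis_exists\<close>.\<close>

lemma fe_determined:
  "\<exists>X. finite X \<and> (\<forall>v\<in>fe_space D \<T>. (\<forall>x\<in>X. v x = 0) \<longrightarrow> v = (\<lambda>_. 0))"
proof -
  have "\<forall>K\<in>\<T>. \<exists>C. finite C \<and> K = convex hull C" using T_hull by blast
  then obtain C where C: "\<And>K. K \<in> \<T> \<Longrightarrow> finite (C K)" "\<And>K. K \<in> \<T> \<Longrightarrow> K = convex hull (C K)"
    by (metis (no_types))
  show ?thesis
  proof (intro exI[of _ "\<Union>K\<in>\<T>. C K"] conjI ballI impI)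
    show "finite (\<Union>K\<in>\<T>. C K)" using finite_T C(1) by blast
    fix v assume v: "v \<in> fe_space D \<T>" and 0: "\<forall>x\<in>\<Union>K\<in>\<T>. C K. v x = 0"
    show "v = (\<lambda>_. 0)"
    proof
      fix x
      show "v x = 0"
      proof (cases "x \<in> D")
        case True
        then have "x \<in> \<Union>\<T>" using Union_T closure_subset by blast
        then obtain K where K: "K \<in> \<T>" "x \<in> K" by blast
        obtain a g where ag: "\<forall>x\<in>K. v x = a + g \<bullet> x" using fe_D(3)[OF v K(1)] by blast
        have sub: "C K \<subseteq> K" using C(2)[OF K(1)] hull_subset[of "C K" convex] by blast
        have "C K \<subseteq> {y. g \<bullet> y = - a}"
        proof
          fix y assume "y \<in> C K"
          then have "a + g \<bullet> y = 0" using 0 ag sub K(1) by force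
          then show "y \<in> {y. g \<bullet> y = - a}" by simp
        qed
        then have "convex hull (C K) \<subseteq> {y. g \<bullet> y = - a}" by (rule hull_minimal) (rule convex_hyperplane)
        then have "g \<bullet> x = - a" using K C(2)[OF K(1)] by blast
        then show ?thesis using ag K(2) by simp
      qed (rule fe_D(2)[OF v])
    qed
  qed
qed

text \<open>The complement of the open set \<open>D\<close> joins the simplices as one more closed
  piece, on which the function is zero.\<close>

lemma fe_lipschitz:
  assumes v: "v \<in> fe_space D \<T>"
  shows "\<exists>L\<ge>0. \<forall>x y. \<bar>v x - v y\<bar> \<le> L * norm (x - y)"
proof -
  have "\<forall>K\<in>\<T>. \<exists>g. \<forall>x\<in>K. \<forall>y\<in>K. v x - v y = g \<bullet> (x - y)"
  proof
    fix K assume "K \<in> \<T>"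
    then obtain a g where "\<forall>x\<in>K. v x = a + g \<bullet> x" using fe_D(3)[OF v] by blast
    then show "\<exists>g. \<forall>x\<in>K. \<forall>y\<in>K. v x - v y = g \<bullet> (x - y)" by (intro exI[of _ g]) (simp add: inner_diff_right)
  qed
  then obtain g where g: "\<And>K. K \<in> \<T> \<Longrightarrow> \<forall>x\<in>K. \<forall>y\<in>K. v x - v y = g K \<bullet> (x - y)" by (metis (no_types))
  define L where "L = (\<Sum>K\<in>\<T>. norm (g K))"
  have L0: "0 \<le> L" unfolding L_def by (intro sum_nonneg) simp
  have gL: "norm (g K) \<le> L" if "K \<in> \<T>" for K
    unfolding L_def using that finite_T by (intro member_le_sum) auto
  have "\<bar>v x - v y\<bar> \<le> L * norm (x - y)" for x y
  proof (rule lipschitz_via_closed_cover[where \<C> = "insert (- D) \<T>"])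
    show "finite (insert (- D) \<T>)" using finite_T by simp
    show "closed K" if "K \<in> insert (- D) \<T>" for K using that T_closed_convex D_open by auto
    show "\<Union>(insert (- D) \<T>) = UNIV" using Union_T closure_subset by auto
    fix K x y assume K: "K \<in> insert (- D) \<T>" and xy: "x \<in> K" "y \<in> K"
    show "\<bar>v x - v y\<bar> \<le> L * norm (x - y)"
    proof (cases "K \<in> \<T>")
      case True
      have "\<bar>v x - v y\<bar> = \<bar>g K \<bullet> (x - y)\<bar>" using g[OF True] xy by simp
      also have "\<dots> \<le> norm (g K) * norm (x - y)" by (rule Cauchy_Schwarz_ineq2)
      also have "\<dots> \<le> L * norm (x - y)" using gL[OF True] by (intro mult_right_mono) auto
      finally show ?thesis .
    next
      case False
      then have "K = - D" using K by simp
      then show ?thesis using xy fe_D(2)[OF v] L0 by simp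
    qed
  qed (rule L0)
  then show ?thesis using L0 by blast
qed

lemma AE_interior: "AE x in M. \<exists>K\<in>\<T>. x \<in> interior K"
proof -
  have "negligible (\<Union>K\<in>\<T>. frontier K)"
    by (rule negligible_Union) (use finite_T T_closed_convex negligible_convex_frontier in auto)
  then have "AE x in lebesgue. x \<notin> (\<Union>K\<in>\<T>. frontier K)" by (intro AE_not_in) (simp add: negligible_iff_null_sets)
  then show ?thesis unfolding AE_M_iff
  proof (rule AE_mp, intro AE_I2 impI)
    fix x assume n: "x \<notin> (\<Union>K\<in>\<T>. frontier K)" and "x \<in> D"
    then have "x \<in> \<Union>\<T>" using Union_T closure_subset by blast
    then obtain K where K: "K \<in> \<T>" "x \<in> K" by blast
    then have "x \<in> interior K" using n closure_subset[of K] by (auto simp: frontier_def)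
    then show "\<exists>K\<in>\<T>. x \<in> interior K" using K by blast
  qed
qed

end

context fe_domain
begin

lemma dilation_affine:
  assumes "v (x0 + t *\<^sub>R (z - x0)) = a + g \<bullet> (x0 + t *\<^sub>R (z - x0))"
  shows "v (x0 + t *\<^sub>R (z - x0)) = (a + g \<bullet> (x0 - t *\<^sub>R x0)) + (t *\<^sub>R g) \<bullet> z"
  unfolding assms by (simp add: inner_add_right inner_diff_right scaleR_diff_right)

text \<open>Dilating about an interior point moves the support of a finite element function into \<open>D\<close>, so
  that it can be mollified there.\<close>

lemma fe_approx:
  assumes v: "v \<in> fe_space D \<T>"
  shows "\<exists>\<phi> B. approx v \<phi> B"
proof -
  obtain x0 where x0: "x0 \<in> D" using D_nonempty by blast
  obtain L where L: "0 \<le> L" "\<And>x y. \<bar>v x - v y\<bar> \<le> L * norm (x - y)" using fe_lipschitz[OF v] by blast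
  define t where "t k = 1 + 1 / real (Suc k)" for k
  have t: "1 < t k" "t k \<le> 2" for k by (auto simp: t_def field_simps)
  have tlim: "t \<longlonglongrightarrow> 1" unfolding t_def by real_asymp
  define p where "p k x = x0 + t k *\<^sub>R (x - x0)" for k x
  define w where "w k x = v (p k x)" for k x
  have pd: "p k x - p k y = t k *\<^sub>R (x - y)" for k x y by (simp add: p_def scaleR_diff_right)
  have wc: "continuous_on UNIV (w k)" for k
    unfolding w_def p_def by (intro continuous_on_compose2[OF fe_D(1)[OF v]] continuous_intros) auto
  have wL: "\<bar>w k x - w k y\<bar> \<le> (2 * L) * norm (x - y)" for k x y
  proof -
    have "\<bar>w k x - w k y\<bar> \<le> L * norm (p k x - p k y)" unfolding w_def by (rule L(2))
    also have "\<dots> = t k * (L * norm (x - y))" unfolding pd using t(1)[of k] by simp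
    also have "\<dots> \<le> 2 * (L * norm (x - y))" using t(2)[of k] L(1) by (intro mult_right_mono) auto
    finally show ?thesis by simp
  qed
  \<comment> \<open>The dilated function \<open>w k\<close> lives on the closure of \<open>D\<close>
    shrunk towards \<open>x0\<close>, and convexity places this compact set inside the open set
    \<open>D\<close>.\<close>
  define S where "S k = (\<lambda>x. x0 + (1 / t k) *\<^sub>R (x - x0)) ` closure D" for k
  have SD: "S k \<subseteq> D" for k
  proof
    fix y assume "y \<in> S k"
    then obtain x where x: "x \<in> closure D" "y = x0 + (1 / t k) *\<^sub>R (x - x0)" unfolding S_def by blast
    have "x - (1 - 1 / t k) *\<^sub>R (x - x0) \<in> interior D"
      by (rule mem_interior_closure_convex_shrink[OF D_convex]) (use x0 x t[of k] D_open in \<open>auto simp: interior_open\<close>)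
    moreover have "x - (1 - 1 / t k) *\<^sub>R (x - x0) = y" unfolding x(2) by (simp add: algebra_simps)
    ultimately show "y \<in> D" using interior_subset by blast
  qed
  have Sc: "compact (S k)" for k
    unfolding S_def by (rule compact_continuous_image) (use D_bounded in \<open>auto intro!: continuous_intros simp: compact_closure\<close>)
  have S0: "w k x = 0" if "x \<notin> S k" for k x
  proof -
    have "p k x \<notin> D"
    proof
      assume "p k x \<in> D"
      then have "p k x \<in> closure D" using closure_subset by blast
      moreover have "x = x0 + (1 / t k) *\<^sub>R (p k x - x0)" unfolding p_def using t(1)[of k] by simp
      ultimately show False using that unfolding S_def by blast
    qed
    then show ?thesis unfolding w_def by (rule fe_D(2)[OF v])
  qed
  have "\<exists>e>0. (\<Union>x\<in>S k. cball x e) \<subseteq> D" for k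
  proof -
    obtain e where e: "e > 0" "(\<Union>x\<in>S k. ball x e) \<subseteq> D"
      using compact_subset_open_imp_ball_epsilon_subset[OF Sc D_open SD] by blast
    have "(\<Union>x\<in>S k. cball x (e / 2)) \<subseteq> (\<Union>x\<in>S k. ball x e)" using e(1) by (intro UN_mono) auto
    then show ?thesis using e by (intro exI[of _ "e / 2"]) auto
  qed
  then obtain e where e: "\<And>k. 0 < e k" "\<And>k. (\<Union>x\<in>S k. cball x (e k)) \<subseteq> D" by metis
  define n where "n = real DIM('a)"
  have n: "0 < n" by (simp add: n_def)
  \<comment> \<open>The kernel with parameter \<epsilon> is supported in the ball of radius
    \<epsilon> times the dimension, hence the division by \<open>n\<close>. The bound by
    \<open>e k\<close> keeps the support in \<open>D\<close>, the other one makes the mollification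
    error vanish in the limit.\<close>
  define \<epsilon> where "\<epsilon> k = min (e k) (1 / real (Suc k)) / n" for k
  have \<epsilon>: "0 < \<epsilon> k" "\<epsilon> k * n \<le> e k" "\<epsilon> k * n \<le> 1 / real (Suc k)" for k
    using e(1)[of k] n by (simp_all add: \<epsilon>_def)
  define \<phi> where "\<phi> k = mollify (\<epsilon> k) (w k)" for k
  have CkU: "Ck m (\<phi> k)" for m k
    unfolding \<phi>_def by (rule mollify_Ck[OF \<epsilon>(1) wc compact_imp_bounded[OF Sc] S0])
  have test: "\<phi> k \<in> test_functions D" for k
  proof (rule test_functionsI)
    show "compact (\<Union>x\<in>S k. cball x (e k))"
      by (rule compact_minkowski_sum_cball[OF Sc])
    show "(\<Union>x\<in>S k. cball x (e k)) \<subseteq> D" by (rule e(2))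
    show "\<phi> k x = 0" if x: "x \<notin> (\<Union>x\<in>S k. cball x (e k))" for x
      unfolding \<phi>_def
    proof (rule mollify_eq_0[OF \<epsilon>(1) wc])
      fix u :: 'a assume "norm u \<le> \<epsilon> k * real DIM('a)"
      then have u: "norm u \<le> e k" using \<epsilon>(2)[of k] by (simp add: n_def)
      have "x - u \<notin> S k"
      proof
        assume "x - u \<in> S k"
        moreover have "x \<in> cball (x - u) (e k)" using u by (simp add: dist_norm)
        ultimately show False using x by blast
      qed
      then show "w k (x - u) = 0" by (rule S0)
    qed
  qed (rule CkU)
  have close: "\<bar>\<phi> k x - v x\<bar> \<le> (2 * L + L * norm (x - x0)) * (1 / real (Suc k))" for k x
  proof -
    have 1: "\<bar>\<phi> k x - w k x\<bar> \<le> 2 * L * (1 / real (Suc k))"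
      unfolding \<phi>_def
    proof (rule mollify_close[OF \<epsilon>(1) wc])
      fix u :: 'a assume "norm u \<le> \<epsilon> k * real DIM('a)"
      then have u: "norm u \<le> 1 / real (Suc k)" using \<epsilon>(3)[of k] by (simp add: n_def)
      have "\<bar>w k (x - u) - w k x\<bar> \<le> 2 * L * norm u" using wL[of k "x - u" x] by simp
      also have "\<dots> \<le> 2 * L * (1 / real (Suc k))" using u L(1) by (intro mult_left_mono) auto
      finally show "\<bar>w k (x - u) - w k x\<bar> \<le> 2 * L * (1 / real (Suc k))" .
    qed
    have "p k x - x = (1 / real (Suc k)) *\<^sub>R (x - x0)" unfolding p_def t_def by (simp add: algebra_simps)
    then have "\<bar>w k x - v x\<bar> \<le> L * norm (x - x0) * (1 / real (Suc k))"
      using L(2)[of "p k x" x] unfolding w_def by simp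
    then show ?thesis using 1 by (simp only: distrib_right)
  qed
  have lim: "(\<lambda>k. \<phi> k x) \<longlonglongrightarrow> v x" for x
  proof -
    have "(\<lambda>k. (2 * L + L * norm (x - x0)) * (1 / real (Suc k))) \<longlonglongrightarrow> 0" by real_asymp
    then have "(\<lambda>k. \<phi> k x - v x) \<longlonglongrightarrow> 0"
      by (rule Lim_null_comparison[rotated]) (use close in auto)
    then show ?thesis by (simp add: LIM_zero_iff)
  qed
  obtain R where R: "\<And>x. x \<in> D \<Longrightarrow> norm x \<le> R" using D_bounded unfolding bounded_iff by blast
  obtain V where V: "\<And>x. \<bar>v x\<bar> \<le> V"
  proof -
    have "\<bar>v x\<bar> \<le> \<bar>v x0\<bar> + L * (2 * R)" for x
    proof (cases "x \<in> D")
      case True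
      have "norm (x - x0) \<le> 2 * R" using R[OF True] R[OF x0] norm_triangle_ineq4[of x x0] by linarith
      then have "\<bar>v x - v x0\<bar> \<le> L * (2 * R)" using L(2)[of x x0] mult_left_mono[OF _ L(1)] by fastforce
      then show ?thesis by linarith
    next
      case False
      have "0 \<le> R" using R[OF x0] norm_ge_zero[of x0] by linarith
      then show ?thesis using fe_D(2)[OF v False] L(1) by simp
    qed
    then show ?thesis using that by blast
  qed
  have bound: "\<bar>\<phi> k x\<bar> \<le> V" for k x
    using mollify_close[OF \<epsilon>(1) wc, of k k x 0 V] V unfolding \<phi>_def w_def by simp
  have gbound: "norm (gr (\<phi> k) x) \<le> 2 * L" for k x
  proof (rule gderiv_norm_le)
    show "GDERIV (\<phi> k) x :> gr (\<phi> k) x" by (rule GDERIV_gr[OF CkU])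
    show "\<bar>\<phi> k y - \<phi> k x\<bar> \<le> 2 * L * norm (y - x)" for y
      unfolding \<phi>_def by (rule mollify_lipschitz[OF \<epsilon>(1) wc wL])
  qed
  \<comment> \<open>At an interior point of a simplex the dilated function is affine nearby for
    large \<open>k\<close> and mollification reproduces it there, so the gradient is exactly
    \<open>t k *\<^sub>R g\<close>.\<close>
  have conv: "AE x in M. convergent (\<lambda>k. gr (\<phi> k) x)"
    using AE_interior
  proof eventually_elim
    case (elim x)
    then obtain K where K: "K \<in> \<T>" "x \<in> interior K" by blast
    obtain a g where ag: "\<And>x. x \<in> K \<Longrightarrow> v x = a + g \<bullet> x" using fe_D(3)[OF v K(1)] by blast
    obtain r where r: "r > 0" "ball x r \<subseteq> K" using K(2) unfolding mem_interior by blast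
    have "(\<lambda>k. norm (p k x - x) + 2 * (r / 4 + 1 / real (Suc k))) \<longlonglongrightarrow> r / 2"
    proof -
      have e: "norm (p k x - x) = norm (x - x0) * (1 / real (Suc k))" for k
        unfolding p_def t_def by (simp add: algebra_simps flip: scaleR_diff_right)
      show ?thesis unfolding e by real_asymp
    qed
    then have "eventually (\<lambda>k. norm (p k x - x) + 2 * (r / 4 + 1 / real (Suc k)) < r) sequentially"
      by (rule order_tendstoD(2)) (use r(1) in simp)
    then have ev: "eventually (\<lambda>k. gr (\<phi> k) x = t k *\<^sub>R g) sequentially"
    proof eventually_elim
      case (elim k)
      have aff: "\<phi> k y = (a + g \<bullet> (x0 - t k *\<^sub>R x0)) + (t k *\<^sub>R g) \<bullet> y" if y: "y \<in> ball x (r / 4)" for y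
        unfolding \<phi>_def
      proof (rule mollify_affine[OF \<epsilon>(1) wc])
        fix u :: 'a assume "norm u \<le> \<epsilon> k * real DIM('a)"
        then have u: "norm u \<le> 1 / real (Suc k)" using \<epsilon>(3)[of k] by (simp add: n_def)
        have "norm (p k (y - u) - x) \<le> norm (p k (y - u) - p k x) + norm (p k x - x)"
          using norm_triangle_ineq[of "p k (y - u) - p k x" "p k x - x"] by simp
        also have "norm (p k (y - u) - p k x) = t k * norm (y - u - x)" unfolding pd using t(1)[of k] by simp
        also have "\<dots> \<le> 2 * (norm (y - x) + norm u)"
        proof (intro mult_mono t)
          show "norm (y - u - x) \<le> norm (y - x) + norm u" using norm_triangle_ineq4[of "y - x" u] by (simp add: algebra_simps)
        qed auto
        also have "\<dots> \<le> 2 * (r / 4 + 1 / real (Suc k))" using y u by (intro mult_left_mono add_mono) (auto simp: dist_norm norm_minus_commute)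
        finally have "norm (p k (y - u) - x) < r" using elim by linarith
        then have "p k (y - u) \<in> ball x r" by (simp add: dist_norm norm_minus_commute)
        then have "p k (y - u) \<in> K" using r(2) by blast
        from ag[OF this]
        show "w k (y - u) = (a + g \<bullet> (x0 - t k *\<^sub>R x0)) + (t k *\<^sub>R g) \<bullet> (y - u)"
          unfolding w_def p_def by (rule dilation_affine)
      qed
      have "GDERIV (\<phi> k) x :> t k *\<^sub>R g"
        unfolding gderiv_def
      proof (rule has_derivative_transform_within_open[where s = "ball x (r / 4)"])
        show "((\<lambda>y. (a + g \<bullet> (x0 - t k *\<^sub>R x0)) + (t k *\<^sub>R g) \<bullet> y) has_derivative (\<lambda>h. h \<bullet> (t k *\<^sub>R g))) (at x)"
          by (auto intro!: derivative_eq_intros simp: inner_commute)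
        show "x \<in> ball x (r / 4)" using r(1) by simp
      qed (use aff in auto)
      then show ?case by (rule gr_eqI)
    qed
    have "(\<lambda>k. t k *\<^sub>R g) \<longlonglongrightarrow> 1 *\<^sub>R g" by (intro tendsto_intros tlim)
    then have "(\<lambda>k. gr (\<phi> k) x) \<longlonglongrightarrow> 1 *\<^sub>R g" using tendsto_cong[OF ev] by blast
    then show ?case by (rule convergentI)
  qed
  have "approx v \<phi> (max V (2 * L))"
    unfolding approx_def using test lim bound gbound conv by (auto simp: max.coboundedI1 max.coboundedI2)
  then show ?thesis by blast
qed

end

section \<open>The Galerkin system\<close>

lemma (in bounded_domain) continuous_AE_0_imp_0:
  fixes v :: "'a \<Rightarrow> real"
  assumes v: "continuous_on UNIV v" and 0: "\<And>x. x \<notin> D \<Longrightarrow> v x = 0" and ae: "AE x in M. v x = 0"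
  shows "v = (\<lambda>_. 0)"
proof -
  have "open (v -` (- {0}))" using v by (intro open_vimage) auto
  moreover have "AE x in lebesgue. v x = 0" using ae unfolding AE_M_iff by eventually_elim (use 0 in blast)
  then obtain S where S: "S \<in> null_sets lebesgue" "{x. v x \<noteq> 0} \<subseteq> S" by (auto simp: eventually_ae_filter)
  then have "negligible {x. v x \<noteq> 0}"
    using negligible_subset by (auto simp: negligible_iff_null_sets[symmetric])
  then have "negligible (v -` (- {0}))" by (rule negligible_subset) auto
  ultimately have "v -` (- {0}) = {}" using open_not_negligible by blast
  then show ?thesis by auto
qed

context fe_domain
begin

abbreviation "V \<equiv> fe_space D \<T>"

lemma fe_grad_measurable: "v \<in> V \<Longrightarrow> grad D v \<in> borel_measurable M"
  using fe_approx approx_grad_measurable by blast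

lemma fe_grad_bound: "v \<in> V \<Longrightarrow> \<exists>B\<ge>0. AE x in M. norm (grad D v x) \<le> B"
  using fe_approx approx_grad_bound approx_bound_nonneg by blast

lemma fe_H10: "v \<in> V \<Longrightarrow> v \<in> H10 D"
  using fe_approx approx_H10 by blast

section \<open>Energy forms with essentially bounded coefficients\<close>

definition ess_bounded :: "('a \<Rightarrow> real) \<Rightarrow> bool" where
  "ess_bounded A \<longleftrightarrow> A \<in> borel_measurable M \<and> (\<exists>C. AE x in M. \<bar>A x\<bar> \<le> C)"

lemma ess_bounded_const: "ess_bounded (\<lambda>_. c)"
  unfolding ess_bounded_def by (auto intro!: exI[of _ "\<bar>c\<bar>"])

lemma ess_bounded_lin: "ess_bounded A \<Longrightarrow> ess_bounded A' \<Longrightarrow> ess_bounded (\<lambda>x. A x + c * A' x)"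
proof -
  assume "ess_bounded A" and "ess_bounded A'"
  then obtain C C' where m: "A \<in> borel_measurable M" "A' \<in> borel_measurable M"
    and b: "AE x in M. \<bar>A x\<bar> \<le> C" "AE x in M. \<bar>A' x\<bar> \<le> C'"
    unfolding ess_bounded_def by blast
  have "AE x in M. \<bar>A x + c * A' x\<bar> \<le> C + \<bar>c\<bar> * C'"
    using b
  proof eventually_elim
    case (elim x)
    then have "\<bar>c\<bar> * \<bar>A' x\<bar> \<le> \<bar>c\<bar> * C'" by (intro mult_left_mono) auto
    then show ?case using elim(1) abs_triangle_ineq[of "A x" "c * A' x"] by (simp add: abs_mult)
  qed
  moreover have "(\<lambda>x. A x + c * A' x) \<in> borel_measurable M" using m by measurable
  ultimately show ?thesis unfolding ess_bounded_def by blast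
qed

lemma ess_bounded_scale: "ess_bounded A \<Longrightarrow> ess_bounded (\<lambda>x. c * A x)"
  using ess_bounded_lin[OF ess_bounded_const[of 0], of A c] by simp

lemma ess_bounded_abs: "ess_bounded A \<Longrightarrow> ess_bounded (\<lambda>x. \<bar>A x\<bar>)"
  unfolding ess_bounded_def by auto

lemma ess_bounded_sum:
  assumes "finite J" "\<And>j. j \<in> J \<Longrightarrow> ess_bounded (A j)"
  shows "ess_bounded (\<lambda>x. \<Sum>j\<in>J. A j x)"
  using assms
proof (induction J rule: finite_induct)
  case empty
  then show ?case using ess_bounded_const[of 0] by simp
next
  case (insert j J)
  then show ?case using ess_bounded_lin[of "A j" "\<lambda>x. \<Sum>j\<in>J. A j x" 1] by simp
qed

definition cform :: "('a \<Rightarrow> real) \<Rightarrow> ('a \<Rightarrow> real) \<Rightarrow> ('a \<Rightarrow> real) \<Rightarrow> real" where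
  "cform A v w = (LINT x|M. A x * (grad D v x \<bullet> grad D w x))"

lemma cform_integrable:
  assumes A: "ess_bounded A" and v: "v \<in> V" and w: "w \<in> V"
  shows "integrable M (\<lambda>x. A x * (grad D v x \<bullet> grad D w x))"
proof -
  obtain C where Am: "A \<in> borel_measurable M" and C: "AE x in M. \<bar>A x\<bar> \<le> C" using A unfolding ess_bounded_def by blast
  obtain B where B: "0 \<le> B" "AE x in M. norm (grad D v x) \<le> B" using fe_grad_bound[OF v] by blast
  obtain B' where B': "0 \<le> B'" "AE x in M. norm (grad D w x) \<le> B'" using fe_grad_bound[OF w] by blast
  show ?thesis
  proof (rule integrable_bounded)
    show "(\<lambda>x. A x * (grad D v x \<bullet> grad D w x)) \<in> borel_measurable M"
      using Am fe_grad_measurable[OF v] fe_grad_measurable[OF w] by measurable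
    show "AE x in M. norm (A x * (grad D v x \<bullet> grad D w x)) \<le> C * (B * B')"
      using C B(2) B'(2)
    proof eventually_elim
      case (elim x)
      have "\<bar>grad D v x \<bullet> grad D w x\<bar> \<le> norm (grad D v x) * norm (grad D w x)" by (rule Cauchy_Schwarz_ineq2)
      also have "\<dots> \<le> B * B'" using elim B(1) by (intro mult_mono) auto
      finally show ?case using elim(1) unfolding real_norm_def abs_mult by (intro mult_mono) auto
    qed
  qed
qed

lemma cform_sym: "cform A v w = cform A w v"
  by (simp add: cform_def inner_commute)

lemma cform_lin_left:
  assumes A: "ess_bounded A" and u: "u \<in> V" and v: "v \<in> V" and w: "w \<in> V"
  shows "cform A (\<lambda>x. u x + c * v x) w = cform A u w + c * cform A v w"
proof -
  obtain \<phi> B where a: "approx u \<phi> B" using fe_approx[OF u] by blast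
  obtain \<xi> C where b: "approx v \<xi> C" using fe_approx[OF v] by blast
  have uv: "(\<lambda>x. u x + c * v x) \<in> V" using fe_subspace u v by (intro fun_subspace_add fun_subspace_scale)
  note i = cform_integrable[OF A u w] cform_integrable[OF A v w] cform_integrable[OF A uv w]
  have "cform A (\<lambda>x. u x + c * v x) w
      = (LINT x|M. A x * (grad D u x \<bullet> grad D w x) + c * (A x * (grad D v x \<bullet> grad D w x)))"
    unfolding cform_def
  proof (rule integral_cong_AE)
    show "AE x in M. A x * (grad D (\<lambda>x. u x + c * v x) x \<bullet> grad D w x)
        = A x * (grad D u x \<bullet> grad D w x) + c * (A x * (grad D v x \<bullet> grad D w x))"
      using grad_lin[OF a b, of c] by eventually_elim (simp add: inner_add_left algebra_simps)
  qed (use i in \<open>auto simp: borel_measurable_integrable\<close>)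
  then show ?thesis using i unfolding cform_def by simp
qed

lemma bilinear_cform: "ess_bounded A \<Longrightarrow> bilinear_on V (cform A)"
proof -
  assume A: "ess_bounded A"
  have z: "(\<lambda>_. 0) \<in> V" by (rule fun_subspace_zero[OF fe_subspace])
  have add: "cform A (\<lambda>x. u x + v x) w = cform A u w + cform A v w" if "u \<in> V" "v \<in> V" "w \<in> V" for u v w
    using cform_lin_left[OF A that, of 1] by simp
  have "cform A (\<lambda>_. 0) w = 0" if "w \<in> V" for w using add[OF z z that] by simp
  then have scale: "cform A (\<lambda>x. c * v x) w = c * cform A v w" if "v \<in> V" "w \<in> V" for c v w
    using cform_lin_left[OF A z that, of c] that by simp
  show ?thesis
    unfolding bilinear_on_def using add scale cform_sym[of A] by (metis (no_types, lifting))
qed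

lemma cform_lin_coeff:
  assumes "ess_bounded A" "ess_bounded A'" and v: "v \<in> V" "w \<in> V"
  shows "cform (\<lambda>x. A x + c * A' x) v w = cform A v w + c * cform A' v w"
  unfolding cform_def using cform_integrable[OF assms(1) v] cform_integrable[OF assms(2) v]
  by (simp add: distrib_right mult.assoc)

lemma cform_sum_coeff:
  assumes "finite J" "\<And>j. j \<in> J \<Longrightarrow> ess_bounded (A j)" and v: "v \<in> V" "w \<in> V"
  shows "cform (\<lambda>x. \<Sum>j\<in>J. A j x) v w = (\<Sum>j\<in>J. cform (A j) v w)"
  unfolding cform_def sum_distrib_right
  by (rule Bochner_Integration.integral_sum) (use cform_integrable[OF assms(2) v] in auto)

lemma cform_mono:
  assumes A: "ess_bounded A" "ess_bounded A'" and v: "v \<in> V" and le: "AE x in M. A x \<le> A' x"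
  shows "cform A v v \<le> cform A' v v"
  unfolding cform_def
proof (rule integral_mono_AE[OF cform_integrable[OF A(1) v v] cform_integrable[OF A(2) v v]])
  show "AE x in M. A x * (grad D v x \<bullet> grad D v x) \<le> A' x * (grad D v x \<bullet> grad D v x)"
    using le by eventually_elim (simp add: mult_right_mono)
qed

text \<open>The mean inequality is applied pointwise under the integral, so the weight given by the
  absolute value of the coefficient is retained. This is the source of the locale assumption
  \<open>P_le\<close>.\<close>

lemma cform_abs_le:
  assumes A: "ess_bounded A" and v: "v \<in> V" "w \<in> V"
  shows "\<bar>cform A v w\<bar> \<le> (cform (\<lambda>x. \<bar>A x\<bar>) v v + cform (\<lambda>x. \<bar>A x\<bar>) w w) / 2"
proof -
  note a = ess_bounded_abs[OF A]
  let ?h = "\<lambda>x. (\<bar>A x\<bar> * (grad D v x \<bullet> grad D v x) + \<bar>A x\<bar> * (grad D w x \<bullet> grad D w x)) / 2"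
  have i: "integrable M ?h" using cform_integrable[OF a v(1,1)] cform_integrable[OF a v(2,2)] by auto
  have "norm (cform A v w) \<le> (LINT x|M. ?h x)"
    unfolding cform_def
  proof (rule Bochner_Integration.integral_norm_bound_integral[OF cform_integrable[OF A v] i])
    fix x
    let ?g = "grad D v x" and ?k = "grad D w x"
    have "0 \<le> (?g - ?k) \<bullet> (?g - ?k)" "0 \<le> (?g + ?k) \<bullet> (?g + ?k)" by simp_all
    then have "\<bar>?g \<bullet> ?k\<bar> \<le> (?g \<bullet> ?g + ?k \<bullet> ?k) / 2" by (simp add: inner_simps inner_commute abs_le_iff)
    then have "\<bar>A x\<bar> * \<bar>?g \<bullet> ?k\<bar> \<le> \<bar>A x\<bar> * ((?g \<bullet> ?g + ?k \<bullet> ?k) / 2)" by (intro mult_left_mono) auto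
    then show "norm (A x * (?g \<bullet> ?k)) \<le> ?h x" by (simp add: abs_mult distrib_left)
  qed
  also have "(LINT x|M. ?h x) = (cform (\<lambda>x. \<bar>A x\<bar>) v v + cform (\<lambda>x. \<bar>A x\<bar>) w w) / 2"
    unfolding cform_def using cform_integrable[OF a v(1,1)] cform_integrable[OF a v(2,2)] by simp
  finally show ?thesis by simp
qed

abbreviation "ip \<equiv> cform (\<lambda>_. 1)"

lemma ip_eq: "ip v v = (LINT x|M. (norm (grad D v x))\<^sup>2)"
  by (simp add: cform_def dot_square_norm)

lemma H10_norm_eq: "H10_norm D v = sqrt (ip v v)"
  by (simp add: H10_norm_def ip_eq)

lemma fe_poincare:
  assumes v: "v \<in> V" and R: "\<And>x. x \<in> D \<Longrightarrow> norm x \<le> R" "0 < R"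
  shows "(LINT x|M. (v x)\<^sup>2) \<le> 4 * R\<^sup>2 * ip v v"
  using fe_approx[OF v] poincare[OF _ R] unfolding ip_eq by blast

lemma fe_L2_integrable: "v \<in> V \<Longrightarrow> integrable M (\<lambda>x. (v x)\<^sup>2)"
proof -
  assume "v \<in> V"
  then obtain \<phi> B where a: "approx v \<phi> B" using fe_approx by blast
  show ?thesis
  proof (rule integrable_bounded[where B = "B\<^sup>2"])
    show "(\<lambda>x. (v x)\<^sup>2) \<in> borel_measurable M" using approx_value_measurable[OF a] by measurable
    show "AE x in M. norm ((v x)\<^sup>2) \<le> B\<^sup>2"
      using power_mono[OF approx_value_bound[OF a], where n = 2] by (intro AE_I2) simp
  qed
qed

text \<open>Poincare turns a vanishing energy into a vanishing L2 norm, and continuity turns that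
  into the zero function.\<close>

lemma ip_pos:
  assumes v: "v \<in> V" "v \<noteq> (\<lambda>_. 0)"
  shows "0 < ip v v"
proof (rule ccontr)
  assume "\<not> 0 < ip v v"
  obtain R where "0 < R" "\<And>x. x \<in> D \<Longrightarrow> norm x \<le> R" using D_bounded unfolding bounded_pos by blast
  then have "(LINT x|M. (v x)\<^sup>2) \<le> 4 * R\<^sup>2 * ip v v" using fe_poincare[OF v(1)] by blast
  also have "\<dots> \<le> 0" using \<open>\<not> 0 < ip v v\<close> by (intro mult_nonneg_nonpos) auto
  finally have "(LINT x|M. (v x)\<^sup>2) = 0" by (intro antisym integral_nonneg_AE) auto
  then have "AE x in M. v x = 0" using integral_nonneg_eq_0_iff_AE[OF fe_L2_integrable[OF v(1)]] by auto
  then show False using continuous_AE_0_imp_0[of v] fe_D[OF v(1)] v(2) by blast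
qed

lemma fe_basis:
  obtains N and e :: "nat \<Rightarrow> 'a \<Rightarrow> real" where "\<And>i. i < N \<Longrightarrow> e i \<in> V"
    and "\<And>i j. i < N \<Longrightarrow> j < N \<Longrightarrow> ip (e i) (e j) = (if i = j then 1 else 0)"
    and "\<And>v. v \<in> V \<Longrightarrow> v = (\<lambda>x. \<Sum>i<N. ip v (e i) * e i x)"
proof -
  obtain X where X: "finite X" "\<forall>v\<in>V. (\<forall>x\<in>X. v x = 0) \<longrightarrow> v = (\<lambda>_. 0)" using fe_determined by blast
  have s: "ip v w = ip w v" for v w by (rule cform_sym)
  obtain N and e :: "nat \<Rightarrow> 'a \<Rightarrow> real" where 1: "\<forall>i<N. e i \<in> V"
    and 2: "\<forall>i<N. \<forall>j<N. ip (e i) (e j) = (if i = j then 1 else 0)"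
    and 3: "\<forall>v\<in>V. v = (\<lambda>x. \<Sum>i<N. ip v (e i) * e i x)"
    using orthonormal_basis_exists[OF X(1) fe_subspace bilinear_cform[OF ess_bounded_const] s ip_pos X(2)[rule_format]]
    by blast
  show ?thesis
  proof (rule that)
    show "e i \<in> V" if "i < N" for i using 1 that by simp
    show "ip (e i) (e j) = (if i = j then 1 else 0)" if "i < N" "j < N" for i j using 2 that by simp
    show "v = (\<lambda>x. \<Sum>i<N. ip v (e i) * e i x)" if "v \<in> V" for v using 3 that by (rule bspec)
  qed
qed

end

section \<open>The component-by-component construction\<close>

lemma powr_add_le:
  fixes x y :: real
  assumes "0 \<le> x" "0 \<le> y" "0 < lam" "lam \<le> 1"
  shows "(x + y) powr lam \<le> x powr lam + y powr lam"
proof (cases "x + y = 0")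
  case False
  then have t: "0 < x + y" using assms by simp
  have le: "u / (x + y) \<le> (u / (x + y)) powr lam" if "0 \<le> u" "u \<le> x + y" for u
    using powr_mono'[of lam 1 "u / (x + y)"] assms that t by simp
  have "1 = x / (x + y) + y / (x + y)" using t by (simp add: add_divide_distrib[symmetric])
  also have "\<dots> \<le> (x / (x + y)) powr lam + (y / (x + y)) powr lam"
    using assms by (intro add_mono le) auto
  also have "\<dots> = (x powr lam + y powr lam) / (x + y) powr lam"
    using assms t by (simp add: powr_divide add_divide_distrib)
  finally show ?thesis using t by (simp add: pos_le_divide_eq)
qed (use assms in auto)

lemma powr_sum_le:
  fixes a :: "'x \<Rightarrow> real"
  assumes "0 < lam" "lam \<le> 1" "\<And>x. x \<in> F \<Longrightarrow> 0 \<le> a x"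
  shows "(\<Sum>x\<in>F. a x) powr lam \<le> (\<Sum>x\<in>F. a x powr lam)"
  using assms(3)
proof (induction F rule: infinite_finite_induct)
  case (insert x F)
  have "(a x + (\<Sum>x\<in>F. a x)) powr lam \<le> a x powr lam + (\<Sum>x\<in>F. a x) powr lam"
    using insert assms by (intro powr_add_le) (auto intro: sum_nonneg)
  then show ?case using insert by simp
qed auto

text \<open>The finite inequality is used after taking the root \<open>1 / lam\<close>: in this form
  it bounds the partial sums themselves and passes to the infinite sum.\<close>

lemma powr_infsum_le:
  fixes a :: "'x \<Rightarrow> real"
  assumes lam: "0 < lam" "lam \<le> 1" and a: "\<And>x. x \<in> A \<Longrightarrow> 0 \<le> a x"
    and s: "a summable_on A" "(\<lambda>x. a x powr lam) summable_on A"
  shows "(\<Sum>\<^sub>\<infinity>x\<in>A. a x) powr lam \<le> (\<Sum>\<^sub>\<infinity>x\<in>A. a x powr lam)"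
proof -
  let ?B = "\<Sum>\<^sub>\<infinity>x\<in>A. a x powr lam"
  have B: "0 \<le> ?B" by (rule infsum_nonneg) simp
  have "(\<Sum>\<^sub>\<infinity>x\<in>A. a x) \<le> ?B powr (1 / lam)"
  proof (rule infsum_le_finite_sums[OF s(1)])
    fix F assume F: "finite F" "F \<subseteq> A"
    have "(\<Sum>x\<in>F. a x) powr lam \<le> (\<Sum>x\<in>F. a x powr lam)"
      using lam a F by (intro powr_sum_le) auto
    also have "\<dots> \<le> ?B" using s(2) F by (intro finite_sum_le_infsum) auto
    finally have "((\<Sum>x\<in>F. a x) powr lam) powr (1 / lam) \<le> ?B powr (1 / lam)"
      using lam by (intro powr_mono2) auto
    moreover have "0 \<le> (\<Sum>x\<in>F. a x)" using a F by (intro sum_nonneg) auto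
    ultimately show "(\<Sum>x\<in>F. a x) \<le> ?B powr (1 / lam)" using lam by (simp add: powr_powr)
  qed
  then have "(\<Sum>\<^sub>\<infinity>x\<in>A. a x) powr lam \<le> (?B powr (1 / lam)) powr lam"
    using lam a by (intro powr_mono2 infsum_nonneg) auto
  also have "\<dots> = ?B" using lam B by (simp add: powr_powr)
  finally show ?thesis .
qed

section \<open>Sums over a single component of the frequencies\<close>

definition psi_int :: "real \<Rightarrow> int \<Rightarrow> real" where
  "psi_int \<beta> m = (if m = 0 then 0 else 1 / real_of_int \<bar>m\<bar> powr \<beta>)"

lemma psi_int_nonneg: "0 \<le> psi_int \<beta> m"
  by (simp add: psi_int_def)

lemma psi_int_has_sum: "1 < \<beta> \<Longrightarrow> (psi_int \<beta> has_sum (2 * zeta_real \<beta>)) UNIV"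
  using has_sum_int_powr[of \<beta> 0 1] unfolding psi_int_def[abs_def] by (simp only: mult_1 add_0)

lemma has_sum_translate_int:
  fixes f :: "int \<Rightarrow> 'b::{comm_monoid_add, t2_space}"
  assumes "(f has_sum a) UNIV"
  shows "((\<lambda>h. f (h + k)) has_sum a) UNIV"
  using has_sum_reindex_bij_betw[OF bij_betwI[of "\<lambda>h. h + k" UNIV UNIV "\<lambda>h. h - k"], of f a] assms by simp

text \<open>One of \<open>h\<close> and \<open>h + l\<close> is at least half as large as
  \<open>l\<close> in absolute value; its factor is bounded by that of \<open>l\<close> at the cost
  of \<open>2 powr \<beta>\<close>.\<close>

lemma psi_int_mult_le:
  assumes "0 \<le> \<beta>" "h \<noteq> 0" "h + l \<noteq> 0" "l \<noteq> 0"
  shows "psi_int \<beta> h * psi_int \<beta> (h + l) \<le> 2 powr \<beta> * psi_int \<beta> l * (psi_int \<beta> h + psi_int \<beta> (h + l))"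
proof -
  have le: "psi_int \<beta> a \<le> 2 powr \<beta> * psi_int \<beta> l" if a: "a \<noteq> 0" "\<bar>l\<bar> \<le> 2 * \<bar>a\<bar>" for a
  proof -
    have "real_of_int \<bar>l\<bar> powr \<beta> \<le> (2 * real_of_int \<bar>a\<bar>) powr \<beta>"
      using a assms by (intro powr_mono2) linarith+
    also have "\<dots> = 2 powr \<beta> * real_of_int \<bar>a\<bar> powr \<beta>" by (simp add: powr_mult)
    finally show ?thesis using a assms by (simp add: psi_int_def field_simps)
  qed
  have nn: "0 \<le> psi_int \<beta> a" "0 \<le> 2 powr \<beta> * psi_int \<beta> l" for a by (simp_all add: psi_int_nonneg)
  show ?thesis
  proof (cases "\<bar>h + l\<bar> \<le> \<bar>h\<bar>")
    case True
    then have "psi_int \<beta> h * psi_int \<beta> (h + l) \<le> 2 powr \<beta> * psi_int \<beta> l * psi_int \<beta> (h + l)"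
      using assms by (intro mult_right_mono le nn) auto
    also have "\<dots> \<le> 2 powr \<beta> * psi_int \<beta> l * (psi_int \<beta> h + psi_int \<beta> (h + l))"
      using nn by (intro mult_left_mono) auto
    finally show ?thesis .
  next
    case False
    then have "\<bar>l\<bar> \<le> 2 * \<bar>h + l\<bar>" using abs_triangle_ineq4[of "h + l" h] by simp
    then have "psi_int \<beta> h * psi_int \<beta> (h + l) \<le> psi_int \<beta> h * (2 powr \<beta> * psi_int \<beta> l)"
      using assms by (intro mult_left_mono le nn) auto
    also have "\<dots> = 2 powr \<beta> * psi_int \<beta> l * psi_int \<beta> h" by simp
    also have "\<dots> \<le> 2 powr \<beta> * psi_int \<beta> l * (psi_int \<beta> h + psi_int \<beta> (h + l))"
      using nn by (intro mult_left_mono) auto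
    finally show ?thesis .
  qed
qed

context
  fixes g :: "nat \<Rightarrow> real" and \<alpha> j :: nat and lam :: real
  assumes g: "0 < g j" and \<beta>: "1 < real \<alpha> * lam"
begin

abbreviation "r m \<equiv> rho g \<alpha> j m powr lam"
abbreviation "q \<equiv> g j powr lam"
abbreviation "Z \<equiv> zeta_real (real \<alpha> * lam)"
abbreviation "\<psi> \<equiv> psi_int (real \<alpha> * lam)"

lemma r_eq: "r m = (if m = 0 then 1 else 0) + q * \<psi> m"
  using rho_powr[of g j \<alpha> m lam, OF g] by (simp add: psi_int_def)

lemma r_has_sum: "(r has_sum (1 + 2 * Z * q)) UNIV"
  using rho_powr_has_sum[of g j \<alpha> lam, OF g \<beta>] by (simp add: mult_ac)

lemma pair_has_sum: "((\<lambda>(h, l). r h * r (h + l)) has_sum (1 + 2 * Z * q)\<^sup>2) UNIV"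
proof -
  have bij: "bij_betw (\<lambda>(h, l). (h, h + l)) (UNIV :: (int \<times> int) set) UNIV"
    by (rule bij_betwI[where g = "\<lambda>(h, m). (h, m - h)"]) auto
  have a: "Infinite_Sum.abs_summable_on r UNIV" using has_sum_imp_summable[OF r_has_sum] by simp
  show ?thesis
    using has_sum_reindex_bij_betw[OF bij, of "\<lambda>(h, m). r h * r m"] has_sum_times(1)[OF r_has_sum a r_has_sum a]
    by (simp add: case_prod_unfold power2_eq_square)
qed

text \<open>The full double sum is the square of \<open>1 + 2 * Z * q\<close>. Splitting off just
  the term at the origin, which is 1, already leaves a bound of first order in \<open>q\<close>. The
  constant is enlarged to the one in \<open>multiples_sum\<close> so that \<open>lead\<close> serves
  both.\<close>

lemma offdiagonal_sum:
  obtains a where "((\<lambda>(h, l). if l \<noteq> 0 then r h * r (h + l) else 0) has_sum a) UNIV"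
    and "0 \<le> a" and "a \<le> 2 powr (real \<alpha> * lam + 3) * Z\<^sup>2 * (q + q\<^sup>2)"
proof -
  let ?F = "\<lambda>(h, l). if l \<noteq> 0 then r h * r (h + l) else 0"
  have sF: "?F summable_on UNIV"
    by (rule summable_on_comparison_test[OF has_sum_imp_summable[OF pair_has_sum]]) auto
  define a where "a = infsum ?F UNIV"
  have a: "(?F has_sum a) UNIV" unfolding a_def using sF by simp
  have "((\<lambda>p. if p = (0, 0) then 1 else 0) has_sum (1 :: real)) (UNIV :: (int \<times> int) set)"
    by (rule has_sum_finite_neutralI[of "{(0, 0)}"]) auto
  from has_sum_mono[OF has_sum_add[OF a this] pair_has_sum]
  have "a + 1 \<le> (1 + 2 * Z * q)\<^sup>2" by (auto simp: rho_def split: if_splits)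
  then have "a \<le> 4 * Z * q + 4 * Z\<^sup>2 * q\<^sup>2" by (simp add: power2_eq_square algebra_simps)
  also have "\<dots> \<le> 2 powr (real \<alpha> * lam + 3) * Z\<^sup>2 * q + 2 powr (real \<alpha> * lam + 3) * Z\<^sup>2 * q\<^sup>2"
  proof -
    have Z1: "1 \<le> Z" by (rule zeta_real_pos[OF \<beta>])
    have "(2::real) powr 3 \<le> 2 powr (real \<alpha> * lam + 3)" using \<beta> by (intro powr_mono) auto
    moreover have "(2::real) powr 3 = 8" using powr_realpow[of "2::real" 3] by simp
    ultimately have c: "4 \<le> (2::real) powr (real \<alpha> * lam + 3)" by linarith
    have "Z \<le> Z\<^sup>2" using Z1 by (simp add: power2_eq_square)
    with c have 1: "4 * Z \<le> 2 powr (real \<alpha> * lam + 3) * Z\<^sup>2" using Z1 by (intro mult_mono) auto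
    have 2: "4 * Z\<^sup>2 \<le> 2 powr (real \<alpha> * lam + 3) * Z\<^sup>2" using c by (intro mult_right_mono) auto
    show ?thesis by (rule add_mono[OF mult_right_mono[OF 1] mult_right_mono[OF 2]]) auto
  qed
  finally have "a \<le> 2 powr (real \<alpha> * lam + 3) * Z\<^sup>2 * (q + q\<^sup>2)" by (simp add: distrib_left)
  moreover have "0 \<le> a" by (rule has_sum_nonneg[OF a]) auto
  ultimately show thesis using that[OF a] by blast
qed

text \<open>The gain \<open>1 / n\<close> comes from the decay in \<open>l = n * k\<close>, which
  provides the factor \<open>n\<close> to the power \<open>- (\<alpha> * lam)\<close>, where
  \<open>\<alpha> * lam\<close> exceeds 1. The terms are dominated by \<open>\<Phi>\<close>, whose
  sum over \<open>h\<close> is explicit for each \<open>k\<close>.\<close>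

lemma multiples_sum:
  assumes n: "0 < n"
  obtains a where "((\<lambda>(h, l). if l \<noteq> 0 \<and> int n dvd l then r h * r (h + l) else 0) has_sum a) UNIV"
    and "0 \<le> a" and "a \<le> 2 powr (real \<alpha> * lam + 3) * Z\<^sup>2 * (q + q\<^sup>2) / real n"
proof -
  let ?b = "real \<alpha> * lam"
  let ?F = "\<lambda>(h, l). if l \<noteq> 0 \<and> int n dvd l then r h * r (h + l) else 0"
  have sF: "?F summable_on UNIV"
    by (rule summable_on_comparison_test[OF has_sum_imp_summable[OF pair_has_sum]]) auto
  define a where "a = infsum ?F UNIV"
  have a: "(?F has_sum a) UNIV" unfolding a_def using sF by simp
  define \<delta> where "\<delta> m = (if m = 0 then 1 else 0 :: real)" for m :: int
  have \<delta>s: "(\<delta> has_sum 1) UNIV" unfolding \<delta>_def by (rule has_sum_finite_neutralI[of "{0}"]) auto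
  define C where "C = real n powr (- ?b)"
  \<comment> \<open>The delta terms cover \<open>h = 0\<close> and \<open>h + l = 0\<close>, where
    one of the two factors is 1; the remaining part comes from
    \<open>psi_int_mult_le\<close>.\<close>
  define \<Phi> where "\<Phi> k h = C * \<psi> k * (q * (\<delta> h + \<delta> (h + int n * k)) + 2 powr ?b * q\<^sup>2 * (\<psi> h + \<psi> (h + int n * k)))" for k h
  define D where "D = q * (1 + 1) + 2 powr ?b * q\<^sup>2 * (2 * Z + 2 * Z)"
  have row: "((\<lambda>h. \<Phi> k h) has_sum (C * \<psi> k * D)) UNIV" for k
    unfolding \<Phi>_def D_def
    by (intro has_sum_cmult_right has_sum_add has_sum_translate_int \<delta>s psi_int_has_sum \<beta>)
  have \<Phi>0: "0 \<le> \<Phi> k h" for k h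
    unfolding \<Phi>_def C_def \<delta>_def by (intro mult_nonneg_nonneg add_nonneg_nonneg) (auto simp: psi_int_nonneg)
  have cols: "((\<lambda>k. C * \<psi> k * D) has_sum (C * (2 * Z) * D)) UNIV"
    by (intro has_sum_cmult_left has_sum_cmult_right psi_int_has_sum \<beta>)
  have "(\<lambda>(k, h). \<Phi> k h) summable_on UNIV \<times> UNIV"
    by (rule summable_on_SigmaI[OF _ has_sum_imp_summable[OF cols]]) (use row \<Phi>0 in auto)
  from has_sum_SigmaI[OF _ cols this] row
  have \<Phi>s: "((\<lambda>(k, h). \<Phi> k h) has_sum (C * (2 * Z) * D)) UNIV" by simp
  have le: "r h * r (h + int n * k) \<le> \<Phi> k h" if k: "k \<noteq> 0" for k h
  proof -
    let ?l = "int n * k"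
    have l: "?l \<noteq> 0" using k n by simp
    have pl: "\<psi> ?l = C * \<psi> k"
      using l k n by (simp add: psi_int_def C_def abs_mult powr_mult powr_minus field_simps)
    have \<psi>0: "\<psi> 0 = 0" by (simp add: psi_int_def)
    have sym: "\<psi> (- m) = \<psi> m" for m by (simp add: psi_int_def)
    have nn: "0 \<le> C * \<psi> k" "0 \<le> \<psi> m" for m by (auto simp: C_def psi_int_nonneg)
    have edge: "q * (C * \<psi> k) \<le> \<Phi> k h" if "1 \<le> \<delta> h + \<delta> (h + ?l)"
    proof -
      have "C * \<psi> k * (q * 1 + 0) \<le> \<Phi> k h"
        unfolding \<Phi>_def using that nn by (intro mult_left_mono add_mono) (auto intro!: mult_nonneg_nonneg add_nonneg_nonneg)
      then show ?thesis by (simp add: mult_ac)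
    qed
    consider "h = 0" | "h \<noteq> 0" "h + ?l = 0" | "h \<noteq> 0" "h + ?l \<noteq> 0" by blast
    then show ?thesis
    proof cases
      case 1
      have "r h * r (h + ?l) = q * (C * \<psi> k)" using 1 l by (simp add: r_eq \<psi>0 pl)
      also have "\<dots> \<le> \<Phi> k h"
by (rule edge) (use 1 l in \<open>simp add: \<delta>_def\<close>)
      finally show ?thesis .
    next
      case 2
      then have h: "h = - ?l" by simp
      have "r h * r (h + ?l) = q * (C * \<psi> k)" using 2 unfolding h by (simp add: r_eq \<psi>0 sym pl)
      also have "\<dots> \<le> \<Phi> k h"
by (rule edge) (use 2 in \<open>simp add: \<delta>_def\<close>)
      finally show ?thesis .
    next
      case 3
      have "r h * r (h + ?l) = q\<^sup>2 * (\<psi> h * \<psi> (h + ?l))" using 3 by (simp add: r_eq power2_eq_square mult_ac)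
      also have "\<dots> \<le> q\<^sup>2 * (2 powr ?b * \<psi> ?l * (\<psi> h + \<psi> (h + ?l)))"
        using 3 l \<beta> by (intro mult_left_mono psi_int_mult_le) auto
      also have "\<dots> = \<Phi> k h" using 3 unfolding pl by (simp add: \<Phi>_def \<delta>_def mult_ac)
      finally show ?thesis .
    qed
  qed
  have "a \<le> C * (2 * Z) * D"
  proof (rule has_sum_le_finite_sums[OF a])
    fix F :: "(int \<times> int) set" assume F: "finite F"
    have "(\<Sum>p\<in>F. ?F p) = (\<Sum>p\<in>{p\<in>F. snd p \<noteq> 0 \<and> int n dvd snd p}. r (fst p) * r (fst p + snd p))"
      using F by (simp add: sum.If_cases case_prod_unfold Int_def)
    also have "\<dots> \<le> (\<Sum>p\<in>{p\<in>F. snd p \<noteq> 0 \<and> int n dvd snd p}. \<Phi> (snd p div int n) (fst p))"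
    proof (rule sum_mono)
      fix p assume p: "p \<in> {p\<in>F. snd p \<noteq> 0 \<and> int n dvd snd p}"
      then have "snd p = int n * (snd p div int n)" "snd p div int n \<noteq> 0" by (auto elim!: dvdE)
      then show "r (fst p) * r (fst p + snd p) \<le> \<Phi> (snd p div int n) (fst p)" using le by metis
    qed
    also have "\<dots> = (\<Sum>p\<in>(\<lambda>p. (snd p div int n, fst p)) ` {p\<in>F. snd p \<noteq> 0 \<and> int n dvd snd p}. \<Phi> (fst p) (snd p))"
      by (subst sum.reindex) (auto simp: inj_on_def elim!: dvdE)
    also have "\<dots> \<le> C * (2 * Z) * D"
      using F \<Phi>0 by (intro finite_sum_le_has_sum[OF \<Phi>s[unfolded case_prod_unfold]]) auto
    finally show "(\<Sum>p\<in>F. ?F p) \<le> C * (2 * Z) * D" .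
  qed
  also have "\<dots> \<le> (1 / real n) * (2 * Z) * (2 powr (?b + 2) * Z * (q + q\<^sup>2))"
  proof -
    have Z1: "1 \<le> Z" by (rule zeta_real_pos[OF \<beta>])
    have "C \<le> real n powr (-1)" unfolding C_def using n \<beta> by (intro powr_mono) auto
    then have C: "C \<le> 1 / real n" using n by (simp add: powr_minus_divide)
    have c: "2 powr (?b + 2) = 4 * 2 powr ?b" by (simp add: powr_add)
    have "(1::real) \<le> 2 powr ?b" using \<beta> by (intro ge_one_powr_ge_zero) auto
    then have "1 * 1 \<le> 2 powr ?b * Z" using Z1 by (intro mult_mono) auto
    then have "2 \<le> 4 * (2 powr ?b * Z)" by linarith
    then have "q * 2 \<le> q * (4 * (2 powr ?b * Z))" by (rule mult_left_mono) simp
    then have D: "D \<le> 2 powr (?b + 2) * Z * (q + q\<^sup>2)" unfolding D_def c by (simp add: algebra_simps)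
    have "0 \<le> D" unfolding D_def using Z1 by auto
    then show ?thesis using Z1 C D by (intro mult_mono) auto
  qed
  also have "\<dots> = 2 powr (?b + 3) * Z\<^sup>2 * (q + q\<^sup>2) / real n"
  proof -
    have "(2::real) powr (?b + 3) = 2 * 2 powr (?b + 2)" using powr_add[of "2::real" 1 "?b + 2"] by (simp add: add.commute)
    then show ?thesis by (simp only: power2_eq_square) simp
  qed
  finally have "a \<le> 2 powr (?b + 3) * Z\<^sup>2 * (q + q\<^sup>2) / real n" .
  moreover have "0 \<le> a" by (rule has_sum_nonneg[OF a]) auto
  ultimately show thesis using that[OF a] by blast
qed

end

section \<open>Averaging the criterion over the candidates for one component\<close>

context lattice_interpolation
begin

definition last_index :: "nat \<Rightarrow> (nat \<Rightarrow> int) set" where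
  "last_index d = {l \<in> Zs s. l d \<noteq> 0 \<and> (\<forall>j>d. l j = 0)}"

lemma dual_lattice_last_index: "L = (\<Union>d\<in>{1..s}. L \<inter> last_index d)"
proof -
  have "\<exists>d\<in>{1..s}. l \<in> last_index d" if l: "l \<in> L" for l
  proof -
    have lZ: "l \<in> Zs s" and ne: "l \<noteq> (\<lambda>_. 0)" using l by (auto simp: dual_lattice_def)
    have sub: "{j. l j \<noteq> 0} \<subseteq> {1..s}" using lZ by (auto simp: Zs_def)
    then have fin: "finite {j. l j \<noteq> 0}" using finite_subset by blast
    have ne': "{j. l j \<noteq> 0} \<noteq> {}" using ne by auto
    define d where "d = Max {j. l j \<noteq> 0}"
    have d: "d \<in> {j. l j \<noteq> 0}" unfolding d_def by (rule Max_in[OF fin ne'])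
    have "l j = 0" if "d < j" for j
      using Max_ge[OF fin, of j] that unfolding d_def by force
    then show ?thesis using d sub lZ by (intro bexI[of _ d]) (auto simp: last_index_def)
  qed
  then show ?thesis by auto
qed

lemma criterion_eq:
  "cbc_criterion (prod g) \<alpha> s n d v = (\<Sum>\<^sub>\<infinity>(h, l)\<in>Zs s \<times> (dual_lattice s n v \<inter> last_index d). w h * w (\<lambda>j. h j + l j))"
proof -
  have e: "{l \<in> dual_lattice s n v. l d \<noteq> 0 \<and> (\<forall>j>d. l j = 0)} = dual_lattice s n v \<inter> last_index d"
    by (auto simp: last_index_def dual_lattice_def)
  show ?thesis unfolding cbc_criterion_def lattice_sum_def e
  proof (rule infsum_cong, clarify)
    fix h l assume "h \<in> Zs s" "l \<in> dual_lattice s n v"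
    then have "h \<in> Zs s" "(\<lambda>j. h j + l j) \<in> Zs s" by (auto simp: dual_lattice_def Zs_def)
    from this[THEN r_weight_eq[of _ s g \<alpha>]]
    show "1 / (r_weight (prod g) \<alpha> h * r_weight (prod g) \<alpha> (\<lambda>j. h j + l j)) = w h * w (\<lambda>j. h j + l j)"
      by (metis divide_divide_eq_left mult.commute times_divide_eq_right mult_1)
  qed
qed

lemma S_eq_sum_criterion: "S = (\<Sum>d=1..s. cbc_criterion (prod g) \<alpha> s n d z)"
proof -
  have e: "Zs s \<times> L = (\<Union>d\<in>{1..s}. Zs s \<times> (L \<inter> last_index d))"
    using dual_lattice_last_index by auto
  have dj: "(Zs s \<times> (L \<inter> last_index d)) \<inter> (Zs s \<times> (L \<inter> last_index d')) = {}" if "d \<noteq> d'" for d d'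
    using that by (auto simp: last_index_def) (metis linorder_neqE_nat)
  show ?thesis unfolding S_eq e criterion_eq
    by (rule sum_infsum[symmetric])
       (use dj in \<open>auto intro!: summable_on_subset_banach[OF dual_summable]\<close>)
qed

definition pair_term :: "real \<Rightarrow> (nat \<Rightarrow> int) \<Rightarrow> (nat \<Rightarrow> int) \<Rightarrow> real" where
  "pair_term lam h l = (w h * w (\<lambda>j. h j + l j)) powr lam"

lemma pair_term_prod:
  "pair_term lam h l = (\<Prod>j=1..s. rho g \<alpha> j (h j) powr lam * rho g \<alpha> j (h j + l j) powr lam)"
proof -
  have p: "0 \<le> rho g \<alpha> j m" if "j \<in> {1..s}" for j m using rho_pos[of g j \<alpha> m] g[OF that] by simp
  show ?thesis
    unfolding pair_term_def wt_def prod.distrib[symmetric]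
    by (subst prod_powr_distrib) (auto intro!: prod.cong simp: p powr_mult)
qed

context
  fixes lam :: real
  assumes lam: "0 < lam" "lam \<le> 1" and \<beta>: "1 < real \<alpha> * lam"
begin

definition grow :: real where "grow = (\<Prod>j=1..s. (1 + 2 * zeta_real (real \<alpha> * lam) * g j powr lam)\<^sup>2)"

text \<open>The contribution of the component \<open>d\<close>, in which \<open>l\<close> is
  nonzero. Without a constant term in \<open>g d powr lam\<close> it can be summed over
  \<open>d\<close> uniformly in \<open>s\<close>.\<close>

definition lead :: "nat \<Rightarrow> real" where
  "lead d = 2 powr (real \<alpha> * lam + 3) * (zeta_real (real \<alpha> * lam))\<^sup>2 * (g d powr lam + (g d powr lam)\<^sup>2)"

text \<open>Dropping the condition on the components of \<open>l\<close> other than the \<open>d\<close>-th one lets the sum factorise.\<close>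

lemma restricted_pair_sum:
  assumes d: "d \<in> {1..s}"
    and a: "((\<lambda>(h, l). if Pr l then rho g \<alpha> d h powr lam * rho g \<alpha> d (h + l) powr lam else 0) has_sum a) UNIV"
    and a0: "0 \<le> a"
  shows "(\<lambda>(h, l). pair_term lam h l) summable_on Zs s \<times> {l \<in> Zs s. Pr (l d)}"
    and "(\<Sum>\<^sub>\<infinity>(h, l)\<in>Zs s \<times> {l \<in> Zs s. Pr (l d)}. pair_term lam h l) \<le> a * grow"
proof -
  define f where "f j = (\<lambda>(h, l). if j = d \<and> \<not> Pr l then 0 else rho g \<alpha> j h powr lam * rho g \<alpha> j (h + l) powr lam)" for j
  define A where "A j = (if j = d then a else (1 + 2 * zeta_real (real \<alpha> * lam) * g j powr lam)\<^sup>2)" for j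
  have f: "(f j has_sum A j) UNIV" if j: "j \<in> {1..s}" for j
  proof (cases "j = d")
    case True
    have "f d = (\<lambda>(h, l). if Pr l then rho g \<alpha> d h powr lam * rho g \<alpha> d (h + l) powr lam else 0)"
      by (auto simp: f_def)
    then show ?thesis using a True by (simp add: A_def)
  next
    case False
    then show ?thesis using pair_has_sum[of g j \<alpha> lam, OF g[OF j] \<beta>] by (simp add: f_def A_def)
  qed
  have f0: "0 \<le> f j p" for j p by (auto simp: f_def split: prod.split)
  have fa: "Infinite_Sum.abs_summable_on (f j) UNIV" if j: "j \<in> {1..s}" for j
    using has_sum_imp_summable[OF f[OF j]] f0 by simp
  let ?P = "\<lambda>(h, l). \<Prod>j=1..s. f j (h j, l j)"
  have hs: "(?P has_sum (\<Prod>j=1..s. A j)) (Zs s \<times> Zs s)" by (rule has_sum_prod_Zs_Times[OF f fa])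
  have sub: "Zs s \<times> {l \<in> Zs s. Pr (l d)} \<subseteq> Zs s \<times> Zs s" by auto
  have eq: "(case p of (h, l) \<Rightarrow> pair_term lam h l) = ?P p" if "p \<in> Zs s \<times> {l \<in> Zs s. Pr (l d)}" for p
  proof -
    obtain h l where p: "p = (h, l)" by (cases p)
    have "Pr (l d)" using that p by simp
    then show ?thesis unfolding p pair_term_prod prod.case by (intro prod.cong refl) (auto simp: f_def)
  qed
  have sm: "?P summable_on Zs s \<times> {l \<in> Zs s. Pr (l d)}"
    by (rule summable_on_subset_banach[OF has_sum_imp_summable[OF hs] sub])
  then show "(\<lambda>(h, l). pair_term lam h l) summable_on Zs s \<times> {l \<in> Zs s. Pr (l d)}"
    by (subst summable_on_cong[OF eq])
  have "(\<Sum>\<^sub>\<infinity>(h, l)\<in>Zs s \<times> {l \<in> Zs s. Pr (l d)}. pair_term lam h l) = infsum ?P (Zs s \<times> {l \<in> Zs s. Pr (l d)})"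
    by (rule infsum_cong[OF eq])
  also have "\<dots> \<le> infsum ?P (Zs s \<times> Zs s)"
    by (rule infsum_mono2[OF sm has_sum_imp_summable[OF hs] sub]) (simp add: case_prod_unfold prod_nonneg f0)
  also have "\<dots> = (\<Prod>j=1..s. A j)" by (rule infsumI[OF hs])
  also have "\<dots> = a * (\<Prod>j\<in>{1..s} - {d}. A j)" using d by (simp add: prod.remove[of _ d] A_def)
  also have "(\<Prod>j\<in>{1..s} - {d}. A j) = (\<Prod>j\<in>{1..s} - {d}. (1 + 2 * zeta_real (real \<alpha> * lam) * g j powr lam)\<^sup>2)"
    by (intro prod.cong) (auto simp: A_def)
  also have "\<dots> \<le> grow"
  proof -
    let ?c = "(1 + 2 * zeta_real (real \<alpha> * lam) * g d powr lam)\<^sup>2"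
    have "0 \<le> 2 * zeta_real (real \<alpha> * lam) * g d powr lam" using zeta_real_pos[OF \<beta>] by simp
    then have "1 \<le> ?c" by (intro one_le_power) simp
    then have "1 * (\<Prod>j\<in>{1..s} - {d}. (1 + 2 * zeta_real (real \<alpha> * lam) * g j powr lam)\<^sup>2) \<le> ?c * (\<Prod>j\<in>{1..s} - {d}. (1 + 2 * zeta_real (real \<alpha> * lam) * g j powr lam)\<^sup>2)"
      by (rule mult_right_mono) (simp add: prod_nonneg)
    moreover have "grow = ?c * (\<Prod>j\<in>{1..s} - {d}. (1 + 2 * zeta_real (real \<alpha> * lam) * g j powr lam)\<^sup>2)"
      unfolding grow_def by (rule prod.remove) (use d in auto)
    ultimately show ?thesis by simp
  qed
  finally show "(\<Sum>\<^sub>\<infinity>(h, l)\<in>Zs s \<times> {l \<in> Zs s. Pr (l d)}. pair_term lam h l) \<le> a * grow"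
    using a0 by (simp add: mult_left_mono)
qed

text \<open>When \<open>l d\<close> is invertible modulo the prime \<open>n\<close>, the congruence
  determines the \<open>d\<close>-th component of \<open>z\<close> modulo \<open>n\<close>.\<close>

lemma card_admissible_components:
  assumes d: "d \<in> {1..s}" and l: "\<not> int n dvd l d"
  shows "card {x \<in> {1..n - 1}. l \<in> dual_lattice s n (z(d := x))} \<le> 1"
proof -
  have "x = y" if x: "x \<in> {1..n - 1}" "l \<in> dual_lattice s n (z(d := x))"
    and y: "y \<in> {1..n - 1}" "l \<in> dual_lattice s n (z(d := y))" for x y
  proof -
    have sm: "(\<Sum>j=1..s. l j * int ((z(d := x)) j)) = l d * int x + (\<Sum>j\<in>{1..s} - {d}. l j * int (z j))" for x
      using d by (subst sum.remove[of _ d]) auto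
    have "int n dvd (\<Sum>j=1..s. l j * int ((z(d := x)) j))" "int n dvd (\<Sum>j=1..s. l j * int ((z(d := y)) j))"
      using x(2) y(2) by (simp_all only: dual_lattice_def mem_Collect_eq cong_0_iff)
    then have "int n dvd (l d * int x + (\<Sum>j\<in>{1..s} - {d}. l j * int (z j)))"
      "int n dvd (l d * int y + (\<Sum>j\<in>{1..s} - {d}. l j * int (z j)))"
      by (simp_all only: sm)
    from dvd_diff[OF this] have "int n dvd l d * (int x - int y)" by (simp add: right_diff_distrib)
    then have "int n dvd int x - int y" using l n prime_dvd_mult_iff[of "int n"] by simp
    then obtain k where k: "int x - int y = int n * k" by (elim dvdE)
    have "\<bar>int n * k\<bar> < int n" unfolding k[symmetric] using x(1) y(1) by auto
    then have "k = 0" using n_pos by (simp add: abs_mult)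
    then show ?thesis using k by simp
  qed
  then show ?thesis by (subst card_le_Suc0_iff_eq[simplified One_nat_def[symmetric]]) auto
qed

lemma criterion_powr_le:
  "cbc_criterion (prod g) \<alpha> s n d v powr lam \<le> (\<Sum>\<^sub>\<infinity>(h, l)\<in>Zs s \<times> (dual_lattice s n v \<inter> last_index d). pair_term lam h l)"
  if pt: "(\<lambda>(h, l). pair_term lam h l) summable_on Zs s \<times> {l \<in> Zs s. l d \<noteq> 0}"
proof -
  have "(\<Sum>\<^sub>\<infinity>(h, l)\<in>Zs s \<times> (dual_lattice s n v \<inter> last_index d). w h * w (\<lambda>j. h j + l j)) powr lam
    \<le> (\<Sum>\<^sub>\<infinity>p\<in>Zs s \<times> (dual_lattice s n v \<inter> last_index d). (case p of (h, l) \<Rightarrow> w h * w (\<lambda>j. h j + l j)) powr lam)"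
  proof (rule powr_infsum_le[OF lam])
    show "(\<lambda>(h, l). w h * w (\<lambda>j. h j + l j)) summable_on Zs s \<times> (dual_lattice s n v \<inter> last_index d)"
      by (rule summable_on_subset_banach[OF w_shift_summable]) (auto simp: last_index_def)
    have "(\<lambda>(h, l). pair_term lam h l) summable_on Zs s \<times> (dual_lattice s n v \<inter> last_index d)"
      by (rule summable_on_subset_banach[OF pt]) (auto simp: last_index_def)
    then show "(\<lambda>p. (case p of (h, l) \<Rightarrow> w h * w (\<lambda>j. h j + l j)) powr lam) summable_on Zs s \<times> (dual_lattice s n v \<inter> last_index d)"
      by (simp add: pair_term_def case_prod_unfold)
  qed (use w_pos in \<open>auto simp: less_imp_le\<close>)
  then show ?thesis unfolding criterion_eq by (simp add: pair_term_def case_prod_unfold)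
qed

text \<open>The minimum is at most the mean over the \<open>n - 1\<close> candidates. A vector
  \<open>l\<close> with \<open>l d\<close> not divisible by \<open>n\<close> is dual for at most one
  candidate, which yields \<open>1 / (n - 1)\<close>; the others may be dual for all of them, but
  \<open>multiples_sum\<close> gives them the factor \<open>1 / n\<close>. The two together are at
  most \<open>3 / n\<close>.\<close>

lemma criterion_bound:
  assumes cbc: "cbc_vector (prod g) \<alpha> s n z" and d: "d \<in> {1..s}"
  shows "cbc_criterion (prod g) \<alpha> s n d z powr lam \<le> 3 * grow * lead d / real n"
proof -
  obtain a where a: "((\<lambda>(h, l). if l \<noteq> 0 then rho g \<alpha> d h powr lam * rho g \<alpha> d (h + l) powr lam else 0) has_sum a) UNIV"
    "0 \<le> a" "a \<le> lead d"
    using offdiagonal_sum[of g d \<alpha> lam, OF g[OF d] \<beta>] unfolding lead_def by blast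
  obtain a' where a': "((\<lambda>(h, l). if l \<noteq> 0 \<and> int n dvd l then rho g \<alpha> d h powr lam * rho g \<alpha> d (h + l) powr lam else 0) has_sum a') UNIV"
    "0 \<le> a'" "a' \<le> lead d / real n"
    using multiples_sum[of g d \<alpha> lam n, OF g[OF d] \<beta> n_pos] unfolding lead_def by blast
  note ra = restricted_pair_sum[OF d a(1,2)]
  note ra' = restricted_pair_sum[OF d a'(1,2)]
  let ?A = "Zs s \<times> {l \<in> Zs s. l d \<noteq> 0}"
  let ?A' = "Zs s \<times> {l \<in> Zs s. l d \<noteq> 0 \<and> int n dvd l d}"
  let ?p = "\<lambda>(h, l). pair_term lam h l"
  have grow0: "0 \<le> grow" unfolding grow_def by (intro prod_nonneg) auto
  have p0: "0 \<le> ?p x" for x by (auto simp: pair_term_def split: prod.split)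
  define D where "D x = dual_lattice s n (z(d := x)) \<inter> last_index d" for x
  define cnt where "cnt l = card {x \<in> {1..n - 1}. l \<in> D x}" for l
  have DA: "Zs s \<times> D x \<subseteq> ?A" for x by (auto simp: D_def last_index_def)
  have n2: "2 \<le> n" using n by (rule prime_ge_2_nat)
  have min: "cbc_criterion (prod g) \<alpha> s n d z powr lam \<le> infsum ?p (Zs s \<times> D x)" if x: "x \<in> {1..n - 1}" for x
  proof -
    have "cbc_criterion (prod g) \<alpha> s n d z \<le> cbc_criterion (prod g) \<alpha> s n d (z(d := x))"
      using cbc d x unfolding cbc_vector_def by blast
    moreover have "0 \<le> cbc_criterion (prod g) \<alpha> s n d z"
      unfolding criterion_eq by (intro infsum_nonneg) (use w_pos in \<open>auto simp: less_imp_le\<close>)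
    ultimately have "cbc_criterion (prod g) \<alpha> s n d z powr lam \<le> cbc_criterion (prod g) \<alpha> s n d (z(d := x)) powr lam"
      using lam by (intro powr_mono2) auto
    also have "\<dots> \<le> infsum ?p (Zs s \<times> D x)" unfolding D_def by (rule criterion_powr_le[OF ra(1)])
    finally show ?thesis .
  qed
  have hx: "((\<lambda>p. if snd p \<in> D x then ?p p else 0) has_sum infsum ?p (Zs s \<times> D x)) ?A" for x
  proof -
    have "(?p has_sum infsum ?p (Zs s \<times> D x)) (Zs s \<times> D x)"
      by (rule has_sum_infsum, rule summable_on_subset_banach[OF ra(1) DA])
    moreover have "(?p has_sum infsum ?p (Zs s \<times> D x)) (Zs s \<times> D x) \<longleftrightarrow>
      ((\<lambda>p. if snd p \<in> D x then ?p p else 0) has_sum infsum ?p (Zs s \<times> D x)) ?A"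
      by (rule has_sum_cong_neutral) (use DA[of x] in \<open>auto\<close>)
    ultimately show ?thesis by blast
  qed
  have "((\<lambda>p. \<Sum>x\<in>{1..n - 1}. if snd p \<in> D x then ?p p else 0) has_sum (\<Sum>x\<in>{1..n - 1}. infsum ?p (Zs s \<times> D x))) ?A"
    by (intro has_sum_finite_sum hx)
  moreover have "(\<Sum>x\<in>{1..n - 1}. if snd p \<in> D x then ?p p else 0) = real (cnt (snd p)) * ?p p" for p
    unfolding cnt_def by (simp add: sum.If_cases Int_def)
  ultimately have hc: "((\<lambda>p. real (cnt (snd p)) * ?p p) has_sum (\<Sum>x\<in>{1..n - 1}. infsum ?p (Zs s \<times> D x))) ?A"
    by simp
  have h': "((\<lambda>p. if int n dvd snd p d then ?p p else 0) has_sum infsum ?p ?A') ?A"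
  proof -
    have "(?p has_sum infsum ?p ?A') ?A'" by (rule has_sum_infsum[OF ra'(1)])
    moreover have "(?p has_sum infsum ?p ?A') ?A' \<longleftrightarrow> ((\<lambda>p. if int n dvd snd p d then ?p p else 0) has_sum infsum ?p ?A') ?A"
      by (rule has_sum_cong_neutral) auto
    ultimately show ?thesis by blast
  qed
  have cnt: "real (cnt (snd p)) * ?p p \<le> ?p p + (real n - 1) * (if int n dvd snd p d then ?p p else 0)" for p
  proof (cases "int n dvd snd p d")
    case True
    have "cnt (snd p) \<le> card {1..n - 1}" unfolding cnt_def by (intro card_mono) auto
    then have "real (cnt (snd p)) \<le> real n - 1" using n2 by auto
    then have "real (cnt (snd p)) * ?p p \<le> (real n - 1) * ?p p" by (rule mult_right_mono) (rule p0)
    then show ?thesis using True p0[of p] by simp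
  next
    case False
    have "cnt (snd p) \<le> card {x \<in> {1..n - 1}. snd p \<in> dual_lattice s n (z(d := x))}"
      unfolding cnt_def D_def by (intro card_mono) auto
    also have "\<dots> \<le> 1" by (rule card_admissible_components[of d "snd p", OF d False])
    finally have "real (cnt (snd p)) \<le> 1" by simp
    then have "real (cnt (snd p)) * ?p p \<le> 1 * ?p p" by (rule mult_right_mono) (rule p0)
    then show ?thesis using False by simp
  qed
  have "(real n - 1) * cbc_criterion (prod g) \<alpha> s n d z powr lam = (\<Sum>x\<in>{1..n - 1}. cbc_criterion (prod g) \<alpha> s n d z powr lam)"
    using n2 by (simp add: of_nat_diff)
  also have "\<dots> \<le> (\<Sum>x\<in>{1..n - 1}. infsum ?p (Zs s \<times> D x))" by (intro sum_mono min)
  also have "\<dots> \<le> infsum ?p ?A + (real n - 1) * infsum ?p ?A'"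
    by (rule has_sum_mono[OF hc has_sum_add[OF has_sum_infsum[OF ra(1)] has_sum_cmult_right[OF h']] cnt])
  also have "\<dots> \<le> lead d * grow + (real n - 1) * (lead d / real n * grow)"
  proof (intro add_mono mult_left_mono)
    show "infsum ?p ?A \<le> lead d * grow" using ra(2) mult_right_mono[OF a(3) grow0] by linarith
    show "infsum ?p ?A' \<le> lead d / real n * grow" using ra'(2) mult_right_mono[OF a'(3) grow0] by linarith
  qed (use n2 in auto)
  also have "\<dots> = (real n - 1) * (lead d * grow * (1 / (real n - 1) + 1 / real n))"
  proof -
    have "X + m * (X' * Y) = m * (X * (1 / m + 1 / real n))" if "m \<noteq> 0" "X = lead d * grow" "X' * Y = X / real n" for X X' Y m :: real
      using that by (simp add: distrib_left)
    from this[of "real n - 1" "lead d * grow" "lead d / real n" grow] show ?thesis using n2 by simp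
  qed
  finally have "cbc_criterion (prod g) \<alpha> s n d z powr lam \<le> lead d * grow * (1 / (real n - 1) + 1 / real n)"
    using n2 by simp
  also have "\<dots> \<le> lead d * grow * (3 / real n)"
  proof (rule mult_left_mono)
    show "1 / (real n - 1) + 1 / real n \<le> 3 / real n" using n2 by (simp add: field_simps)
    show "0 \<le> lead d * grow" using a grow0 by simp
  qed
  finally show ?thesis by (simp add: mult_ac)
qed

theorem cbc_bound:
  assumes cbc: "cbc_vector (prod g) \<alpha> s n z"
  shows "S powr lam \<le> 3 * grow * (\<Sum>d=1..s. lead d) / real n"
proof -
  have "S powr lam \<le> (\<Sum>d=1..s. cbc_criterion (prod g) \<alpha> s n d z powr lam)"
    unfolding S_eq_sum_criterion
  proof (rule powr_sum_le[OF lam])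
    show "0 \<le> cbc_criterion (prod g) \<alpha> s n d z" for d
      unfolding criterion_eq by (intro infsum_nonneg) (use w_pos in \<open>auto simp: less_imp_le\<close>)
  qed
  also have "\<dots> \<le> (\<Sum>d=1..s. 3 * grow * lead d / real n)" by (intro sum_mono criterion_bound[OF cbc])
  finally show ?thesis by (simp add: sum_distrib_left sum_divide_distrib)
qed

end

end

section \<open>Interpolation of the parametric solution\<close>

context form_system
begin

text \<open>\<open>elliptic\<close> is the worst case over all signs, so it covers any factors of
  absolute value at most 1, in particular the sines.\<close>

lemma perturbed_coercive:
  assumes c: "\<And>j. j \<in> {1..s} \<Longrightarrow> \<bar>c j\<bar> \<le> 1"
  shows "amin * sqn N v \<le> (\<Sum>i<N. v i * (\<Sum>k<N. (A0 i k + (\<Sum>j=1..s. P j i k * c j)) * v k))"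
proof -
  have "(\<Sum>i<N. v i * (\<Sum>k<N. (A0 i k + (\<Sum>j=1..s. P j i k * c j)) * v k))
      = form N A0 v v + (\<Sum>i<N. \<Sum>k<N. \<Sum>j=1..s. c j * (P j i k * v i * v k))"
  proof -
    have "v i * ((A0 i k + (\<Sum>j=1..s. P j i k * c j)) * v k) = A0 i k * v i * v k + (\<Sum>j=1..s. c j * (P j i k * v i * v k))" for i k
    proof -
      have "(\<Sum>j=1..s. c j * (P j i k * v i * v k)) = (\<Sum>j=1..s. P j i k * c j) * (v i * v k)"
        unfolding sum_distrib_right by (intro sum.cong refl) (simp only: mult_ac)
      then show ?thesis by (simp only: distrib_left distrib_right mult_ac)
    qed
    then show ?thesis by (simp only: form_def sum_distrib_left sum.distrib)
  qed
  also have "(\<Sum>i<N. \<Sum>k<N. \<Sum>j=1..s. c j * (P j i k * v i * v k)) = (\<Sum>j=1..s. c j * form N (P j) v v)"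
  proof -
    have "(\<Sum>i<N. \<Sum>k<N. \<Sum>j=1..s. c j * (P j i k * v i * v k)) = (\<Sum>i<N. \<Sum>j=1..s. \<Sum>k<N. c j * (P j i k * v i * v k))"
      by (intro sum.cong refl sum.swap)
    also have "\<dots> = (\<Sum>j=1..s. \<Sum>i<N. \<Sum>k<N. c j * (P j i k * v i * v k))" by (rule sum.swap)
    finally show ?thesis by (simp only: form_def sum_distrib_left)
  qed
  finally have e: "(\<Sum>i<N. v i * (\<Sum>k<N. (A0 i k + (\<Sum>j=1..s. P j i k * c j)) * v k))
      = form N A0 v v + (\<Sum>j=1..s. c j * form N (P j) v v)" .
  have "- (\<Sum>j=1..s. Q j v) \<le> (\<Sum>j=1..s. c j * form N (P j) v v)"
    unfolding sum_negf[symmetric]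
  proof (rule sum_mono)
    fix j assume j: "j \<in> {1..s}"
    have "\<bar>c j * form N (P j) v v\<bar> \<le> 1 * \<bar>form N (P j) v v\<bar>"
      unfolding abs_mult by (intro mult_right_mono c[OF j]) simp
    then show "- Q j v \<le> c j * form N (P j) v v" using P_le[OF j, of v v] abs_ge_minus_self[of "c j * form N (P j) v v"] by simp
  qed
  then show ?thesis using elliptic[of v] e by linarith
qed

lemma perturbed_unique:
  fixes v :: "nat \<Rightarrow> real"
  assumes c: "\<And>j. j \<in> {1..s} \<Longrightarrow> \<bar>c j\<bar> \<le> 1"
    and v: "\<And>i. i < N \<Longrightarrow> (\<Sum>k<N. (A0 i k + (\<Sum>j=1..s. P j i k * c j)) * v k) = 0" and i: "i < N"
  shows "v i = 0"
proof -
  have "amin * sqn N v \<le> (\<Sum>i<N. v i * (\<Sum>k<N. (A0 i k + (\<Sum>j=1..s. P j i k * c j)) * v k))"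
    by (rule perturbed_coercive) (rule c)
  then have "amin * sqn N v \<le> 0" using v by simp
  then have "sqn N v = 0" using amin sqn_nonneg[of N v] by (simp add: mult_le_0_iff)
  then show ?thesis using i by (auto simp: sqn_def sum_nonneg_eq_0_iff)
qed

lemma solution_existence:
  fixes r :: real
  assumes "1 \<le> r"
  shows "\<exists>d. (\<forall>h\<in>Zs s. \<forall>i<N. sys_op d h i = (if h = (\<lambda>_. 0) then l i else 0)) \<and>
      (\<forall>W R F. admissible r W R \<longrightarrow> finite F \<longrightarrow> F \<subseteq> Zs s \<longrightarrow>
        (\<Sum>h\<in>F. (W h)\<^sup>2 * sqn N (d h)) \<le> 6 * sqn N l / (amin / 2)\<^sup>2)"
proof (rule solution_exists[OF assms, of l])
  fix d assume d: "\<And>h i. h \<in> Zs s \<Longrightarrow> i < N \<Longrightarrow> sys_op d h i = (if h = (\<lambda>_. 0) then l i else 0)"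
    and dW: "\<And>W R F. admissible r W R \<Longrightarrow> finite F \<Longrightarrow> F \<subseteq> Zs s \<Longrightarrow>
      (\<Sum>h\<in>F. (W h)\<^sup>2 * sqn N (d h)) \<le> 6 * sqn N l / (amin / 2)\<^sup>2"
  show ?thesis
  proof (rule exI[of _ d], intro conjI ballI allI impI)
    show "sys_op d h i = (if h = (\<lambda>_. 0) then l i else 0)" if "h \<in> Zs s" "i < N" for h i
      by (rule d[OF that])
    show "(\<Sum>h\<in>F. (W h)\<^sup>2 * sqn N (d h)) \<le> 6 * sqn N l / (amin / 2)\<^sup>2"
      if "admissible r W R" "finite F" "F \<subseteq> Zs s" for W R F
      by (rule dW[OF that])
  qed
qed

end

locale parametric_interpolation =
  form_system s N A0 P Q b amin + lattice_interpolation s n "2 * \<sigma>" z g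
  for s N A0 P Q b amin n \<sigma> z g +
  fixes B :: real
  assumes \<sigma>: "1 \<le> \<sigma>" and B: "\<And>j. j \<in> {1..s} \<Longrightarrow> b j \<le> B"
begin

definition norm_product :: real where
  "norm_product = (\<Prod>j=1..s. 1 + (decay_const \<sigma> B * exp (real \<sigma>) * (real j ^ \<sigma> * b j))\<^sup>2 / g j)"

text \<open>The coefficient functions in the spatial basis are interpolated one by one. Their
  weighted norms add up to the quantity bounded by \<open>weighted_norm_bound\<close>, so the number
  \<open>N\<close> of basis functions does not appear in the result.\<close>

theorem solution_interpolation_error:
  fixes l :: "nat \<Rightarrow> real"
  obtains f where
    "\<And>y i. i < N \<Longrightarrow> (\<Sum>k<N. (A0 i k + (\<Sum>j=1..s. P j i k * sin (2 * pi * y j))) * f k y) = l i"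
    and "\<And>\<epsilon>. 0 < \<epsilon> \<Longrightarrow> \<exists>G. integrable (Pi\<^sub>M {1..s} (\<lambda>_. unit_measure)) G \<and>
       (\<forall>y. sqn N (\<lambda>i. f i y - interpolant (f i) y) \<le> G y) \<and>
       (LINT y|Pi\<^sub>M {1..s} (\<lambda>_. unit_measure). G y)
         \<le> 2 * sqrt S * (6 * sqn N l / (amin / 2)\<^sup>2 * norm_product) + \<epsilon>"
proof -
  define r where "r = 1 + (\<Sum>j=1..s. 1 / b j)"
  have "0 \<le> (\<Sum>j=1..s. 1 / b j)" by (intro sum_nonneg divide_nonneg_pos b_pos) auto
  then have r1: "1 \<le> r" by (simp add: r_def)
  have "\<exists>d. (\<forall>h\<in>Zs s. \<forall>i<N. sys_op d h i = (if h = (\<lambda>_. 0) then l i else 0)) \<and>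
      (\<forall>W R F. admissible r W R \<longrightarrow> finite F \<longrightarrow> F \<subseteq> Zs s \<longrightarrow>
        (\<Sum>h\<in>F. (W h)\<^sup>2 * sqn N (d h)) \<le> 6 * sqn N l / (amin / 2)\<^sup>2)"
    by (rule solution_existence[OF r1])
  then obtain d where d': "\<forall>h\<in>Zs s. \<forall>i<N. sys_op d h i = (if h = (\<lambda>_. 0) then l i else 0)"
    and dW': "\<forall>W R F. admissible r W R \<longrightarrow> finite F \<longrightarrow> F \<subseteq> Zs s \<longrightarrow>
        (\<Sum>h\<in>F. (W h)\<^sup>2 * sqn N (d h)) \<le> 6 * sqn N l / (amin / 2)\<^sup>2"
    by (elim exE conjE)
  have d: "sys_op d h i = (if h = (\<lambda>_. 0) then l i else 0)" if "h \<in> Zs s" "i < N" for h i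
    using d' that by simp
  have dW: "(\<Sum>h\<in>F. (W h)\<^sup>2 * sqn N (d h)) \<le> 6 * sqn N l / (amin / 2)\<^sup>2"
    if "admissible r W R" "finite F" "F \<subseteq> Zs s" for W R F
    using dW' that by blast
  define E where "E = 6 * sqn N l / (amin / 2)\<^sup>2 * norm_product"
  have fin: "(\<Sum>h\<in>F. sqn N (d h) / w h) \<le> E" if "finite F" "F \<subseteq> Zs s" for F
    unfolding E_def norm_product_def
  proof (rule weighted_norm_bound)
    fix W R F assume "admissible (1 + (\<Sum>j=1..s. 1 / b j)) W R" and F: "finite F" "F \<subseteq> Zs s"
    then have "admissible r W R" by (simp only: r_def)
    from dW[OF this F] show "(\<Sum>h\<in>F. (W h)\<^sup>2 * sqn N (d h)) \<le> 6 * sqn N l / (amin / 2)\<^sup>2" .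
  qed (fact B g \<sigma> that)+
  have sq_summable: "(\<lambda>h. sqn N (d h) / w h) summable_on Zs s"
  proof (rule nonneg_bdd_above_summable_on)
    show "bdd_above (sum (\<lambda>h. sqn N (d h) / w h) ` {F. F \<subseteq> Zs s \<and> finite F})"
      using fin by (intro bdd_aboveI[of _ E]) auto
  qed (intro divide_nonneg_pos sqn_nonneg w_pos)
  have sq_infsum: "(\<Sum>\<^sub>\<infinity>h\<in>Zs s. sqn N (d h) / w h) \<le> E"
    by (rule infsum_le_finite_sums[OF sq_summable]) (use fin in auto)
  \<comment> \<open>The real coefficients \<open>d\<close> belong to the variable shifted by a
    quarter period; the constant phase converts them into Fourier coefficients in
    \<open>y\<close>.\<close>
  define c where "c i h = of_real (d h i) * chr s h (\<lambda>_. - 1 / 4)" for i h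
  have cn: "cmod (c i h) = \<bar>d h i\<bar>" for i h by (simp add: c_def norm_mult)
  have c2: "(\<lambda>h. (cmod (c i h))\<^sup>2 / w h) summable_on Zs s" if i: "i < N" for i
  proof (rule summable_on_comparison_test[OF sq_summable])
    fix h
    have "(d h i)\<^sup>2 \<le> sqn N (d h)" unfolding sqn_def using i by (intro member_le_sum) auto
    then show "(cmod (c i h))\<^sup>2 / w h \<le> sqn N (d h) / w h" using w_pos[of h] by (simp add: cn divide_right_mono)
  qed (intro divide_nonneg_pos zero_le_power2 w_pos)
  have c1: "(\<lambda>h. cmod (c i h)) summable_on Zs s" if i: "i < N" for i
  proof (rule summable_on_comparison_test[OF summable_on_add[OF c2[OF i] w_summable]])
    fix h
    have "0 \<le> (cmod (c i h) - w h)\<^sup>2 + cmod (c i h) * w h"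
      using w_pos[of h] by (intro add_nonneg_nonneg mult_nonneg_nonneg) auto
    then have "cmod (c i h) * w h \<le> (cmod (c i h))\<^sup>2 + (w h)\<^sup>2" by (simp add: power2_eq_square algebra_simps)
    then show "cmod (c i h) \<le> (cmod (c i h))\<^sup>2 / w h + w h"
      using w_pos[of h] by (simp add: field_simps power2_eq_square)
  qed auto
  define u where "u i y = (\<Sum>\<^sub>\<infinity>h\<in>Zs s. c i h * chr s h y)" for i y
  have u: "((\<lambda>h. c i h * chr s h y) has_sum u i y) (Zs s)" if i: "i < N" for i y
  proof -
    have "(\<lambda>h. c i h * chr s h y) summable_on Zs s"
    proof (rule abs_summable_summable)
      show "Infinite_Sum.abs_summable_on (\<lambda>h. c i h * chr s h y) (Zs s)" using c1[OF i] by (simp add: norm_mult)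
    qed
    then show ?thesis unfolding u_def by (rule has_sum_infsum)
  qed
  have phase: "c i h * chr s h y = of_real (d h i) * chr s h (\<lambda>j. y j - 1 / 4)" for i h y
  proof -
    have "dotp s h (\<lambda>j. y j - 1 / 4) = dotp s h (\<lambda>_. - 1 / 4) + dotp s h y"
      unfolding dotp_def sum.distrib[symmetric] by (intro sum.cong refl) (simp add: right_diff_distrib)
    then have "chr s h (\<lambda>j. y j - 1 / 4) = chr s h (\<lambda>_. - 1 / 4) * chr s h y"
      unfolding chr_def cis_mult by (simp only: distrib_left)
    then show ?thesis by (simp only: c_def mult.assoc)
  qed
  have sin: "cos (2 * pi * (x - 1 / 4)) = sin (2 * pi * x)" for x :: real
  proof -
    have "2 * pi * (x - 1 / 4) = 2 * pi * x - pi / 2" by (simp add: right_diff_distrib)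
    then show ?thesis by (simp add: cos_diff)
  qed
  have solves: "(\<Sum>k<N. of_real (A0 i k + (\<Sum>j=1..s. P j i k * sin (2 * pi * y j))) * u k y) = of_real (l i)"
    if i: "i < N" for i y
  proof -
    have "(\<Sum>k<N. of_real (A0 i k + (\<Sum>j=1..s. P j i k * cos (2 * pi * (y j - 1 / 4)))) * u k y) = of_real (l i)"
    proof (rule fourier_series_solves[where d = d and u = "\<lambda>i. u i y"])
      show "sys_op d h i = (if h = (\<lambda>_. 0) then l i else 0)" if "h \<in> Zs s" "i < N" for h i by (rule d[OF that])
      show "((\<lambda>h. of_real (d h i) * chr s h (\<lambda>j. y j - 1 / 4)) has_sum u i y) (Zs s)" if "i < N" for i
        using u[OF that, of y] by (simp add: phase)
    qed (rule i)
    then show ?thesis by (simp only: sin)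
  qed
  \<comment> \<open>Matrix and load are real, so the imaginary part solves the homogeneous system,
    which has only the zero solution by coercivity.\<close>
  have Im0: "Im (u k y) = 0" if k: "k < N" for k y
  proof (rule perturbed_unique[where v = "\<lambda>k. Im (u k y)" and c = "\<lambda>j. sin (2 * pi * y j)", OF _ _ k])
    fix i assume "i < N"
    from arg_cong[OF solves[OF this, of y], of Im]
    show "(\<Sum>k<N. (A0 i k + (\<Sum>j=1..s. P j i k * sin (2 * pi * y j))) * Im (u k y)) = 0"
      by (simp del: of_real_add)
  qed simp
  define f where "f i y = Re (u i y)" for i y
  have uf: "u i y = of_real (f i y)" if "i < N" for i y
    using Im0[OF that, of y] by (simp add: f_def complex_eq_iff)
  have f: "((\<lambda>h. c i h * chr s h y) has_sum of_real (f i y)) (Zs s)" if "i < N" for i y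
    using u[OF that, of y] uf[OF that] by simp
  show ?thesis
  proof (rule that)
    show "(\<Sum>k<N. (A0 i k + (\<Sum>j=1..s. P j i k * sin (2 * pi * y j))) * f k y) = l i" if "i < N" for y i
      using arg_cong[OF solves[OF that, of y], of Re] by (simp add: f_def del: of_real_add)
    fix \<epsilon> :: real assume \<epsilon>: "0 < \<epsilon>"
    let ?M = "Pi\<^sub>M {1..s} (\<lambda>_. unit_measure)"
    \<comment> \<open>The tolerance is shared by the \<open>N\<close> components;
      \<open>Suc N\<close> keeps the quotient meaningful for the trivial space.\<close>
    define X where "X i G \<longleftrightarrow> integrable ?M G \<and> (\<forall>y. (f i y - interpolant (f i) y)\<^sup>2 \<le> G y) \<and>
       (LINT y|?M. G y) \<le> 2 * sqrt S * (\<Sum>\<^sub>\<infinity>h\<in>Zs s. (cmod (c i h))\<^sup>2 / w h) + \<epsilon> / real (Suc N)" for i G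
    have "\<exists>G. X i G" if i: "i < N" for i
    proof (rule interpolation_error_coefficients[where f = "f i" and c = "c i"])
      show "((\<lambda>h. c i h * chr s h y) has_sum of_real (f i y)) (Zs s)" for y by (rule f[OF i])
      show "(\<lambda>h. (cmod (c i h))\<^sup>2 / w h) summable_on Zs s" by (rule c2[OF i])
      fix e assume e: "\<And>y. ((\<lambda>h. e h * chr s h y) has_sum of_real (f i y - interpolant (f i) y)) (Zs s)"
        "(\<lambda>h. cmod (e h)) summable_on Zs s" "(\<lambda>h. (cmod (e h))\<^sup>2) summable_on Zs s"
        "(\<Sum>\<^sub>\<infinity>h\<in>Zs s. (cmod (e h))\<^sup>2) \<le> 2 * sqrt S * (\<Sum>\<^sub>\<infinity>h\<in>Zs s. (cmod (c i h))\<^sup>2 / w h)"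
      show "\<exists>G. X i G"
      proof (rule parseval_majorant[where W = "\<lambda>y. f i y - interpolant (f i) y" and c = e and \<epsilon> = "\<epsilon> / real (Suc N)"])
        show "((\<lambda>h. e h * chr s h y) has_sum of_real (f i y - interpolant (f i) y)) (Zs s)" for y by (rule e(1))
        show "(\<lambda>h. cmod (e h)) summable_on Zs s" by (rule e(2))
        show "(\<lambda>h. (cmod (e h))\<^sup>2) summable_on Zs s" by (rule e(3))
        show "0 < \<epsilon> / real (Suc N)" using \<epsilon> by simp
        fix G assume G: "integrable ?M G" "\<And>y. (f i y - interpolant (f i) y)\<^sup>2 \<le> G y"
          "(LINT y|?M. G y) \<le> (\<Sum>\<^sub>\<infinity>h\<in>Zs s. (cmod (e h))\<^sup>2) + \<epsilon> / real (Suc N)"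
        have "X i G" unfolding X_def
        proof (intro conjI allI)
          show "integrable ?M G" by (rule G(1))
          show "(f i y - interpolant (f i) y)\<^sup>2 \<le> G y" for y by (rule G(2))
          show "(LINT y|?M. G y) \<le> 2 * sqrt S * (\<Sum>\<^sub>\<infinity>h\<in>Zs s. (cmod (c i h))\<^sup>2 / w h) + \<epsilon> / real (Suc N)"
            using G(3) e(4) by linarith
        qed
        then show "\<exists>G. X i G" using exI[of "X i" G] by blast
      qed
    qed
    then obtain G where X: "\<And>i. i < N \<Longrightarrow> X i (G i)" by metis
    have G: "integrable ?M (G i)" "(f i y - interpolant (f i) y)\<^sup>2 \<le> G i y"
      "(LINT y|?M. G i y) \<le> 2 * sqrt S * (\<Sum>\<^sub>\<infinity>h\<in>Zs s. (cmod (c i h))\<^sup>2 / w h) + \<epsilon> / real (Suc N)" if "i < N" for i y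
      using X[OF that] unfolding X_def by blast+
    show "\<exists>G. integrable ?M G \<and> (\<forall>y. sqn N (\<lambda>i. f i y - interpolant (f i) y) \<le> G y) \<and>
       (LINT y|?M. G y) \<le> 2 * sqrt S * (6 * sqn N l / (amin / 2)\<^sup>2 * norm_product) + \<epsilon>"
    proof (intro exI[of _ "\<lambda>y. \<Sum>i<N. G i y"] conjI allI)
      show "integrable ?M (\<lambda>y. \<Sum>i<N. G i y)" by (rule Bochner_Integration.integrable_sum) (rule G(1), simp)
      show "sqn N (\<lambda>i. f i y - interpolant (f i) y) \<le> (\<Sum>i<N. G i y)" for y
        unfolding sqn_def by (intro sum_mono) (simp add: G(2))
      have "(LINT y|?M. (\<Sum>i<N. G i y)) = (\<Sum>i<N. LINT y|?M. G i y)"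
        by (rule Bochner_Integration.integral_sum) (rule G(1), simp)
      also have "\<dots> \<le> (\<Sum>i<N. 2 * sqrt S * (\<Sum>\<^sub>\<infinity>h\<in>Zs s. (cmod (c i h))\<^sup>2 / w h) + \<epsilon> / real (Suc N))"
        by (rule sum_mono) (use G(3) in blast)
      also have "\<dots> = 2 * sqrt S * (\<Sum>i<N. \<Sum>\<^sub>\<infinity>h\<in>Zs s. (cmod (c i h))\<^sup>2 / w h) + real N * (\<epsilon> / real (Suc N))"
        by (simp add: sum.distrib sum_distrib_left)
      also have "(\<Sum>i<N. \<Sum>\<^sub>\<infinity>h\<in>Zs s. (cmod (c i h))\<^sup>2 / w h) = (\<Sum>\<^sub>\<infinity>h\<in>Zs s. \<Sum>i<N. (cmod (c i h))\<^sup>2 / w h)"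
        by (rule infsumI[symmetric], rule has_sum_finite_sum) (use c2 in auto)
      also have "(\<lambda>h. \<Sum>i<N. (cmod (c i h))\<^sup>2 / w h) = (\<lambda>h. sqn N (d h) / w h)"
        by (simp add: cn sqn_def sum_divide_distrib)
      also have "2 * sqrt S * (\<Sum>\<^sub>\<infinity>h\<in>Zs s. sqn N (d h) / w h) + real N * (\<epsilon> / real (Suc N)) \<le> 2 * sqrt S * E + \<epsilon>"
      proof (rule add_mono)
        show "2 * sqrt S * (\<Sum>\<^sub>\<infinity>h\<in>Zs s. sqn N (d h) / w h) \<le> 2 * sqrt S * E"
          by (intro mult_left_mono sq_infsum) (use S_pos in \<open>simp add: less_imp_le\<close>)
        show "real N * (\<epsilon> / real (Suc N)) \<le> \<epsilon>" using \<epsilon> by (simp add: field_simps)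
      qed
      finally show "(LINT y|?M. (\<Sum>i<N. G i y)) \<le> 2 * sqrt S * (6 * sqn N l / (amin / 2)\<^sup>2 * norm_product) + \<epsilon>"
        unfolding E_def .
    qed
  qed
qed

end

lemma (in fe_domain) fe_sum: "(\<And>i. i < (N::nat) \<Longrightarrow> e i \<in> V) \<Longrightarrow> (\<lambda>x. \<Sum>i<N. c i * e i x) \<in> V"
  by (rule fun_subspace_sum[OF fe_subspace]) auto

lemma (in fe_domain) cform_sums:
  assumes A: "ess_bounded A" and e: "\<And>i. i < (N::nat) \<Longrightarrow> e i \<in> V"
  shows "cform A (\<lambda>x. \<Sum>i<N. v i * e i x) (\<lambda>x. \<Sum>k<N. w k * e k x) = form N (\<lambda>i k. cform A (e i) (e k)) v w"
proof -
  have "cform A (\<lambda>x. \<Sum>i<N. v i * e i x) (\<lambda>x. \<Sum>k<N. w k * e k x)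
      = (\<Sum>i<N. v i * cform A (e i) (\<lambda>x. \<Sum>k<N. w k * e k x))"
    by (rule bilinear_on_sum_left[OF fe_subspace bilinear_cform[OF A] fe_sum]) (use e in auto)
  also have "\<dots> = (\<Sum>i<N. v i * (\<Sum>k<N. w k * cform A (e i) (e k)))"
  proof (intro sum.cong refl arg_cong2[where f = "(*)"])
    fix i assume "i \<in> {..<N}"
    then show "cform A (e i) (\<lambda>x. \<Sum>k<N. w k * e k x) = (\<Sum>k<N. w k * cform A (e i) (e k))"
      by (intro bilinear_on_sum_right[OF fe_subspace bilinear_cform[OF A]]) (use e in auto)
  qed
  also have "\<dots> = form N (\<lambda>i k. cform A (e i) (e k)) v w"
    by (simp add: form_def sum_distrib_left mult_ac)
  finally show ?thesis .
qed

lemma Linf_AE_bound: "f \<in> Linf D \<Longrightarrow> AE x in lebesgue_on D. \<bar>f x\<bar> \<le> Linf_norm D f"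
  and Linf_norm_pos: "f \<in> Linf D \<Longrightarrow> \<not> (AE x in lebesgue_on D. f x = 0) \<Longrightarrow> 0 < Linf_norm D f"
proof -
  assume f: "f \<in> Linf D"
  let ?E = "esssup (lebesgue_on D) (\<lambda>x. ereal \<bar>f x\<bar>)"
  have fin: "?E < \<infinity>" using f by (simp add: Linf_def)
  have ae: "AE x in lebesgue_on D. ereal \<bar>f x\<bar> \<le> ?E" by (rule esssup_AE)
  show *: "AE x in lebesgue_on D. \<bar>f x\<bar> \<le> Linf_norm D f"
    using ae
  proof eventually_elim
    case (elim x)
    then have "ereal (Linf_norm D f) = ?E" using fin unfolding Linf_norm_def by (cases ?E) auto
    then have "ereal \<bar>f x\<bar> \<le> ereal (Linf_norm D f)" using elim by simp
    then show ?case by simp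
  qed
  assume n: "\<not> (AE x in lebesgue_on D. f x = 0)"
  show "0 < Linf_norm D f"
  proof (rule ccontr)
    assume 0: "\<not> 0 < Linf_norm D f"
    from * have "AE x in lebesgue_on D. f x = 0" by eventually_elim (use 0 in linarith)
    with n show False by contradiction
  qed
qed

section \<open>The diffusion coefficient and its Galerkin matrices\<close>

locale diffusion_problem = fe_domain D \<T>
  for D :: "'a::euclidean_space set" and \<T> +
  fixes a0 :: "'a \<Rightarrow> real" and \<psi> :: "nat \<Rightarrow> 'a \<Rightarrow> real" and amin amax :: real
  assumes a0: "a0 \<in> Linf D" and psi: "\<And>j. 1 \<le> j \<Longrightarrow> \<psi> j \<in> Linf D"
    and psi_nz: "\<And>j. 1 \<le> j \<Longrightarrow> \<not> (AE x in lebesgue_on D. \<psi> j x = 0)"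
    and amin: "0 < amin"
    and ellipticity: "\<And>y. y \<in> param_domain \<Longrightarrow>
          AE x in lebesgue_on D. amin \<le> diffusion_coeff a0 \<psi> y x \<and> diffusion_coeff a0 \<psi> y x \<le> amax"
begin

lemma b_seq_pos: "1 \<le> j \<Longrightarrow> 0 < b_seq D \<psi> amin j"
  unfolding b_seq_def using Linf_norm_pos[OF psi psi_nz] amin by simp

lemma Linf_ess_bounded: "f \<in> Linf D \<Longrightarrow> ess_bounded f"
  using Linf_AE_bound[of f D] unfolding ess_bounded_def Linf_def by auto

definition perturbation :: "nat \<Rightarrow> 'a \<Rightarrow> real" where
  "perturbation j x = 1 / sqrt 6 * \<psi> j x"

lemma perturbation_bounded: "1 \<le> j \<Longrightarrow> ess_bounded (perturbation j)"
  unfolding perturbation_def using ess_bounded_scale[OF Linf_ess_bounded[OF psi]] by blast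

lemma perturbation_le: "1 \<le> j \<Longrightarrow> AE x in M. \<bar>perturbation j x\<bar> \<le> amin * b_seq D \<psi> amin j"
proof -
  assume j: "1 \<le> j"
  show ?thesis
    using Linf_AE_bound[OF psi[OF j]]
  proof eventually_elim
    case (elim x)
    then show ?case using amin by (simp add: perturbation_def b_seq_def abs_mult divide_right_mono)
  qed
qed

lemma diffusion_coeff_truncated:
  assumes "\<And>j. j \<notin> {1..s} \<Longrightarrow> y j = 0"
  shows "diffusion_coeff a0 \<psi> y x = a0 x + (\<Sum>j=1..s. sin (2 * pi * y j) * perturbation j x)"
proof -
  have "(\<Sum>j. sin (2 * pi * y (Suc j)) * \<psi> (Suc j) x) = (\<Sum>j<s. sin (2 * pi * y (Suc j)) * \<psi> (Suc j) x)"
    by (rule suminf_finite) (use assms in auto)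
  also have "\<dots> = (\<Sum>j=1..s. sin (2 * pi * y j) * \<psi> j x)"
    by (rule sum.reindex_bij_witness[where i = "\<lambda>j. j - 1" and j = Suc]) auto
  finally show ?thesis
    unfolding diffusion_coeff_def perturbation_def by (simp add: sum_distrib_left mult_ac)
qed

text \<open>Ellipticity at the finitely many parameters with entries in \<open>{1/4, 3/4}\<close>, where the sine is \<open>\<plusminus>1\<close>.\<close>

lemma worst_case: "AE x in M. amin \<le> a0 x - (\<Sum>j=1..s. \<bar>perturbation j x\<bar>)"
proof -
  define y where "y J j = (if j \<in> {1..s} then (if j \<in> J then 1 / 4 else 3 / 4) else 0 :: real)" for J :: "nat set" and j
  have "y J \<in> param_domain" for J by (auto simp: y_def param_domain_def)
  then have ae: "AE x in M. amin \<le> diffusion_coeff a0 \<psi> (y J) x" for J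
  proof -
    have "AE x in M. amin \<le> diffusion_coeff a0 \<psi> (y J) x \<and> diffusion_coeff a0 \<psi> (y J) x \<le> amax"
      by (rule ellipticity) fact
    then show ?thesis by eventually_elim blast
  qed
  have "AE x in M. \<forall>J\<in>Pow {1..s}. amin \<le> diffusion_coeff a0 \<psi> (y J) x"
    by (rule AE_finite_allI) (simp, rule ae)
  then show ?thesis
  proof eventually_elim
    case (elim x)
    \<comment> \<open>The sign pattern depends on the point \<open>x\<close>, which is why the
      exceptional null sets of all finitely many patterns were united beforehand.\<close>
    define J where "J = {j \<in> {1..s}. perturbation j x < 0}"
    have "J \<in> Pow {1..s}" by (auto simp: J_def)
    then have "amin \<le> diffusion_coeff a0 \<psi> (y J) x" using elim by blast
    also have "diffusion_coeff a0 \<psi> (y J) x = a0 x + (\<Sum>j=1..s. sin (2 * pi * y J j) * perturbation j x)"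
      by (rule diffusion_coeff_truncated) (simp add: y_def)
    also have "(\<Sum>j=1..s. sin (2 * pi * y J j) * perturbation j x) = (\<Sum>j=1..s. - \<bar>perturbation j x\<bar>)"
    proof (intro sum.cong refl)
      fix j assume j: "j \<in> {1..s}"
      have q: "sin (2 * pi * (1 / 4)) = 1" "sin (2 * pi * (3 / 4)) = - 1"
        using sin_3over2_pi by (simp_all add: mult.commute)
      show "sin (2 * pi * y J j) * perturbation j x = - \<bar>perturbation j x\<bar>"
        using j q by (cases "j \<in> J") (auto simp: y_def J_def)
    qed
    finally show ?case by (simp add: sum_negf)
  qed
qed

end

text \<open>Orthonormality for the gradient inner product makes \<open>sqn N\<close> the squared
  gradient norm, so the constants in \<open>form_system\<close> are those of the continuous problem
  and do not depend on the mesh.\<close>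

locale galerkin_basis = diffusion_problem D \<T> a0 \<psi> amin amax
  for D :: "'a::euclidean_space set" and \<T> a0 \<psi> amin amax +
  fixes N :: nat and e :: "nat \<Rightarrow> 'a \<Rightarrow> real"
  assumes e: "\<And>i. i < N \<Longrightarrow> e i \<in> V"
    and orthonormal: "\<And>i j. i < N \<Longrightarrow> j < N \<Longrightarrow> ip (e i) (e j) = (if i = j then 1 else 0)"
    and expand: "\<And>v. v \<in> V \<Longrightarrow> v = (\<lambda>x. \<Sum>i<N. ip v (e i) * e i x)"
begin

abbreviation "lc v \<equiv> (\<lambda>x. \<Sum>i<N. v i * e i x)"

abbreviation "A0 \<equiv> (\<lambda>i k. cform a0 (e i) (e k))"
abbreviation "P \<equiv> (\<lambda>j i k. cform (perturbation j) (e i) (e k))"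
abbreviation "Q \<equiv> (\<lambda>j v. cform (\<lambda>x. \<bar>perturbation j x\<bar>) (lc v) (lc v))"

lemma lc_V: "lc v \<in> V" by (rule fe_sum) (rule e)

lemma cform_lc: "ess_bounded A \<Longrightarrow> cform A (lc v) (lc w) = form N (\<lambda>i k. cform A (e i) (e k)) v w"
  by (rule cform_sums) (auto intro: e)

lemma ip_lc: "ip (lc v) (lc v) = sqn N v"
proof -
  have "ip (lc v) (lc v) = (\<Sum>i<N. \<Sum>k<N. (if i = k then 1 else 0) * v i * v k)"
    unfolding cform_lc[OF ess_bounded_const] form_def by (intro sum.cong refl) (simp add: orthonormal)
  also have "\<dots> = (\<Sum>i<N. \<Sum>k<N. if i = k then v i * v k else 0)" by (intro sum.cong refl) simp
  also have "\<dots> = sqn N v" unfolding sqn_def by (intro sum.cong refl) (simp add: power2_eq_square)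
  finally show ?thesis .
qed

lemma cform_const_lc: "cform (\<lambda>_. c) (lc v) (lc v) = c * sqn N v"
  using ip_lc[of v] by (simp add: cform_def)

lemma Q_bounds: "1 \<le> j \<Longrightarrow> 0 \<le> Q j v" "1 \<le> j \<Longrightarrow> Q j v \<le> amin * b_seq D \<psi> amin j * sqn N v"
proof -
  assume j: "1 \<le> j"
  note b = ess_bounded_abs[OF perturbation_bounded[OF j]]
  have "cform (\<lambda>_. 0) (lc v) (lc v) \<le> Q j v"
    by (rule cform_mono[OF ess_bounded_const b lc_V]) simp
  then show "0 \<le> Q j v" by (simp add: cform_def)
  have "Q j v \<le> cform (\<lambda>_. amin * b_seq D \<psi> amin j) (lc v) (lc v)"
    by (rule cform_mono[OF b ess_bounded_const lc_V perturbation_le[OF j]])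
  then show "Q j v \<le> amin * b_seq D \<psi> amin j * sqn N v" by (simp only: cform_const_lc)
qed

lemma Q_elliptic: "amin * sqn N v \<le> form N A0 v v - (\<Sum>j=1..s. Q j v)"
proof -
  have a: "ess_bounded a0" by (rule Linf_ess_bounded[OF a0])
  have p: "ess_bounded (\<lambda>x. \<bar>perturbation j x\<bar>)" if "j \<in> {1..s}" for j
    using that by (intro ess_bounded_abs perturbation_bounded) auto
  have ps: "ess_bounded (\<lambda>x. \<Sum>j=1..s. \<bar>perturbation j x\<bar>)" by (rule ess_bounded_sum) (use p in auto)
  have "amin * sqn N v = cform (\<lambda>_. amin) (lc v) (lc v)" by (simp only: cform_const_lc)
  also have "\<dots> \<le> cform (\<lambda>x. a0 x + (- 1) * (\<Sum>j=1..s. \<bar>perturbation j x\<bar>)) (lc v) (lc v)"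
    by (rule cform_mono[OF ess_bounded_const ess_bounded_lin[OF a ps] lc_V]) (use worst_case[of s] in simp)
  also have "\<dots> = cform a0 (lc v) (lc v) + (- 1) * cform (\<lambda>x. \<Sum>j=1..s. \<bar>perturbation j x\<bar>) (lc v) (lc v)"
    by (rule cform_lin_coeff[OF a ps lc_V lc_V])
  also have "cform (\<lambda>x. \<Sum>j=1..s. \<bar>perturbation j x\<bar>) (lc v) (lc v) = (\<Sum>j=1..s. Q j v)"
    by (rule cform_sum_coeff) (use p lc_V in auto)
  also have "cform a0 (lc v) (lc v) = form N A0 v v" by (rule cform_lc[OF a])
  finally show ?thesis by simp
qed

lemma form_system: "form_system s N A0 P Q (b_seq D \<psi> amin) amin"
proof
  show "0 < amin" by (rule amin)
  show "amin * sqn N v \<le> form N A0 v v - (\<Sum>j=1..s. Q j v)" for v by (rule Q_elliptic)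
  fix j v w assume "j \<in> {1..s}"
  then have j: "1 \<le> j" by simp
  show "0 < b_seq D \<psi> amin j" by (rule b_seq_pos[OF j])
  show "0 \<le> Q j v" "Q j v \<le> amin * b_seq D \<psi> amin j * sqn N v" by (rule Q_bounds[OF j])+
  show "\<bar>form N (P j) v w\<bar> \<le> (Q j v + Q j w) / 2"
    using cform_abs_le[OF perturbation_bounded[OF j] lc_V lc_V, of v w]
    unfolding cform_lc[OF perturbation_bounded[OF j]] .
qed

lemma Hm1_sum:
  fixes q :: "('a \<Rightarrow> real) \<Rightarrow> real"
  assumes q: "q \<in> Hm1 D"
  shows "q (lc v) = (\<Sum>i<N. v i * q (e i))"
proof -
  have add: "q (\<lambda>x. v x + w x) = q v + q w" if "v \<in> V" "w \<in> V" for v w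
    using q fe_H10 that unfolding Hm1_def by blast
  have scale: "q (\<lambda>x. c * v x) = c * q v" if "v \<in> V" for c v
    using q fe_H10 that unfolding Hm1_def by blast
  have "q (\<lambda>x. \<Sum>i<n. v i * e i x) = (\<Sum>i<n. v i * q (e i))" if "n \<le> N" for n
    using that
  proof (induction n)
    case 0
    show ?case using scale[OF fun_subspace_zero[OF fe_subspace], of 0] by simp
  next
    case (Suc n)
    have en: "e n \<in> V" using Suc.prems e by simp
    have sn: "(\<lambda>x. \<Sum>i<n. v i * e i x) \<in> V" by (rule fe_sum) (use Suc.prems e in simp)
    have "q (\<lambda>x. (\<Sum>i<n. v i * e i x) + v n * e n x) = q (\<lambda>x. \<Sum>i<n. v i * e i x) + q (\<lambda>x. v n * e n x)"
      by (rule add[OF sn fun_subspace_scale[OF fe_subspace en]])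
    then show ?case using Suc.IH Suc.prems scale[OF en] by simp
  qed
  then show ?thesis by blast
qed

text \<open>Test \<open>q\<close> with the function whose coefficients are the load vector: the
  value is the squared norm of the load, and it is at most the dual norm of \<open>q\<close> times
  the norm of the load.\<close>

lemma sqn_load:
  fixes q :: "('a \<Rightarrow> real) \<Rightarrow> real"
  assumes q: "q \<in> Hm1 D"
  shows "sqn N (\<lambda>i. q (e i)) \<le> (Hm1_norm D q)\<^sup>2"
proof (cases "sqn N (\<lambda>i. q (e i)) = 0")
  case False
  let ?l = "\<lambda>i. q (e i)"
  have pos: "0 < sqn N ?l" using False sqn_nonneg[of N ?l] by linarith
  obtain \<phi> B where a: "approx (lc ?l) \<phi> B" using fe_approx[OF lc_V[of ?l]] by blast
  have "sqn N ?l = q (lc ?l)" unfolding Hm1_sum[OF q] sqn_def by (simp add: power2_eq_square)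
  also have "\<dots> \<le> Hm1_norm D q * sqrt (sqn N ?l)"
    using Hm1_bound[OF q a] unfolding H10_norm_eq ip_lc by linarith
  finally have "sqrt (sqn N ?l) * sqrt (sqn N ?l) \<le> Hm1_norm D q * sqrt (sqn N ?l)" using pos by simp
  then have "sqrt (sqn N ?l) \<le> Hm1_norm D q" by (rule mult_right_le_imp_le) (use pos in simp)
  then have "(sqrt (sqn N ?l))\<^sup>2 \<le> (Hm1_norm D q)\<^sup>2" using pos by (intro power_mono) auto
  then show ?thesis using pos by simp
qed simp

text \<open>Testing with the basis is equivalent to testing with all of \<open>V\<close>, and
  coercivity of the matrix provides the uniqueness that the definite description in
  \<open>fe_solution\<close> requires.\<close>

lemma fe_solution_eq:
  fixes q :: "('a \<Rightarrow> real) \<Rightarrow> real"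
  assumes q: "q \<in> Hm1 D"
    and c: "\<And>i. i < N \<Longrightarrow> (\<Sum>k<N. (A0 i k + (\<Sum>j=1..s. P j i k * sin (2 * pi * y j))) * c k) = q (e i)"
  shows "fe_solution D \<T> (diffusion_coeff a0 \<psi> (truncate s y)) q = lc c"
proof -
  interpret fs: form_system s N A0 P Q "b_seq D \<psi> amin" amin by (rule form_system)
  define A where "A x = a0 x + (\<Sum>j=1..s. sin (2 * pi * y j) * perturbation j x)" for x
  have a: "ess_bounded a0" by (rule Linf_ess_bounded[OF a0])
  have p: "ess_bounded (\<lambda>x. sin (2 * pi * y j) * perturbation j x)" if "j \<in> {1..s}" for j
    using that by (intro ess_bounded_scale perturbation_bounded) auto
  have ps: "ess_bounded (\<lambda>x. \<Sum>j=1..s. sin (2 * pi * y j) * perturbation j x)" by (rule ess_bounded_sum) (use p in auto)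
  have A: "ess_bounded A" using ess_bounded_lin[OF a ps, of 1] by (simp add: A_def[abs_def])
  have coeff: "diffusion_coeff a0 \<psi> (truncate s y) = A"
  proof
    fix x
    have "diffusion_coeff a0 \<psi> (truncate s y) x = a0 x + (\<Sum>j=1..s. sin (2 * pi * truncate s y j) * perturbation j x)"
      by (rule diffusion_coeff_truncated) (auto simp: truncate_def)
    then show "diffusion_coeff a0 \<psi> (truncate s y) x = A x" by (simp add: A_def truncate_def)
  qed
  have entry: "cform A (e i) (e k) = A0 i k + (\<Sum>j=1..s. P j i k * sin (2 * pi * y j))" if i: "i < N" and k: "k < N" for i k
  proof -
    have "cform A (e i) (e k) = A0 i k + 1 * cform (\<lambda>x. \<Sum>j=1..s. sin (2 * pi * y j) * perturbation j x) (e i) (e k)"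
      using cform_lin_coeff[OF a ps e[OF i] e[OF k], of 1] by (simp add: A_def[abs_def])
    also have "cform (\<lambda>x. \<Sum>j=1..s. sin (2 * pi * y j) * perturbation j x) (e i) (e k)
        = (\<Sum>j=1..s. cform (\<lambda>x. sin (2 * pi * y j) * perturbation j x) (e i) (e k))"
      by (rule cform_sum_coeff) (use p e i k in auto)
    also have "\<dots> = (\<Sum>j=1..s. P j i k * sin (2 * pi * y j))"
    proof (intro sum.cong refl)
      fix j
      show "cform (\<lambda>x. sin (2 * pi * y j) * perturbation j x) (e i) (e k) = P j i k * sin (2 * pi * y j)"
        unfolding cform_def mult.assoc integral_mult_right_zero by (simp only: mult_ac)
    qed
    finally show ?thesis by simp
  qed
  have galerkin: "(\<forall>v\<in>V. cform A (lc u) v = q v) \<longleftrightarrow>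
      (\<forall>i<N. (\<Sum>k<N. (A0 i k + (\<Sum>j=1..s. P j i k * sin (2 * pi * y j))) * u k) = q (e i))" for u
  proof -
    have row: "cform A (lc u) (e i) = (\<Sum>k<N. (A0 i k + (\<Sum>j=1..s. P j i k * sin (2 * pi * y j))) * u k)" if i: "i < N" for i
    proof -
      have "cform A (lc u) (e i) = (\<Sum>k<N. u k * cform A (e k) (e i))"
        by (rule bilinear_on_sum_left[OF fe_subspace bilinear_cform[OF A] e[OF i]]) (use e in auto)
      also have "\<dots> = (\<Sum>k<N. (A0 i k + (\<Sum>j=1..s. P j i k * sin (2 * pi * y j))) * u k)"
      proof (intro sum.cong refl)
        fix k assume "k \<in> {..<N}"
        then have k: "k < N" by simp
        show "u k * cform A (e k) (e i) = (A0 i k + (\<Sum>j=1..s. P j i k * sin (2 * pi * y j))) * u k"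
          unfolding cform_sym[of A "e k"] entry[OF i k] by (rule mult.commute)
      qed
      finally show ?thesis .
    qed
    show ?thesis
    proof
      assume *: "\<forall>v\<in>V. cform A (lc u) v = q v"
      show "\<forall>i<N. (\<Sum>k<N. (A0 i k + (\<Sum>j=1..s. P j i k * sin (2 * pi * y j))) * u k) = q (e i)"
      proof (intro allI impI)
        fix i assume i: "i < N"
        show "(\<Sum>k<N. (A0 i k + (\<Sum>j=1..s. P j i k * sin (2 * pi * y j))) * u k) = q (e i)"
          using row[OF i] bspec[OF * e[OF i]] by simp
      qed
    next
      assume *: "\<forall>i<N. (\<Sum>k<N. (A0 i k + (\<Sum>j=1..s. P j i k * sin (2 * pi * y j))) * u k) = q (e i)"
      have "cform A (lc u) (lc v) = q (lc v)" for v
      proof -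
        have "cform A (lc u) (lc v) = (\<Sum>i<N. v i * cform A (lc u) (e i))"
          by (rule bilinear_on_sum_right[OF fe_subspace bilinear_cform[OF A] lc_V]) (use e in auto)
        also have "\<dots> = (\<Sum>i<N. v i * q (e i))"
        proof (intro sum.cong refl)
          fix i assume "i \<in> {..<N}"
          then have i: "i < N" by simp
          show "v i * cform A (lc u) (e i) = v i * q (e i)" unfolding row[OF i] using * i by simp
        qed
        finally show ?thesis by (simp only: Hm1_sum[OF q])
      qed
      note lc = this
      show "\<forall>v\<in>V. cform A (lc u) v = q v"
      proof
        fix v assume v: "v \<in> V"
        define w where "w i = ip v (e i)" for i
        have "v = lc w" unfolding w_def by (rule expand[OF v])
        then show "cform A (lc u) v = q v" using lc[of w] by simp
      qed
    qed
  qed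
  have "fe_solution D \<T> A q = (THE u. u \<in> V \<and> (\<forall>v\<in>V. cform A u v = q v))"
    by (simp add: fe_solution_def cform_def)
  also have "\<dots> = lc c"
  proof (rule the_equality)
    show "lc c \<in> V \<and> (\<forall>v\<in>V. cform A (lc c) v = q v)"
      unfolding galerkin[of c] using c lc_V by blast
    fix u assume u: "u \<in> V \<and> (\<forall>v\<in>V. cform A u v = q v)"
    define u' where "u' i = ip u (e i)" for i
    have uu: "u = lc u'" unfolding u'_def by (rule expand) (use u in blast)
    have u': "\<forall>i<N. (\<Sum>k<N. (A0 i k + (\<Sum>j=1..s. P j i k * sin (2 * pi * y j))) * u' k) = q (e i)"
      using u galerkin[of u'] unfolding uu[symmetric] by blast
    have "u' i - c i = 0" if i: "i < N" for i
    proof (rule fs.perturbed_unique[where v = "\<lambda>i. u' i - c i" and c = "\<lambda>j. sin (2 * pi * y j)"])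
      fix i assume i: "i < N"
      show "(\<Sum>k<N. (A0 i k + (\<Sum>j=1..s. P j i k * sin (2 * pi * y j))) * (u' k - c k)) = 0"
        unfolding right_diff_distrib sum_subtractf using u' c[OF i] i by simp
    qed (use i in auto)
    then show "u = lc c" unfolding uu by simp
  qed
  finally show ?thesis by (simp only: coeff)
qed

end

text \<open>Interpolation is linear, so for fixed \<open>y\<close> the error is the finite element
  function whose coefficients are the interpolation errors of the coefficient functions. Poincare
  bounds its L2 norm on \<open>D\<close> by \<open>sqn\<close>, and only an integral over
  \<open>y\<close> is left.\<close>

lemma (in galerkin_basis) galerkin_error_bound:
  fixes q :: "('a \<Rightarrow> real) \<Rightarrow> real"
  assumes s: "1 \<le> s" and \<sigma>: "1 \<le> \<sigma>" and n: "prime n"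
    and z: "\<And>j. j \<in> {1..s} \<Longrightarrow> z j \<in> {1..n - 1}" and g: "\<And>j. j \<in> {1..s} \<Longrightarrow> 0 < g j"
    and B: "\<And>j. j \<in> {1..s} \<Longrightarrow> b_seq D \<psi> amin j \<le> B" and q: "q \<in> Hm1 D"
    and R: "\<And>x. x \<in> D \<Longrightarrow> norm x \<le> R" "0 < R"
  shows "(interpolation_error D (prod g) (2 * \<sigma>) s n z (u_fe D a0 \<psi> \<T> q s))\<^sup>2
    \<le> 4 * R\<^sup>2 * (2 * sqrt (lattice_sum (prod g) (2 * \<sigma>) s (dual_lattice s n z)) *
        (6 * (Hm1_norm D q)\<^sup>2 / (amin / 2)\<^sup>2 *
          (\<Prod>j=1..s. 1 + (decay_const \<sigma> B * exp (real \<sigma>) * (real j ^ \<sigma> * b_seq D \<psi> amin j))\<^sup>2 / g j)))"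
proof -
  interpret fs: form_system s N A0 P Q "b_seq D \<psi> amin" amin by (rule form_system)
  interpret pin: parametric_interpolation s N A0 P Q "b_seq D \<psi> amin" amin n \<sigma> z g B
  proof unfold_locales
    show "z j \<in> {1..n - 1}" if "j \<in> {1..s}" for j by (rule z[OF that])
    show "0 < g j" if "j \<in> {1..s}" for j by (rule g[OF that])
    show "b_seq D \<psi> amin j \<le> B" if "j \<in> {1..s}" for j by (rule B[OF that])
  qed (use s n \<sigma> in auto)
  let ?U = "Pi\<^sub>M {1..s} (\<lambda>_. restrict_space lborel {0..1::real})"
  let ?l = "\<lambda>i. q (e i)"
  let ?I = "kernel_interpolant (prod g) (2 * \<sigma>) s n z"
  let ?S = "pin.S"
  define E where "E = 2 * sqrt ?S * (6 * sqn N ?l / (amin / 2)\<^sup>2 * pin.norm_product)"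
  define X where "X f \<longleftrightarrow> (\<forall>y. \<forall>i<N. (\<Sum>k<N. (A0 i k + (\<Sum>j=1..s. P j i k * sin (2 * pi * y j))) * f k y) = ?l i) \<and>
     (\<forall>\<epsilon>>0. \<exists>G. integrable ?U G \<and> (\<forall>y. sqn N (\<lambda>i. f i y - ?I (f i) y) \<le> G y) \<and> (LINT y|?U. G y) \<le> E + \<epsilon>)" for f
  have "\<exists>f. X f"
  proof (rule pin.solution_interpolation_error[where l = ?l])
    fix f assume f: "\<And>y i. i < N \<Longrightarrow> (\<Sum>k<N. (A0 i k + (\<Sum>j=1..s. P j i k * sin (2 * pi * y j))) * f k y) = ?l i"
      and G: "\<And>\<epsilon>. 0 < \<epsilon> \<Longrightarrow> \<exists>G. integrable (Pi\<^sub>M {1..s} (\<lambda>_. unit_measure)) G \<and>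
       (\<forall>y. sqn N (\<lambda>i. f i y - ?I (f i) y) \<le> G y) \<and>
       (LINT y|Pi\<^sub>M {1..s} (\<lambda>_. unit_measure). G y)
         \<le> 2 * sqrt ?S * (6 * sqn N ?l / (amin / 2)\<^sup>2 * pin.norm_product) + \<epsilon>"
    have "X f" unfolding X_def E_def
    proof (intro conjI allI impI)
      show "(\<Sum>k<N. (A0 i k + (\<Sum>j=1..s. P j i k * sin (2 * pi * y j))) * f k y) = ?l i" if "i < N" for y i by (rule f[OF that])
    qed (rule G)
    then show "\<exists>f. X f" using exI[of X f] by blast
  qed
  then obtain f where Xf: "X f" by blast
  have f: "\<And>y i. i < N \<Longrightarrow> (\<Sum>k<N. (A0 i k + (\<Sum>j=1..s. P j i k * sin (2 * pi * y j))) * f k y) = ?l i"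
    using Xf unfolding X_def by blast
  have u: "u_fe D a0 \<psi> \<T> q s x = (\<lambda>y. \<Sum>i<N. e i x * f i y)" for x
  proof
    fix y
    have "fe_solution D \<T> (diffusion_coeff a0 \<psi> (truncate s y)) q = lc (\<lambda>i. f i y)"
      by (rule fe_solution_eq[OF q]) (rule f)
    then show "u_fe D a0 \<psi> \<T> q s x y = (\<Sum>i<N. e i x * f i y)"
      unfolding u_fe_def by (simp add: mult.commute)
  qed
  have diff: "u_fe D a0 \<psi> \<T> q s x y - ?I (u_fe D a0 \<psi> \<T> q s x) y = lc (\<lambda>i. f i y - ?I (f i) y) x" for x y
    unfolding u pin.interpolant_sum by (simp add: sum_subtractf[symmetric] algebra_simps)
  have inner: "(LINT x|M. (u_fe D a0 \<psi> \<T> q s x y - ?I (u_fe D a0 \<psi> \<T> q s x) y)\<^sup>2)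
      \<le> 4 * R\<^sup>2 * sqn N (\<lambda>i. f i y - ?I (f i) y)" for y
    unfolding diff using fe_poincare[OF lc_V R] unfolding ip_lc .
  have outer: "(LINT y|?U. LINT x|M. (u_fe D a0 \<psi> \<T> q s x y - ?I (u_fe D a0 \<psi> \<T> q s x) y)\<^sup>2) \<le> 4 * R\<^sup>2 * E"
  proof (rule field_le_epsilon)
    fix \<delta> :: real assume \<delta>: "0 < \<delta>"
    have \<epsilon>: "0 < \<delta> / (4 * R\<^sup>2)" using \<delta> R(2) by simp
    then obtain G where G: "integrable ?U G" "\<And>y. sqn N (\<lambda>i. f i y - ?I (f i) y) \<le> G y"
      "(LINT y|?U. G y) \<le> E + \<delta> / (4 * R\<^sup>2)"
      using Xf unfolding X_def by blast
    have "(LINT y|?U. LINT x|M. (u_fe D a0 \<psi> \<T> q s x y - ?I (u_fe D a0 \<psi> \<T> q s x) y)\<^sup>2) \<le> (LINT y|?U. 4 * R\<^sup>2 * G y)"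
    \<comment> \<open>It is the majorant that has to be integrable: an integrand on the left that is
      not integrable has integral 0 by convention.\<close>
    proof (rule integral_mono')
      show "integrable ?U (\<lambda>y. 4 * R\<^sup>2 * G y)" using G(1) by (rule integrable_mult_right)
      fix y
      have "4 * R\<^sup>2 * sqn N (\<lambda>i. f i y - ?I (f i) y) \<le> 4 * R\<^sup>2 * G y" by (intro mult_left_mono G(2)) simp
      then show "(LINT x|M. (u_fe D a0 \<psi> \<T> q s x y - ?I (u_fe D a0 \<psi> \<T> q s x) y)\<^sup>2) \<le> 4 * R\<^sup>2 * G y"
        using inner[of y] by linarith
      have "0 \<le> G y" using order_trans[OF sqn_nonneg G(2)[of y]] .
      then show "0 \<le> 4 * R\<^sup>2 * G y" by simp
    qed
    also have "\<dots> = 4 * R\<^sup>2 * (LINT y|?U. G y)" by simp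
    also have "\<dots> \<le> 4 * R\<^sup>2 * (E + \<delta> / (4 * R\<^sup>2))" by (intro mult_left_mono G(3)) simp
    also have "\<dots> = 4 * R\<^sup>2 * E + \<delta>" using R(2) by (simp add: distrib_left)
    finally show "(LINT y|?U. LINT x|M. (u_fe D a0 \<psi> \<T> q s x y - ?I (u_fe D a0 \<psi> \<T> q s x) y)\<^sup>2) \<le> 4 * R\<^sup>2 * E + \<delta>" .
  qed
  have np: "0 \<le> pin.norm_product" unfolding pin.norm_product_def using g by (intro prod_nonneg ballI add_nonneg_nonneg divide_nonneg_pos) auto
  have S0: "0 \<le> ?S" using pin.S_pos by linarith
  have "(interpolation_error D (prod g) (2 * \<sigma>) s n z (u_fe D a0 \<psi> \<T> q s))\<^sup>2
      = (LINT y|?U. LINT x|M. (u_fe D a0 \<psi> \<T> q s x y - ?I (u_fe D a0 \<psi> \<T> q s x) y)\<^sup>2)"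
    unfolding interpolation_error_def by (rule real_sqrt_pow2) (intro integral_nonneg_AE AE_I2, simp)
  also have "\<dots> \<le> 4 * R\<^sup>2 * E" by (rule outer)
  also have "\<dots> \<le> 4 * R\<^sup>2 * (2 * sqrt ?S * (6 * (Hm1_norm D q)\<^sup>2 / (amin / 2)\<^sup>2 * pin.norm_product))"
    unfolding E_def
    by (intro mult_left_mono mult_right_mono divide_right_mono sqn_load[OF q] np) (use S0 in auto)
  finally show ?thesis unfolding pin.norm_product_def pin.S_def .
qed

lemma (in diffusion_problem) interpolation_error_bound:
  fixes q :: "('a \<Rightarrow> real) \<Rightarrow> real"
  assumes "1 \<le> s" "1 \<le> \<sigma>" "prime n" "\<And>j. j \<in> {1..s} \<Longrightarrow> z j \<in> {1..n - 1}" "\<And>j. j \<in> {1..s} \<Longrightarrow> 0 < g j"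
    "\<And>j. j \<in> {1..s} \<Longrightarrow> b_seq D \<psi> amin j \<le> B" "q \<in> Hm1 D" "\<And>x. x \<in> D \<Longrightarrow> norm x \<le> R" "0 < R"
  shows "(interpolation_error D (prod g) (2 * \<sigma>) s n z (u_fe D a0 \<psi> \<T> q s))\<^sup>2
    \<le> 4 * R\<^sup>2 * (2 * sqrt (lattice_sum (prod g) (2 * \<sigma>) s (dual_lattice s n z)) *
        (6 * (Hm1_norm D q)\<^sup>2 / (amin / 2)\<^sup>2 *
          (\<Prod>j=1..s. 1 + (decay_const \<sigma> B * exp (real \<sigma>) * (real j ^ \<sigma> * b_seq D \<psi> amin j))\<^sup>2 / g j)))"
proof (rule fe_basis)
  fix N and e :: "nat \<Rightarrow> 'a \<Rightarrow> real"
  assume e: "\<And>i. i < N \<Longrightarrow> e i \<in> V" "\<And>i j. i < N \<Longrightarrow> j < N \<Longrightarrow> ip (e i) (e j) = (if i = j then 1 else 0)"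
    "\<And>v. v \<in> V \<Longrightarrow> v = (\<lambda>x. \<Sum>i<N. ip v (e i) * e i x)"
  interpret galerkin_basis D \<T> a0 \<psi> amin amax N e
  proof unfold_locales
    show "e i \<in> V" if "i < N" for i by (rule e(1)[OF that])
    show "ip (e i) (e j) = (if i = j then 1 else 0)" if "i < N" "j < N" for i j by (rule e(2)[OF that])
    show "v = (\<lambda>x. \<Sum>i<N. ip v (e i) * e i x)" if "v \<in> V" for v by (rule e(3)[OF that])
  qed
  show ?thesis
    by (rule galerkin_error_bound) (fact assms)+
qed

section \<open>The weights\<close>

text \<open>\<open>Stirling \<sigma> 1\<close> is 1 for positive \<sigma>, so the linear term of the
  polynomial already equals \<open>x\<close>.\<close>

lemma Bell_poly_ge:
  assumes "1 \<le> \<sigma>" "0 \<le> x"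
  shows "x \<le> Bell_poly \<sigma> x"
proof -
  have S1: "Stirling \<sigma> 1 = 1" using assms(1) Stirling_1[of "\<sigma> - 1"] by (simp del: Stirling.simps Stirling_1)
  have "real (Stirling \<sigma> 1) * x ^ 1 \<le> (\<Sum>m=0..\<sigma>. real (Stirling \<sigma> m) * x ^ m)"
    by (rule member_le_sum) (use assms in auto)
  then show ?thesis unfolding S1 Bell_poly_def by simp
qed

text \<open>For positive \<sigma> the constant term vanishes, so a factor \<open>x\<close> can be
  taken out of every term.\<close>

lemma Bell_poly_le:
  assumes \<sigma>: "1 \<le> \<sigma>" and x: "0 \<le> x" "x \<le> B" and B: "1 \<le> B"
  shows "Bell_poly \<sigma> x \<le> (\<Sum>m=0..\<sigma>. real (Stirling \<sigma> m) * B ^ \<sigma>) * x"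
  unfolding Bell_poly_def sum_distrib_right
proof (rule sum_mono)
  fix m assume m: "m \<in> {0..\<sigma>}"
  show "real (Stirling \<sigma> m) * x ^ m \<le> real (Stirling \<sigma> m) * B ^ \<sigma> * x"
  proof (cases m)
    case 0
    then have "Stirling \<sigma> m = 0" using \<sigma> by (cases \<sigma>) auto
    then show ?thesis by simp
  next
    case (Suc m')
    have "x ^ m' \<le> B ^ m'" using x by (intro power_mono) auto
    also have "\<dots> \<le> B ^ \<sigma>" using B m Suc by (intro power_increasing) auto
    finally have "x ^ m' * x \<le> B ^ \<sigma> * x" using x by (intro mult_right_mono) auto
    then have "real (Stirling \<sigma> m) * (x ^ m' * x) \<le> real (Stirling \<sigma> m) * (B ^ \<sigma> * x)" by (intro mult_left_mono) auto
    then show ?thesis using Suc by (simp add: mult_ac)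
  qed
qed

text \<open>The first \<open>j\<close> terms of the series are all at least
  \<open>f j powr p\<close>, so \<open>j * f j powr p\<close> is at most the whole sum.\<close>

lemma decreasing_summable_powr_bound:
  fixes f :: "nat \<Rightarrow> real"
  assumes pos: "\<And>j. 1 \<le> j \<Longrightarrow> 0 < f j" and dec: "\<And>j. 1 \<le> j \<Longrightarrow> f (Suc j) \<le> f j"
    and p: "0 < p" and s: "summable (\<lambda>j. f (Suc j) powr p)"
  shows "\<exists>C>0. \<forall>j\<ge>1. f j \<le> C * real j powr (- 1 / p)"
proof -
  define T where "T = (\<Sum>j. f (Suc j) powr p)"
  have mono: "f j \<le> f i" if "1 \<le> i" "i \<le> j" for i j
    using that(2) by (induction j rule: dec_induct) (use dec that(1) in \<open>auto intro: order_trans\<close>)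
  have T0: "0 < T" unfolding T_def by (rule suminf_pos[OF s]) (use pos in \<open>simp add: powr_gt_zero less_imp_neq[THEN not_sym]\<close>)
  have "f j \<le> T powr (1 / p) * real j powr (- 1 / p)" if j: "1 \<le> j" for j
  proof -
    have "(\<Sum>i<j. f j powr p) \<le> (\<Sum>i<j. f (Suc i) powr p)"
      using p pos[OF j] mono[of _ j] by (intro sum_mono powr_mono2) auto
    also have "\<dots> \<le> T" unfolding T_def by (rule sum_le_suminf[OF s]) auto
    finally have "real j * f j powr p \<le> T" by simp
    then have "f j powr p \<le> T / real j" using j by (simp add: field_simps)
    then have "(f j powr p) powr (1 / p) \<le> (T / real j) powr (1 / p)" using p by (intro powr_mono2) auto
    then have "f j \<le> (T / real j) powr (1 / p)" using p pos[OF j] by (simp add: powr_powr)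
    also have "\<dots> = T powr (1 / p) * real j powr (- 1 / p)"
      using T0 j by (simp add: powr_divide powr_minus_divide)
    finally show ?thesis .
  qed
  then show ?thesis using T0 by (intro exI[of _ "T powr (1 / p)"]) auto
qed

lemma prod_one_plus_le_exp:
  fixes x :: "nat \<Rightarrow> real"
  assumes "\<And>j. j \<in> J \<Longrightarrow> 0 \<le> x j" "finite J"
  shows "(\<Prod>j\<in>J. 1 + x j) \<le> exp (\<Sum>j\<in>J. x j)"
proof -
  have "(\<Prod>j\<in>J. 1 + x j) \<le> (\<Prod>j\<in>J. exp (x j))"
    using assms(1) exp_ge_add_one_self by (intro prod_mono) (auto intro: add_nonneg_nonneg)
  then show ?thesis using assms(2) by (simp add: exp_sum)
qed

definition weight_factor :: "(nat \<Rightarrow> real) \<Rightarrow> nat \<Rightarrow> real \<Rightarrow> nat \<Rightarrow> real" where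
  "weight_factor b \<sigma> lam j = (((real j * real \<sigma>) ^ \<sigma> * Bell_poly \<sigma> (b j))\<^sup>2
     / (2 * exp 1 powr (1 / exp 1) * zeta_real (real (2 * \<sigma>) * lam))) powr (1 / (1 + lam))"

lemma product_weight_eq: "product_weight b (2 * \<sigma>) \<sigma> lam = prod (weight_factor b \<sigma> lam)"
  by (simp add: fun_eq_iff product_weight_def weight_factor_def)

text \<open>The exponent \<open>1 / (1 + \<lambda>)\<close> balances the growth of the CBC bound, through \<open>g\<^sub>j powr \<lambda>\<close>, against the
  norm of the solution, through \<open>(j^\<sigma> b\<^sub>j)\<^sup>2 / g\<^sub>j\<close>: both are of the order of the same summable sequence.\<close>

lemma weight_factor_bounds:
  fixes b :: "nat \<Rightarrow> real"
  assumes pos: "\<And>j. 1 \<le> j \<Longrightarrow> 0 < b j" and B: "\<And>j. 1 \<le> j \<Longrightarrow> b j \<le> B"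
    and decay: "\<And>j. 1 \<le> j \<Longrightarrow> b j \<le> c0 * real j powr (- 1 / p)" and c0: "0 < c0" and p: "0 < p"
    and \<sigma>: "1 \<le> \<sigma>" and lam: "0 < lam" "1 < real (2 * \<sigma>) * lam" and expo: "1 / lam + 1 < 2 / p - 2 * real \<sigma>"
  shows "\<exists>K>0. \<exists>\<Gamma>>0. (\<forall>j\<ge>1. 0 < weight_factor b \<sigma> lam j
      \<and> (real j ^ \<sigma> * b j)\<^sup>2 / weight_factor b \<sigma> lam j \<le> K * weight_factor b \<sigma> lam j powr lam)
    \<and> (\<forall>s. (\<Sum>j=1..s. weight_factor b \<sigma> lam j powr lam) \<le> \<Gamma>)"
proof -
  define K where "K = 2 * exp 1 powr (1 / exp 1) * zeta_real (real (2 * \<sigma>) * lam)"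
  define g where "g = weight_factor b \<sigma> lam"
  define a where "a j = (real j * real \<sigma>) ^ \<sigma> * Bell_poly \<sigma> (b j)" for j
  define \<theta> where "\<theta> = lam / (1 + lam)"
  have K: "0 < K" unfolding K_def using zeta_real_pos[OF lam(2)] by simp
  have ge: "g j = ((a j)\<^sup>2 / K) powr (1 / (1 + lam))" for j by (simp add: g_def weight_factor_def a_def K_def)
  have a_ge: "real j ^ \<sigma> * b j \<le> a j" and a_pos: "0 < a j" if j: "1 \<le> j" for j
  proof -
    have bb: "b j \<le> Bell_poly \<sigma> (b j)" using Bell_poly_ge[OF \<sigma>, of "b j"] pos[OF j] by simp
    have "real j * 1 \<le> real j * real \<sigma>" using \<sigma> by (intro mult_left_mono) auto
    then have "real j ^ \<sigma> \<le> (real j * real \<sigma>) ^ \<sigma>" by (intro power_mono) auto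
    then show "real j ^ \<sigma> * b j \<le> a j" unfolding a_def using bb pos[OF j] by (intro mult_mono) auto
    moreover have "0 < real j ^ \<sigma> * b j" using j pos[OF j] by simp
    ultimately show "0 < a j" by linarith
  qed
  have gpos: "0 < g j" if "1 \<le> j" for j unfolding ge using a_pos[OF that] K by simp
  have ratio: "(real j ^ \<sigma> * b j)\<^sup>2 / g j \<le> K * g j powr lam" if j: "1 \<le> j" for j
  proof -
    have "(real j ^ \<sigma> * b j)\<^sup>2 \<le> (a j)\<^sup>2" using a_ge[OF j] pos[OF j] by (intro power_mono) auto
    also have "(a j)\<^sup>2 = K * g j powr (1 + lam)" unfolding ge using a_pos[OF j] K lam by (simp add: powr_powr)
    also have "\<dots> = K * g j powr lam * g j" using gpos[OF j] by (simp add: powr_add)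
    finally show ?thesis using gpos[OF j] by (simp add: pos_divide_le_eq)
  qed
  define CB where "CB = (\<Sum>m=0..\<sigma>. real (Stirling \<sigma> m) * max 1 B ^ \<sigma>)"
  have CB0: "0 \<le> CB" unfolding CB_def by (intro sum_nonneg) auto
  define A where "A = real \<sigma> ^ \<sigma> * (CB * c0)"
  have A0: "0 \<le> A" unfolding A_def using CB0 c0 by simp
  have a_le: "a j \<le> A * real j powr (real \<sigma> - 1 / p)" if j: "1 \<le> j" for j
  proof -
    have "Bell_poly \<sigma> (b j) \<le> CB * b j"
      unfolding CB_def by (rule Bell_poly_le[OF \<sigma>]) (use pos[OF j] B[OF j] in auto)
    also have "\<dots> \<le> CB * (c0 * real j powr (- 1 / p))" by (rule mult_left_mono[OF decay[OF j] CB0])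
    finally have "a j \<le> (real j * real \<sigma>) ^ \<sigma> * (CB * (c0 * real j powr (- 1 / p)))"
      unfolding a_def by (intro mult_left_mono) auto
    also have "\<dots> = A * (real j ^ \<sigma> * real j powr (- 1 / p))" by (simp add: A_def power_mult_distrib mult_ac)
    also have "real j ^ \<sigma> * real j powr (- 1 / p) = real j powr (real \<sigma> - 1 / p)"
      using j by (simp add: powr_realpow[symmetric] powr_add[symmetric])
    finally show ?thesis .
  qed
  define ex where "ex = 2 * (real \<sigma> - 1 / p) * \<theta>"
  \<comment> \<open>This is the assumption \<open>expo\<close> rewritten: it says that the bound
    \<open>j powr ex\<close> for \<open>g j powr lam\<close> is summable.\<close>
  have ex: "ex < - 1"
  proof -
    have "(1 / lam + 1) * lam < (2 / p - 2 * real \<sigma>) * lam" using expo lam by (intro mult_strict_right_mono) auto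
    then have "1 + lam < (2 / p - 2 * real \<sigma>) * lam" using lam by (simp add: distrib_right)
    then have "1 < (2 / p - 2 * real \<sigma>) * lam / (1 + lam)" using lam by (simp add: pos_less_divide_eq)
    also have "2 / p - 2 * real \<sigma> = - (2 * (real \<sigma> - 1 / p))" by (simp add: right_diff_distrib)
    also have "- (2 * (real \<sigma> - 1 / p)) * lam / (1 + lam) = - ex"
    proof -
      have "- X * lam / (1 + lam) = - (X * (lam / (1 + lam)))" for X :: real by simp
      then show ?thesis unfolding ex_def \<theta>_def .
    qed
    finally show ?thesis by simp
  qed
  define C1 where "C1 = (A\<^sup>2 / K) powr \<theta>"
  have C10: "0 \<le> C1" by (simp add: C1_def)
  have th: "0 < \<theta>" unfolding \<theta>_def using lam by simp
  have G_le: "g j powr lam \<le> C1 * real j powr ex" if j: "1 \<le> j" for j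
  proof -
    have "(a j)\<^sup>2 \<le> (A * real j powr (real \<sigma> - 1 / p))\<^sup>2" using a_le[OF j] a_pos[OF j] by (intro power_mono) auto
    then have "(a j)\<^sup>2 / K \<le> A\<^sup>2 / K * (real j powr (real \<sigma> - 1 / p))\<^sup>2"
      using K by (simp add: power_mult_distrib divide_right_mono)
    then have "((a j)\<^sup>2 / K) powr \<theta> \<le> (A\<^sup>2 / K * (real j powr (real \<sigma> - 1 / p))\<^sup>2) powr \<theta>"
      using K th by (intro powr_mono2) auto
    also have "\<dots> = C1 * ((real j powr (real \<sigma> - 1 / p))\<^sup>2) powr \<theta>"
      unfolding C1_def by (rule powr_mult)
    also have "((real j powr (real \<sigma> - 1 / p))\<^sup>2) powr \<theta> = real j powr ex"
    proof -
      have "(real j powr (real \<sigma> - 1 / p))\<^sup>2 = real j powr ((real \<sigma> - 1 / p) + (real \<sigma> - 1 / p))"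
        unfolding powr_add by (simp add: power2_eq_square)
      also have "(real \<sigma> - 1 / p) + (real \<sigma> - 1 / p) = 2 * (real \<sigma> - 1 / p)" by simp
      finally show ?thesis by (simp only: powr_powr ex_def)
    qed
    finally have "((a j)\<^sup>2 / K) powr \<theta> \<le> C1 * real j powr ex" .
    moreover have "g j powr lam = ((a j)\<^sup>2 / K) powr \<theta>" unfolding ge \<theta>_def by (simp add: powr_powr)
    ultimately show ?thesis by simp
  qed
  have sm: "summable (\<lambda>j. real j powr ex)" using ex by (simp add: summable_real_powr_iff)
  define \<Gamma> where "\<Gamma> = C1 * (\<Sum>j. real j powr ex) + 1"
  have G: "(\<Sum>j=1..s. g j powr lam) \<le> \<Gamma>" for s
  proof -
    have "(\<Sum>j=1..s. g j powr lam) \<le> (\<Sum>j=1..s. C1 * real j powr ex)" using G_le by (intro sum_mono) auto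
    also have "\<dots> = C1 * (\<Sum>j=1..s. real j powr ex)" by (simp add: sum_distrib_left)
    also have "\<dots> \<le> C1 * (\<Sum>j. real j powr ex)" by (intro mult_left_mono[OF _ C10] sum_le_suminf[OF sm]) auto
    finally show ?thesis by (simp add: \<Gamma>_def)
  qed
  have "0 \<le> (\<Sum>j. real j powr ex)" by (rule suminf_nonneg[OF sm]) simp
  then have \<Gamma>: "0 < \<Gamma>" unfolding \<Gamma>_def using C10 by (intro add_nonneg_pos mult_nonneg_nonneg) auto
  show ?thesis
    using K \<Gamma> gpos ratio G unfolding g_def[symmetric] by blast
qed

section \<open>The error bound\<close>

lemma (in fe_domain) Hm1_norm_nonneg:
  fixes q :: "('a \<Rightarrow> real) \<Rightarrow> real"
  assumes q: "q \<in> Hm1 D"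
  shows "0 \<le> Hm1_norm D q"
proof -
  have z: "(\<lambda>_. 0) \<in> V" by (rule fun_subspace_zero[OF fe_subspace])
  have "ip (\<lambda>_. 0) (\<lambda>_. 0) = 0"
    using bilinear_on_sum_left[OF fe_subspace bilinear_cform[OF ess_bounded_const] z, of "{} :: nat set"] by simp
  then have n: "H10_norm D (\<lambda>_. 0) \<le> 1" unfolding H10_norm_eq by simp
  obtain C where C: "\<And>v. v \<in> H10 D \<Longrightarrow> \<bar>q v\<bar> \<le> C * H10_norm D v" using q unfolding Hm1_def by blast
  have "\<bar>q (\<lambda>_. 0)\<bar> \<le> Hm1_norm D q"
    unfolding Hm1_norm_def
  proof (rule cSUP_upper)
    show "(\<lambda>_. 0) \<in> {v \<in> H10 D. H10_norm D v \<le> 1}" using fe_H10[OF z] n by blast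
    show "bdd_above ((\<lambda>v. \<bar>q v\<bar>) ` {v \<in> H10 D. H10_norm D v \<le> 1})"
    proof (rule bdd_aboveI2)
      fix v assume "v \<in> {v \<in> H10 D. H10_norm D v \<le> 1}"
      then have v: "v \<in> H10 D" "H10_norm D v \<le> 1" by auto
      have "0 \<le> H10_norm D v" by (simp add: H10_norm_def)
      then have "C * H10_norm D v \<le> \<bar>C\<bar> * 1" using v(2) by (intro mult_mono) auto
      then show "\<bar>q v\<bar> \<le> \<bar>C\<bar>" using C[OF v(1)] by simp
    qed
  qed
  then show ?thesis using abs_ge_zero order_trans by blast
qed

text \<open>From \<open>S powr lam \<le> H / n\<close> the square root of \<open>S\<close> is of
  order \<open>n\<close> to the power \<open>- 1 / (2 * lam)\<close>. The squared error is
  proportional to this square root, whence the rate \<open>1 / (4 * lam)\<close>. The products in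
  both bounds are at most exponentials of multiples of \<open>\<Gamma>\<close>, which is free of
  \<open>s\<close>.\<close>

theorem uniform_interpolation_error_bound:
  fixes D :: "'a::euclidean_space set" and a0 :: "'a \<Rightarrow> real" and \<psi> :: "nat \<Rightarrow> 'a \<Rightarrow> real"
    and amin amax p lam :: real and \<T> :: "nat \<Rightarrow> 'a set set" and \<sigma> :: nat
  defines "\<gamma> \<equiv> product_weight (b_seq D \<psi> amin) (2 * \<sigma>) \<sigma> lam"
  assumes D: "open D" "D \<noteq> {}" "convex D" "bounded D" and a0: "a0 \<in> Linf D"
    and psi: "\<And>j. j \<ge> 1 \<Longrightarrow> \<psi> j \<in> Linf D"
    and psi_nz: "\<And>j. j \<ge> 1 \<Longrightarrow> \<not> (AE x in lebesgue_on D. \<psi> j x = 0)"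
    and dec: "\<And>j. j \<ge> 1 \<Longrightarrow> Linf_norm D (\<psi> (Suc j)) \<le> Linf_norm D (\<psi> j)"
    and p: "0 < p" and sum_p: "summable (\<lambda>j. Linf_norm D (\<psi> (Suc j)) powr p)" and amin: "0 < amin"
    and ell: "\<And>y. y \<in> param_domain \<Longrightarrow>
          AE x in lebesgue_on D. amin \<le> diffusion_coeff a0 \<psi> y x \<and> diffusion_coeff a0 \<psi> y x \<le> amax"
    and meshes: "mesh_family D \<T>"
    and \<sigma>: "1 \<le> \<sigma>" and lam: "0 < lam" "lam \<le> 1" "1 < real (2 * \<sigma>) * lam" and expo: "1 / lam + 1 < 2 / p - 2 * real \<sigma>"
  shows "\<exists>C>0. \<forall>s\<ge>1. \<forall>n. prime n \<longrightarrow> (\<forall>z. cbc_vector \<gamma> (2 * \<sigma>) s n z \<longrightarrow> (\<forall>k. \<forall>q\<in>Hm1 D.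
    interpolation_error D \<gamma> (2 * \<sigma>) s n z (u_fe D a0 \<psi> (\<T> k) q s) \<le> C * Hm1_norm D q * real n powr - (1 / (4 * lam))))"
proof -
  have dp: "diffusion_problem D (\<T> k) a0 \<psi> amin amax" for k
  proof unfold_locales
    show "triangulation_of D (\<T> k)" using meshes by (simp add: mesh_family_def)
    show "\<psi> j \<in> Linf D" if "1 \<le> j" for j by (rule psi[OF that])
    show "\<not> (AE x in lebesgue_on D. \<psi> j x = 0)" if "1 \<le> j" for j by (rule psi_nz[OF that])
    show "AE x in lebesgue_on D. amin \<le> diffusion_coeff a0 \<psi> y x \<and> diffusion_coeff a0 \<psi> y x \<le> amax"
      if "y \<in> param_domain" for y by (rule ell[OF that])
  qed (fact D a0 amin)+
  define b where "b = b_seq D \<psi> amin"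
  have bpos: "0 < b j" if "1 \<le> j" for j unfolding b_def by (rule diffusion_problem.b_seq_pos[OF dp[of 0] that])
  have bL: "b j = 1 / (sqrt 6 * amin) * Linf_norm D (\<psi> j)" for j by (simp add: b_def b_seq_def)
  have bdec: "b (Suc j) \<le> b j" if "1 \<le> j" for j unfolding bL using dec[OF that] amin by (intro mult_left_mono) auto
  have bB: "b j \<le> b 1" if "1 \<le> j" for j
    using that by (induction j rule: dec_induct) (use bdec in \<open>auto intro: order_trans\<close>)
  have "(\<lambda>j. b (Suc j) powr p) = (\<lambda>j. (1 / (sqrt 6 * amin)) powr p * Linf_norm D (\<psi> (Suc j)) powr p)"
    unfolding bL by (rule ext) (rule powr_mult)
  then have bs: "summable (\<lambda>j. b (Suc j) powr p)" using sum_p by (simp add: summable_mult)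
  obtain c0 where c0: "0 < c0" "\<And>j. 1 \<le> j \<Longrightarrow> b j \<le> c0 * real j powr (- 1 / p)"
  proof -
    have "\<exists>C>0. \<forall>j\<ge>1. b j \<le> C * real j powr (- 1 / p)"
      by (rule decreasing_summable_powr_bound) (fact bpos bdec p bs)+
    then show ?thesis using that by blast
  qed
  define g where "g = weight_factor b \<sigma> lam"
  have \<gamma>: "\<gamma> = prod g" unfolding \<gamma>_def g_def b_def by (rule product_weight_eq)
  obtain K \<Gamma> where K: "0 < K" and \<Gamma>: "0 < \<Gamma>" and gpos: "\<And>j. 1 \<le> j \<Longrightarrow> 0 < g j"
    and ratio: "\<And>j. 1 \<le> j \<Longrightarrow> (real j ^ \<sigma> * b j)\<^sup>2 / g j \<le> K * g j powr lam"
    and G: "\<And>s. (\<Sum>j=1..s. g j powr lam) \<le> \<Gamma>"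
  proof -
    have "\<exists>K>0. \<exists>\<Gamma>>0. (\<forall>j\<ge>1. 0 < weight_factor b \<sigma> lam j
        \<and> (real j ^ \<sigma> * b j)\<^sup>2 / weight_factor b \<sigma> lam j \<le> K * weight_factor b \<sigma> lam j powr lam)
      \<and> (\<forall>s. (\<Sum>j=1..s. weight_factor b \<sigma> lam j powr lam) \<le> \<Gamma>)"
      by (rule weight_factor_bounds[where B = "b 1"]) (fact bpos bB c0 p \<sigma> lam expo)+
    then show ?thesis using that unfolding g_def[symmetric] by blast
  qed
  obtain R where R: "0 < R" "\<And>x. x \<in> D \<Longrightarrow> norm x \<le> R" using D(4) unfolding bounded_pos by blast
  define Z where "Z = zeta_real (real (2 * \<sigma>) * lam)"
  have Z: "1 \<le> Z" unfolding Z_def by (rule zeta_real_pos[OF lam(3)])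
  define d where "d = decay_const \<sigma> (b 1) * exp (real \<sigma>)"
  define Pb where "Pb = exp (d\<^sup>2 * K * \<Gamma>)"
  define c1 where "c1 = 2 powr (real (2 * \<sigma>) * lam + 3) * Z\<^sup>2"
  have c1: "0 < c1" unfolding c1_def using Z by simp
  define H where "H = 3 * exp (4 * Z * \<Gamma>) * (c1 * (\<Gamma> + \<Gamma>\<^sup>2))"
  have H: "0 < H" unfolding H_def using c1 \<Gamma> by (simp add: add_pos_pos)
  define C2 where "C2 = 4 * R\<^sup>2 * (2 * H powr (1 / (2 * lam)) * (6 / (amin / 2)\<^sup>2 * Pb))"
  have C2: "0 < C2" unfolding C2_def Pb_def using R(1) H amin by simp
  have "interpolation_error D \<gamma> (2 * \<sigma>) s n z (u_fe D a0 \<psi> (\<T> k) q s) \<le> sqrt C2 * Hm1_norm D q * real n powr - (1 / (4 * lam))"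
    if s: "1 \<le> s" and n: "prime n" and cbc: "cbc_vector \<gamma> (2 * \<sigma>) s n z" and q: "q \<in> Hm1 D" for s n z k q
  proof -
    interpret dpk: diffusion_problem D "\<T> k" a0 \<psi> amin amax by (rule dp)
    have zz: "z j \<in> {1..n - 1}" if "j \<in> {1..s}" for j using cbc that unfolding cbc_vector_def by blast
    have gp: "0 < g j" if "j \<in> {1..s}" for j using that gpos by simp
    interpret li: lattice_interpolation s n "2 * \<sigma>" z g
    proof unfold_locales
      show "z j \<in> {1..n - 1}" if "j \<in> {1..s}" for j by (rule zz[OF that])
      show "0 < g j" if "j \<in> {1..s}" for j by (rule gp[OF that])
    qed (use s n \<sigma> in auto)
    have n0: "0 < real n" using n by (simp add: prime_gt_0_nat)
    have G0: "0 \<le> g j powr lam" for j by simp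
    have grow: "li.grow lam \<le> exp (4 * Z * \<Gamma>)"
    proof -
      have "li.grow lam = (\<Prod>j=1..s. (1 + 2 * zeta_real (real (2 * \<sigma>) * lam) * g j powr lam)\<^sup>2)"
        by ((rule li.grow_def, (fact lam)+) | rule li.grow_def)
      also have "\<dots> = (\<Prod>j=1..s. 1 + 2 * Z * g j powr lam)\<^sup>2"
        unfolding Z_def by (rule prod_power_distrib[symmetric])
      also have "\<dots> \<le> (exp (\<Sum>j=1..s. 2 * Z * g j powr lam))\<^sup>2"
        using Z by (intro power_mono prod_one_plus_le_exp prod_nonneg) (auto intro!: add_nonneg_nonneg)
      also have "\<dots> = exp (4 * Z * (\<Sum>j=1..s. g j powr lam))"
        by (simp add: power2_eq_square exp_add[symmetric] sum_distrib_left[symmetric])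
      also have "\<dots> \<le> exp (4 * Z * \<Gamma>)" using G[of s] Z by simp
      finally show ?thesis .
    qed
    have lead_eq: "li.lead lam j = 2 powr (real (2 * \<sigma>) * lam + 3) * (zeta_real (real (2 * \<sigma>) * lam))\<^sup>2 * (g j powr lam + (g j powr lam)\<^sup>2)" for j
      by ((rule li.lead_def, (fact lam)+) | rule li.lead_def)
    have lead: "(\<Sum>d=1..s. li.lead lam d) \<le> c1 * (\<Gamma> + \<Gamma>\<^sup>2)"
    proof -
      have each: "g j powr lam \<le> \<Gamma>" if "j \<in> {1..s}" for j
        using member_le_sum[of j "{1..s}" "\<lambda>j. g j powr lam"] that G[of s] by auto
      have "(\<Sum>d=1..s. li.lead lam d) = (\<Sum>j=1..s. c1 * (g j powr lam + g j powr lam * g j powr lam))"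
        by (intro sum.cong refl) (simp only: lead_eq c1_def Z_def power2_eq_square)
      also have "\<dots> \<le> (\<Sum>j=1..s. c1 * (g j powr lam + \<Gamma> * g j powr lam))"
        using c1 each by (intro sum_mono mult_left_mono add_left_mono mult_right_mono) auto
      also have "\<dots> = c1 * (1 + \<Gamma>) * (\<Sum>j=1..s. g j powr lam)"
        unfolding sum_distrib_left by (intro sum.cong refl) (simp add: algebra_simps)
      also have "\<dots> \<le> c1 * (1 + \<Gamma>) * \<Gamma>" using c1 \<Gamma> by (intro mult_left_mono G) simp
      finally show ?thesis by (simp add: algebra_simps power2_eq_square)
    qed
    have lead0: "0 \<le> (\<Sum>d=1..s. li.lead lam d)" by (intro sum_nonneg) (simp add: lead_eq)
    have "li.S powr lam \<le> 3 * li.grow lam * (\<Sum>d=1..s. li.lead lam d) / real n"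
      by (rule li.cbc_bound[OF lam]) (use cbc in \<open>simp add: \<gamma>\<close>)
    also have "\<dots> \<le> 3 * exp (4 * Z * \<Gamma>) * (c1 * (\<Gamma> + \<Gamma>\<^sup>2)) / real n"
      using n0 by (intro divide_right_mono mult_mono mult_left_mono grow lead lead0) auto
    finally have SH: "li.S powr lam \<le> H / real n" by (simp add: H_def)
    have "li.S powr (1 / 2) = (li.S powr lam) powr (1 / (2 * lam))" using lam by (simp add: powr_powr)
    also have "\<dots> \<le> (H / real n) powr (1 / (2 * lam))" using SH lam by (intro powr_mono2) auto
    also have "\<dots> = H powr (1 / (2 * lam)) * real n powr - (1 / (2 * lam))"
      using H n0 by (simp add: powr_divide powr_minus_divide)
    finally have S: "sqrt li.S \<le> H powr (1 / (2 * lam)) * real n powr - (1 / (2 * lam))"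
      using li.S_pos by (simp add: powr_half_sqrt)
    have Pb: "(\<Prod>j=1..s. 1 + (decay_const \<sigma> (b 1) * exp (real \<sigma>) * (real j ^ \<sigma> * b j))\<^sup>2 / g j) \<le> Pb"
    proof -
      have t: "(d * (real j ^ \<sigma> * b j))\<^sup>2 / g j \<le> d\<^sup>2 * K * g j powr lam" if "j \<in> {1..s}" for j
      proof -
        have "d\<^sup>2 * ((real j ^ \<sigma> * b j)\<^sup>2 / g j) \<le> d\<^sup>2 * (K * g j powr lam)"
          by (rule mult_left_mono[OF ratio]) (use that in auto)
        then show ?thesis by (simp add: power_mult_distrib mult.assoc)
      qed
      have t0: "0 \<le> (d * (real j ^ \<sigma> * b j))\<^sup>2 / g j" if "j \<in> {1..s}" for j
        by (rule divide_nonneg_pos[OF zero_le_power2 gp[OF that]])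
      have "(\<Prod>j=1..s. 1 + (d * (real j ^ \<sigma> * b j))\<^sup>2 / g j) \<le> exp (\<Sum>j=1..s. (d * (real j ^ \<sigma> * b j))\<^sup>2 / g j)"
        by (rule prod_one_plus_le_exp) (fact t0, simp)
      also have "\<dots> \<le> Pb" unfolding Pb_def exp_le_cancel_iff
      proof -
        have "(\<Sum>j=1..s. (d * (real j ^ \<sigma> * b j))\<^sup>2 / g j) \<le> d\<^sup>2 * K * (\<Sum>j=1..s. g j powr lam)"
          unfolding sum_distrib_left by (rule sum_mono) (fact t)
        also have "\<dots> \<le> d\<^sup>2 * K * \<Gamma>" using K by (intro mult_left_mono G) simp
        finally show "(\<Sum>j=1..s. (d * (real j ^ \<sigma> * b j))\<^sup>2 / g j) \<le> d\<^sup>2 * K * \<Gamma>" .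
      qed
      finally show ?thesis by (simp add: d_def)
    qed
    have Hq: "0 \<le> Hm1_norm D q" by (rule dpk.Hm1_norm_nonneg[OF q])
    have bB': "b_seq D \<psi> amin j \<le> b 1" if "j \<in> {1..s}" for j using bB[of j] that by (simp add: b_def)
    have "(interpolation_error D (prod g) (2 * \<sigma>) s n z (u_fe D a0 \<psi> (\<T> k) q s))\<^sup>2
      \<le> 4 * R\<^sup>2 * (2 * sqrt li.S * (6 * (Hm1_norm D q)\<^sup>2 / (amin / 2)\<^sup>2 *
          (\<Prod>j=1..s. 1 + (decay_const \<sigma> (b 1) * exp (real \<sigma>) * (real j ^ \<sigma> * b j))\<^sup>2 / g j)))"
      unfolding li.S_def b_def
      by (rule dpk.interpolation_error_bound[where B = "b_seq D \<psi> amin 1" and R = R])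
         (fact s \<sigma> n zz gp bB'[unfolded b_def] q R)+
    also have "\<dots> \<le> 4 * R\<^sup>2 * (2 * (H powr (1 / (2 * lam)) * real n powr - (1 / (2 * lam))) * (6 * (Hm1_norm D q)\<^sup>2 / (amin / 2)\<^sup>2 * Pb))"
      by (intro mult_left_mono mult_mono S Pb order_refl mult_nonneg_nonneg prod_nonneg ballI add_nonneg_nonneg divide_nonneg_pos gp)
         (use amin in auto)
    also have "\<dots> = C2 * (Hm1_norm D q)\<^sup>2 * real n powr - (1 / (2 * lam))" by (simp add: C2_def)
    also have "real n powr - (1 / (2 * lam)) = (real n powr - (1 / (4 * lam)))\<^sup>2"
      by (simp add: power2_eq_square powr_add[symmetric])
    also have "C2 * (Hm1_norm D q)\<^sup>2 * (real n powr - (1 / (4 * lam)))\<^sup>2 = (sqrt C2 * Hm1_norm D q * real n powr - (1 / (4 * lam)))\<^sup>2"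
      using C2 by (simp add: power_mult_distrib)
    finally show ?thesis
      unfolding \<gamma> by (rule power2_le_imp_le) (use C2 Hq in simp)
  qed
  then show ?thesis using C2 by (intro exI[of _ "sqrt C2"]) auto
qed

text \<open>With \<open>\<mu> = 1 / lam\<close> the general bound applies when
  \<open>1 < \<mu>\<close>, \<open>\<mu> < 2 * \<sigma>\<close> and
  \<open>\<mu> < 2 / p - 1 - 2 * \<sigma>\<close>, and its rate is \<open>\<mu> / 4\<close>. In the
  first case \<open>2 * \<sigma>\<close> is the smaller upper limit, in the second
  \<open>2 / p - 1 - 2 * \<sigma>\<close>; \<open>4 * \<delta>\<close> is the distance to that
  limit, and the range of \<delta> expresses \<open>1 < \<mu>\<close>.\<close>

theorem theorem12:
  fixes D :: "'a::euclidean_space set"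
    and a0 :: "'a \<Rightarrow> real" and \<psi> :: "nat \<Rightarrow> 'a \<Rightarrow> real"
    and amin amax p :: real
    and \<T> :: "nat \<Rightarrow> 'a set set"
  assumes dim: "DIM('a) \<in> {1, 2, 3}"
    and D: "open D" "D \<noteq> {}" "convex D" "bounded D" "polyhedron (closure D)"
    and a0: "a0 \<in> Linf D"
    and psi: "\<And>j. j \<ge> 1 \<Longrightarrow> \<psi> j \<in> Linf D"
    and psi_nz: "\<And>j. j \<ge> 1 \<Longrightarrow> \<not> (AE x in lebesgue_on D. \<psi> j x = 0)"
    and psi_summable: "summable (\<lambda>j. Linf_norm D (\<psi> (Suc j)))"
    and psi_decreasing: "\<And>j. j \<ge> 1 \<Longrightarrow> Linf_norm D (\<psi> (Suc j)) \<le> Linf_norm D (\<psi> j)"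
    and p: "0 < p" "p < 1 / 2"
    and psi_p_summable: "summable (\<lambda>j. Linf_norm D (\<psi> (Suc j)) powr p)"
    and amin: "0 < amin"
    and ellipticity: "\<And>y. y \<in> param_domain \<Longrightarrow>
          AE x in lebesgue_on D. amin \<le> diffusion_coeff a0 \<psi> y x \<and> diffusion_coeff a0 \<psi> y x \<le> amax"
    and meshes: "mesh_family D \<T>"
  shows
    "(p \<in> (\<Union>k\<in>{1::nat..}. {2 / (4 * real k + 3)..2 / (4 * real k + 1)}) \<longrightarrow>
       (let \<alpha> = 2 * nat \<lfloor>1 / (2 * p) - 1 / 4\<rfloor>; \<sigma> = \<alpha> div 2 in
        \<forall>\<delta>. 0 < \<delta> \<and> \<delta> < real \<sigma> / 2 - 1 / 4 \<longrightarrow>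
          (let lam = 1 / (2 * real \<sigma> - 4 * \<delta>);
               \<gamma> = product_weight (b_seq D \<psi> amin) \<alpha> \<sigma> lam in
           \<exists>C>0. \<forall>s\<ge>1. \<forall>n. prime n \<longrightarrow> (\<forall>z. cbc_vector \<gamma> \<alpha> s n z \<longrightarrow> (\<forall>k. \<forall>q\<in>Hm1 D.
             interpolation_error D \<gamma> \<alpha> s n z (u_fe D a0 \<psi> (\<T> k) q s)
               \<le> C * Hm1_norm D q
                   * real n powr - (1 / 2 * real_of_int \<lfloor>1 / (2 * p) - 1 / 4\<rfloor> - \<delta>)))))) \<and>
     (p \<in> {2 / 5<..<1 / 2} \<union> (\<Union>k\<in>{1::nat..}. {2 / (4 * real k + 5)<..<2 / (4 * real k + 3)}) \<longrightarrow>
       (let \<alpha> = 2 * nat \<lceil>1 / (2 * p) - 1 / 4\<rceil>; \<sigma> = \<alpha> div 2 in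
        \<forall>\<delta>. 0 < \<delta> \<and> \<delta> < 1 / (2 * p) - 1 / 2 - real \<sigma> / 2 \<longrightarrow>
          (let lam = 1 / (2 / p - 1 - 2 * real \<sigma> - 4 * \<delta>);
               \<gamma> = product_weight (b_seq D \<psi> amin) \<alpha> \<sigma> lam in
           \<exists>C>0. \<forall>s\<ge>1. \<forall>n. prime n \<longrightarrow> (\<forall>z. cbc_vector \<gamma> \<alpha> s n z \<longrightarrow> (\<forall>k. \<forall>q\<in>Hm1 D.
             interpolation_error D \<gamma> \<alpha> s n z (u_fe D a0 \<psi> (\<T> k) q s)
               \<le> C * Hm1_norm D q
                   * real n powr - (1 / (2 * p) - 1 / 4
                        - 1 / 2 * real_of_int \<lceil>1 / (2 * p) - 1 / 4\<rceil> - \<delta>))))))"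
proof -
  have general: "\<exists>C>0. \<forall>s\<ge>1. \<forall>n. prime n \<longrightarrow> (\<forall>z. cbc_vector (product_weight (b_seq D \<psi> amin) (2 * m) m lam) (2 * m) s n z \<longrightarrow> (\<forall>k. \<forall>q\<in>Hm1 D.
      interpolation_error D (product_weight (b_seq D \<psi> amin) (2 * m) m lam) (2 * m) s n z (u_fe D a0 \<psi> (\<T> k) q s)
        \<le> C * Hm1_norm D q * real n powr - (1 / (4 * lam))))"
    if m: "1 \<le> m" and lam: "0 < lam" "lam \<le> 1" "1 < real (2 * m) * lam" and e: "1 / lam + 1 < 2 / p - 2 * real m" for m lam
    by (rule uniform_interpolation_error_bound[where p = p and amax = amax and ?a0.0 = a0])
       (fact D a0 psi psi_nz psi_decreasing p psi_p_summable amin ellipticity meshes m lam e)+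
  have dbl: "2 * m div 2 = m" for m :: nat by simp
  show ?thesis
  proof (rule conjI)
    show "p \<in> (\<Union>k\<in>{1::nat..}. {2 / (4 * real k + 3)..2 / (4 * real k + 1)}) \<longrightarrow>
       (let \<alpha> = 2 * nat \<lfloor>1 / (2 * p) - 1 / 4\<rfloor>; \<sigma> = \<alpha> div 2 in
        \<forall>\<delta>. 0 < \<delta> \<and> \<delta> < real \<sigma> / 2 - 1 / 4 \<longrightarrow>
          (let lam = 1 / (2 * real \<sigma> - 4 * \<delta>);
               \<gamma> = product_weight (b_seq D \<psi> amin) \<alpha> \<sigma> lam in
           \<exists>C>0. \<forall>s\<ge>1. \<forall>n. prime n \<longrightarrow> (\<forall>z. cbc_vector \<gamma> \<alpha> s n z \<longrightarrow> (\<forall>k. \<forall>q\<in>Hm1 D.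
             interpolation_error D \<gamma> \<alpha> s n z (u_fe D a0 \<psi> (\<T> k) q s)
               \<le> C * Hm1_norm D q
                   * real n powr - (1 / 2 * real_of_int \<lfloor>1 / (2 * p) - 1 / 4\<rfloor> - \<delta>)))))"
    proof (rule impI)
      assume "p \<in> (\<Union>k\<in>{1::nat..}. {2 / (4 * real k + 3)..2 / (4 * real k + 1)})"
      then obtain m :: nat where m: "1 \<le> m" "2 / (4 * real m + 3) \<le> p" "p \<le> 2 / (4 * real m + 1)" by auto
      have p1: "2 / p \<le> 4 * real m + 3" "4 * real m + 1 \<le> 2 / p"
        using m(2,3) p(1) by (simp_all add: field_simps)
      have x: "1 / (2 * p) = (2 / p) / 4" by simp
      \<comment> \<open>As \<open>2 / p\<close> lies between \<open>4 * m + 1\<close> and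
        \<open>4 * m + 3\<close>, the argument of the floor lies between \<open>m\<close> and
        \<open>m + 1 / 2\<close>.\<close>
      have fl: "\<lfloor>1 / (2 * p) - 1 / 4\<rfloor> = int m"
        unfolding x by (rule floor_unique) (use p1 in auto)
      show "let \<alpha> = 2 * nat \<lfloor>1 / (2 * p) - 1 / 4\<rfloor>; \<sigma> = \<alpha> div 2 in
        \<forall>\<delta>. 0 < \<delta> \<and> \<delta> < real \<sigma> / 2 - 1 / 4 \<longrightarrow>
          (let lam = 1 / (2 * real \<sigma> - 4 * \<delta>);
               \<gamma> = product_weight (b_seq D \<psi> amin) \<alpha> \<sigma> lam in
           \<exists>C>0. \<forall>s\<ge>1. \<forall>n. prime n \<longrightarrow> (\<forall>z. cbc_vector \<gamma> \<alpha> s n z \<longrightarrow> (\<forall>k. \<forall>q\<in>Hm1 D.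
             interpolation_error D \<gamma> \<alpha> s n z (u_fe D a0 \<psi> (\<T> k) q s)
               \<le> C * Hm1_norm D q
                   * real n powr - (1 / 2 * real_of_int \<lfloor>1 / (2 * p) - 1 / 4\<rfloor> - \<delta>))))"
        unfolding fl Let_def nat_int dbl of_int_of_nat_eq
      proof (intro allI impI)
        fix \<delta> :: real assume \<delta>: "0 < \<delta> \<and> \<delta> < real m / 2 - 1 / 4"
        define \<mu> where "\<mu> = 2 * real m - 4 * \<delta>"
        have \<mu>: "1 < \<mu>" "\<mu> < 2 * real m" "\<mu> + 1 < 2 / p - 2 * real m" using \<delta> p1 by (auto simp: \<mu>_def)
        have rate: "1 / 2 * real m - \<delta> = 1 / (4 * (1 / \<mu>))" by (simp add: \<mu>_def)
        show "\<exists>C>0. \<forall>s\<ge>1. \<forall>n. prime n \<longrightarrow> (\<forall>z. cbc_vector (product_weight (b_seq D \<psi> amin) (2 * m) m (1 / (2 * real m - 4 * \<delta>))) (2 * m) s n z \<longrightarrow> (\<forall>k. \<forall>q\<in>Hm1 D.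
             interpolation_error D (product_weight (b_seq D \<psi> amin) (2 * m) m (1 / (2 * real m - 4 * \<delta>))) (2 * m) s n z (u_fe D a0 \<psi> (\<T> k) q s)
               \<le> C * Hm1_norm D q * real n powr - (1 / 2 * real m - \<delta>)))"
          unfolding rate unfolding \<mu>_def[symmetric]
          by (rule general[OF m(1)]) (use \<mu> in \<open>auto simp: field_simps\<close>)
      qed
    qed
    show "p \<in> {2 / 5<..<1 / 2} \<union> (\<Union>k\<in>{1::nat..}. {2 / (4 * real k + 5)<..<2 / (4 * real k + 3)}) \<longrightarrow>
       (let \<alpha> = 2 * nat \<lceil>1 / (2 * p) - 1 / 4\<rceil>; \<sigma> = \<alpha> div 2 in
        \<forall>\<delta>. 0 < \<delta> \<and> \<delta> < 1 / (2 * p) - 1 / 2 - real \<sigma> / 2 \<longrightarrow>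
          (let lam = 1 / (2 / p - 1 - 2 * real \<sigma> - 4 * \<delta>);
               \<gamma> = product_weight (b_seq D \<psi> amin) \<alpha> \<sigma> lam in
           \<exists>C>0. \<forall>s\<ge>1. \<forall>n. prime n \<longrightarrow> (\<forall>z. cbc_vector \<gamma> \<alpha> s n z \<longrightarrow> (\<forall>k. \<forall>q\<in>Hm1 D.
             interpolation_error D \<gamma> \<alpha> s n z (u_fe D a0 \<psi> (\<T> k) q s)
               \<le> C * Hm1_norm D q
                   * real n powr - (1 / (2 * p) - 1 / 4
                        - 1 / 2 * real_of_int \<lceil>1 / (2 * p) - 1 / 4\<rceil> - \<delta>)))))"
    proof (rule impI)
      assume p': "p \<in> {2 / 5<..<1 / 2} \<union> (\<Union>k\<in>{1::nat..}. {2 / (4 * real k + 5)<..<2 / (4 * real k + 3)})"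
      \<comment> \<open>The separate interval is the case \<open>m = 1\<close> cut off at
        \<open>p < 1 / 2\<close>; the interval with index \<open>k\<close> has
        \<open>m = k + 1\<close>.\<close>
      have "\<exists>m::nat. 1 \<le> m \<and> 4 * real m - 1 < 2 / p \<and> 2 / p < 4 * real m + 1"
        using p'
      proof
        assume "p \<in> {2 / 5<..<1 / 2}"
        then have "4 < 2 / p" "2 / p < 5" using p(1) by (simp_all add: field_simps)
        then show ?thesis by (intro exI[of _ 1]) auto
      next
        assume "p \<in> (\<Union>k\<in>{1::nat..}. {2 / (4 * real k + 5)<..<2 / (4 * real k + 3)})"
        then obtain k :: nat where k: "2 / (4 * real k + 5) < p" "p < 2 / (4 * real k + 3)" by auto
        have "2 / p < 4 * real k + 5" "4 * real k + 3 < 2 / p" using k p(1) by (simp_all add: field_simps)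
        then show ?thesis by (intro exI[of _ "Suc k"]) auto
      qed
      then obtain m :: nat where m: "1 \<le> m" and p1: "4 * real m - 1 < 2 / p" "2 / p < 4 * real m + 1" by blast
      have x: "1 / (2 * p) = (2 / p) / 4" by simp
      have ce: "\<lceil>1 / (2 * p) - 1 / 4\<rceil> = int m"
        unfolding x by (rule ceiling_unique) (use p1 in auto)
      show "let \<alpha> = 2 * nat \<lceil>1 / (2 * p) - 1 / 4\<rceil>; \<sigma> = \<alpha> div 2 in
        \<forall>\<delta>. 0 < \<delta> \<and> \<delta> < 1 / (2 * p) - 1 / 2 - real \<sigma> / 2 \<longrightarrow>
          (let lam = 1 / (2 / p - 1 - 2 * real \<sigma> - 4 * \<delta>);
               \<gamma> = product_weight (b_seq D \<psi> amin) \<alpha> \<sigma> lam in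
           \<exists>C>0. \<forall>s\<ge>1. \<forall>n. prime n \<longrightarrow> (\<forall>z. cbc_vector \<gamma> \<alpha> s n z \<longrightarrow> (\<forall>k. \<forall>q\<in>Hm1 D.
             interpolation_error D \<gamma> \<alpha> s n z (u_fe D a0 \<psi> (\<T> k) q s)
               \<le> C * Hm1_norm D q
                   * real n powr - (1 / (2 * p) - 1 / 4
                        - 1 / 2 * real_of_int \<lceil>1 / (2 * p) - 1 / 4\<rceil> - \<delta>))))"
        unfolding ce Let_def nat_int dbl of_int_of_nat_eq
      proof (intro allI impI)
        fix \<delta> :: real assume \<delta>: "0 < \<delta> \<and> \<delta> < 1 / (2 * p) - 1 / 2 - real m / 2"
        define \<mu> where "\<mu> = 2 / p - 1 - 2 * real m - 4 * \<delta>"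
        have \<mu>: "1 < \<mu>" "\<mu> < 2 * real m" "\<mu> + 1 < 2 / p - 2 * real m" using \<delta> p1 unfolding x by (auto simp: \<mu>_def)
        have rate: "1 / (2 * p) - 1 / 4 - 1 / 2 * real m - \<delta> = 1 / (4 * (1 / \<mu>))" unfolding x by (simp add: \<mu>_def)
        show "\<exists>C>0. \<forall>s\<ge>1. \<forall>n. prime n \<longrightarrow> (\<forall>z. cbc_vector (product_weight (b_seq D \<psi> amin) (2 * m) m (1 / (2 / p - 1 - 2 * real m - 4 * \<delta>))) (2 * m) s n z \<longrightarrow> (\<forall>k. \<forall>q\<in>Hm1 D.
             interpolation_error D (product_weight (b_seq D \<psi> amin) (2 * m) m (1 / (2 / p - 1 - 2 * real m - 4 * \<delta>))) (2 * m) s n z (u_fe D a0 \<psi> (\<T> k) q s)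
               \<le> C * Hm1_norm D q * real n powr - (1 / (2 * p) - 1 / 4 - 1 / 2 * real m - \<delta>)))"
          unfolding rate unfolding \<mu>_def[symmetric]
          by (rule general[OF m]) (use \<mu> in \<open>auto simp: field_simps\<close>)
      qed
    qed
  qed
qed

end
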